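(* Let $\mathbb{X}^{n-1}$ be a mirror of $\Gamma$ in $\mathbb{M}^n$, let $F\subset\mathbb{X}^{n-1}$ be a facet of a chamber $C$, and let $B\subset\mathbb{X}^{n-1}$ be the chamber of $\Delta(\mathbb{X}^{n-1})$ obtained by rolling $C$ along $\mathbb{X}^{n-1}$ starting from $F$. Let $H\subset F$ be an $(n-k)$-dimensional stratum of $C$, $k\ge 3$. Then the group $\Gamma_H(B)$ is obtained by reduction of the finite Coxeter group $\Gamma_H(C)$ (with respect to the mirror of $\Gamma_H(C)$ corresponding to $\mathbb{X}^{n-1}$), and the subdivision of the normal cone $\mathfrak{N}_H(B)$ is a partial development of the Weyl chamber $\mathfrak{N}_H(C)$.
   Context: $\mathbb{M}^n$ is one of $\mathbb{R}^n$, $\mathbb{S}^n$, $\mathbb{L}^n$ (Lobachevsky space) equipped with a Coxeter (reflection) group $\Gamma$, i.e. the group generated by the reflections in the $(n-1)$-dimensional faces of a Coxeter domain (an intersection of a finite or locally finite family of half-spaces whose iterated reflections in faces tile the whole space). More generally, $\mathbb{M}^n$ may be an open convex subset of $\mathbb{RP}^n$ on which a Coxeter group $\Gamma$ acts, in Tits' realization, by projective transformations, generated by reflections in hyperplanes meeting the subset, the closures of chambers being convex polyhedra; then two distinct mirrors are called orthogonal if their reflections commute. Mirrors are the hyperplanes of reflections in $\Gamma$; they divide $\mathbb{M}^n$ into chambers. A facet is an $(n-1)$-dimensional face of a chamber, a hyperedge an $(n-2)$-dimensional stratum; the label of a hyperedge with dihedral angle $\pi/m$ is $m$. $\Delta(\mathbb{X}^{n-1})$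 is the group acting on $\mathbb{X}^{n-1}$ generated by the reflections in all mirrors orthogonal to $\mathbb{X}^{n-1}$. Rolling: let a chamber $C'$ have a facet $F'\subset\mathbb{X}^{n-1}$, let $I$ be a hyperedge of $F'$ with odd label, and let $G'\neq F'$ be the other facet of $C'$ containing $I$. There is $\gamma\in\Gamma$ fixing $I$ pointwise with $\gamma G'$ the facet of $\mathbb{X}^{n-1}$ adjacent to $F'$ across $I$; the rolling step over $I$ replaces $(C',F')$ by $(\gamma C',\gamma G')$. Rolling over even hyperedges is forbidden. $B$ is the union of all facets in $\mathbb{X}^{n-1}$ reached from $(C,F)$ by finite sequences of such steps; it is a chamber of $\Delta(\mathbb{X}^{n-1})$ and is tiled by these facets. Equipment of $C$: for a stratum $H$ of $C$, $\Gamma_H(C)$ is the group generated by the reflections in the facets of $C$ containing $H$; it acts as a finite reflection group on the normal space to $H$ in $\mathbb{M}^n$ (of dimension $k$) at a point of the relative interior of $H$, and $\mathfrak{N}_H(C)$ is its chamber in that space, namely the cone of normal vectors pointing into $C$. Equipment of $B$: $\Gamma_H(B)$ is the group generated by the reflections in the walls (facets) of $B$, as a chamber of $\Delta(\mathbb{X}^{n-1})$, that contain $H$; it acts on the normal space $N_H$ to $H$ in $\mathbb{X}^{n-1}$ (of dimension $k-1$), and $\mathfrak{N}_H(B)\subset N_H$ is the normal cone consisting of the normal vectors pointing into $B$. The cone $\mathfrak{N}_H(B)$ is subdivided by the tangent spaces to those $(n-2)$-dimensional strata (hyperedges of $\mathbb{M}^n$) of the tiling of $B$ which contain $H$. Reduction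 of a finite reflection group: let $G$ be a finite reflection group on $\mathbb{R}^k$ with mirrors $X_j$ and normal vectors $v_j$. The reduction of $G$ with respect to a mirror $X_l$ is the reflection group on $X_l$ generated by the reflections in the mirrors $X_i$ with $v_i$ orthogonal to $v_l$. Partial development of a Weyl chamber $W$ of $G$ having a facet $E$ in $X_l$: the domain in $X_l$, together with its subdivision into copies of facets of $W$, obtained by rolling $W$ along $X_l$ over odd hyperedges (hyperedges of even label being forbidden), starting from the facet $E$. Here a rolling step is as follows: if a chamber $W'$ of $G$ has a facet $E'\subset X_l$, $J$ is a hyperedge ($(k-2)$-dimensional stratum) of $E'$ with odd label, and $E''\neq E'$ is the other facet of $W'$ containing $J$, then there is $g\in G$ fixing $J$ pointwise with $gE''$ the facet in $X_l$ adjacent to $E'$ across $J$, and the step over $J$ replaces $(W',E')$ by $(gW',gE'')$; the domain is the union of all facets in $X_l$ reached from $(W,E)$ by finite sequences of such steps, and it is subdivided into these facets. Here $G=\Gamma_H(C)$, $W=\mathfrak{N}_H(C)$, and $X_l$ is the mirror of $\Gamma_H(C)$ determined by $\mathbb{X}^{n-1}$. *)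

theory Defs
  imports "HOL-Analysis.Analysis" "HOL-Algebra.Bij" "HOL-Algebra.Generated_Groups"
begin

text \<open>
  All spaces of dimension \<open>n\<close> are represented by an open convex cone in a real vector space
  \<open>'a\<close> of dimension \<open>n + 1\<close>; a point of the space is a ray of the cone (the origin is never a
  point), a subset of the space is the union of its rays, and a hyperplane of the space is the
  trace of a linear hyperplane.  In particular a stratum of dimension \<open>d\<close> is a cone of affine
  dimension \<open>d + 1\<close>, and a transformation of the space is a linear map.

  The parameter \<open>e\<close> is a unit vector:
  \<^item> \<open>Euclidean e\<close>: the space is the affine hyperplane \<open>{x. e \<bullet> x = 1}\<close>, coned off from \<open>0\<close>;
  \<^item> \<open>Spherical\<close>: the unit sphere;
  \<^item> \<open>Lobachevsky e\<close>: the upper sheet of the hyperboloid of the Lorentz form with time axis \<open>e\<close>;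
  \<^item> \<open>Projective \<Omega>\<close>: the image in projective space of the open convex cone \<open>\<Omega>\<close>.
\<close>

datatype 'a geometry =
  Euclidean 'a | Spherical | Lobachevsky 'a | Projective "'a set"

definition lorentz :: "'a::euclidean_space \<Rightarrow> 'a \<Rightarrow> 'a \<Rightarrow> real" where
  "lorentz e x y = x \<bullet> y - 2 * (e \<bullet> x) * (e \<bullet> y)"

fun space_cone :: "'a::euclidean_space geometry \<Rightarrow> 'a set" where
  "space_cone (Euclidean e) = {x. e \<bullet> x > 0}"
| "space_cone Spherical = UNIV"
| "space_cone (Lobachevsky e) = {x. e \<bullet> x > 0 \<and> lorentz e x x < 0}"
| "space_cone (Projective \<Omega>) = \<Omega>"

fun wf_geometry :: "'a::euclidean_space geometry \<Rightarrow> bool" where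
  "wf_geometry (Euclidean e) \<longleftrightarrow> norm e = 1"
| "wf_geometry Spherical \<longleftrightarrow> True"
| "wf_geometry (Lobachevsky e) \<longleftrightarrow> norm e = 1"
| "wf_geometry (Projective \<Omega>) \<longleftrightarrow>
     open \<Omega> \<and> convex \<Omega> \<and> \<Omega> \<noteq> {} \<and> (\<forall>x\<in>\<Omega>. \<forall>t>0. t *\<^sub>R x \<in> \<Omega>)"

fun is_motion :: "'a::euclidean_space geometry \<Rightarrow> ('a \<Rightarrow> 'a) \<Rightarrow> bool" where
  "is_motion (Euclidean e) f \<longleftrightarrow> linear f \<and>
     f ` {x. e \<bullet> x = 1} = {x. e \<bullet> x = 1} \<and>
     (\<forall>x y. e \<bullet> x = 1 \<longrightarrow> e \<bullet> y = 1 \<longrightarrow> dist (f x) (f y) = dist x y)"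
| "is_motion Spherical f \<longleftrightarrow> linear f \<and> (\<forall>x. norm (f x) = norm x)"
| "is_motion (Lobachevsky e) f \<longleftrightarrow> linear f \<and>
     f ` space_cone (Lobachevsky e) = space_cone (Lobachevsky e) \<and>
     (\<forall>x y. lorentz e (f x) (f y) = lorentz e x y)"
| "is_motion (Projective \<Omega>) f \<longleftrightarrow> linear f \<and> f ` \<Omega> = \<Omega>"

text \<open>
  The Riemannian metric, as a bilinear form on the tangent spaces \<open>tangent_space g p\<close>; there is
  none in the projective case, where \<open>tangent_space\<close> is unspecified and not used.
\<close>

fun metric :: "'a::euclidean_space geometry \<Rightarrow> ('a \<Rightarrow> 'a \<Rightarrow> real) option" where
  "metric (Euclidean e) = Some (\<bullet>)"
| "metric Spherical = Some (\<bullet>)"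
| "metric (Lobachevsky e) = Some (lorentz e)"
| "metric (Projective \<Omega>) = None"

fun tangent_space :: "'a::euclidean_space geometry \<Rightarrow> 'a \<Rightarrow> 'a set" where
  "tangent_space (Euclidean e) p = {v. e \<bullet> v = 0}"
| "tangent_space Spherical p = {v. p \<bullet> v = 0}"
| "tangent_space (Lobachevsky e) p = {v. lorentz e p v = 0}"


section \<open>Groups generated by reflections of a vector space\<close>

text \<open>
  Everything in this section is relative to a linear subspace \<open>E\<close>.  It is used for the group
  \<open>\<Gamma>\<close> itself (\<open>E = UNIV\<close>), for the group \<open>\<Delta>(X)\<close> (\<open>E = X\<close>), and for the finite reflection
  group on a normal space.  Transformations of \<open>E\<close> are extensional functions, as in
  \<open>BijGroup E\<close>.
\<close>

definition mirror :: "'a::euclidean_space set \<Rightarrow> ('a \<Rightarrow> 'a) \<Rightarrow> 'a set" where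
  "mirror E r = {x\<in>E. r x = x}"

definition is_reflection :: "'a::euclidean_space set \<Rightarrow> ('a \<Rightarrow> 'a) \<Rightarrow> bool" where
  "is_reflection E r \<longleftrightarrow>
     (\<exists>f. linear f \<and> r = restrict f E) \<and> r ` E \<subseteq> E \<and> (\<forall>x\<in>E. r (r x) = x) \<and>
     dim (mirror E r) + 1 = dim E"

definition reflections :: "'a::euclidean_space set \<Rightarrow> ('a \<Rightarrow> 'a) set \<Rightarrow> ('a \<Rightarrow> 'a) set" where
  "reflections E G = {r\<in>G. is_reflection E r}"

text \<open>The (closed) chambers into which the mirrors of \<open>G\<close> divide the open convex cone \<open>U\<close> of \<open>E\<close>.\<close>

definition chambers ::
    "'a::euclidean_space set \<Rightarrow> 'a set \<Rightarrow> ('a \<Rightarrow> 'a) set \<Rightarrow> 'a set set" where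
  "chambers E U G =
     {U \<inter> closure K | K. K \<in> components (U - (\<Union>r\<in>reflections E G. mirror E r))}"

definition inner_product_on :: "'a::euclidean_space set \<Rightarrow> ('a \<Rightarrow> 'a \<Rightarrow> real) \<Rightarrow> bool" where
  "inner_product_on E \<beta> \<longleftrightarrow>
     (\<forall>x\<in>E. \<forall>y\<in>E. \<beta> x y = \<beta> y x) \<and>
     (\<forall>x\<in>E. \<forall>y\<in>E. \<forall>z\<in>E. \<beta> (x + y) z = \<beta> x z + \<beta> y z) \<and>
     (\<forall>c. \<forall>x\<in>E. \<forall>y\<in>E. \<beta> (c *\<^sub>R x) y = c * \<beta> x y) \<and>
     (\<forall>x\<in>E. x \<noteq> 0 \<longrightarrow> \<beta> x x > 0)"

definition preserves_on ::
    "'a::euclidean_space set \<Rightarrow> ('a \<Rightarrow> 'a \<Rightarrow> real) \<Rightarrow> ('a \<Rightarrow> 'a) \<Rightarrow> bool" where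
  "preserves_on E \<beta> f \<longleftrightarrow> (\<forall>x\<in>E. \<forall>y\<in>E. \<beta> (f x) (f y) = \<beta> x y)"

text \<open>
  The hyperedge at which the facets \<open>F1\<close>, \<open>F2\<close> of the chamber \<open>C\<close> meet has dihedral angle
  \<open>\<pi>/m\<close>.  Here \<open>u\<close> and \<open>v\<close> are the unit normals of \<open>F1\<close>, \<open>F2\<close> pointing into \<open>C\<close>, and the angle
  is measured by an inner product \<open>\<beta>\<close> on the normal plane for which the reflections in \<open>F1\<close>
  and \<open>F2\<close> are orthogonal.  In the metric geometries the Riemannian metric is such a \<open>\<beta>\<close>; in
  general \<open>\<beta>\<close> is unique up to a factor unless the two reflections commute, in which case \<open>u\<close>
  and \<open>v\<close> are orthogonal for every such \<open>\<beta>\<close>.  So the angle does not depend on the choice.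
\<close>

definition has_label ::
    "'a::euclidean_space set \<Rightarrow> ('a \<Rightarrow> 'a) set \<Rightarrow> 'a set \<Rightarrow> 'a set \<Rightarrow> 'a set \<Rightarrow> nat \<Rightarrow> bool"
  where
  "has_label E G C F1 F2 m \<longleftrightarrow> m \<ge> 2 \<and>
     (\<exists>r\<in>reflections E G. \<exists>s\<in>reflections E G. \<exists>u\<in>E. \<exists>v\<in>E. \<exists>\<beta>.
        F1 \<subseteq> mirror E r \<and> F2 \<subseteq> mirror E s \<and>
        r u = - u \<and> (\<forall>x\<in>C. \<exists>t\<ge>0. x - r x = t *\<^sub>R u) \<and>
        s v = - v \<and> (\<forall>x\<in>C. \<exists>t\<ge>0. x - s x = t *\<^sub>R v) \<and>
        inner_product_on (span {u, v}) \<beta> \<and>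
        preserves_on (span {u, v}) \<beta> r \<and> preserves_on (span {u, v}) \<beta> s \<and>
        \<beta> u u = 1 \<and> \<beta> v v = 1 \<and> pi - arccos (\<beta> u v) = pi / real m)"

text \<open>
  Rolling the chamber \<open>C\<close> along the mirror \<open>X\<close>, starting from the facet \<open>F\<close>: the set of all
  pairs (chamber, facet in \<open>X\<close>) that are reached.  As exactly two facets in \<open>X\<close> contain the
  hyperedge \<open>I\<close>, the last two premises say that \<open>\<gamma> ` G'\<close> is the one adjacent to \<open>F'\<close> across \<open>I\<close>.
\<close>

inductive_set rolling ::
    "'a::euclidean_space set \<Rightarrow> ('a \<Rightarrow> 'a) set \<Rightarrow> 'a set \<Rightarrow> 'a set \<Rightarrow> 'a set \<Rightarrow> ('a set \<times> 'a set) set"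
  for E G X C F where
  start: "(C, F) \<in> rolling E G X C F"
| step: "(\<gamma> ` C', \<gamma> ` G') \<in> rolling E G X C F"
    if "(C', F') \<in> rolling E G X C F"
      and "I facet_of F'" "G' facet_of C'" "G' \<noteq> F'" "I \<subseteq> G'"
      and "has_label E G C' F' G' m" "odd m"
      and "\<gamma> \<in> G" "\<forall>x\<in>I. \<gamma> x = x" "\<gamma> ` G' \<subseteq> X" "\<gamma> ` G' \<noteq> F'"

definition rolled_facets ::
    "'a::euclidean_space set \<Rightarrow> ('a \<Rightarrow> 'a) set \<Rightarrow> 'a set \<Rightarrow> 'a set \<Rightarrow> 'a set \<Rightarrow> 'a set set" where
  "rolled_facets E G X C F = snd ` rolling E G X C F"

definition stratum_group ::
    "'a::euclidean_space set \<Rightarrow> ('a \<Rightarrow> 'a) set \<Rightarrow> 'a set \<Rightarrow> 'a set \<Rightarrow> ('a \<Rightarrow> 'a) set" where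
  "stratum_group E G P H =
     generate (BijGroup E)
       {r\<in>reflections E G. \<exists>W. W facet_of P \<and> H \<subseteq> W \<and> W \<subseteq> mirror E r}"

text \<open>The vectors of \<open>N\<close> which at the point \<open>p\<close> point into \<open>P\<close>.\<close>

definition normal_cone_at :: "'a::euclidean_space set \<Rightarrow> 'a \<Rightarrow> 'a set \<Rightarrow> 'a set" where
  "normal_cone_at N p P = {v\<in>N. \<exists>\<epsilon>>0. \<forall>t. 0 \<le> t \<and> t < \<epsilon> \<longrightarrow> p + t *\<^sub>R v \<in> P}"

definition finite_reflection_group ::
    "'a::euclidean_space set \<Rightarrow> ('a \<Rightarrow> 'a \<Rightarrow> real) \<Rightarrow> ('a \<Rightarrow> 'a) set \<Rightarrow> bool" where
  "finite_reflection_group E \<beta> G \<longleftrightarrow>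
     subspace E \<and> inner_product_on E \<beta> \<and> finite G \<and>
     G = generate (BijGroup E) (reflections E G) \<and> (\<forall>\<gamma>\<in>G. preserves_on E \<beta> \<gamma>)"

definition normals ::
    "'a::euclidean_space set \<Rightarrow> ('a \<Rightarrow> 'a \<Rightarrow> real) \<Rightarrow> 'a set \<Rightarrow> 'a set" where
  "normals E \<beta> Y = {v\<in>E. \<forall>y\<in>Y. \<beta> v y = 0}"

definition reduction ::
    "'a::euclidean_space set \<Rightarrow> ('a \<Rightarrow> 'a \<Rightarrow> real) \<Rightarrow> ('a \<Rightarrow> 'a) set \<Rightarrow> 'a set \<Rightarrow> ('a \<Rightarrow> 'a) set" where
  "reduction E \<beta> G X =
     generate (BijGroup X)
       {restrict r X | r. r \<in> reflections E G \<and>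
          (\<forall>v\<in>normals E \<beta> (mirror E r). \<forall>w\<in>normals E \<beta> X. \<beta> v w = 0)}"

text \<open>
  The domain \<open>D\<close> with its subdivision into the tiles \<open>T\<close> is a partial development, in the mirror
  \<open>X\<close>, of the Weyl chamber \<open>W\<close> of the finite reflection group \<open>G\<close> on \<open>E\<close>.  (\<open>W\<close> has at most one
  facet in \<open>X\<close>.)
\<close>

definition is_partial_development ::
    "'a::euclidean_space set \<Rightarrow> ('a \<Rightarrow> 'a) set \<Rightarrow> 'a set \<Rightarrow> 'a set \<Rightarrow> 'a set \<Rightarrow> 'a set set \<Rightarrow> bool"
  where
  "is_partial_development E G X W D T \<longleftrightarrow>
     W \<in> chambers E E G \<and>
     (\<exists>F. F facet_of W \<and> F \<subseteq> X \<and> T = rolled_facets E G X W F \<and> D = \<Union>T)"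

text \<open>The pieces into which the cone \<open>D\<close> is cut by the linear spans of the given sets.\<close>

definition subdivision :: "'a::euclidean_space set \<Rightarrow> 'a set set \<Rightarrow> 'a set set" where
  "subdivision D S = closure ` components (D - (\<Union>e\<in>S. span e))"


section \<open>Coxeter groups acting on a space\<close>

text \<open>
  \<open>D\<close> is a Coxeter domain and \<open>S\<close> is the set of reflections in its facets.  (In the projective case
  a reflection is not determined by its mirror, so \<open>S\<close> is part of the data.)  A tiling is
  understood to be locally finite.
\<close>

definition coxeter_domain ::
    "'a::euclidean_space geometry \<Rightarrow> 'a set \<Rightarrow> ('a \<Rightarrow> 'a) set \<Rightarrow> bool" where
  "coxeter_domain g D S \<longleftrightarrow>
     (\<exists>\<H>. (\<forall>h\<in>\<H>. \<exists>a. a \<noteq> 0 \<and> h = {x. 0 \<le> a \<bullet> x}) \<and>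
          (\<forall>x\<in>space_cone g - {0}. \<exists>V. open V \<and> x \<in> V \<and> finite {h\<in>\<H>. frontier h \<inter> V \<noteq> {}}) \<and>
          D = space_cone g \<inter> \<Inter>\<H>) \<and>
     interior D \<noteq> {} \<and>
     (\<forall>s\<in>S. is_reflection UNIV s \<and> is_motion g s \<and> (\<exists>F. F facet_of D \<and> F \<subseteq> mirror UNIV s)) \<and>
     (\<forall>F. F facet_of D \<longrightarrow> (\<exists>!s. s \<in> S \<and> F \<subseteq> mirror UNIV s)) \<and>
     (let \<Gamma> = generate (BijGroup UNIV) S in
        (\<Union>\<gamma>\<in>\<Gamma>. \<gamma> ` D) = space_cone g \<and>
        (\<forall>\<gamma>\<in>\<Gamma>. \<gamma> \<noteq> id \<longrightarrow> interior D \<inter> \<gamma> ` interior D = {}) \<and>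
        (\<forall>x\<in>space_cone g - {0}. \<exists>V. open V \<and> x \<in> V \<and> finite {\<gamma>\<in>\<Gamma>. \<gamma> ` D \<inter> V \<noteq> {}}))"

definition coxeter_group :: "'a::euclidean_space geometry \<Rightarrow> ('a \<Rightarrow> 'a) set \<Rightarrow> bool" where
  "coxeter_group g \<Gamma> \<longleftrightarrow> (\<exists>D S. coxeter_domain g D S \<and> \<Gamma> = generate (BijGroup UNIV) S)"

text \<open>
  Orthogonality of the mirrors of the reflections \<open>r\<close> and \<open>s\<close>.  In the metric geometries the
  normals of the mirror of \<open>r\<close> are the eigenvectors of \<open>r\<close> for the eigenvalue \<open>-1\<close>.
\<close>

definition orthogonal_mirrors ::
    "'a::euclidean_space geometry \<Rightarrow> ('a \<Rightarrow> 'a) \<Rightarrow> ('a \<Rightarrow> 'a) \<Rightarrow> bool" where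
  "orthogonal_mirrors g r s \<longleftrightarrow>
     (case metric g of
        Some b \<Rightarrow> \<forall>u v. r u = - u \<longrightarrow> s v = - v \<longrightarrow> b u v = 0
      | None \<Rightarrow> mirror UNIV r \<noteq> mirror UNIV s \<and> r \<circ> s = s \<circ> r)"

text \<open>The group \<open>\<Delta>(X)\<close> for the mirror \<open>X\<close> of the reflection \<open>\<rho>\<close>.\<close>

definition mirror_group ::
    "'a::euclidean_space geometry \<Rightarrow> ('a \<Rightarrow> 'a) set \<Rightarrow> ('a \<Rightarrow> 'a) \<Rightarrow> ('a \<Rightarrow> 'a) set" where
  "mirror_group g \<Gamma> \<rho> =
     generate (BijGroup (mirror UNIV \<rho>))
       {restrict s (mirror UNIV \<rho>) | s. s \<in> reflections UNIV \<Gamma> \<and> orthogonal_mirrors g \<rho> s}"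

text \<open>
  The normal space at \<open>p\<close> to a stratum \<open>H\<close> with group \<open>A\<close>.  Without a metric, it is the
  \<open>A\<close>-invariant complement to \<open>span H\<close>, spanned by the normals (\<open>-1\<close>-eigenvectors) of the
  reflections in \<open>A\<close>; it represents the quotient of \<open>'a\<close> by \<open>span H\<close>, which is the quotient of the
  tangent space of projective space at \<open>p\<close> by the tangent space of \<open>H\<close>.
\<close>

definition normal_space_at ::
    "'a::euclidean_space geometry \<Rightarrow> ('a \<Rightarrow> 'a) set \<Rightarrow> 'a \<Rightarrow> 'a set \<Rightarrow> 'a set" where
  "normal_space_at g A p H =
     (case metric g of
        Some b \<Rightarrow> {v\<in>tangent_space g p. \<forall>w\<in>tangent_space g p \<inter> span H. b v w = 0}
      | None \<Rightarrow> span {v. \<exists>r\<in>reflections UNIV A. r v = - v})"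

text \<open>
  Inner products allowed on the normal space \<open>N\<close>: the Riemannian metric if there is one, and
  otherwise any (invariance is part of \<open>finite_reflection_group\<close>).
\<close>

definition normal_metric ::
    "'a::euclidean_space geometry \<Rightarrow> 'a set \<Rightarrow> ('a \<Rightarrow> 'a \<Rightarrow> real) \<Rightarrow> bool" where
  "normal_metric g N \<beta> \<longleftrightarrow>
     (case metric g of Some b \<Rightarrow> \<forall>x\<in>N. \<forall>y\<in>N. \<beta> x y = b x y | None \<Rightarrow> True)"

end

theory Submission
  imports Defs
begin

text \<open>
  A chamber is recorded by a point \<open>x\<close> on no mirror: it consists of the points which no mirror
  separates from \<open>x\<close>.  In the same way the facets in the mirror \<open>X\<close> of \<open>\<rho>\<close> are the cells of the
  arrangement which the other mirrors cut out on \<open>X\<close> (\<open>facet_in_mirror\<close>).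

  The heart of the proof is a description of rolling without reference to steps
  (\<open>rolled_facets_eq\<close>).  Let a chamber have the facets \<open>F'\<close> in \<open>X\<close> and \<open>G'\<close> in another mirror, meeting
  in a hyperedge of label \<open>m\<close>.  The group generated by the two reflections is dihedral, and its
  mirrors make angles \<open>j * pi / m\<close> with \<open>X\<close> (\<open>dihedral_roots\<close>).  If \<open>m\<close> is even, one of them is
  orthogonal to \<open>X\<close> (\<open>even_label_orthogonal\<close>).  If \<open>m\<close> is odd, no mirror of the whole group through
  the hyperedge is orthogonal to \<open>X\<close> (\<open>odd_label_no_orthogonal\<close>), and one reflection of the dihedral
  group carries the mirror of \<open>G'\<close> to \<open>X\<close> (\<open>odd_label_swap\<close>).  So a rolling step never crosses a
  mirror orthogonal to \<open>X\<close>, and across every wall of a facet that does not lie in such a mirror there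
  is a rolling step.  The facets reached from \<open>F\<close> are therefore exactly those that no mirror orthogonal
  to \<open>X\<close> separates from \<open>F\<close>, and their union \<open>B\<close> is the chamber of \<open>\<Delta>(X)\<close> containing \<open>F\<close>
  (\<open>Union_rolled_facets\<close>).

  This is proved for any discrete linear group with reflections (\<open>refl_action\<close>), because it is needed
  twice: for \<open>\<Gamma>\<close> on the cone over the space, and for the finite group \<open>\<Gamma>\<^sub>C\<close> on the normal space \<open>N\<close> of
  \<open>H\<close> at \<open>p\<close>, with the mirror \<open>N \<inter> X\<close>.  It remains to compare the two.

  Near \<open>p\<close> only the mirrors through \<open>p\<close> matter, so the normal cone of a cell at \<open>p\<close> is a cell of the
  finite arrangement of these mirrors (\<open>normal_cone_cell\<close>).  They all contain \<open>H\<close>, and their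
  reflections belong to the group generated by the walls of the chamber that contain \<open>H\<close>
  (\<open>reflections_in_stratum_group\<close>).  Applied to \<open>C\<close>, this identifies the mirrors of the finite
  group with the mirrors of \<open>\<Gamma>\<close> through \<open>p\<close>.  Applied to \<open>B\<close>, it shows that \<open>\<Gamma>\<^sub>B\<close> is
  generated by the reflections in the mirrors through \<open>p\<close> that are orthogonal to \<open>X\<close>
  (\<open>stratum_group_B\<close>); and these generate the reduction (\<open>reduction_eq\<close>).  Likewise, the
  tiles of the partial development are by \<open>rolled_facets_eq\<close> the cells cut out in the normal
  cone of \<open>B\<close> by all mirrors through \<open>p\<close> other than \<open>X\<close>, and the hyperedges of the tiling of \<open>B\<close> that
  contain \<open>H\<close> cut the cone along the same hyperplanes (\<open>subdivision_eq_tiles\<close>).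

  The geometries enter only at the end, through three facts: a Coxeter group acts discretely
  (\<open>coxeter_refl_action\<close>), different mirrors are orthogonal if and only if their reflections commute
  (\<open>orthogonal_mirrors_iff\<close>), and the normal space of \<open>H\<close> is spanned by the normals of the mirrors
  through \<open>p\<close> (\<open>normal_space_eq\<close>).
\<close>

section \<open>Sides and cells of an arrangement of hyperplanes\<close>

text \<open>
  The displacements \<open>x - r x\<close> under a reflection are multiples of one vector, and
  the sign of the multiple tells the side of the mirror. So \<open>side r x y\<close> is
  positive, negative or zero according to whether the mirror leaves \<open>x\<close> and
  \<open>y\<close> on the same side, separates them, or contains one of them. This needs no
  choice of a normal vector, and it makes sense for the restriction of \<open>r\<close> to a
  subspace.
\<close>

definition side :: "('a::euclidean_space \<Rightarrow> 'a) \<Rightarrow> 'a \<Rightarrow> 'a \<Rightarrow> real" where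
  "side r x y = (x - r x) \<bullet> (y - r y)"

text \<open>
  If \<open>x\<close> lies on no mirror, this is the closed chamber around \<open>x\<close>.
\<close>

definition cell :: "'a::euclidean_space set \<Rightarrow> ('a \<Rightarrow> 'a) set \<Rightarrow> 'a \<Rightarrow> 'a set" where
  "cell U R x = {y\<in>U. \<forall>r\<in>R. side r x y \<ge> 0}"

definition open_cell :: "'a::euclidean_space set \<Rightarrow> ('a \<Rightarrow> 'a) set \<Rightarrow> 'a \<Rightarrow> 'a set" where
  "open_cell U R x = {y\<in>U. \<forall>r\<in>R. side r x y > 0}"

text \<open>
  This is what remains of a reflection when it is restricted to a subspace that its mirror
  does not contain, but which it need not preserve. It is all that is needed to speak of
  sides.
\<close>

definition hyperplanar :: "'a::euclidean_space set \<Rightarrow> ('a \<Rightarrow> 'a) \<Rightarrow> bool" where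
  "hyperplanar E r \<longleftrightarrow> (\<exists>a u. u \<noteq> 0 \<and> (\<exists>x\<in>E. a \<bullet> x \<noteq> 0) \<and> (\<forall>x\<in>E. r x = x - (a \<bullet> x) *\<^sub>R u))"

definition conormal :: "'a::euclidean_space set \<Rightarrow> ('a \<Rightarrow> 'a) \<Rightarrow> 'a" where
  "conormal E r = (SOME a. (\<exists>x\<in>E. a \<bullet> x \<noteq> 0) \<and> (\<forall>x\<in>E. r x = x \<longleftrightarrow> a \<bullet> x = 0) \<and>
     (\<forall>x\<in>E. \<forall>y\<in>E. side r x y = (a \<bullet> x) * (a \<bullet> y)))"

lemma conormal:
  assumes "hyperplanar E r"
  shows "\<exists>x\<in>E. conormal E r \<bullet> x \<noteq> 0"
    and "\<And>x. x \<in> E \<Longrightarrow> r x = x \<longleftrightarrow> conormal E r \<bullet> x = 0"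
    and "\<And>x y. x \<in> E \<Longrightarrow> y \<in> E \<Longrightarrow> side r x y = (conormal E r \<bullet> x) * (conormal E r \<bullet> y)"
proof -
  obtain a u where au: "u \<noteq> 0" "\<exists>x\<in>E. a \<bullet> x \<noteq> 0" "\<forall>x\<in>E. r x = x - (a \<bullet> x) *\<^sub>R u"
    using assms unfolding hyperplanar_def by blast
  let ?b = "norm u *\<^sub>R a"
  have "(\<exists>x\<in>E. ?b \<bullet> x \<noteq> 0) \<and> (\<forall>x\<in>E. r x = x \<longleftrightarrow> ?b \<bullet> x = 0) \<and>
     (\<forall>x\<in>E. \<forall>y\<in>E. side r x y = (?b \<bullet> x) * (?b \<bullet> y))"
    using au by (auto simp: side_def dot_square_norm power2_eq_square)
  from someI[where P="\<lambda>a. (\<exists>x\<in>E. a \<bullet> x \<noteq> 0) \<and> (\<forall>x\<in>E. r x = x \<longleftrightarrow> a \<bullet> x = 0) \<and>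
     (\<forall>x\<in>E. \<forall>y\<in>E. side r x y = (a \<bullet> x) * (a \<bullet> y))", OF this]
  have *: "(\<exists>x\<in>E. conormal E r \<bullet> x \<noteq> 0) \<and> (\<forall>x\<in>E. r x = x \<longleftrightarrow> conormal E r \<bullet> x = 0) \<and>
     (\<forall>x\<in>E. \<forall>y\<in>E. side r x y = (conormal E r \<bullet> x) * (conormal E r \<bullet> y))"
    unfolding conormal_def .
  show "\<exists>x\<in>E. conormal E r \<bullet> x \<noteq> 0" using * by blast
  show "r x = x \<longleftrightarrow> conormal E r \<bullet> x = 0" if "x \<in> E" for x using * that by blast
  show "side r x y = (conormal E r \<bullet> x) * (conormal E r \<bullet> y)" if "x \<in> E" "y \<in> E" for x y
    using * that by blast
qed

text \<open>
  A sufficiently small move off one more hyperplane stays in \<open>D\<close> and off the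
  hyperplanes that are already avoided.
\<close>

lemma avoid_hyperplanes:
  assumes E: "subspace E" and D: "openin (top_of_set E) D" and x: "x \<in> D" and fin: "finite Q"
    and nz: "\<And>c. c \<in> Q \<Longrightarrow> \<exists>v\<in>E. c \<bullet> v \<noteq> 0"
  shows "\<exists>x'\<in>D. \<forall>c\<in>Q. c \<bullet> x' \<noteq> 0"
  using fin nz
proof (induction Q)
  case empty then show ?case using x by auto
next
  case (insert c Q)
  then obtain x' where x': "x' \<in> D" "\<forall>c\<in>Q. c \<bullet> x' \<noteq> 0" by (metis insertCI)
  show ?case
  proof (cases "c \<bullet> x' = 0")
    case False then show ?thesis using x' by auto
  next
    case True
    obtain v where v: "v \<in> E" "c \<bullet> v \<noteq> 0" using insert.prems by blast
    obtain T where T: "open T" "D = E \<inter> T" using D by (auto simp: openin_open)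
    let ?f = "\<lambda>t::real. x' + t *\<^sub>R v"
    have lim: "(?f \<longlongrightarrow> ?f 0) (at_right 0)" by (intro tendsto_intros)
    have "eventually (\<lambda>t. ?f t \<in> T) (at_right 0)"
      using lim T x' by (intro topological_tendstoD[OF lim]) auto
    moreover have "eventually (\<lambda>t. \<forall>c\<in>Q. c \<bullet> ?f t \<noteq> 0) (at_right 0)"
    proof (intro eventually_ball_finite ballI insert.hyps)
      fix d assume d: "d \<in> Q"
      have "((\<lambda>t. d \<bullet> ?f t) \<longlongrightarrow> d \<bullet> ?f 0) (at_right 0)" by (intro tendsto_intros)
      moreover have "d \<bullet> ?f 0 \<noteq> 0" using x' d by simp
      ultimately show "eventually (\<lambda>t. d \<bullet> ?f t \<noteq> 0) (at_right 0)"
        by (rule tendsto_imp_eventually_ne)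
    qed
    moreover have "eventually (\<lambda>t::real. t > 0) (at_right 0)" by (simp add: eventually_at_right_less)
    ultimately have "eventually (\<lambda>t. ?f t \<in> T \<and> (\<forall>c\<in>Q. c \<bullet> ?f t \<noteq> 0) \<and> t > 0) (at_right 0)"
      by eventually_elim auto
    then obtain t where t: "?f t \<in> T" "\<forall>c\<in>Q. c \<bullet> ?f t \<noteq> 0" "t > 0"
      using eventually_happens[of _ "at_right (0::real)"] by (auto simp: trivial_limit_at_right_real)
    have "?f t \<in> D" using T t x' v E by (auto simp: subspace_add subspace_scale)
    moreover have "c \<bullet> ?f t \<noteq> 0" using True v t by (simp add: inner_add_right)
    ultimately show ?thesis using t by (intro bexI[of _ "?f t"]) auto
  qed
qed

lemma sgn_trans:
  fixes a b c :: real assumes "a * b > 0" "b * c > 0" shows "a * c > 0"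
  using assms by (auto simp: zero_less_mult_iff)
lemma sgn_trans_ge:
  fixes a b c :: real assumes "a * b > 0" "b * c \<ge> 0" shows "a * c \<ge> 0"
  using assms by (auto simp: zero_less_mult_iff zero_le_mult_iff)
lemma sgn_trans_less:
  fixes a b c :: real assumes "a * b > 0" "b * c < 0" shows "a * c < 0"
  using assms by (auto simp: zero_less_mult_iff mult_less_0_iff)

lemma side_commute: "side r x y = side r y x" by (simp add: side_def inner_commute)

text \<open>
  This is used for the mirrors of a group in the cone over the space, for their traces on one
  mirror \<open>X\<close>, and for the finitely many mirrors through a point, where \<open>U =
  E\<close>.
\<close>

locale arrangement =
  fixes E U :: "'a::euclidean_space set" and R :: "('a \<Rightarrow> 'a) set"
  assumes subE: "subspace E" and convU: "convex U" and openU: "openin (top_of_set E) U"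
    and hyp: "r \<in> R \<Longrightarrow> hyperplanar E r"
    and locally_finite: "x \<in> U \<Longrightarrow> \<exists>V. open V \<and> x \<in> V \<and> finite {r\<in>R. \<exists>y\<in>V \<inter> U. r y = y}"
begin

abbreviation cn :: "('a \<Rightarrow> 'a) \<Rightarrow> 'a" where "cn \<equiv> conormal E"

lemma UE: "x \<in> U \<Longrightarrow> x \<in> E" using openU by (auto dest: openin_imp_subset)

lemmas cn_nz = conormal(1)[OF hyp] and cn_fix = conormal(2)[OF hyp] and cn_side = conormal(3)[OF hyp]

lemma side_self: "r \<in> R \<Longrightarrow> x \<in> E \<Longrightarrow> r x \<noteq> x \<Longrightarrow> side r x x > 0"
  by (simp add: side_def)

lemma side_trans: "r \<in> R \<Longrightarrow> x \<in> E \<Longrightarrow> y \<in> E \<Longrightarrow> z \<in> E \<Longrightarrow> side r x y > 0 \<Longrightarrow> side r y z > 0 \<Longrightarrow> side r x z > 0"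
  using sgn_trans[of "cn r \<bullet> x" "cn r \<bullet> y" "cn r \<bullet> z"] by (simp add: cn_side)
lemma side_trans_ge: "r \<in> R \<Longrightarrow> x \<in> E \<Longrightarrow> y \<in> E \<Longrightarrow> z \<in> E \<Longrightarrow> side r x y > 0 \<Longrightarrow> side r y z \<ge> 0 \<Longrightarrow> side r x z \<ge> 0"
  using sgn_trans_ge[of "cn r \<bullet> x" "cn r \<bullet> y" "cn r \<bullet> z"] by (simp add: cn_side)
lemma side_trans_less: "r \<in> R \<Longrightarrow> x \<in> E \<Longrightarrow> y \<in> E \<Longrightarrow> z \<in> E \<Longrightarrow> side r x y > 0 \<Longrightarrow> side r y z < 0 \<Longrightarrow> side r x z < 0"
  using sgn_trans_less[of "cn r \<bullet> x" "cn r \<bullet> y" "cn r \<bullet> z"] by (simp add: cn_side)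
lemma side_pos: "r \<in> R \<Longrightarrow> x \<in> E \<Longrightarrow> y \<in> E \<Longrightarrow> r x \<noteq> x \<Longrightarrow> r y \<noteq> y \<Longrightarrow> side r x y \<ge> 0 \<Longrightarrow> side r x y > 0"
  using cn_side cn_fix by (metis less_eq_real_def mult_eq_0_iff)
lemma side_nz: "r \<in> R \<Longrightarrow> x \<in> E \<Longrightarrow> y \<in> E \<Longrightarrow> side r x y \<noteq> 0 \<longleftrightarrow> r x \<noteq> x \<and> r y \<noteq> y"
  using cn_side cn_fix by auto
lemma side_neg_pos: "r \<in> R \<Longrightarrow> x \<in> E \<Longrightarrow> y \<in> E \<Longrightarrow> z \<in> E \<Longrightarrow> side r x y < 0 \<Longrightarrow> side r x z < 0 \<Longrightarrow> side r y z > 0"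
  by (auto simp: cn_side mult_less_0_iff zero_less_mult_iff)

lemma opposite_sides_meet:
  assumes r: "r \<in> R" and x: "x \<in> E" "y \<in> E" and "side r x y \<le> 0"
  shows "\<exists>z\<in>closed_segment x y. r z = z"
proof -
  let ?f = "\<lambda>t. cn r \<bullet> ((1 - t) *\<^sub>R x + t *\<^sub>R y)"
  have cont: "continuous_on {0..1} ?f" by (intro continuous_intros)
  have "(cn r \<bullet> x) * (cn r \<bullet> y) \<le> 0" using assms cn_side by auto
  then have "(?f 0 \<le> 0 \<and> 0 \<le> ?f 1) \<or> (?f 1 \<le> 0 \<and> 0 \<le> ?f 0)" by (auto simp: mult_le_0_iff)
  then have "\<exists>t. 0 \<le> t \<and> t \<le> 1 \<and> ?f t = 0"
    using IVT'[of ?f 0 0 1] IVT2'[of ?f 1 0 0] cont by auto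
  then obtain t where t: "0 \<le> t" "t \<le> 1" "?f t = 0" by auto
  let ?z = "(1 - t) *\<^sub>R x + t *\<^sub>R y"
  have "?z \<in> E" using x subE by (intro subspace_add subspace_scale)
  then have "r ?z = ?z" using t cn_fix[OF r] by blast
  moreover have "?z \<in> closed_segment x y" using t by (auto simp: closed_segment_def)
  ultimately show ?thesis by blast
qed

text \<open>
  A mirror that does not meet a convex neighbourhood of \<open>y\<close> has this
  neighbourhood on one side, and only finitely many mirrors meet a small neighbourhood. So one
  bound serves all of \<open>R\<close>.
\<close>

lemma sign_stable:
  assumes y: "y \<in> U"
  shows "\<exists>e>0. \<forall>z\<in>E. dist y z < e \<longrightarrow> z \<in> U \<and> (\<forall>r\<in>R. r y \<noteq> y \<longrightarrow> side r y z > 0)"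
proof -
  have yE: "y \<in> E" using UE y by blast
  obtain V where V: "open V" "y \<in> V" "finite {r\<in>R. \<exists>z\<in>V \<inter> U. r z = z}" using locally_finite y by blast
  obtain T where T: "open T" "U = E \<inter> T" using openU by (auto simp: openin_open)
  let ?Q = "{r\<in>R. (\<exists>z\<in>V \<inter> U. r z = z) \<and> r y \<noteq> y}"
  have finQ: "finite ?Q" by (rule finite_subset[OF _ V(3)]) auto
  let ?W = "V \<inter> T \<inter> (\<Inter>r\<in>?Q. {z. (cn r \<bullet> y) * (cn r \<bullet> z) > 0})"
  have oW: "open ?W"
    by (intro open_Int V T open_INT finQ ballI open_Collect_less continuous_intros)
  have "(cn r \<bullet> y) * (cn r \<bullet> y) > 0" if "r \<in> ?Q" for r
    using that yE side_self[of r y] cn_side[of r y y] by simp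
  then have "y \<in> (\<Inter>r\<in>?Q. {z. (cn r \<bullet> y) * (cn r \<bullet> z) > 0})" by blast
  moreover have "y \<in> V \<inter> T" using V T y by blast
  ultimately have yW: "y \<in> ?W" by blast
  obtain e where e: "e > 0" "ball y e \<subseteq> ?W" by (rule openE[OF oW yW])
  have "z \<in> U \<and> (\<forall>r\<in>R. r y \<noteq> y \<longrightarrow> side r y z > 0)" if z: "z \<in> E" "dist y z < e" for z
  proof
    have inW: "closed_segment y z \<subseteq> ball y e" using e z by (intro closed_segment_subset) auto
    have zW: "z \<in> ?W" by (rule subsetD[OF e(2)]) (use z in simp)
    then show zU: "z \<in> U" using T z by auto
    show "\<forall>r\<in>R. r y \<noteq> y \<longrightarrow> side r y z > 0"
    proof (intro ballI impI)
      fix r assume r: "r \<in> R" "r y \<noteq> y"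
      show "side r y z > 0"
      proof (cases "r \<in> ?Q")
        case True then have "(cn r \<bullet> y) * (cn r \<bullet> z) > 0" using zW by blast
        then show ?thesis using r z yE cn_side by auto
      next
        case False
        show ?thesis
        proof (rule ccontr)
          assume "\<not> ?thesis"
          then obtain w where w: "w \<in> closed_segment y z" "r w = w"
            using opposite_sides_meet[of r y z] r yE z by auto
          have "w \<in> V" using w inW e by blast
          moreover have "w \<in> U" using convU y zU w closed_segment_subset by blast
          ultimately show False using False r w by blast
        qed
      qed
    qed
  qed
  then show ?thesis using e by blast
qed

lemma finite_meeting_compact:
  assumes K: "compact K" "K \<subseteq> U"
  shows "finite {r\<in>R. \<exists>y\<in>K. r y = y}"
proof -
  define V where "V x = (SOME V. open V \<and> x \<in> V \<and> finite {r\<in>R. \<exists>y\<in>V \<inter> U. r y = y})" for x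
  have V': "open (V x) \<and> x \<in> V x \<and> finite {r\<in>R. \<exists>y\<in>V x \<inter> U. r y = y}" if "x \<in> K" for x
    unfolding V_def by (rule someI_ex) (use locally_finite K that in blast)
  then have V: "\<And>x. x \<in> K \<Longrightarrow> open (V x)" "\<And>x. x \<in> K \<Longrightarrow> x \<in> V x"
     "\<And>x. x \<in> K \<Longrightarrow> finite {r\<in>R. \<exists>y\<in>V x \<inter> U. r y = y}" by blast+
  have "K \<subseteq> (\<Union>x\<in>K. V x)" using V by blast
  then obtain K' where K': "K' \<subseteq> K" "finite K'" "K \<subseteq> (\<Union>x\<in>K'. V x)"
    using compactE_image[OF K(1), of K V] V(1) by metis
  have "{r\<in>R. \<exists>y\<in>K. r y = y} \<subseteq> (\<Union>x\<in>K'. {r\<in>R. \<exists>y\<in>V x \<inter> U. r y = y})"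
  proof clarify
    fix r y assume r: "r \<in> R" "y \<in> K" "r y = y"
    then obtain x where "x \<in> K'" "y \<in> V x" using K' by blast
    then show "r \<in> (\<Union>x\<in>K'. {r\<in>R. \<exists>y\<in>V x \<inter> U. r y = y})" using r K by blast
  qed
  moreover have "finite (\<Union>x\<in>K'. {r\<in>R. \<exists>y\<in>V x \<inter> U. r y = y})"
    using K' V by (intro finite_UN_I) auto
  ultimately show ?thesis by (rule finite_subset)
qed

lemma finite_fixing: "p \<in> U \<Longrightarrow> finite {r\<in>R. r p = p}"
  using finite_meeting_compact[of "{p}"] by auto

text \<open>A mirror separating two points meets the compact segment between them.\<close>

lemma finite_separating:
  assumes x: "x \<in> U" "y \<in> U" shows "finite {r\<in>R. side r x y < 0}"
proof (rule finite_subset)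
  show "{r\<in>R. side r x y < 0} \<subseteq> {r\<in>R. \<exists>z\<in>closed_segment x y. r z = z}"
    using opposite_sides_meet UE x by fastforce
  show "finite {r\<in>R. \<exists>z\<in>closed_segment x y. r z = z}"
    using x convU by (intro finite_meeting_compact) (auto intro: closed_segment_subset[THEN subsetD])
qed

lemma side_convex:
  assumes "r \<in> R" "x \<in> E" "y \<in> E" "z \<in> E"
  shows "side r x (s *\<^sub>R y + t *\<^sub>R z) = s * side r x y + t * side r x z"
proof -
  have "s *\<^sub>R y + t *\<^sub>R z \<in> E" using assms subE by (intro subspace_add subspace_scale)
  then show ?thesis using assms by (simp add: cn_side inner_add_right algebra_simps)
qed

lemma open_cell_convex: assumes x: "x \<in> E" shows "convex (open_cell U R x)"
proof (rule convexI)
  fix y z and s t :: real assume a: "y \<in> open_cell U R x" "z \<in> open_cell U R x" "0 \<le> s" "0 \<le> t" "s + t = 1"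
  have "s *\<^sub>R y + t *\<^sub>R z \<in> U" using a convU by (auto simp: open_cell_def convex_def)
  moreover have "side r x (s *\<^sub>R y + t *\<^sub>R z) > 0" if r: "r \<in> R" for r
  proof -
    have yz: "side r x y > 0" "side r x z > 0" "y \<in> E" "z \<in> E" using a r UE by (auto simp: open_cell_def)
    have "s > 0 \<or> t > 0" using a by linarith
    then show ?thesis using a yz side_convex[OF r x] by (auto intro: add_pos_nonneg add_nonneg_pos)
  qed
  ultimately show "s *\<^sub>R y + t *\<^sub>R z \<in> open_cell U R x" by (auto simp: open_cell_def)
qed

lemma cell_convex: assumes x: "x \<in> E" shows "convex (cell U R x)"
proof (rule convexI)
  fix y z and s t :: real assume a: "y \<in> cell U R x" "z \<in> cell U R x" "0 \<le> s" "0 \<le> t" "s + t = 1"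
  have "s *\<^sub>R y + t *\<^sub>R z \<in> U" using a convU by (auto simp: cell_def convex_def)
  then show "s *\<^sub>R y + t *\<^sub>R z \<in> cell U R x"
    using a side_convex[OF _ x] UE by (auto simp: cell_def)
qed

text \<open>Open cells are convex, and a connected set that misses a mirror lies on one side of it.\<close>

lemma components_regular:
  "components {x\<in>U. \<forall>r\<in>R. r x \<noteq> x} = open_cell U R ` {x\<in>U. \<forall>r\<in>R. r x \<noteq> x}"
proof -
  let ?S = "{x\<in>U. \<forall>r\<in>R. r x \<noteq> x}"
  have "connected_component_set ?S x = open_cell U R x" if x: "x \<in> ?S" for x
  proof
    have xE: "x \<in> E" using x UE by auto
    show "open_cell U R x \<subseteq> connected_component_set ?S x"
    proof (rule connected_component_maximal)
      show "x \<in> open_cell U R x" using x xE side_self by (auto simp: open_cell_def)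
      show "connected (open_cell U R x)" using open_cell_convex xE convex_connected by blast
      show "open_cell U R x \<subseteq> ?S" using xE UE side_nz by (fastforce simp: open_cell_def)
    qed
    show "connected_component_set ?S x \<subseteq> open_cell U R x"
    proof
      fix y assume "y \<in> connected_component_set ?S x"
      then obtain T where T: "connected T" "T \<subseteq> ?S" "x \<in> T" "y \<in> T" by (auto simp: connected_component_def)
      have yE: "y \<in> E" using T UE by auto
      have "side r x y > 0" if r: "r \<in> R" for r
      proof (rule ccontr)
        assume "\<not> ?thesis"
        then have neg: "(cn r \<bullet> x) * (cn r \<bullet> y) \<le> 0" using cn_side r xE yE by auto
        have "connected ((\<bullet>) (cn r) ` T)" by (intro connected_continuous_image T continuous_intros)
        then have "0 \<in> (\<bullet>) (cn r) ` T"
          using neg T connected_contains_Icc[of "(\<bullet>) (cn r) ` T" "cn r \<bullet> x" "cn r \<bullet> y"]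
            connected_contains_Icc[of "(\<bullet>) (cn r) ` T" "cn r \<bullet> y" "cn r \<bullet> x"]
          by (auto simp: mult_le_0_iff)
        then obtain z where "z \<in> T" "cn r \<bullet> z = 0" by auto
        then show False using T cn_fix[OF r] UE r by auto
      qed
      then show "y \<in> open_cell U R x" using T by (auto simp: open_cell_def)
    qed
  qed
  then show ?thesis by (auto simp: components_def)
qed

text \<open>
  The segment from a point of the closed cell to \<open>x\<close> runs in the open cell,
  except for its start.
\<close>

lemma closure_open_cell:
  assumes x: "x \<in> U" "\<forall>r\<in>R. r x \<noteq> x"
  shows "U \<inter> closure (open_cell U R x) = cell U R x"
proof
  have xE: "x \<in> E" using x UE by auto
  show "U \<inter> closure (open_cell U R x) \<subseteq> cell U R x"
  proof
    fix y assume y: "y \<in> U \<inter> closure (open_cell U R x)"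
    have "side r x y \<ge> 0" if r: "r \<in> R" for r
    proof -
      have "open_cell U R x \<subseteq> {z. (cn r \<bullet> x) * (cn r \<bullet> z) \<ge> 0}"
        using cn_side[OF r xE] UE r by (force simp: open_cell_def)
      moreover have "closed {z. (cn r \<bullet> x) * (cn r \<bullet> z) \<ge> 0}"
        by (intro closed_Collect_le continuous_intros)
      ultimately have "y \<in> {z. (cn r \<bullet> x) * (cn r \<bullet> z) \<ge> 0}" using y closure_minimal by blast
      then show ?thesis using cn_side[OF r xE] UE y by auto
    qed
    then show "y \<in> cell U R x" using y by (auto simp: cell_def)
  qed
  show "cell U R x \<subseteq> U \<inter> closure (open_cell U R x)"
  proof
    fix y assume y: "y \<in> cell U R x"
    then have yE: "y \<in> E" "y \<in> U" using UE by (auto simp: cell_def)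
    let ?f = "\<lambda>t::real. (1 - t) *\<^sub>R y + t *\<^sub>R x"
    have "?f t \<in> open_cell U R x" if t: "0 < t" "t < 1" for t
    proof -
      have "?f t \<in> U" using t x yE convU unfolding convex_def by (metis add.commute diff_add_cancel diff_ge_0_iff_ge less_eq_real_def)
      moreover have "side r x (?f t) > 0" if r: "r \<in> R" for r
        using side_convex[OF r xE yE(1) xE] t r x y side_self[OF r xE] by (auto simp: cell_def intro: add_nonneg_pos)
      ultimately show ?thesis by (auto simp: open_cell_def)
    qed
    then have "eventually (\<lambda>t. ?f t \<in> open_cell U R x) (at_right 0)"
      unfolding eventually_at_right_field by (intro exI[of _ 1]) auto
    then have "eventually (\<lambda>t. ?f t \<in> closure (open_cell U R x)) (at_right 0)"
      by (rule eventually_mono) (use closure_subset in blast)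
    moreover have "(?f \<longlongrightarrow> ?f 0) (at_right 0)" by (intro tendsto_intros)
    ultimately have "?f 0 \<in> closure (open_cell U R x)"
      by (intro Lim_in_closed_set[OF closed_closure, where F="at_right 0"]) simp_all
    then show "y \<in> U \<inter> closure (open_cell U R x)" using yE by simp
  qed
qed

lemma chambers_are_cells:
  "{U \<inter> closure K | K. K \<in> components (U - (\<Union>r\<in>R. mirror E r))} = cell U R ` {x\<in>U. \<forall>r\<in>R. r x \<noteq> x}"
proof -
  have "U - (\<Union>r\<in>R. mirror E r) = {x\<in>U. \<forall>r\<in>R. r x \<noteq> x}" using UE by (auto simp: mirror_def)
  moreover have "{U \<inter> closure K | K. K \<in> open_cell U R ` {x\<in>U. \<forall>r\<in>R. r x \<noteq> x}} = cell U R ` {x\<in>U. \<forall>r\<in>R. r x \<noteq> x}"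
    using closure_open_cell by (auto simp: image_iff)
  ultimately show ?thesis by (simp only: components_regular)
qed

lemma cell_cong:
  assumes "x \<in> E" "x' \<in> E" "\<forall>r\<in>R. side r x x' > 0"
  shows "cell U R x = cell U R x'"
  using assms side_trans_ge UE by (auto simp: cell_def) (metis side_commute)+

end

section \<open>Walls and facets of a cell\<close>

text \<open>
  A wall is witnessed by a point \<open>w\<close> of the cell on no other mirror. The
  condition compares mirrors and not maps because different mirrors may have the same trace on
  a subspace.
\<close>

definition wall_at :: "'a::euclidean_space set \<Rightarrow> 'a set \<Rightarrow> ('a \<Rightarrow> 'a) set \<Rightarrow> 'a \<Rightarrow> ('a \<Rightarrow> 'a) \<Rightarrow> 'a \<Rightarrow> bool" where
  "wall_at E U R x r w \<longleftrightarrow> r \<in> R \<and> w \<in> cell U R x \<and> r w = w \<and>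
     (\<forall>s\<in>R. s w = w \<longrightarrow> mirror E s = mirror E r)"

lemma crossing_parameter:
  fixes a b :: real assumes "a * b < 0"
  shows "0 < a / (a - b)" "a / (a - b) < 1" "(1 - a / (a - b)) * a + a / (a - b) * b = 0"
proof -
  consider "a > 0" "b < 0" | "a < 0" "b > 0" using assms by (auto simp: mult_less_0_iff)
  then have "0 < a / (a - b) \<and> a / (a - b) < 1 \<and> (1 - a / (a - b)) * a + a / (a - b) * b = 0"
    by cases (auto simp: field_simps)
  then show "0 < a / (a - b)" "a / (a - b) < 1" "(1 - a / (a - b)) * a + a / (a - b) * b = 0" by auto
qed

lemma crossing_interpolate:
  fixes a b :: real assumes eq: "(1 - S) * a + S * b = 0" and S: "S > 0"
  shows "(1 - t) * a + t * b = (1 - t / S) * a"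
proof -
  have b: "b = a - a / S" using eq S by (simp add: field_simps)
  show ?thesis unfolding b using S by (simp add: field_simps)
qed

lemma span_relative_nbhd:
  fixes M :: "'a::real_normed_vector set"
  assumes M: "subspace M" and w: "w \<in> M" and e: "e > 0" "\<And>z. z \<in> M \<Longrightarrow> dist w z < e \<Longrightarrow> z \<in> Z" and Z: "Z \<subseteq> M"
  shows "span Z = M"
proof
  show "span Z \<subseteq> M" using Z M span_minimal by blast
  show "M \<subseteq> span Z"
  proof
    fix v assume v: "v \<in> M"
    define t where "t = e / (2 * (norm v + 1))"
    have n: "norm v + 1 > 0" by (simp add: add_nonneg_pos)
    then have t: "t > 0" using e by (auto simp: t_def)
    have "t * norm v < e" 
    proof -
      have "t * norm v \<le> t * (norm v + 1)" using t by simp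
      also have "\<dots> = e / 2" using n by (simp add: t_def field_simps)
      finally show ?thesis using e by simp
    qed
    then have "w + t *\<^sub>R v \<in> Z" using M w v t by (intro e) (auto simp: dist_norm subspace_add subspace_scale)
    moreover have "w \<in> Z" using w e by auto
    ultimately have "(1/t) *\<^sub>R ((w + t *\<^sub>R v) - w) \<in> span Z" by (intro span_scale span_diff span_base)
    then show "v \<in> span Z" using t by simp
  qed
qed

context arrangement begin

lemma mirror_eq: "r \<in> R \<Longrightarrow> mirror E r = E \<inter> {x. cn r \<bullet> x = 0}"
  using cn_fix by (auto simp: mirror_def)

lemma subspace_mirror: "r \<in> R \<Longrightarrow> subspace (mirror E r)"
  by (simp add: mirror_eq subspace_inter subE subspace_hyperplane)

lemma aff_dim_mirror: assumes r: "r \<in> R" shows "aff_dim (mirror E r) = aff_dim E - 1"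
proof -
  have "E \<inter> {x. cn r \<bullet> x = 0} \<noteq> {}" "\<not> E \<subseteq> {x. cn r \<bullet> x = 0}"
    using subspace_0[OF subE] cn_nz[OF r] by auto
  then show ?thesis
    using aff_dim_affine_Int_hyperplane[OF subspace_imp_affine[OF subE], of "cn r" 0] mirror_eq[OF r] by auto
qed

lemma mirror_subset_eq:
  assumes "r \<in> R" "s \<in> R" "mirror E r \<subseteq> mirror E s" shows "mirror E r = mirror E s"
proof -
  have "aff_dim (mirror E r) = aff_dim (mirror E s)" using assms aff_dim_mirror by simp
  then show ?thesis
    using assms subspace_mirror affine_dim_equal[of "mirror E r" "mirror E s"]
    by (metis empty_iff subspace_0 subspace_imp_affine)
qed

lemma aff_dim_two_mirrors:
  assumes "r \<in> R" "s \<in> R" "mirror E r \<noteq> mirror E s"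
  shows "aff_dim (mirror E r \<inter> mirror E s) = aff_dim E - 2"
proof -
  have eq: "mirror E r \<inter> mirror E s = mirror E r \<inter> {x. cn s \<bullet> x = 0}"
    using mirror_eq assms by auto
  have "\<not> mirror E r \<subseteq> {x. cn s \<bullet> x = 0}"
    using mirror_subset_eq[OF assms(1,2)] assms mirror_eq by auto
  moreover have "0 \<in> mirror E r \<inter> {x. cn s \<bullet> x = 0}" using subspace_0[OF subspace_mirror] assms by auto
  ultimately show ?thesis
    using aff_dim_affine_Int_hyperplane[OF subspace_imp_affine[OF subspace_mirror[OF assms(1)]], of "cn s" 0]
      aff_dim_mirror[OF assms(1)] eq by auto
qed

lemma cellD: "y \<in> cell U R x \<Longrightarrow> y \<in> U" "y \<in> cell U R x \<Longrightarrow> r \<in> R \<Longrightarrow> side r x y \<ge> 0"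
  by (auto simp: cell_def)

lemma mem_cell_self: "x \<in> U \<Longrightarrow> x \<in> cell U R x" by (auto simp: cell_def side_def)

text \<open>
  On the straight way from \<open>x\<close> to \<open>z\<close> the first mirror that is
  crossed is a wall of the cell of \<open>x\<close>, unless several are crossed at the same
  time. The latter is avoided by starting at a generic point \<open>x'\<close> near
  \<open>x\<close>.
\<close>

lemma separating_wall:
  assumes x: "x \<in> U" "\<forall>r\<in>R. r x \<noteq> x" and z: "z \<in> U" and r0: "r0 \<in> R" "side r0 x z < 0"
  shows "\<exists>r w. wall_at E U R x r w \<and> side r x z < 0"
proof -
  have E: "x \<in> E" "z \<in> E" using x z UE by auto
  obtain e where e: "e > 0" "\<And>y. y \<in> E \<Longrightarrow> dist x y < e \<Longrightarrow> y \<in> U \<and> (\<forall>r\<in>R. r x \<noteq> x \<longrightarrow> side r x y > 0)"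
    using sign_stable[OF x(1)] by blast
  \<comment> \<open>\<open>K\<close> contains the segments to \<open>z\<close> from all the points that may
    serve as \<open>x'\<close>. So only the finitely many mirrors meeting \<open>K\<close>
    can be crossed.\<close>
  define K where "K = convex hull (insert z (E \<inter> cball x (e/2)))"
  have "compact K" unfolding K_def
    using closed_subspace[OF subE] by (intro compact_convex_hull compact_insert) (simp add: closed_Int_compact)
  moreover have "K \<subseteq> U" unfolding K_def using z e convU by (intro hull_minimal) auto
  ultimately have finK: "finite {r\<in>R. \<exists>y\<in>K. r y = y}" by (rule finite_meeting_compact)
  define Rf where "Rf = {r\<in>R. \<exists>y\<in>K. r y = y}"
  \<comment> \<open>If the mirrors of \<open>r\<close> and \<open>s\<close> meet the segment from
    \<open>x'\<close> to \<open>z\<close> in the same point, then a vector of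
    \<open>Q\<close> is orthogonal to \<open>x'\<close>.\<close>
  define Q where "Q = (\<lambda>(r, s). (cn s \<bullet> z) *\<^sub>R cn r - (cn r \<bullet> z) *\<^sub>R cn s) `
     {(r, s) \<in> Rf \<times> Rf. mirror E r \<noteq> mirror E s \<and> cn r \<bullet> z \<noteq> 0 \<and> cn s \<bullet> z \<noteq> 0}"
  have finQ: "finite Q" unfolding Q_def 
    by (rule finite_imageI, rule finite_subset[of _ "Rf \<times> Rf"]) (use finK in \<open>auto simp: Rf_def[symmetric]\<close>)
  have nz: "\<exists>v\<in>E. c \<bullet> v \<noteq> 0" if c: "c \<in> Q" for c
  proof (rule ccontr)
    assume "\<not> ?thesis" then have c0: "\<And>v. v \<in> E \<Longrightarrow> c \<bullet> v = 0" by blast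
    obtain r s where rs: "r \<in> R" "s \<in> R" "mirror E r \<noteq> mirror E s" "cn r \<bullet> z \<noteq> 0" "cn s \<bullet> z \<noteq> 0"
      "c = (cn s \<bullet> z) *\<^sub>R cn r - (cn r \<bullet> z) *\<^sub>R cn s" using c unfolding Q_def Rf_def by auto
    have "cn r \<bullet> v = 0 \<longleftrightarrow> cn s \<bullet> v = 0" if "v \<in> E" for v
      using c0[OF that] rs by (auto simp: inner_diff_left)
    then show False using rs mirror_eq by auto
  qed
  obtain x' where x': "x' \<in> E \<inter> ball x (e/2)" "\<forall>c\<in>Q. c \<bullet> x' \<noteq> 0"
    using avoid_hyperplanes[OF subE _ _ finQ nz, of "E \<inter> ball x (e/2)" x] E e by (auto simp: openin_open_Int)
  have x'E: "x' \<in> E" "x' \<in> U" using x' e by auto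
  have sx': "side r x x' > 0" if "r \<in> R" for r using e(2)[of x'] x' x that e(1) by auto
  have nx': "cn r \<bullet> x' \<noteq> 0" if "r \<in> R" for r using sx'[OF that] cn_side[OF that] E x'E by auto
  define S where "S = {r\<in>R. (cn r \<bullet> x') * (cn r \<bullet> z) < 0}"
  \<comment> \<open>the parameter of the point where the segment from \<open>x'\<close> to \<open>z\<close>
    crosses the mirror of \<open>r\<close>\<close>
  define T where "T r = (cn r \<bullet> x') / (cn r \<bullet> x' - cn r \<bullet> z)" for r
  let ?w = "\<lambda>t. (1 - t) *\<^sub>R x' + t *\<^sub>R z"
  have T: "0 < T r \<and> T r < 1 \<and> cn r \<bullet> ?w (T r) = 0" if "r \<in> S" for r
  proof -
    have "(cn r \<bullet> x') * (cn r \<bullet> z) < 0" using that by (auto simp: S_def)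
    then show ?thesis using crossing_parameter[of "cn r \<bullet> x'" "cn r \<bullet> z"] unfolding T_def
      by (simp only: inner_add_right inner_scaleR_right)
  qed
  have wU: "?w t \<in> U" if "0 \<le> t" "t \<le> 1" for t
    using that x'E z convU by (auto simp: convex_alt)
  have wE: "?w t \<in> E" for t using x'E E subE by (intro subspace_add subspace_scale)
  have "r \<in> Rf" if r: "r \<in> S" for r
  proof -
    have rR: "r \<in> R" using r by (auto simp: S_def)
    have "x' \<in> K" "z \<in> K" using x' unfolding K_def by (auto intro!: hull_inc)
    then have "?w (T r) \<in> K" using T[OF r] convex_convex_hull[of "insert z (E \<inter> cball x (e/2))"] unfolding K_def convex_alt by auto
    moreover have "r (?w (T r)) = ?w (T r)" using T[OF r] cn_fix[OF rR wE] by blast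
    ultimately show ?thesis using rR unfolding Rf_def by blast
  qed
  then have SRf: "S \<subseteq> Rf" by blast
  then have finS: "finite S" using finK finite_subset unfolding Rf_def by blast
  have "r0 \<in> S" using r0 sx'[OF r0(1)] cn_side[OF r0(1)] E x'E sgn_trans_less[of "cn r0 \<bullet> x'" "cn r0 \<bullet> x" "cn r0 \<bullet> z"]
    by (auto simp: S_def mult.commute)
  then obtain r where r: "r \<in> S" "\<And>s. s \<in> S \<Longrightarrow> T r \<le> T s"
    using finS arg_min_if_finite[of S T] by (metis empty_iff leI)
  have rR: "r \<in> R" using r by (auto simp: S_def)
  let ?t = "T r"
  have t: "0 < ?t" "?t < 1" "cn r \<bullet> ?w ?t = 0" using T r by auto
  have zero: "s \<in> S \<and> (1 - ?t) * (cn s \<bullet> x') = - ?t * (cn s \<bullet> z)" if s: "s \<in> R" "cn s \<bullet> ?w ?t = 0" for s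
  proof -
    have eq: "(1 - ?t) * (cn s \<bullet> x') = - ?t * (cn s \<bullet> z)" using s(2) by (simp add: inner_add_right)
    have "cn s \<bullet> x' = - (?t / (1 - ?t)) * (cn s \<bullet> z)" using eq t by (simp add: field_simps)
    then have eq2: "(cn s \<bullet> x') * (cn s \<bullet> z) = - ((?t / (1 - ?t)) * (cn s \<bullet> z)\<^sup>2)" by (simp add: power2_eq_square)
    have "(?t / (1 - ?t)) > 0" using t by simp
    moreover have "(cn s \<bullet> z)\<^sup>2 > 0" using eq nx'[OF s(1)] t by auto
    ultimately have "(?t / (1 - ?t)) * (cn s \<bullet> z)\<^sup>2 > 0" by (rule mult_pos_pos)
    then have "(cn s \<bullet> x') * (cn s \<bullet> z) < 0" using eq2 by linarith
    then show ?thesis using s eq by (auto simp: S_def)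
  qed
  have "?w ?t \<in> cell U R x"
  proof -
    have "side s x (?w ?t) \<ge> 0" if s: "s \<in> R" for s
    proof -
      have "(cn s \<bullet> x') * (cn s \<bullet> ?w ?t) \<ge> 0"
      proof (cases "s \<in> S")
        case False
        then have "(cn s \<bullet> x') * (cn s \<bullet> z) \<ge> 0" using s by (auto simp: S_def)
        then have "?t * ((cn s \<bullet> x') * (cn s \<bullet> z)) \<ge> 0" using t by simp
        moreover have "(1 - ?t) * ((cn s \<bullet> x') * (cn s \<bullet> x')) \<ge> 0" using t by simp
        ultimately have "(1 - ?t) * ((cn s \<bullet> x') * (cn s \<bullet> x')) + ?t * ((cn s \<bullet> x') * (cn s \<bullet> z)) \<ge> 0" by linarith
        then show ?thesis by (simp add: inner_add_right algebra_simps)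
      next
        case True
        then have le: "?t \<le> T s" and s2: "0 < T s" "(cn s \<bullet> x') * (cn s \<bullet> z) < 0" using r T by (auto simp: S_def)
        have eq: "(1 - T s) * (cn s \<bullet> x') + T s * (cn s \<bullet> z) = 0" using T[OF True] by (simp add: inner_add_right)
        have "cn s \<bullet> ?w ?t = (1 - ?t / T s) * (cn s \<bullet> x')"
        proof -
          have "(1 - ?t) * (cn s \<bullet> x') + ?t * (cn s \<bullet> z) = (1 - ?t / T s) * (cn s \<bullet> x')"
            using crossing_interpolate[OF eq] s2 by simp
          then show ?thesis by (simp only: inner_add_right inner_scaleR_right)
        qed
        then have "(cn s \<bullet> x') * (cn s \<bullet> ?w ?t) = (1 - ?t / T s) * (cn s \<bullet> x')\<^sup>2" by (simp add: power2_eq_square)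
        then show ?thesis using le s2 by simp
      qed
      then show ?thesis using cn_side[OF s] x'E E wE side_trans_ge[OF s E(1) x'E(1) wE sx'[OF s]] by auto
    qed
    then show ?thesis using wU[of ?t] t by (auto simp: cell_def)
  qed
  moreover have "mirror E s = mirror E r" if s: "s \<in> R" "s (?w ?t) = ?w ?t" for s
  proof (rule ccontr)
    assume ne: "mirror E s \<noteq> mirror E r"
    have s0: "cn s \<bullet> ?w ?t = 0" using s cn_fix[OF s(1) wE] by blast
    have 1: "s \<in> S" "(1 - ?t) * (cn s \<bullet> x') = - ?t * (cn s \<bullet> z)" using zero[OF s(1) s0] by auto
    have 2: "(1 - ?t) * (cn r \<bullet> x') = - ?t * (cn r \<bullet> z)" using zero[OF rR t(3)] by auto
    have nz: "cn r \<bullet> z \<noteq> 0" "cn s \<bullet> z \<noteq> 0" using 1(1) r(1) by (auto simp: S_def)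
    let ?c = "(cn s \<bullet> z) *\<^sub>R cn r - (cn r \<bullet> z) *\<^sub>R cn s"
    have "?c \<in> Q" unfolding Q_def using 1(1) r(1) SRf ne nz by (intro image_eqI[of _ _ "(r, s)"]) auto
    then have "?c \<bullet> x' \<noteq> 0" using x' by blast
    moreover have "(1 - ?t) * (?c \<bullet> x') = (cn s \<bullet> z) * ((1 - ?t) * (cn r \<bullet> x')) - (cn r \<bullet> z) * ((1 - ?t) * (cn s \<bullet> x'))"
      by (simp add: inner_diff_left algebra_simps)
    then have "(1 - ?t) * (?c \<bullet> x') = 0" unfolding 1(2) 2 by simp
    ultimately show False using t by simp
  qed
  moreover have "r (?w ?t) = ?w ?t" using t(3) cn_fix[OF rR wE] by blast
  moreover have "side r x z < 0"
    using r(1) cn_side[OF rR] E sx'[OF rR] sgn_trans_less[of "cn r \<bullet> x" "cn r \<bullet> x'" "cn r \<bullet> z"] x'E by (auto simp: S_def)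
  ultimately show ?thesis unfolding wall_at_def using rR by blast
qed

lemma wall_nbhd:
  assumes x: "x \<in> U" "\<forall>r\<in>R. r x \<noteq> x" and w: "wall_at E U R x r w"
  shows "\<exists>e>0. \<forall>z\<in>mirror E r. dist w z < e \<longrightarrow> z \<in> cell U R x"
proof -
  have E: "x \<in> E" "w \<in> E" "w \<in> U" and rR: "r \<in> R" using x w UE by (auto simp: wall_at_def cell_def)
  obtain e where e: "e > 0" "\<And>y. y \<in> E \<Longrightarrow> dist w y < e \<Longrightarrow> y \<in> U \<and> (\<forall>r\<in>R. r w \<noteq> w \<longrightarrow> side r w y > 0)"
    using sign_stable[OF E(3)] by blast
  have "z \<in> cell U R x" if z: "z \<in> mirror E r" "dist w z < e" for z
  proof -
    have zE: "z \<in> E" using z by (auto simp: mirror_def)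
    have "side s x z \<ge> 0" if s: "s \<in> R" for s
    proof (cases "s w = w")
      case True
      then have "mirror E s = mirror E r" using w s unfolding wall_at_def by blast
      then have "z \<in> mirror E s" using z by simp
      then show ?thesis by (auto simp: mirror_def side_def)
    next
      case False
      then have "side s w z > 0" using e z zE s by blast
      moreover have "side s x w > 0" using False w s E x by (intro side_pos) (auto simp: wall_at_def cell_def)
      ultimately show ?thesis using side_trans[OF s E(1,2) zE] by simp
    qed
    then show ?thesis using e z zE by (auto simp: cell_def)
  qed
  then show ?thesis using e by blast
qed

lemma aff_dim_cell: assumes x: "x \<in> U" "\<forall>r\<in>R. r x \<noteq> x" shows "aff_dim (cell U R x) = aff_dim E"
proof (rule antisym)
  show "aff_dim (cell U R x) \<le> aff_dim E" using UE by (intro aff_dim_subset) (auto simp: cell_def)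
  obtain e where e: "e > 0" "\<And>y. y \<in> E \<Longrightarrow> dist x y < e \<Longrightarrow> y \<in> U \<and> (\<forall>r\<in>R. r x \<noteq> x \<longrightarrow> side r x y > 0)"
    using sign_stable[OF x(1)] by blast
  have "x \<in> E \<inter> ball x e" using x UE e by simp
  then have "E \<inter> ball x e \<noteq> {}" by blast
  then have "aff_dim (E \<inter> ball x e) = aff_dim E"
    using subspace_imp_convex[OF subE] by (intro aff_dim_convex_Int_open) auto
  moreover have "E \<inter> ball x e \<subseteq> cell U R x" using e x by (auto simp: cell_def less_imp_le)
  ultimately show "aff_dim E \<le> aff_dim (cell U R x)" using aff_dim_subset by metis
qed

lemma cell_Int_mirror_face:
  assumes x: "x \<in> U" "\<forall>r\<in>R. r x \<noteq> x" and r: "r \<in> R"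
  shows "(cell U R x \<inter> mirror E r) face_of cell U R x"
proof -
  let ?b = "(cn r \<bullet> x) *\<^sub>R cn r"
  have xE: "x \<in> E" using x UE by auto
  have eq: "cell U R x \<inter> mirror E r = cell U R x \<inter> {z. ?b \<bullet> z = 0}"
    using UE mirror_eq[OF r] cn_fix[OF r xE] x r by (auto simp: cell_def)
  show ?thesis unfolding eq
  proof (rule face_of_Int_supporting_hyperplane_ge)
    show "convex (cell U R x)" using cell_convex xE by blast
    show "\<And>z. z \<in> cell U R x \<Longrightarrow> 0 \<le> ?b \<bullet> z" using cn_side[OF r xE] UE r by (auto simp: cell_def)
  qed
qed

lemma wall_facet:
  assumes x: "x \<in> U" "\<forall>r\<in>R. r x \<noteq> x" and w: "wall_at E U R x r w"
  shows "(cell U R x \<inter> mirror E r) facet_of cell U R x"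
    and "span (cell U R x \<inter> mirror E r) = mirror E r"
proof -
  have E: "x \<in> E" "w \<in> E" "w \<in> U" and rR: "r \<in> R" using x w UE by (auto simp: wall_at_def cell_def)
  have wM: "w \<in> mirror E r" "w \<in> cell U R x" using w E unfolding wall_at_def mirror_def by blast+
  obtain e where e: "e > 0" "\<And>z. z \<in> mirror E r \<Longrightarrow> dist w z < e \<Longrightarrow> z \<in> cell U R x"
    using wall_nbhd[OF x w] by blast
  show "span (cell U R x \<inter> mirror E r) = mirror E r"
    using e wM by (intro span_relative_nbhd[OF subspace_mirror[OF rR], of w e]) auto
  have "aff_dim (mirror E r \<inter> ball w e) = aff_dim (mirror E r)"
    using subspace_imp_convex[OF subspace_mirror[OF rR]] wM e by (intro aff_dim_convex_Int_open) auto
  moreover have "aff_dim (mirror E r \<inter> ball w e) \<le> aff_dim (cell U R x \<inter> mirror E r)"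
    using e by (intro aff_dim_subset) auto
  moreover have "aff_dim (cell U R x \<inter> mirror E r) \<le> aff_dim (mirror E r)" by (intro aff_dim_subset) auto
  ultimately have "aff_dim (cell U R x \<inter> mirror E r) = aff_dim E - 1" using aff_dim_mirror[OF rR] by simp
  then show "(cell U R x \<inter> mirror E r) facet_of cell U R x"
    unfolding facet_of_def using cell_Int_mirror_face[OF x rR] wM aff_dim_cell[OF x] by auto
qed

text \<open>
  A relatively interior point \<open>w\<close> of the facet lies on some mirror, for otherwise
  it would be an interior point of the cell. It does not lie on two mirrors, because the facet
  would then be contained in both and have too small a dimension.
\<close>

lemma facet_of_cellE:
  assumes x: "x \<in> U" "\<forall>r\<in>R. r x \<noteq> x" and W: "W facet_of cell U R x"
  obtains r w where "wall_at E U R x r w" "W = cell U R x \<inter> mirror E r"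
proof -
  have xE: "x \<in> E" using x UE by auto
  have face: "W face_of cell U R x" "W \<noteq> {}" and dimW: "aff_dim W = aff_dim E - 1"
    using W aff_dim_cell[OF x] by (auto simp: facet_of_def)
  have WC: "W \<subseteq> cell U R x" using face face_of_imp_subset by blast
  have WE: "W \<subseteq> E" using WC UE by (auto simp: cell_def)
  obtain w where w: "w \<in> rel_interior W"
    using face face_of_imp_convex rel_interior_eq_empty by blast
  have wW: "w \<in> W" using w rel_interior_subset by blast
  have wU: "w \<in> U" "w \<in> E" "w \<in> cell U R x" using wW WC UE by (auto simp: cell_def)
  have WM: "W \<subseteq> mirror E r" if r: "r \<in> R" "r w = w" for r
  proof -
    have "cell U R x \<inter> mirror E r face_of cell U R x" using cell_Int_mirror_face[OF x r(1)] .
    moreover have "(cell U R x \<inter> mirror E r) \<inter> rel_interior W \<noteq> {}" using w wU r by (auto simp: mirror_def)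
    ultimately have "W \<subseteq> cell U R x \<inter> mirror E r"
      using subset_of_face_of[OF _ WC] by blast
    then show ?thesis by blast
  qed
  have "\<exists>r\<in>R. r w = w"
  proof (rule ccontr)
    assume nw: "\<not> ?thesis"
    obtain e where e: "e > 0" "\<And>y. y \<in> E \<Longrightarrow> dist w y < e \<Longrightarrow> y \<in> U \<and> (\<forall>r\<in>R. r w \<noteq> w \<longrightarrow> side r w y > 0)"
      using sign_stable[OF wU(1)] by blast
    have inC: "y \<in> cell U R x" if y: "y \<in> E" "dist w y < e" for y
    proof -
      have "side r x y \<ge> 0" if r: "r \<in> R" for r
        using side_trans[OF r xE wU(2) y(1)] side_pos[OF r xE wU(2)] x nw r cellD(2)[OF wU(3) r] e(2)[OF y] by (metis less_imp_le)
      then show ?thesis using e(2)[OF y] by (auto simp: cell_def)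
    qed
    have "w \<in> rel_interior (cell U R x)"
    proof -
      have "cell U R x \<subseteq> E" using UE by (auto simp: cell_def)
      then have "affine hull (cell U R x) \<subseteq> E" by (intro hull_minimal subspace_imp_affine subE)
      then show ?thesis unfolding mem_rel_interior_ball using wU e inC by (intro conjI exI[of _ e]) auto
    qed
    then have "W = cell U R x" using face_of_disjoint_rel_interior[OF face(1)] wW by blast
    then show False using dimW aff_dim_cell[OF x] by simp
  qed
  then obtain r where r: "r \<in> R" "r w = w" by blast
  have same: "mirror E s = mirror E r" if s: "s \<in> R" "s w = w" for s
  proof (rule ccontr)
    assume ne: "mirror E s \<noteq> mirror E r"
    have "W \<subseteq> mirror E s \<inter> mirror E r" using WM s r by blast
    then have "aff_dim W \<le> aff_dim E - 2" using aff_dim_two_mirrors[OF s(1) r(1) ne] aff_dim_subset by metis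
    then show False using dimW by simp
  qed
  have wall: "wall_at E U R x r w" unfolding wall_at_def using r same wU by blast
  have WF: "W \<subseteq> cell U R x \<inter> mirror E r" using WC WM r by blast
  have "W = cell U R x \<inter> mirror E r"
  proof (rule ccontr)
    assume ne: "W \<noteq> cell U R x \<inter> mirror E r"
    have "W face_of (cell U R x \<inter> mirror E r)" using face_of_subset[OF face(1) WF] by blast
    moreover have "convex (cell U R x \<inter> mirror E r)"
      using cell_Int_mirror_face[OF x r(1)] face_of_imp_convex by blast
    ultimately have "aff_dim W < aff_dim (cell U R x \<inter> mirror E r)" using ne face_of_aff_dim_lt by blast
    also have "\<dots> \<le> aff_dim (mirror E r)" by (intro aff_dim_subset) auto
    finally show False using aff_dim_mirror[OF r(1)] dimW by simp
  qed
  then show ?thesis using that wall by blast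
qed

lemma local_arrangement:
  assumes E': "subspace E'" "E' \<subseteq> E" and U': "convex U'" "openin (top_of_set E') U'" and R': "R' \<subseteq> R"
    and ns: "\<And>r. r \<in> R' \<Longrightarrow> \<exists>x\<in>E'. r x \<noteq> x"
    and fin: "finite R' \<or> U' \<subseteq> U"
  shows "arrangement E' U' R'"
proof
  show "subspace E'" "convex U'" "openin (top_of_set E') U'" using assms by auto
  show "hyperplanar E' r" if r: "r \<in> R'" for r
  proof -
    obtain a u where au: "u \<noteq> 0" "(\<forall>x\<in>E. r x = x - (a \<bullet> x) *\<^sub>R u)" using hyp[of r] r R' unfolding hyperplanar_def by blast
    obtain x where x: "x \<in> E'" "r x \<noteq> x" using ns[OF r] by blast
    then have "a \<bullet> x \<noteq> 0" using au E' by auto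
    then show ?thesis unfolding hyperplanar_def using au x E' by blast
  qed
  show "\<exists>V. open V \<and> x \<in> V \<and> finite {r \<in> R'. \<exists>y\<in>V \<inter> U'. r y = y}" if x: "x \<in> U'" for x
    using fin
  proof
    assume "finite R'" then show ?thesis by (intro exI[of _ UNIV]) auto
  next
    assume U: "U' \<subseteq> U"
    obtain V where V: "open V" "x \<in> V" "finite {r \<in> R. \<exists>y\<in>V \<inter> U. r y = y}" using locally_finite[of x] x U by blast
    have "finite {r \<in> R'. \<exists>y\<in>V \<inter> U'. r y = y}" by (rule finite_subset[OF _ V(3)]) (use U R' in blast)
    then show ?thesis using V by blast
  qed
qed

end

section \<open>An arrangement near a point\<close>

context arrangement begin

lemma ray_nbhd:
  assumes p: "p \<in> U" and v: "v \<in> E"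
  shows "\<exists>d>0. \<forall>t. 0 \<le> t \<and> t < d \<longrightarrow> p + t *\<^sub>R v \<in> U \<and> (\<forall>s\<in>R. s p \<noteq> p \<longrightarrow> side s p (p + t *\<^sub>R v) > 0)"
proof -
  have pE: "p \<in> E" using p UE by auto
  obtain e where e: "e > 0" "\<And>z. z \<in> E \<Longrightarrow> dist p z < e \<Longrightarrow> z \<in> U \<and> (\<forall>r\<in>R. r p \<noteq> p \<longrightarrow> side r p z > 0)"
    using sign_stable[OF p] by blast
  have n: "norm v + 1 > 0" by (simp add: add_nonneg_pos)
  have "p + t *\<^sub>R v \<in> U \<and> (\<forall>s\<in>R. s p \<noteq> p \<longrightarrow> side s p (p + t *\<^sub>R v) > 0)" if t: "0 \<le> t" "t < e / (norm v + 1)" for t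
  proof -
    have "t * norm v \<le> t * (norm v + 1)" using t by (simp add: mult_left_mono)
    also have "\<dots> < e" using t n by (simp add: field_simps)
    finally show ?thesis using t pE v subE by (intro e) (auto simp: dist_norm subspace_add subspace_scale)
  qed
  then show ?thesis using e n by (intro exI[of _ "e / (norm v + 1)"]) auto
qed

text \<open>
  The point \<open>w\<close> is obtained by moving from \<open>y\<close> a little towards
  \<open>x\<close>.
\<close>

lemma regular_nearby:
  assumes x: "x \<in> U" "\<forall>r\<in>R. r x \<noteq> x" and y: "y \<in> U"
  shows "\<exists>w\<in>U. (\<forall>r\<in>R. r w \<noteq> w) \<and> y \<in> cell U R w \<and> (\<forall>r\<in>R. side r x y \<ge> 0 \<longrightarrow> side r x w > 0)"
proof -
  have E: "x \<in> E" "y \<in> E" "x - y \<in> E" using x y UE subE by (auto simp: subspace_diff)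
  obtain d where d: "d > 0" "\<And>t. 0 \<le> t \<Longrightarrow> t < d \<Longrightarrow> y + t *\<^sub>R (x - y) \<in> U \<and> (\<forall>s\<in>R. s y \<noteq> y \<longrightarrow> side s y (y + t *\<^sub>R (x - y)) > 0)"
    using ray_nbhd[OF y E(3)] by blast
  define t where "t = min d 1 / 2"
  have t: "0 < t" "t < d" "t < 1" using d by (auto simp: t_def)
  define w where "w = (1 - t) *\<^sub>R y + t *\<^sub>R x"
  have "w = y + t *\<^sub>R (x - y)" by (simp add: w_def algebra_simps)
  then have w: "w \<in> U" "\<And>s. s \<in> R \<Longrightarrow> s y \<noteq> y \<Longrightarrow> side s y w > 0" using d(2)[of t] t by auto
  have pos: "side r x w > 0" if r: "r \<in> R" "side r x y \<ge> 0" for r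
  proof -
    have "side r x w = (1 - t) * side r x y + t * side r x x" unfolding w_def by (rule side_convex[OF r(1) E(1,2,1)])
    moreover have "(1 - t) * side r x y \<ge> 0" "t * side r x x > 0" using r t side_self[OF r(1) E(1)] x(2) by simp_all
    ultimately show ?thesis by linarith
  qed
  have "r w \<noteq> w" if r: "r \<in> R" for r
  proof
    assume f: "r w = w"
    then have "r y = y" using w(2)[OF r] by (fastforce simp: side_def)
    then show False using pos[OF r] f by (simp add: side_def)
  qed
  moreover have "side r w y \<ge> 0" if r: "r \<in> R" for r
    using w(2)[OF r] by (cases "r y = y") (auto simp: side_def inner_commute)
  then have "y \<in> cell U R w" using y by (simp add: cell_def)
  ultimately show ?thesis using w(1) pos by blast
qed

lemma side_local:
  assumes "s \<in> R" "p \<in> E" "v \<in> E" "y \<in> E" "s p = p"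
  shows "side s y (p + t *\<^sub>R v) = t * side s y v"
proof -
  have "side s y (1 *\<^sub>R p + t *\<^sub>R v) = 1 * side s y p + t * side s y v" using assms by (intro side_convex)
  moreover have "side s y p = 0" using assms by (simp add: side_def)
  ultimately show ?thesis by simp
qed

lemma fix_local:
  assumes "s \<in> R" "p \<in> E" "v \<in> E" "s p = p"
  shows "s (p + t *\<^sub>R v) = p + t *\<^sub>R v \<longleftrightarrow> t = 0 \<or> s v = v"
proof -
  have "p + t *\<^sub>R v \<in> E" using assms subE by (intro subspace_add subspace_scale)
  then show ?thesis using assms by (simp add: cn_fix inner_add_right)
qed

text \<open>
  Along a ray from \<open>p\<close> the position relative to a mirror through \<open>p\<close>
  does not change, and for a short time no other mirror is met.
\<close>

lemma normal_cone_cell: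
  assumes x: "x \<in> U" "\<forall>r\<in>R. r x \<noteq> x" and p: "p \<in> cell U R x" and E': "E' \<subseteq> E"
  shows "normal_cone_at E' p (cell U R x) = cell E' {r\<in>R. r p = p} x"
proof -
  have pE: "p \<in> E" "p \<in> U" "x \<in> E" using p x UE by (auto simp: cell_def)
  show ?thesis
  proof (intro equalityI subsetI)
    fix v assume "v \<in> normal_cone_at E' p (cell U R x)"
    then obtain e where v: "v \<in> E'" "e > 0" "\<And>t. 0 \<le> t \<Longrightarrow> t < e \<Longrightarrow> p + t *\<^sub>R v \<in> cell U R x"
      by (auto simp: normal_cone_at_def)
    have "side r x v \<ge> 0" if r: "r \<in> R" "r p = p" for r
    proof -
      have "side r x (p + (e/2) *\<^sub>R v) \<ge> 0" using v r by (intro cellD) auto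
      moreover have "side r x (p + (e/2) *\<^sub>R v) = (e/2) * side r x v"
        using v(1) E' by (intro side_local r pE) auto
      ultimately show ?thesis using v(2) by (simp add: zero_le_mult_iff)
    qed
    then show "v \<in> cell E' {r\<in>R. r p = p} x" using v by (auto simp: cell_def)
  next
    fix v assume v: "v \<in> cell E' {r\<in>R. r p = p} x"
    then have vE: "v \<in> E'" "v \<in> E" using E' by (auto simp: cell_def)
    obtain d where d: "d > 0" "\<And>t. 0 \<le> t \<Longrightarrow> t < d \<Longrightarrow> p + t *\<^sub>R v \<in> U \<and> (\<forall>s\<in>R. s p \<noteq> p \<longrightarrow> side s p (p + t *\<^sub>R v) > 0)"
      using ray_nbhd[OF pE(2) vE(2)] by blast
    have "p + t *\<^sub>R v \<in> cell U R x" if t: "0 \<le> t" "t < d" for t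
    proof -
      have tE: "p + t *\<^sub>R v \<in> E" using d t UE by blast
      have "side s x (p + t *\<^sub>R v) \<ge> 0" if s: "s \<in> R" for s
      proof (cases "s p = p")
        case True
        then have "side s x v \<ge> 0" using v s by (auto simp: cell_def)
        then show ?thesis using side_local[OF s pE(1) vE(2) pE(3) True] t by simp
      next
        case False
        then have "side s x p > 0" using s pE x p by (intro side_pos) (auto simp: cell_def)
        moreover have "side s p (p + t *\<^sub>R v) > 0" using d t s False by blast
        ultimately show ?thesis using side_trans[OF s pE(3,1) tE] by simp
      qed
      then show ?thesis using d t by (auto simp: cell_def)
    qed
    then show "v \<in> normal_cone_at E' p (cell U R x)" using vE d unfolding normal_cone_at_def by blast
  qed
qed

lemma arrangement_at:
  assumes p: "p \<in> U" shows "arrangement E E {r\<in>R. r p = p}"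
proof (rule local_arrangement)
  show "\<exists>x\<in>E. r x \<noteq> x" if "r \<in> {r\<in>R. r p = p}" for r using that cn_nz cn_fix by (metis (mono_tags) mem_Collect_eq)
qed (use subE finite_fixing[OF p] in \<open>auto intro: subspace_imp_convex\<close>)

text \<open>
  A wall of the cell of the mirrors through \<open>p\<close> is also a wall of the full cell,
  because its witness can be moved close to \<open>p\<close>, where no other mirrors are
  present.
\<close>

lemma wall_from_local:
  assumes x: "x \<in> U" "\<forall>r\<in>R. r x \<noteq> x" and p: "p \<in> cell U R x"
    and w: "wall_at E E {r\<in>R. r p = p} x r w"
  shows "\<exists>t>0. wall_at E U R x r (p + t *\<^sub>R w)"
proof -
  have pE: "p \<in> E" "p \<in> U" "x \<in> E" using p x UE by (auto simp: cell_def)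
  have wE: "w \<in> E" "w \<in> cell E {r\<in>R. r p = p} x" and r: "r \<in> R" "r p = p" "r w = w" using w by (auto simp: wall_at_def cell_def)
  have "w \<in> normal_cone_at E p (cell U R x)" using wE normal_cone_cell[OF x p, of E] by simp
  then obtain d where d: "d > 0" "\<And>t. 0 \<le> t \<Longrightarrow> t < d \<Longrightarrow> p + t *\<^sub>R w \<in> cell U R x" by (auto simp: normal_cone_at_def)
  obtain d' where d': "d' > 0" "\<And>t. 0 \<le> t \<Longrightarrow> t < d' \<Longrightarrow> p + t *\<^sub>R w \<in> U \<and> (\<forall>s\<in>R. s p \<noteq> p \<longrightarrow> side s p (p + t *\<^sub>R w) > 0)"
      using ray_nbhd[OF pE(2) wE(1)] by blast
  define t where "t = min d d' / 2"
  have t: "0 < t" "t < d" "t < d'" using d d' by (auto simp: t_def)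
  have "wall_at E U R x r (p + t *\<^sub>R w)" unfolding wall_at_def
  proof (intro conjI ballI impI)
    show "r \<in> R" "p + t *\<^sub>R w \<in> cell U R x" using r d t by auto
    show "r (p + t *\<^sub>R w) = p + t *\<^sub>R w" using fix_local[OF r(1) pE(1) wE(1) r(2)] r by blast
    fix s assume s: "s \<in> R" "s (p + t *\<^sub>R w) = p + t *\<^sub>R w"
    have "s p = p"
    proof (rule ccontr)
      assume "s p \<noteq> p"
      then have "side s p (p + t *\<^sub>R w) > 0" using d'(2)[of t] t s by auto
      then show False using s by (simp add: side_def)
    qed
    then have "s w = w" using fix_local[OF s(1) pE(1) wE(1), of t] s t by auto
    then show "mirror E s = mirror E r" using w s(1) \<open>s p = p\<close> unfolding wall_at_def by blast
  qed
  then show ?thesis using t by blast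
qed

lemma local_wall:
  assumes x: "x \<in> U" "\<forall>r\<in>R. r x \<noteq> x" and p: "p \<in> cell U R x" and z: "z \<in> E"
    and r0: "r0 \<in> R" "r0 p = p" "side r0 x z < 0"
  shows "\<exists>r w. wall_at E U R x r w \<and> r p = p \<and> side r x z < 0"
proof -
  have pU: "p \<in> U" "x \<in> E" using p x UE by (auto simp: cell_def)
  interpret L: arrangement E E "{r\<in>R. r p = p}" using arrangement_at[OF pU(1)] .
  obtain r w where "wall_at E E {r\<in>R. r p = p} x r w" "side r x z < 0"
    using L.separating_wall[of x z r0] x r0 z pU by auto
  then show ?thesis using wall_from_local[OF x p] by (metis (mono_tags) mem_Collect_eq wall_at_def)
qed

end

section \<open>Reflections and roots\<close>

text \<open>
  A reflection is described by a root \<open>u\<close> and a coroot \<open>a\<close>. The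
  coroot is a vector only because the ambient inner product identifies vectors and linear
  forms; this inner product need not be invariant under the reflection, and so
  \<open>u\<close> and \<open>a\<close> need not be parallel.
\<close>

definition root_pair :: "'a::euclidean_space set \<Rightarrow> ('a \<Rightarrow> 'a) \<Rightarrow> 'a \<Rightarrow> 'a \<Rightarrow> bool" where
  "root_pair E r a u \<longleftrightarrow> u \<in> E \<and> a \<bullet> u = 2 \<and> (\<forall>x\<in>E. r x = x - (a \<bullet> x) *\<^sub>R u)"

lemma rootD:
  assumes "root_pair E r a u"
  shows "u \<in> E" "a \<bullet> u = 2" "x \<in> E \<Longrightarrow> r x = x - (a \<bullet> x) *\<^sub>R u" "u \<noteq> 0" "r u = - u"
    "x \<in> E \<Longrightarrow> r x = x \<longleftrightarrow> a \<bullet> x = 0"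
    "x \<in> E \<Longrightarrow> y \<in> E \<Longrightarrow> side r x y = (a \<bullet> x) * (a \<bullet> y) * (u \<bullet> u)"
proof -
  have 1: "u \<in> E" "a \<bullet> u = 2" "\<forall>x\<in>E. r x = x - (a \<bullet> x) *\<^sub>R u" using assms by (auto simp: root_pair_def)
  show "u \<in> E" "a \<bullet> u = 2" "x \<in> E \<Longrightarrow> r x = x - (a \<bullet> x) *\<^sub>R u" using 1 by auto
  show u0: "u \<noteq> 0" using 1 by auto
  show "r u = - u" using 1 by (simp add: scaleR_2)
  show "x \<in> E \<Longrightarrow> r x = x \<longleftrightarrow> a \<bullet> x = 0" using 1 u0 by auto
  show "x \<in> E \<Longrightarrow> y \<in> E \<Longrightarrow> side r x y = (a \<bullet> x) * (a \<bullet> y) * (u \<bullet> u)" using 1 by (simp add: side_def)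
qed

lemma root_uminus: "root_pair E r a u \<Longrightarrow> subspace E \<Longrightarrow> root_pair E r (- a) (- u)"
  by (auto simp: root_pair_def subspace_neg)

lemma root_hyperplanar: "root_pair E r a u \<Longrightarrow> hyperplanar E r"
  unfolding hyperplanar_def using rootD(1-4)[of E r a u] by (metis zero_neq_numeral)

text \<open>
  The displacement \<open>y - r y\<close> of a point off the mirror is a
  \<open>-1\<close>-eigenvector \<open>u\<close>, and a vector of \<open>E\<close> orthogonal
  to the mirror, suitably scaled, is the coroot.
\<close>

lemma reflection_root:
  assumes E: "subspace E" and r: "is_reflection E r"
  shows "\<exists>a u. root_pair E r a u"
proof -
  obtain f where f: "linear f" "r = restrict f E" using r by (auto simp: is_reflection_def)
  have rE: "\<And>x. x \<in> E \<Longrightarrow> r x \<in> E" "\<And>x. x \<in> E \<Longrightarrow> r (r x) = x" "dim (mirror E r) + 1 = dim E"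
    using r by (auto simp: is_reflection_def)
  have rf: "\<And>x. x \<in> E \<Longrightarrow> r x = f x" using f by auto
  have sM: "subspace (mirror E r)"
    using E f unfolding mirror_def subspace_def by (auto simp: linear_0 linear_add linear_scale)
  have MsubE: "mirror E r \<subseteq> E" by (auto simp: mirror_def)
  have "mirror E r \<noteq> E" using rE(3) by auto
  then have "span (mirror E r) \<subset> span E" using MsubE sM E by (simp add: span_eq_iff[THEN iffD2] psubset_eq)
  then obtain b where b: "b \<noteq> 0" "b \<in> span E" "\<And>y. y \<in> span (mirror E r) \<Longrightarrow> orthogonal b y"
    using orthogonal_to_subspace_exists_gen by metis
  have bE: "b \<in> E" using b E by (simp add: span_eq_iff[THEN iffD2])
  have MsubK: "mirror E r \<subseteq> E \<inter> {x. b \<bullet> x = 0}" using b span_base MsubE by (auto simp: orthogonal_def)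
  have eqM: "mirror E r = E \<inter> {x. b \<bullet> x = 0}"
  proof (rule subspace_dim_equal)
    show "subspace (E \<inter> {x. b \<bullet> x = 0})" using E by (simp add: subspace_inter subspace_hyperplane)
    have "b \<notin> E \<inter> {x. b \<bullet> x = 0}" using b by simp
    then have "E \<inter> {x. b \<bullet> x = 0} \<noteq> E" using bE by blast
    then have "dim (E \<inter> {x. b \<bullet> x = 0}) < dim E"
      using E dim_psubset[of "E \<inter> {x. b \<bullet> x = 0}" E] by (simp add: span_eq_iff[THEN iffD2] subspace_inter subspace_hyperplane psubset_eq)
    then show "dim (E \<inter> {x. b \<bullet> x = 0}) \<le> dim (mirror E r)" using rE by simp
  qed (use sM MsubK in auto)
  obtain y where y: "y \<in> E" "r y \<noteq> y" using \<open>mirror E r \<noteq> E\<close> by (auto simp: mirror_def)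
  define u where "u = y - r y"
  have uE: "u \<in> E" "u \<noteq> 0" using y rE E by (auto simp: u_def subspace_diff)
  have ru: "r u = - u" using y rE rf uE f by (simp add: u_def linear_diff)
  have "u \<notin> mirror E r"
  proof
    assume "u \<in> mirror E r"
    then have "u = - u" using ru by (simp add: mirror_def)
    then have "2 *\<^sub>R u = 0" by (metis add.right_inverse scaleR_2)
    then show False using uE by simp
  qed
  then have bu: "b \<bullet> u \<noteq> 0" using eqM uE by auto
  define a where "a = (2 / (b \<bullet> u)) *\<^sub>R b"
  have au: "a \<bullet> u = 2" using bu by (simp add: a_def)
  have "r x = x - (a \<bullet> x) *\<^sub>R u" if x: "x \<in> E" for x
  proof -
    let ?c = "(a \<bullet> x) / 2"
    let ?m = "x - ?c *\<^sub>R u"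
    have mE: "?m \<in> E" using x uE E by (simp add: subspace_diff subspace_scale)
    have "a \<bullet> ?m = 0" using au by (simp add: inner_diff_right)
    then have "b \<bullet> ?m = 0" using bu by (simp add: a_def)
    then have "?m \<in> mirror E r" using mE eqM by blast
    then have "r ?m = ?m" by (simp add: mirror_def)
    then have "f x - ?c *\<^sub>R f u = x - ?c *\<^sub>R u" using rf mE f by (simp add: linear_diff linear_scale)
    then have "r x = x - ?c *\<^sub>R u + ?c *\<^sub>R r u" using rf[OF x] rf[OF uE(1)] by (simp add: algebra_simps)
    then show ?thesis unfolding ru by (simp add: algebra_simps flip: scaleR_add_left)
  qed
  then show ?thesis using uE au unfolding root_pair_def by blast
qed

lemma root_reflection:
  assumes E: "subspace E" and ext: "r \<in> extensional E" and root: "root_pair E r a u"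
  shows "is_reflection E r"
  unfolding is_reflection_def
proof (intro conjI ballI)
  note rt = rootD[OF root]
  have "linear (\<lambda>x. x - (a \<bullet> x) *\<^sub>R u)"
    by (intro linearI) (auto simp: inner_add_right algebra_simps)
  moreover have "r = restrict (\<lambda>x. x - (a \<bullet> x) *\<^sub>R u) E" using ext rt(3) by (auto simp: extensional_def)
  ultimately show "\<exists>f. linear f \<and> r = restrict f E" by blast
  show rE: "r ` E \<subseteq> E" using rt E by (auto simp: subspace_diff subspace_scale)
  show "r (r x) = x" if "x \<in> E" for x
  proof -
    have "r x \<in> E" using rE that by blast
    then have "r (r x) = r x - (a \<bullet> r x) *\<^sub>R u" using rt by blast
    also have "a \<bullet> r x = - (a \<bullet> x)" using rt(2) rt(3)[OF that] by (simp add: inner_diff_right)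
    finally show ?thesis using rt(3)[OF that] by simp
  qed
  have eq: "mirror E r = E \<inter> {x. a \<bullet> x = 0}" using rt(6) by (auto simp: mirror_def)
  have "E \<inter> {x. a \<bullet> x = 0} \<noteq> {}" "\<not> E \<subseteq> {x. a \<bullet> x = 0}" using subspace_0[OF E] rt by auto
  then have "aff_dim (E \<inter> {x. a \<bullet> x = 0}) = aff_dim E - 1"
    using aff_dim_affine_Int_hyperplane[OF subspace_imp_affine[OF E], of a 0] by auto
  then have "int (dim (E \<inter> {x. a \<bullet> x = 0})) = int (dim E) - 1"
    using E by (simp add: aff_dim_subspace subspace_inter subspace_hyperplane)
  then show "dim (mirror E r) + 1 = dim E" unfolding eq by linarith
qed

section \<open>Groups generated by involutions\<close>

lemma BijGroup_one: "\<one>\<^bsub>BijGroup N\<^esub> = (\<lambda>x\<in>N. x)" by (simp add: BijGroup_def)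

lemma BijGroup_mult:
  "f \<in> carrier (BijGroup N) \<Longrightarrow> g \<in> carrier (BijGroup N) \<Longrightarrow> f \<otimes>\<^bsub>BijGroup N\<^esub> g = compose N f g"
  by (simp add: BijGroup_def)

lemma involution_in_BijGroup:
  assumes "f \<in> extensional N" "\<And>z. z \<in> N \<Longrightarrow> f z \<in> N" "\<And>z. z \<in> N \<Longrightarrow> f (f z) = z"
  shows "f \<in> carrier (BijGroup N)"
proof -
  have "bij_betw f N N" by (rule bij_betwI[where g=f]) (use assms in auto)
  then show ?thesis using assms by (simp add: BijGroup_def Bij_def)
qed

lemma involution_inv:
  assumes f: "f \<in> carrier (BijGroup N)" and inv: "\<And>z. z \<in> N \<Longrightarrow> f (f z) = z"
  shows "inv\<^bsub>BijGroup N\<^esub> f = f"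
proof -
  interpret B: group "BijGroup N" by (rule group_BijGroup)
  have "f \<otimes>\<^bsub>BijGroup N\<^esub> f = \<one>\<^bsub>BijGroup N\<^esub>"
    unfolding BijGroup_mult[OF f f] BijGroup_one using inv by (auto simp: compose_def)
  then show ?thesis using B.inv_equality f by blast
qed

lemma subgroup_BijGroup:
  assumes "subgroup A (BijGroup E)"
  shows "(\<lambda>x\<in>E. x) \<in> A" "\<gamma> \<in> A \<Longrightarrow> \<gamma> \<in> extensional E" "\<gamma> \<in> A \<Longrightarrow> x \<in> E \<Longrightarrow> \<gamma> x \<in> E"
    "\<gamma> \<in> A \<Longrightarrow> \<delta> \<in> A \<Longrightarrow> compose E \<gamma> \<delta> \<in> A"
    "\<gamma> \<in> A \<Longrightarrow> \<exists>\<delta>\<in>A. \<forall>x\<in>E. \<delta> (\<gamma> x) = x \<and> \<gamma> (\<delta> x) = x"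
proof -
  interpret B: group "BijGroup E" by (rule group_BijGroup)
  interpret A: subgroup A "BijGroup E" by (rule assms)
  show "(\<lambda>x\<in>E. x) \<in> A" using A.one_closed by (simp add: BijGroup_one)
  show "\<gamma> \<in> A \<Longrightarrow> \<gamma> \<in> extensional E" "\<gamma> \<in> A \<Longrightarrow> x \<in> E \<Longrightarrow> \<gamma> x \<in> E"
    using A.subset by (auto simp: BijGroup_def Bij_def bij_betw_def)
  show "compose E \<gamma> \<delta> \<in> A" if "\<gamma> \<in> A" "\<delta> \<in> A"
    using A.m_closed[OF that] BijGroup_mult[OF A.mem_carrier[OF that(1)] A.mem_carrier[OF that(2)]] by simp
  assume \<gamma>: "\<gamma> \<in> A"
  let ?d = "inv\<^bsub>BijGroup E\<^esub> \<gamma>"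
  have d: "?d \<in> A" using \<gamma> by simp
  note c = A.mem_carrier[OF \<gamma>] A.mem_carrier[OF d]
  have "compose E ?d \<gamma> = (\<lambda>x\<in>E. x)" "compose E \<gamma> ?d = (\<lambda>x\<in>E. x)"
    using B.l_inv[OF c(1)] B.r_inv[OF c(1)] BijGroup_mult[OF c(2,1)] BijGroup_mult[OF c] by (auto simp: BijGroup_one)
  then have "\<forall>x\<in>E. ?d (\<gamma> x) = x \<and> \<gamma> (?d x) = x" by (metis compose_eq restrict_apply')
  then show "\<exists>\<delta>\<in>A. \<forall>x\<in>E. \<delta> (\<gamma> x) = x \<and> \<gamma> (\<delta> x) = x" using d by blast
qed

text \<open>
  The inverse of a generator is again a generator, so the induction has no case for inverses.
\<close>

lemma generate_involutions_induct [consumes 1, case_names carrier involution one gen comp]: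
  assumes \<gamma>: "\<gamma> \<in> generate (BijGroup E) S"
    and S: "\<And>s. s \<in> S \<Longrightarrow> s \<in> carrier (BijGroup E)" "\<And>s z. s \<in> S \<Longrightarrow> z \<in> E \<Longrightarrow> s (s z) = z"
    and one: "P (\<lambda>x\<in>E. x)" and gen: "\<And>s. s \<in> S \<Longrightarrow> P s"
    and comp: "\<And>f h. f \<in> generate (BijGroup E) S \<Longrightarrow> h \<in> generate (BijGroup E) S \<Longrightarrow> P f \<Longrightarrow> P h \<Longrightarrow> P (compose E f h)"
  shows "P \<gamma>"
  using \<gamma>
proof induction
  case one show ?case unfolding BijGroup_one by (rule assms(4))
next
  case (incl s) then show ?case by (rule gen)
next
  case (inv s)
  have "inv\<^bsub>BijGroup E\<^esub> s = s" by (rule involution_inv) (use S inv in auto)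
  then show ?case using gen[OF inv] by simp
next
  case (eng f h)
  interpret B: group "BijGroup E" by (rule group_BijGroup)
  have "f \<in> carrier (BijGroup E)" "h \<in> carrier (BijGroup E)"
    using eng.hyps B.generate_in_carrier[of S] S(1) by blast+
  then show ?case using comp[OF eng.hyps eng.IH] BijGroup_mult by metis
qed

lemma restrict_compose:
  "N \<subseteq> E \<Longrightarrow> \<forall>z\<in>N. g z \<in> N \<Longrightarrow> restrict (compose E f g) N = compose N (restrict f N) (restrict g N)"
  by (rule ext) (auto simp: compose_def)

text \<open>Restricting transformations to a set that the generators preserve is multiplicative.\<close>

lemma generate_restrict:
  assumes NE: "N \<subseteq> E" and S: "\<And>s. s \<in> S \<Longrightarrow> s \<in> carrier (BijGroup E)" "\<And>s z. s \<in> S \<Longrightarrow> z \<in> E \<Longrightarrow> s (s z) = z"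
    "\<And>s z. s \<in> S \<Longrightarrow> z \<in> N \<Longrightarrow> s z \<in> N"
  shows "(\<lambda>\<gamma>. restrict \<gamma> N) ` generate (BijGroup E) S = generate (BijGroup N) ((\<lambda>s. restrict s N) ` S)"
    and "subgroup (generate (BijGroup N) ((\<lambda>s. restrict s N) ` S)) (BijGroup N)"
proof -
  interpret E: group "BijGroup E" by (rule group_BijGroup)
  interpret N: group "BijGroup N" by (rule group_BijGroup)
  let ?S = "(\<lambda>s. restrict s N) ` S"
  have restr_one: "restrict (\<lambda>x\<in>E. x) N = (\<lambda>x\<in>N. x)" by (rule ext) (use NE in auto)
  have invN: "s (s z) = z" if "s \<in> ?S" "z \<in> N" for s z using S(2,3) NE that by (auto simp: subset_iff)
  have SN: "s \<in> carrier (BijGroup N)" if "s \<in> ?S" for s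
    by (rule involution_in_BijGroup) (use S(3) invN[OF that] that in auto)
  show sub: "subgroup (generate (BijGroup N) ?S) (BijGroup N)" by (rule N.generate_is_subgroup) (use SN in blast)
  have sE: "subgroup (generate (BijGroup E) S) (BijGroup E)" by (rule E.generate_is_subgroup) (use S(1) in blast)
  have fwd: "(\<forall>z\<in>N. \<gamma> z \<in> N) \<and> restrict \<gamma> N \<in> generate (BijGroup N) ?S" if "\<gamma> \<in> generate (BijGroup E) S" for \<gamma>
    using that
  proof (induction rule: generate_involutions_induct)
    case one
    have "\<forall>z\<in>N. (\<lambda>x\<in>E. x) z \<in> N" using NE by auto
    then show ?case unfolding restr_one using subgroup_BijGroup(1)[OF sub] by blast
  next
    case (gen s) then show ?case using S(3) by (auto intro: generate.incl)
  next
    case (comp f h)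
    have "restrict (compose E f h) N = compose N (restrict f N) (restrict h N)"
      using comp.IH by (intro restrict_compose NE) blast
    moreover have "\<forall>z\<in>N. compose E f h z \<in> N" using comp.IH NE by (auto simp: compose_def)
    ultimately show ?case using subgroup_BijGroup(4)[OF sub, of "restrict f N" "restrict h N"] comp.IH by metis
  qed (use S in auto)
  have bwd: "x \<in> (\<lambda>\<gamma>. restrict \<gamma> N) ` generate (BijGroup E) S" if "x \<in> generate (BijGroup N) ?S" for x
    using that
  proof (induction rule: generate_involutions_induct)
    case one show ?case by (rule image_eqI[where x="\<lambda>x\<in>E. x"]) (simp only: restr_one, rule subgroup_BijGroup(1)[OF sE])
  next
    case (gen s) then show ?case by (auto intro: generate.incl)
  next
    case (comp f h)
    then obtain f' h' where g: "f' \<in> generate (BijGroup E) S" "f = restrict f' N" "h' \<in> generate (BijGroup E) S" "h = restrict h' N"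
      by blast
    have "restrict (compose E f' h') N = compose N f h"
      unfolding g(2,4) using fwd[OF g(3)] by (intro restrict_compose NE) blast
    then show ?case using subgroup_BijGroup(4)[OF sE g(1,3)] by (metis image_eqI)
  qed (use SN invN in auto)
  show "(\<lambda>\<gamma>. restrict \<gamma> N) ` generate (BijGroup E) S = generate (BijGroup N) ?S" using fwd bwd by blast
qed

section \<open>Discrete linear groups with reflections\<close>

text \<open>
  Of a Coxeter group only the discreteness is retained: finite stabilizers and locally
  finitely many mirrors. In this form \<open>\<Gamma>\<close> on the cone over the space,
  \<open>\<Delta>(X)\<close> on the mirror \<open>X\<close>, and
  \<open>\<Gamma>\<^sub>C\<close> on the normal space are all instances.
\<close>

locale refl_action =
  fixes E U :: "'a::euclidean_space set" and G :: "('a \<Rightarrow> 'a) set"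
  assumes subspace_E: "subspace E" and convex_U: "convex U" and openin_U: "openin (top_of_set E) U" and U_ne: "U \<noteq> {}"
    and G_subgroup: "subgroup G (BijGroup E)"
    and G_lin: "\<gamma> \<in> G \<Longrightarrow> \<exists>f. linear f \<and> (\<forall>x\<in>E. \<gamma> x = f x)"
    and G_U: "\<gamma> \<in> G \<Longrightarrow> x \<in> U \<Longrightarrow> \<gamma> x \<in> U"
    and G_fin: "x \<in> U \<Longrightarrow> finite {\<gamma>\<in>G. \<gamma> x = x}"
    and G_lf: "x \<in> U \<Longrightarrow> \<exists>V. open V \<and> x \<in> V \<and> finite {r\<in>reflections E G. \<exists>y\<in>V \<inter> U. r y = y}"
begin

abbreviation "R \<equiv> reflections E G"

lemmas G_id = subgroup_BijGroup(1)[OF G_subgroup]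
  and G_ext = subgroup_BijGroup(2)[OF G_subgroup]
  and G_E = subgroup_BijGroup(3)[OF G_subgroup]
  and G_comp = subgroup_BijGroup(4)[OF G_subgroup]
  and G_inv = subgroup_BijGroup(5)[OF G_subgroup]

lemma R_root: "r \<in> R \<Longrightarrow> \<exists>a u. root_pair E r a u"
  using reflection_root[OF subspace_E] by (auto simp: reflections_def)

lemma R_G: "r \<in> R \<Longrightarrow> r \<in> G" by (simp add: reflections_def)

lemma R_I: "r \<in> G \<Longrightarrow> root_pair E r a u \<Longrightarrow> r \<in> R"
  using root_reflection[OF subspace_E G_ext] by (auto simp: reflections_def)

sublocale arrangement E U R
proof
  show "hyperplanar E r" if "r \<in> R" for r using R_root[OF that] root_hyperplanar by blast
qed (use subspace_E convex_U openin_U G_lf in auto)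

lemma G_add: "\<gamma> \<in> G \<Longrightarrow> x \<in> E \<Longrightarrow> y \<in> E \<Longrightarrow> \<gamma> (x + y) = \<gamma> x + \<gamma> y"
  using G_lin[of \<gamma>] by (auto simp: linear_add subspace_add[OF subspace_E])
lemma G_scale: "\<gamma> \<in> G \<Longrightarrow> x \<in> E \<Longrightarrow> \<gamma> (c *\<^sub>R x) = c *\<^sub>R \<gamma> x"
  using G_lin subspace_E by (metis linear_scale subspace_scale)
lemma G_diff: "\<gamma> \<in> G \<Longrightarrow> x \<in> E \<Longrightarrow> y \<in> E \<Longrightarrow> \<gamma> (x - y) = \<gamma> x - \<gamma> y"
  using G_lin[of \<gamma>] by (auto simp: linear_diff subspace_diff[OF subspace_E])
lemma G_inj: "\<gamma> \<in> G \<Longrightarrow> x \<in> E \<Longrightarrow> y \<in> E \<Longrightarrow> \<gamma> x = \<gamma> y \<Longrightarrow> x = y"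
  using G_inv by metis
lemma G_zero: "\<gamma> \<in> G \<Longrightarrow> \<gamma> 0 = 0"
  using G_scale[of \<gamma> 0 0] subspace_0[OF subspace_E] by simp
lemma G_comp_app: "x \<in> E \<Longrightarrow> compose E \<gamma> \<delta> x = \<gamma> (\<delta> x)" by (simp add: compose_def)
lemma G_eqI: "\<gamma> \<in> G \<Longrightarrow> \<delta> \<in> G \<Longrightarrow> (\<And>x. x \<in> E \<Longrightarrow> \<gamma> x = \<delta> x) \<Longrightarrow> \<gamma> = \<delta>"
  using extensionalityI[OF G_ext G_ext] by blast

lemma R_E: "r \<in> R \<Longrightarrow> x \<in> E \<Longrightarrow> r x \<in> E" using G_E R_G by blast
lemma R_invol: "r \<in> R \<Longrightarrow> x \<in> E \<Longrightarrow> r (r x) = x" by (simp add: reflections_def is_reflection_def)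

text \<open>The midpoint of \<open>x\<close> and \<open>r x\<close> lies on the mirror.\<close>

lemma mirror_meets_U: assumes r: "r \<in> R" shows "\<exists>y\<in>U. r y = y"
proof -
  obtain x where x: "x \<in> U" using U_ne by blast
  let ?y = "(1/2) *\<^sub>R x + (1/2) *\<^sub>R r x"
  have rx: "r x \<in> U" "x \<in> E" "r x \<in> E" using x r G_U R_G UE R_E by auto
  have yU: "?y \<in> U" using convex_U x rx unfolding convex_def by (metis field_sum_of_halves half_gt_zero less_imp_le zero_less_one)
  have "r ?y = r ((1/2) *\<^sub>R x) + r ((1/2) *\<^sub>R r x)"
    using rx subspace_scale[OF subspace_E] by (intro G_add R_G r) auto
  also have "\<dots> = (1/2) *\<^sub>R r x + (1/2) *\<^sub>R x"
    by (simp only: G_scale[OF R_G[OF r] rx(2)] G_scale[OF R_G[OF r] rx(3)] R_invol[OF r rx(2)])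
  finally show ?thesis using yU by (metis add.commute)
qed

text \<open>
  If two different reflections had the same mirror, their product \<open>\<tau>\<close> would
  be a shear \<open>x \<mapsto> x - (b \<bullet> x) w\<close> with \<open>b \<bullet> w =
  0\<close>. Its powers are all different and fix the points of the mirror, which contradicts
  the finiteness of stabilizers.
\<close>

lemma refl_unique:
  assumes r: "r \<in> R" and s: "s \<in> R" and eq: "mirror E r = mirror E s"
  shows "r = s"
proof -
  obtain a u where r': "root_pair E r a u" using R_root[OF r] by blast
  obtain b v where s': "root_pair E s b v" using R_root[OF s] by blast
  note ru = rootD[OF r'] and sv = rootD[OF s']
  have ker: "a \<bullet> x = 0 \<longleftrightarrow> b \<bullet> x = 0" if "x \<in> E" for x
    using eq ru(6)[OF that] sv(6)[OF that] that unfolding mirror_def by blast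
  define c where "c = (a \<bullet> v) / 2"
  have ab: "a \<bullet> x = c * (b \<bullet> x)" if x: "x \<in> E" for x
  proof -
    have "x - ((b \<bullet> x) / 2) *\<^sub>R v \<in> E" using x sv subspace_E by (simp add: subspace_diff subspace_scale)
    moreover have "b \<bullet> (x - ((b \<bullet> x) / 2) *\<^sub>R v) = 0" using sv(2) by (simp add: inner_diff_right)
    ultimately have "a \<bullet> (x - ((b \<bullet> x) / 2) *\<^sub>R v) = 0" using ker by blast
    then show ?thesis by (simp add: inner_diff_right c_def)
  qed
  define w where "w = c *\<^sub>R u - v"
  have bw: "b \<bullet> w = 0" using ab[OF ru(1)] ru(2) sv(2) by (simp add: w_def inner_diff_right)
  have wE: "w \<in> E" using ru sv subspace_E by (simp add: w_def subspace_diff subspace_scale)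
  define \<tau> where "\<tau> = compose E s r"
  have \<tau>G: "\<tau> \<in> G" using G_comp R_G r s by (simp add: \<tau>_def)
  have \<tau>: "\<tau> x = x - (b \<bullet> x) *\<^sub>R w" if x: "x \<in> E" for x
  proof -
    have "\<tau> x = s (r x)" using x by (simp add: \<tau>_def G_comp_app)
    also have "\<dots> = r x - (b \<bullet> r x) *\<^sub>R v" using sv(3) R_E[OF r x] by blast
    also have "r x = x - (c * (b \<bullet> x)) *\<^sub>R u" using ru(3)[OF x] ab[OF x] by simp
    also have "b \<bullet> (x - (c * (b \<bullet> x)) *\<^sub>R u) = - (b \<bullet> x)" using ab[OF ru(1)] ru(2) by (simp add: inner_diff_right)
    finally show ?thesis by (simp add: w_def algebra_simps)
  qed
  obtain y where y: "y \<in> U" "r y = y" using mirror_meets_U[OF r] by blast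
  have by0: "b \<bullet> y = 0" using y ru(6) ker UE by auto
  have pow: "\<exists>\<delta>\<in>G. \<forall>x\<in>E. \<delta> x = x - (real (Suc n) * (b \<bullet> x)) *\<^sub>R w" for n
  proof (induction n)
    case 0 then show ?case using \<tau> \<tau>G by (intro bexI[of _ \<tau>]) auto
  next
    case (Suc n)
    then obtain \<delta> where \<delta>: "\<delta> \<in> G" "\<forall>x\<in>E. \<delta> x = x - (real (Suc n) * (b \<bullet> x)) *\<^sub>R w" by blast
    have "compose E \<delta> \<tau> x = x - (real (Suc (Suc n)) * (b \<bullet> x)) *\<^sub>R w" if x: "x \<in> E" for x
    proof -
      have "b \<bullet> \<tau> x = b \<bullet> x" using \<tau>[OF x] bw by (simp add: inner_diff_right)
      then have "\<delta> (\<tau> x) = x - ((b \<bullet> x) *\<^sub>R w + (real (Suc n) * (b \<bullet> x)) *\<^sub>R w)"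
        using \<delta>(2) G_E[OF \<tau>G x] \<tau>[OF x] by (simp add: diff_diff_eq)
      also have "(b \<bullet> x) *\<^sub>R w + (real (Suc n) * (b \<bullet> x)) *\<^sub>R w = (real (Suc (Suc n)) * (b \<bullet> x)) *\<^sub>R w"
        unfolding scaleR_add_left[symmetric] by (simp add: algebra_simps)
      finally show ?thesis using x by (simp add: G_comp_app)
    qed
    then show ?case using G_comp[OF \<delta>(1) \<tau>G] by blast
  qed
  have "w = 0"
  proof (rule ccontr)
    assume w0: "w \<noteq> 0"
    obtain D where D: "\<And>n. D n \<in> G" "\<And>n x. x \<in> E \<Longrightarrow> D n x = x - (real (Suc n) * (b \<bullet> x)) *\<^sub>R w" using pow by metis
    have "inj D"
    proof (rule injI)
      fix m n assume "D m = D n"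
      then have "(real (Suc m) * (b \<bullet> v)) *\<^sub>R w = (real (Suc n) * (b \<bullet> v)) *\<^sub>R w" using D(2)[OF sv(1)] by (metis diff_right_commute diff_eq_eq diff_add_cancel add_left_cancel)
      then show "m = n" using w0 sv(2) by simp
    qed
    moreover have "range D \<subseteq> {\<gamma>\<in>G. \<gamma> y = y}" using D y UE by0 by auto
    ultimately show False using G_fin[OF y(1)] by (meson finite_imageD finite_subset infinite_UNIV_nat)
  qed
  then have v: "v = c *\<^sub>R u" by (simp add: w_def)
  have "r x = s x" if x: "x \<in> E" for x
    using ru(3)[OF x] sv(3)[OF x] ab[OF x] v by (simp add: mult.commute)
  then show ?thesis using G_eqI R_G r s by blast
qed

text \<open>
  The reflection \<open>s\<close> is \<open>\<gamma> r \<gamma>\<inverse>\<close>. The factor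
  \<open>k\<close> appears because \<open>\<gamma>\<close> does not preserve lengths of
  displacements; only the signs matter.
\<close>

lemma conj_refl:
  assumes \<gamma>: "\<gamma> \<in> G" and r: "r \<in> R"
  shows "\<exists>s\<in>R. (\<forall>x\<in>E. s (\<gamma> x) = \<gamma> (r x)) \<and> (\<forall>x\<in>E. s (\<gamma> x) = \<gamma> x \<longleftrightarrow> r x = x) \<and>
    (\<exists>k>0. \<forall>x\<in>E. \<forall>y\<in>E. side s (\<gamma> x) (\<gamma> y) = k * side r x y)"
proof -
  obtain a u where r': "root_pair E r a u" using R_root[OF r] by blast
  note ru = rootD[OF r']
  obtain \<delta> where \<delta>: "\<delta> \<in> G" "\<And>x. x \<in> E \<Longrightarrow> \<delta> (\<gamma> x) = x" "\<And>x. x \<in> E \<Longrightarrow> \<gamma> (\<delta> x) = x" using G_inv[OF \<gamma>] by blast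
  obtain f where f: "linear f" "\<And>x. x \<in> E \<Longrightarrow> \<delta> x = f x" using G_lin[OF \<delta>(1)] by blast
  define s where "s = compose E \<gamma> (compose E r \<delta>)"
  have sG: "s \<in> G" unfolding s_def using G_comp \<gamma> \<delta>(1) R_G[OF r] by blast
  have s: "s (\<gamma> x) = \<gamma> (r x)" if "x \<in> E" for x
    using that G_E[OF \<gamma>] \<delta> by (simp add: s_def G_comp_app)
  have ad: "adjoint f a \<bullet> x = a \<bullet> \<delta> x" if "x \<in> E" for x
    using adjoint_works[OF f(1), of x a] f(2)[OF that] by (simp add: inner_commute)
  have "root_pair E s (adjoint f a) (\<gamma> u)"
    unfolding root_pair_def
  proof (intro conjI ballI)
    show "\<gamma> u \<in> E" using G_E \<gamma> ru by blast
    show "adjoint f a \<bullet> \<gamma> u = 2" using ad[OF G_E[OF \<gamma> ru(1)]] \<delta>(2)[OF ru(1)] ru(2) by simp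
    fix x assume x: "x \<in> E"
    have dx: "\<delta> x \<in> E" using G_E \<delta>(1) x by blast
    have "s x = \<gamma> (r (\<delta> x))" using s[OF dx] \<delta>(3)[OF x] by simp
    also have "\<dots> = \<gamma> (\<delta> x) - (a \<bullet> \<delta> x) *\<^sub>R \<gamma> u"
      using ru(3)[OF dx] G_diff[OF \<gamma> dx] G_scale[OF \<gamma> ru(1)] ru(1) subspace_scale[OF subspace_E] by simp
    finally show "s x = x - (adjoint f a \<bullet> x) *\<^sub>R \<gamma> u" using \<delta>(3)[OF x] ad[OF x] by simp
  qed
  note sr = R_I[OF sG this] and srt = rootD[OF this]
  have fixs: "s (\<gamma> x) = \<gamma> x \<longleftrightarrow> r x = x" if x: "x \<in> E" for x
    using s[OF x] G_inj[OF \<gamma> _ x] R_E[OF r x] by auto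
  have "side s (\<gamma> x) (\<gamma> y) = ((\<gamma> u \<bullet> \<gamma> u) / (u \<bullet> u)) * side r x y" if xy: "x \<in> E" "y \<in> E" for x y
    using srt(7)[OF G_E[OF \<gamma> xy(1)] G_E[OF \<gamma> xy(2)]] ru(7)[OF xy] ru(4)
      ad[OF G_E[OF \<gamma> xy(1)]] ad[OF G_E[OF \<gamma> xy(2)]] \<delta>(2)[OF xy(1)] \<delta>(2)[OF xy(2)] by simp
  moreover have "(\<gamma> u \<bullet> \<gamma> u) / (u \<bullet> u) > 0" using ru(4) srt(4) by simp
  ultimately show ?thesis using sr s fixs by blast
qed

lemma regular_image:
  assumes \<gamma>: "\<gamma> \<in> G" and x: "x \<in> U" "\<forall>r\<in>R. r x \<noteq> x"
  shows "\<gamma> x \<in> U" "\<forall>r\<in>R. r (\<gamma> x) \<noteq> \<gamma> x"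
proof -
  show "\<gamma> x \<in> U" using G_U \<gamma> x by blast
  have xE: "x \<in> E" using x UE by blast
  obtain \<delta> where \<delta>: "\<delta> \<in> G" "\<And>x. x \<in> E \<Longrightarrow> \<delta> (\<gamma> x) = x" "\<And>x. x \<in> E \<Longrightarrow> \<gamma> (\<delta> x) = x" using G_inv[OF \<gamma>] by blast
  show "\<forall>r\<in>R. r (\<gamma> x) \<noteq> \<gamma> x"
  proof
    fix r assume r: "r \<in> R"
    obtain s where s: "s \<in> R" "\<forall>y\<in>E. s (\<delta> y) = \<delta> y \<longleftrightarrow> r y = y" using conj_refl[OF \<delta>(1) r] by blast
    have "s (\<delta> (\<gamma> x)) \<noteq> \<delta> (\<gamma> x)" using s x \<delta>(2)[OF xE] by auto
    then show "r (\<gamma> x) \<noteq> \<gamma> x" using s G_E[OF \<gamma> xE] by blast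
  qed
qed

lemma image_cell_subset:
  assumes \<gamma>: "\<gamma> \<in> G" and x: "x \<in> E" and y: "y \<in> cell U R x"
  shows "\<gamma> y \<in> cell U R (\<gamma> x)"
proof -
  have yE: "y \<in> E" "y \<in> U" using y UE by (auto simp: cell_def)
  obtain \<delta> where \<delta>: "\<delta> \<in> G" "\<And>x. x \<in> E \<Longrightarrow> \<delta> (\<gamma> x) = x" "\<And>x. x \<in> E \<Longrightarrow> \<gamma> (\<delta> x) = x" using G_inv[OF \<gamma>] by blast
  have "side r (\<gamma> x) (\<gamma> y) \<ge> 0" if r: "r \<in> R" for r
  proof -
    obtain s k where s: "s \<in> R" "k > 0" "\<forall>x\<in>E. \<forall>y\<in>E. side s (\<delta> x) (\<delta> y) = k * side r x y" using conj_refl[OF \<delta>(1) r] by blast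
    have "side s x y = k * side r (\<gamma> x) (\<gamma> y)" using s(3) \<delta>(2) x yE G_E[OF \<gamma>] by metis
    moreover have "side s x y \<ge> 0" using y s(1) by (simp add: cell_def)
    ultimately show ?thesis using s(2) by (simp add: zero_le_mult_iff)
  qed
  then show ?thesis using G_U[OF \<gamma> yE(2)] by (simp add: cell_def)
qed

lemma image_cell:
  assumes \<gamma>: "\<gamma> \<in> G" and x: "x \<in> E"
  shows "\<gamma> ` cell U R x = cell U R (\<gamma> x)"
proof
  show "\<gamma> ` cell U R x \<subseteq> cell U R (\<gamma> x)" using image_cell_subset[OF \<gamma> x] by blast
  obtain \<delta> where \<delta>: "\<delta> \<in> G" "\<And>x. x \<in> E \<Longrightarrow> \<delta> (\<gamma> x) = x" "\<And>x. x \<in> E \<Longrightarrow> \<gamma> (\<delta> x) = x" using G_inv[OF \<gamma>] by blast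
  show "cell U R (\<gamma> x) \<subseteq> \<gamma> ` cell U R x"
  proof
    fix y assume y: "y \<in> cell U R (\<gamma> x)"
    then have "y \<in> E" using UE by (auto simp: cell_def)
    moreover have "\<delta> y \<in> cell U R x" using image_cell_subset[OF \<delta>(1) G_E[OF \<gamma> x] y] \<delta>(2)[OF x] by simp
    ultimately show "y \<in> \<gamma> ` cell U R x" using \<delta>(3) by (metis image_eqI)
  qed
qed

text \<open>
  Reflecting in the wall \<open>s\<close> fixes \<open>w\<close>, and \<open>w\<close> lies on
  no mirror other than that of \<open>s\<close>. So \<open>x\<close> and \<open>s x\<close>
  are both on the side of \<open>w\<close>.
\<close>

lemma other_side_of_wall:
  assumes x: "x \<in> U" "\<forall>r\<in>R. r x \<noteq> x" and w: "wall_at E U R x s w" and r: "r \<in> R" "r \<noteq> s"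
  shows "side r x (s x) > 0"
proof -
  have s: "s \<in> R" "s w = w" "w \<in> cell U R x" using w by (auto simp: wall_at_def)
  have E: "x \<in> E" "w \<in> E" "s x \<in> E" using x s UE R_E by (auto simp: cell_def)
  have nw: "r w \<noteq> w" using w r refl_unique[OF r(1) s(1)] unfolding wall_at_def by blast
  have "w \<in> cell U R (s x)" using image_cell_subset[OF R_G[OF s(1)] E(1) s(3)] s(2) by simp
  then have "side r (s x) w \<ge> 0" using r by (simp add: cell_def)
  then have "side r (s x) w > 0" using nw regular_image(2)[OF R_G[OF s(1)] x] r E by (intro side_pos) auto
  moreover have "side r x w > 0" using s(3) r x nw E by (intro side_pos) (auto simp: cell_def)
  ultimately show ?thesis using side_trans[OF r(1) E(1,2,3)] by (simp add: side_commute)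
qed

lemma G_Bij: "\<gamma> \<in> G \<Longrightarrow> \<gamma> \<in> carrier (BijGroup E)"
  by (rule subgroup.mem_carrier[OF G_subgroup])

lemma R_Bij: "r \<in> R \<Longrightarrow> r \<in> carrier (BijGroup E)"
  using G_Bij R_G by blast

end

section \<open>Reflections through a point of a chamber\<close>

context refl_action begin

text \<open>
  The walls at \<open>p\<close> of the chamber of \<open>x\<close> contain \<open>H\<close>;
  let \<open>A\<close> be the group generated by their reflections. Consider the cells of the
  arrangement of the mirrors through \<open>p\<close>. As long as some mirror separates a
  point \<open>z\<close> from \<open>x\<close>, a wall \<open>s\<close> of the chamber does so
  too, and \<open>s z\<close> is separated from \<open>x\<close> by fewer mirrors. So
  \<open>A\<close> acts transitively on these cells.

  Given \<open>r\<close>, choose a point \<open>w0\<close> on its mirror and on no other, and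
  a cell adjacent to \<open>w0\<close>. If \<open>\<gamma>\<close> in \<open>A\<close> takes
  this cell to the cell of \<open>x\<close>, then \<open>\<gamma> r \<gamma>\<inverse>\<close>
  is the reflection in a wall, and so \<open>r\<close> is in \<open>A\<close>.
\<close>

lemma reflections_in_stratum_group:
  assumes x: "x \<in> U" "\<forall>r\<in>R. r x \<noteq> x" and p: "p \<in> cell U R x"
    and H: "H \<subseteq> cell U R x" "\<And>s h. s \<in> R \<Longrightarrow> s p = p \<Longrightarrow> h \<in> H \<Longrightarrow> s h = h"
    and r: "r \<in> R" "r p = p"
  shows "r \<in> stratum_group E G (cell U R x) H"
proof -
  interpret B: group "BijGroup E" by (rule group_BijGroup)
  let ?C = "cell U R x"
  define S where "S = {r\<in>R. \<exists>W. W facet_of ?C \<and> H \<subseteq> W \<and> W \<subseteq> mirror E r}"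
  have SC: "S \<subseteq> carrier (BijGroup E)" using G_Bij R_G by (auto simp: S_def)
  define A where "A = generate (BijGroup E) S"
  interpret A: subgroup A "BijGroup E" unfolding A_def by (rule B.generate_is_subgroup[OF SC])
  define Rp where "Rp = {r\<in>R. r p = p}"
  have pE: "p \<in> E" "p \<in> U" "x \<in> E" using p x UE by (auto simp: cell_def)
  interpret L: arrangement E E Rp unfolding Rp_def using arrangement_at[OF pE(2)] .
  have finRp: "finite Rp" unfolding Rp_def using finite_fixing pE by blast
  have RpR: "\<And>s. s \<in> Rp \<Longrightarrow> s \<in> R" "\<And>s. s \<in> Rp \<Longrightarrow> s p = p" by (auto simp: Rp_def)
  have wallS: "s \<in> S" if "wall_at E U R x s w" "s p = p" for s w
  proof -
    have s: "s \<in> R" using that by (simp add: wall_at_def)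
    have "H \<subseteq> ?C \<inter> mirror E s" using H s that(2) UE by (auto simp: mirror_def cell_def)
    then show ?thesis unfolding S_def using wall_facet(1)[OF x that(1)] s by blast
  qed
  have trans: "\<exists>\<gamma>\<in>A. \<gamma> \<in> G \<and> \<gamma> p = p \<and> (\<forall>r\<in>Rp. side r x (\<gamma> z) > 0)" if "z \<in> E" "\<forall>r\<in>Rp. r z \<noteq> z" for z
    using that
  proof (induction "card {r\<in>Rp. side r x z < 0}" arbitrary: z rule: less_induct)
    case less
    show ?case
    proof (cases "\<exists>r0\<in>Rp. side r0 x z < 0")
      case False
      have "side r x z > 0" if "r \<in> Rp" for r
        using False that less.prems RpR x pE by (intro side_pos) (auto simp: not_less)
      then show ?thesis using G_id less.prems pE A.one_closed by (intro bexI[of _ "\<lambda>x\<in>E. x"]) (auto simp: BijGroup_one)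
    next
      case True
      then obtain r0 where r0: "r0 \<in> R" "r0 p = p" "side r0 x z < 0" using RpR by blast
      obtain s w where s: "wall_at E U R x s w" "s p = p" "side s x z < 0"
        using local_wall[OF x p less.prems(1) r0] by blast
      have sR: "s \<in> R" using s by (simp add: wall_at_def)
      have sS: "s \<in> S" using wallS s by blast
      have szE: "s z \<in> E" "s (s z) = z" "s x \<in> E" using R_E[OF sR] R_invol[OF sR] less.prems pE by auto
      define conj where "conj r t \<longleftrightarrow> t \<in> R \<and> (\<forall>y\<in>E. t (s y) = s (r y)) \<and> (\<forall>y\<in>E. t (s y) = s y \<longleftrightarrow> r y = y) \<and>
        (\<exists>k>0. \<forall>x\<in>E. \<forall>y\<in>E. side t (s x) (s y) = k * side r x y)" for r t
      have "\<forall>r\<in>R. \<exists>t. conj r t" using conj_refl[OF R_G[OF sR]] unfolding conj_def by blast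
      then obtain \<phi> where conj: "\<forall>r\<in>R. conj r (\<phi> r)" by (rule bchoice[THEN exE])
      have \<phi>: "\<And>r. r \<in> R \<Longrightarrow> \<phi> r \<in> R"
          "\<And>r y. r \<in> R \<Longrightarrow> y \<in> E \<Longrightarrow> \<phi> r (s y) = s (r y)"
          "\<And>r y. r \<in> R \<Longrightarrow> y \<in> E \<Longrightarrow> \<phi> r (s y) = s y \<longleftrightarrow> r y = y"
          "\<And>r. r \<in> R \<Longrightarrow> \<exists>k>0. \<forall>x\<in>E. \<forall>y\<in>E. side (\<phi> r) (s x) (s y) = k * side r x y"
        using conj unfolding conj_def by blast+
      have \<phi>p: "\<phi> r \<in> Rp" if "r \<in> Rp" for r
        using \<phi>(1)[of r] \<phi>(3)[of r p] that pE s(2) by (auto simp: Rp_def)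
      have reg: "\<forall>r\<in>Rp. r (s z) \<noteq> s z"
      proof
        fix r assume r: "r \<in> Rp"
        have "\<phi> r z \<noteq> z" using less.prems \<phi>p r by blast
        then show "r (s z) \<noteq> s z" using \<phi>(3)[OF RpR(1)[OF r] szE(1)] szE(2) by simp
      qed
      \<comment> \<open>The map \<open>\<phi>\<close> is conjugation by \<open>s\<close>. A mirror that
        separates \<open>s z\<close> from \<open>x\<close> corresponds to one separating
        \<open>z\<close> from \<open>s x\<close>. The latter also separates \<open>z\<close>
        from \<open>x\<close>, because it is not the mirror of \<open>s\<close>: that one
        does not separate \<open>s z\<close> from \<open>x\<close>.\<close>
      have map: "\<phi> r \<in> {r\<in>Rp. side r x z < 0} - {s}" if r: "r \<in> Rp" "side r x (s z) < 0" for r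
      proof -
        have rR: "r \<in> R" using RpR r by blast
        obtain k where k: "k > 0" "\<forall>x\<in>E. \<forall>y\<in>E. side (\<phi> r) (s x) (s y) = k * side r x y" using \<phi>(4)[OF rR] by blast
        have neg: "side (\<phi> r) (s x) z < 0" using k r(2) pE(3) szE by (metis mult_pos_neg)
        have ne: "\<phi> r \<noteq> s"
        proof
          assume eq: "\<phi> r = s"
          have "s y = r y" if "y \<in> E" for y
            using \<phi>(2)[OF rR that] eq G_inj[OF R_G[OF sR] R_E[OF sR that] R_E[OF rR that]] by simp
          then have "s = r" using G_eqI R_G sR rR by blast
          moreover obtain a u where rt: "root_pair E s a u" using R_root[OF sR] by blast
          have "a \<bullet> s z = - (a \<bullet> z)" using rootD(2)[OF rt] rootD(3)[OF rt less.prems(1)] by (simp add: inner_diff_right)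
          then have "side s x (s z) = - side s x z" using rootD(7)[OF rt pE(3)] less.prems(1) szE by simp
          ultimately show False using r s by simp
        qed
        have "side (\<phi> r) x (s x) > 0" using other_side_of_wall[OF x s(1) \<phi>(1)[OF rR] ne] .
        then have "side (\<phi> r) x z < 0" using side_trans_less[OF \<phi>(1)[OF rR] pE(3) szE(3) less.prems(1)] neg by simp
        then show ?thesis using ne \<phi>p r by blast
      qed
      have inj: "inj_on \<phi> {r\<in>Rp. side r x (s z) < 0}"
      proof (rule inj_onI)
        fix r r' assume a: "r \<in> {r\<in>Rp. side r x (s z) < 0}" "r' \<in> {r\<in>Rp. side r x (s z) < 0}" "\<phi> r = \<phi> r'"
        then have R: "r \<in> R" "r' \<in> R" using RpR by auto
        have "r y = r' y" if "y \<in> E" for y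
          using \<phi>(2)[OF R(1) that] \<phi>(2)[OF R(2) that] a(3) G_inj[OF R_G[OF sR] R_E[OF R(1) that] R_E[OF R(2) that]] by simp
        then show "r = r'" using G_eqI R_G R by blast
      qed
      have "card {r\<in>Rp. side r x (s z) < 0} \<le> card ({r\<in>Rp. side r x z < 0} - {s})"
        by (rule card_inj_on_le[OF inj]) (use map finRp in auto)
      also have "\<dots> < card {r\<in>Rp. side r x z < 0}"
      proof (rule card_Diff1_less)
        show "finite {r\<in>Rp. side r x z < 0}" using finRp by simp
        show "s \<in> {r\<in>Rp. side r x z < 0}" using s sR by (simp add: Rp_def)
      qed
      finally obtain \<gamma> where \<gamma>: "\<gamma> \<in> A" "\<gamma> \<in> G" "\<gamma> p = p" "\<forall>r\<in>Rp. side r x (\<gamma> (s z)) > 0"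
        using less.hyps[OF _ szE(1) reg] by blast
      have "compose E \<gamma> s \<in> A"
        using A.m_closed[OF \<gamma>(1), of s] BijGroup_mult[OF G_Bij[OF \<gamma>(2)] R_Bij[OF sR]] sS by (simp add: A_def generate.incl)
      moreover have "compose E \<gamma> s \<in> G" using G_comp \<gamma> R_G[OF sR] by blast
      moreover have "compose E \<gamma> s p = p" "compose E \<gamma> s z = \<gamma> (s z)" using pE s less.prems \<gamma> by (auto simp: G_comp_app)
      ultimately show ?thesis using \<gamma>(4) by (intro bexI[of _ "compose E \<gamma> s"]) auto
    qed
  qed
  have rRp: "r \<in> Rp" using r by (simp add: Rp_def)
  have "\<exists>w0\<in>mirror E r. \<forall>c\<in>cn ` (Rp - {r}). c \<bullet> w0 \<noteq> 0"
  proof (rule avoid_hyperplanes[OF subspace_mirror[OF r(1)], of _ 0])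
    show "openin (top_of_set (mirror E r)) (mirror E r)" by simp
    show "0 \<in> mirror E r" using subspace_0[OF subspace_mirror[OF r(1)]] .
    show "finite (cn ` (Rp - {r}))" using finRp by simp
    fix c assume "c \<in> cn ` (Rp - {r})"
    then obtain s where s: "s \<in> R" "s \<noteq> r" "c = cn s" using RpR by auto
    have "\<not> mirror E r \<subseteq> mirror E s" using mirror_subset_eq[OF r(1) s(1)] refl_unique[OF r(1) s(1)] s by blast
    then show "\<exists>v\<in>mirror E r. c \<bullet> v \<noteq> 0" using mirror_eq[OF s(1)] s by (auto simp: mirror_def)
  qed
  then obtain w0 where w0: "w0 \<in> mirror E r" "\<And>s. s \<in> Rp \<Longrightarrow> s \<noteq> r \<Longrightarrow> cn s \<bullet> w0 \<noteq> 0" by blast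
  have w0E: "w0 \<in> E" "r w0 = w0" using w0 by (auto simp: mirror_def)
  have w0n: "s w0 \<noteq> w0" if "s \<in> Rp" "s \<noteq> r" for s using cn_fix[OF RpR(1)[OF that(1)] w0E(1)] w0(2)[OF that] by blast
  obtain v where v: "v \<in> E" "r v \<noteq> v" using cn_nz[OF r(1)] cn_fix[OF r(1)] by blast
  obtain d where d: "d > 0" "\<And>t. 0 \<le> t \<Longrightarrow> t < d \<Longrightarrow> (\<forall>s\<in>Rp. s w0 \<noteq> w0 \<longrightarrow> side s w0 (w0 + t *\<^sub>R v) > 0)"
    using L.ray_nbhd[OF w0E(1) v(1)] by blast
  \<comment> \<open>a point of a cell that has \<open>w0\<close> in its boundary\<close>
  define z where "z = w0 + (d/2) *\<^sub>R v"
  have zE: "z \<in> E" using w0E v subspace_E by (simp add: z_def subspace_add subspace_scale)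
  have zs: "side s w0 z > 0" if "s \<in> Rp" "s \<noteq> r" for s unfolding z_def using d w0n that by simp
  have "\<forall>s\<in>Rp. s z \<noteq> z"
  proof
    fix s assume s: "s \<in> Rp"
    show "s z \<noteq> z"
    proof (cases "s = r")
      case True then show ?thesis using fix_local[OF r(1) w0E(1) v(1) w0E(2), of "d/2"] v d by (auto simp: z_def)
    next
      case False then show ?thesis using zs[OF s] by (auto simp: side_def)
    qed
  qed
  then obtain \<gamma> where \<gamma>: "\<gamma> \<in> A" "\<gamma> \<in> G" "\<gamma> p = p" "\<And>s. s \<in> Rp \<Longrightarrow> side s x (\<gamma> z) > 0" using trans[OF zE] by blast
  obtain \<delta> where \<delta>: "\<delta> \<in> G" "\<And>x. x \<in> E \<Longrightarrow> \<delta> (\<gamma> x) = x" "\<And>x. x \<in> E \<Longrightarrow> \<gamma> (\<delta> x) = x" using G_inv[OF \<gamma>(2)] by blast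
  have \<delta>p: "\<delta> p = p" using \<delta>(2)[OF pE(1)] \<gamma>(3) by simp
  have gE: "\<gamma> z \<in> E" "\<gamma> w0 \<in> E" using G_E[OF \<gamma>(2)] zE w0E by auto
  obtain r' where r': "r' \<in> R" "\<And>y. y \<in> E \<Longrightarrow> r' (\<gamma> y) = \<gamma> (r y)" using conj_refl[OF \<gamma>(2) r(1)] by blast
  have r'p: "r' p = p" using r'(2)[OF pE(1)] \<gamma>(3) r(2) by simp
  have local: "side s x (\<gamma> w0) \<ge> 0 \<and> (s (\<gamma> w0) = \<gamma> w0 \<longrightarrow> s = r')" if s: "s \<in> Rp" for s
  proof -
    have sR: "s \<in> R" "s p = p" using RpR s by auto
    obtain t k where t: "t \<in> R" "\<forall>y\<in>E. t (\<delta> y) = \<delta> (s y)" "\<forall>y\<in>E. t (\<delta> y) = \<delta> y \<longleftrightarrow> s y = y"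
      "k > 0" "\<forall>y\<in>E. \<forall>y'\<in>E. side t (\<delta> y) (\<delta> y') = k * side s y y'" using conj_refl[OF \<delta>(1) sR(1)] by blast
    have tp: "t \<in> Rp" using t(1,3) pE sR \<delta>p by (auto simp: Rp_def)
    have "side t z w0 \<ge> 0"
    proof (cases "t = r")
      case True then show ?thesis using w0E by (simp add: side_def)
    next
      case False then show ?thesis using zs[OF tp False] by (simp add: side_commute)
    qed
    moreover have "side t z w0 = k * side s (\<gamma> z) (\<gamma> w0)" using t(5) gE \<delta>(2) zE w0E(1) by metis
    ultimately have "side s (\<gamma> z) (\<gamma> w0) \<ge> 0" using t(4) by (simp add: zero_le_mult_iff)
    then have 1: "side s x (\<gamma> w0) \<ge> 0" using side_trans_ge[OF sR(1) pE(3) gE] \<gamma>(4)[OF s] by blast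
    have "s = r'" if fixd: "s (\<gamma> w0) = \<gamma> w0"
    proof -
      have "t w0 = w0" using t(3) gE(2) fixd \<delta>(2)[OF w0E(1)] by metis
      then have tr: "t = r" using w0n tp by blast
      have "s y = r' y" if y: "y \<in> E" for y
      proof -
        have "s y = \<gamma> (\<delta> (s y))" using \<delta>(3) R_E[OF sR(1) y] by simp
        also have "\<dots> = \<gamma> (r (\<delta> y))" using t(2) tr y by simp
        also have "\<dots> = r' (\<gamma> (\<delta> y))" using r'(2) G_E[OF \<delta>(1) y] by simp
        finally show ?thesis using \<delta>(3)[OF y] by simp
      qed
      then show ?thesis using G_eqI R_G sR r' by blast
    qed
    then show ?thesis using 1 by blast
  qed
  have "wall_at E E Rp x r' (\<gamma> w0)"
    unfolding wall_at_def
  proof (intro conjI ballI impI)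
    show "r' \<in> Rp" using r'(1) r'p by (simp add: Rp_def)
    show "\<gamma> w0 \<in> cell E Rp x" using local gE by (simp add: cell_def)
    show "r' (\<gamma> w0) = \<gamma> w0" using r'(2)[OF w0E(1)] w0E(2) by simp
    show "mirror E s = mirror E r'" if "s \<in> Rp" "s (\<gamma> w0) = \<gamma> w0" for s using local that by blast
  qed
  then obtain t where "wall_at E U R x r' (p + t *\<^sub>R \<gamma> w0)" using wall_from_local[OF x p] unfolding Rp_def by blast
  then have r'A: "r' \<in> A" using wallS r'p by (auto simp: A_def intro: generate.incl)
  have "r' \<otimes>\<^bsub>BijGroup E\<^esub> \<gamma> = \<gamma> \<otimes>\<^bsub>BijGroup E\<^esub> r"
  proof -
    have "compose E r' \<gamma> = compose E \<gamma> r" using r'(2) by (auto simp: compose_def)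
    then show ?thesis using BijGroup_mult R_Bij r'(1) r(1) G_Bij[OF \<gamma>(2)] by metis
  qed
  then have "r = inv\<^bsub>BijGroup E\<^esub> \<gamma> \<otimes>\<^bsub>BijGroup E\<^esub> (r' \<otimes>\<^bsub>BijGroup E\<^esub> \<gamma>)"
    using B.inv_solve_left[of r \<gamma> "r' \<otimes>\<^bsub>BijGroup E\<^esub> \<gamma>"] G_Bij R_G r(1) r'(1) \<gamma>(2) by auto
  then have "r \<in> A" using A.m_closed A.m_inv_closed \<gamma>(1) r'A by metis
  then show ?thesis unfolding stratum_group_def A_def S_def .
qed

section \<open>Dihedral groups of reflections\<close>

text \<open>The reflection is \<open>t s t\<close>.\<close>

lemma conj_root:
  assumes t: "t \<in> R" "root_pair E t a u" and s: "s \<in> R" "root_pair E s b v"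
  shows "\<exists>q\<in>R. root_pair E q (b - (b \<bullet> u) *\<^sub>R a) (v - (a \<bullet> v) *\<^sub>R u)"
proof -
  note tu = rootD[OF t(2)] and sv = rootD[OF s(2)]
  define q where "q = compose E t (compose E s t)"
  have qG: "q \<in> G" unfolding q_def using G_comp R_G t s by blast
  have tv: "t v = v - (a \<bullet> v) *\<^sub>R u" using tu(3) sv(1) by blast
  have bt: "b \<bullet> t x = (b - (b \<bullet> u) *\<^sub>R a) \<bullet> x" if "x \<in> E" for x
    using tu(3)[OF that] by (simp add: inner_diff_left inner_diff_right)
  have "root_pair E q (b - (b \<bullet> u) *\<^sub>R a) (v - (a \<bullet> v) *\<^sub>R u)"
    unfolding root_pair_def
  proof (intro conjI ballI)
    show "v - (a \<bullet> v) *\<^sub>R u \<in> E" using tv R_E[OF t(1) sv(1)] by simp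
    have "(b - (b \<bullet> u) *\<^sub>R a) \<bullet> t v = b \<bullet> t (t v)" using bt[OF R_E[OF t(1) sv(1)]] by simp
    then show "(b - (b \<bullet> u) *\<^sub>R a) \<bullet> (v - (a \<bullet> v) *\<^sub>R u) = 2" using tv R_invol[OF t(1) sv(1)] sv(2) by simp
    fix x assume x: "x \<in> E"
    have tx: "t x \<in> E" using R_E t x by blast
    have "q x = t (s (t x))" using x tx R_E[OF s(1) tx] by (simp add: q_def G_comp_app)
    also have "s (t x) = t x - (b \<bullet> t x) *\<^sub>R v" using sv(3)[OF tx] .
    also have "t \<dots> = t (t x) - (b \<bullet> t x) *\<^sub>R t v"
      using G_diff[OF R_G[OF t(1)] tx] G_scale[OF R_G[OF t(1)] sv(1)] subspace_scale[OF subspace_E sv(1)] by simp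
    finally show "q x = x - ((b - (b \<bullet> u) *\<^sub>R a) \<bullet> x) *\<^sub>R (v - (a \<bullet> v) *\<^sub>R u)"
      using R_invol[OF t(1) x] bt[OF x] tv by simp
  qed
  then show ?thesis using R_I[OF qG] by blast
qed

text \<open>
  Reflecting a root in the mirror of the next one gives, up to sign, the root after that. The
  coefficients therefore satisfy the recursion of the Chebyshev polynomials of the second
  kind, whose values at \<open>cos \<theta>\<close> are \<open>sin (j * \<theta>) / sin
  \<theta>\<close>.
\<close>

lemma dihedral_roots:
  fixes a u b v :: 'a and \<theta> :: real
  assumes r: "r \<in> R" "root_pair E r a u" and s: "s \<in> R" "root_pair E s b v"
    and c: "a \<bullet> v = - 2 * cos \<theta>" "b \<bullet> u = - 2 * cos \<theta>" and sin: "sin \<theta> \<noteq> 0"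
  defines "P \<equiv> \<lambda>j::nat. sin (real j * \<theta>) / sin \<theta>"
  shows "\<exists>t\<in>R. root_pair E t (P (Suc j) *\<^sub>R a + P j *\<^sub>R b) (P (Suc j) *\<^sub>R u + P j *\<^sub>R v)"
proof -
  have P0: "P 0 = 0" and P1: "P (Suc 0) = 1" using sin by (auto simp: P_def)
  have Prec: "P (Suc (Suc j)) = 2 * cos \<theta> * P (Suc j) - P j" for j
  proof -
    have e1: "real (Suc (Suc j)) * \<theta> = real (Suc j) * \<theta> + \<theta>" by (simp add: algebra_simps)
    have e2: "real j * \<theta> = real (Suc j) * \<theta> - \<theta>" by (simp add: algebra_simps)
    have "sin (real (Suc (Suc j)) * \<theta>) = 2 * cos \<theta> * sin (real (Suc j) * \<theta>) - sin (real j * \<theta>)"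
      unfolding e1 e2 sin_add sin_diff by simp
    then show ?thesis by (simp add: P_def diff_divide_distrib)
  qed
  note ru = rootD[OF r(2)] and sv = rootD[OF s(2)]
  let ?k = "\<lambda>j. P (Suc j) *\<^sub>R a + P j *\<^sub>R b" and ?w = "\<lambda>j. P (Suc j) *\<^sub>R u + P j *\<^sub>R v"
  have krec: "?k (Suc (Suc j)) = - (?k j - (2 * cos \<theta>) *\<^sub>R ?k (Suc j))"
    and wrec: "?w (Suc (Suc j)) = - (?w j - (2 * cos \<theta>) *\<^sub>R ?w (Suc j))" for j
    unfolding Prec[of "Suc j"] Prec[of j] by (simp_all add: algebra_simps)
  have "(\<exists>t\<in>R. root_pair E t (?k j) (?w j)) \<and> (\<exists>t\<in>R. root_pair E t (?k (Suc j)) (?w (Suc j))) \<and>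
     ?k j \<bullet> ?w (Suc j) = 2 * cos \<theta> \<and> ?k (Suc j) \<bullet> ?w j = 2 * cos \<theta>" for j
  proof (induction j)
    case 0
    have k0: "?k 0 = a" "?w 0 = u" using P0 P1 by auto
    have k1: "?k (Suc 0) = b - (b \<bullet> u) *\<^sub>R a" "?w (Suc 0) = v - (a \<bullet> v) *\<^sub>R u"
      using P0 P1 Prec[of 0] c by auto
    have "a \<bullet> (v - (a \<bullet> v) *\<^sub>R u) = 2 * cos \<theta>" "(b - (b \<bullet> u) *\<^sub>R a) \<bullet> u = 2 * cos \<theta>"
      using c ru(2) by (simp_all add: inner_add_left inner_add_right)
    then show ?case unfolding k0 k1 using r conj_root[OF r s] by blast
  next
    case (Suc j)
    obtain t where t: "t \<in> R" "root_pair E t (?k j) (?w j)" using Suc.IH by blast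
    obtain t' where t': "t' \<in> R" "root_pair E t' (?k (Suc j)) (?w (Suc j))" using Suc.IH by blast
    have kw: "?k j \<bullet> ?w (Suc j) = 2 * cos \<theta>" "?k (Suc j) \<bullet> ?w j = 2 * cos \<theta>" using Suc.IH by blast+
    obtain q where q: "q \<in> R" "root_pair E q (?k j - (2 * cos \<theta>) *\<^sub>R ?k (Suc j)) (?w j - (2 * cos \<theta>) *\<^sub>R ?w (Suc j))"
      using conj_root[OF t' t] unfolding kw by blast
    have "root_pair E q (?k (Suc (Suc j))) (?w (Suc (Suc j)))"
      unfolding krec wrec by (rule root_uminus[OF q(2) subspace_E])
    moreover have "?k (Suc j) \<bullet> ?w (Suc (Suc j)) = 2 * cos \<theta>" "?k (Suc (Suc j)) \<bullet> ?w (Suc j) = 2 * cos \<theta>"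
      unfolding krec wrec inner_minus_left inner_minus_right inner_diff_left inner_diff_right inner_scaleR_left inner_scaleR_right
        kw rootD(2)[OF t'(2)] by simp_all
    ultimately show ?case using t' q(1) by blast
  qed
  then show ?thesis by blast
qed

end

text \<open>
  Take the first multiple \<open>m * \<theta>\<close> that is at least \<open>pi\<close>. It
  is less than \<open>2 * pi\<close>, so its sine is negative unless it equals
  \<open>pi\<close>, whereas the sine of the preceding multiple is positive.
\<close>

lemma angle_is_submultiple_of_pi:
  fixes \<theta> :: real
  assumes th: "0 < \<theta>" "\<theta> < pi" and sgn: "\<And>j::nat. sin (real (Suc j) * \<theta>) * sin (real j * \<theta>) \<ge> 0"
  shows "\<exists>m\<ge>2. \<theta> = pi / real m"
proof -
  obtain n :: nat where n: "pi < real n * \<theta>" using reals_Archimedean3[OF th(1)] by blast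
  define m where "m = (LEAST m. pi \<le> real m * \<theta>)"
  have m: "pi \<le> real m * \<theta>" unfolding m_def by (rule LeastI[of _ n]) (use n in simp)
  have least: "real k * \<theta> < pi" if "k < m" for k using not_less_Least[of k] that unfolding m_def by fastforce
  have m2: "m \<ge> 2"
  proof (rule ccontr)
    assume "\<not> m \<ge> 2" then have "m = 0 \<or> m = 1" by auto
    then show False using m th by auto
  qed
  then obtain j where j: "m = Suc j" "j \<ge> 1" by (cases m) auto
  have "real j * \<theta> < pi" using least j by simp
  moreover have "0 < real j * \<theta>" using j th by simp
  ultimately have sj: "sin (real j * \<theta>) > 0" using sin_gt_zero by blast
  have "real m * \<theta> = real j * \<theta> + \<theta>" using j by (simp add: algebra_simps)
  then have lt: "real m * \<theta> < 2 * pi" using \<open>real j * \<theta> < pi\<close> th by linarith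
  have "sin (real m * \<theta>) \<ge> 0" using sgn[of j] sj j by (simp add: zero_le_mult_iff)
  moreover have "sin (real m * \<theta>) < 0" if "pi < real m * \<theta>" using sin_lt_zero[OF that lt] .
  ultimately have "real m * \<theta> = pi" using m by fastforce
  then have "\<theta> = pi / real m" using m2 by (simp add: field_simps)
  then show ?thesis using m2 by blast
qed

section \<open>The label of a hyperedge\<close>

lemma same_sign_mult:
  fixes p q x :: real assumes "x \<noteq> 0" "x * p \<ge> 0" "x * q \<ge> 0" shows "p * q \<ge> 0"
  using assms by (auto simp: zero_le_mult_iff)

lemma pos_mult_sign:
  fixes p k :: real assumes "k > 0" shows "0 \<le> p * k \<longleftrightarrow> 0 \<le> p" "0 < p * k \<longleftrightarrow> 0 < p" "0 \<le> k * p \<longleftrightarrow> 0 \<le> p"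
  using assms by (simp_all add: zero_le_mult_iff zero_less_mult_iff)

lemma root_sign:
  assumes "root_pair E r a u" "x \<in> E" "y \<in> E"
  shows "0 \<le> side r x y \<longleftrightarrow> 0 \<le> (a \<bullet> x) * (a \<bullet> y)" "0 < side r x y \<longleftrightarrow> 0 < (a \<bullet> x) * (a \<bullet> y)"
proof -
  have "u \<bullet> u > 0" using rootD(4)[OF assms(1)] by simp
  then show "0 \<le> side r x y \<longleftrightarrow> 0 \<le> (a \<bullet> x) * (a \<bullet> y)" "0 < side r x y \<longleftrightarrow> 0 < (a \<bullet> x) * (a \<bullet> y)"
    unfolding rootD(7)[OF assms] by (rule pos_mult_sign)+
qed

lemma inner_product_onD:
  assumes "inner_product_on E \<beta>" "subspace E"
  shows "x \<in> E \<Longrightarrow> y \<in> E \<Longrightarrow> \<beta> x y = \<beta> y x"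
    "x \<in> E \<Longrightarrow> y \<in> E \<Longrightarrow> z \<in> E \<Longrightarrow> \<beta> (x + y) z = \<beta> x z + \<beta> y z"
    "x \<in> E \<Longrightarrow> y \<in> E \<Longrightarrow> \<beta> (c *\<^sub>R x) y = c * \<beta> x y"
    "x \<in> E \<Longrightarrow> y \<in> E \<Longrightarrow> z \<in> E \<Longrightarrow> \<beta> z (x + y) = \<beta> z x + \<beta> z y"
    "x \<in> E \<Longrightarrow> y \<in> E \<Longrightarrow> \<beta> x (c *\<^sub>R y) = c * \<beta> x y"
    "x \<in> E \<Longrightarrow> y \<in> E \<Longrightarrow> z \<in> E \<Longrightarrow> \<beta> (x - y) z = \<beta> x z - \<beta> y z"
    "x \<in> E \<Longrightarrow> y \<in> E \<Longrightarrow> z \<in> E \<Longrightarrow> \<beta> z (x - y) = \<beta> z x - \<beta> z y"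
    "x \<in> E \<Longrightarrow> x \<noteq> 0 \<Longrightarrow> \<beta> x x > 0"
    "x \<in> E \<Longrightarrow> \<beta> x x \<ge> 0"
proof -
  have sym: "\<And>x y. x \<in> E \<Longrightarrow> y \<in> E \<Longrightarrow> \<beta> x y = \<beta> y x"
    and add: "\<And>x y z. x \<in> E \<Longrightarrow> y \<in> E \<Longrightarrow> z \<in> E \<Longrightarrow> \<beta> (x + y) z = \<beta> x z + \<beta> y z"
    and scale: "\<And>c x y. x \<in> E \<Longrightarrow> y \<in> E \<Longrightarrow> \<beta> (c *\<^sub>R x) y = c * \<beta> x y"
    and pos: "\<And>x. x \<in> E \<Longrightarrow> x \<noteq> 0 \<Longrightarrow> \<beta> x x > 0"
    using assms(1) unfolding inner_product_on_def by blast+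
  have sadd: "\<And>x y. x \<in> E \<Longrightarrow> y \<in> E \<Longrightarrow> x + y \<in> E" and sscale: "\<And>c x. x \<in> E \<Longrightarrow> c *\<^sub>R x \<in> E"
    using assms(2) by (auto simp: subspace_add subspace_scale)
  have add2: "\<And>x y z. x \<in> E \<Longrightarrow> y \<in> E \<Longrightarrow> z \<in> E \<Longrightarrow> \<beta> z (x + y) = \<beta> z x + \<beta> z y"
    using sym add sadd by metis
  have scale2: "\<And>c x y. x \<in> E \<Longrightarrow> y \<in> E \<Longrightarrow> \<beta> x (c *\<^sub>R y) = c * \<beta> x y" using sym scale sscale by metis
  have diff: "\<beta> (x - y) z = \<beta> x z - \<beta> y z" if "x \<in> E" "y \<in> E" "z \<in> E" for x y z
    using add[OF that(1) sscale[OF that(2), of "-1"] that(3)] scale[OF that(2,3), of "-1"] by simp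
  have diff2: "\<beta> z (x - y) = \<beta> z x - \<beta> z y" if "x \<in> E" "y \<in> E" "z \<in> E" for x y z
    using add2[OF that(1) sscale[OF that(2), of "-1"] that(3)] scale2[OF that(3,2), of "-1"] by simp
  have nn: "\<beta> x x \<ge> 0" if "x \<in> E" for x
    using pos[OF that] scale[OF that that, of 0] by (cases "x = 0") auto
  show "x \<in> E \<Longrightarrow> y \<in> E \<Longrightarrow> \<beta> x y = \<beta> y x"
    "x \<in> E \<Longrightarrow> y \<in> E \<Longrightarrow> z \<in> E \<Longrightarrow> \<beta> (x + y) z = \<beta> x z + \<beta> y z"
    "x \<in> E \<Longrightarrow> y \<in> E \<Longrightarrow> \<beta> (c *\<^sub>R x) y = c * \<beta> x y"
    "x \<in> E \<Longrightarrow> y \<in> E \<Longrightarrow> z \<in> E \<Longrightarrow> \<beta> z (x + y) = \<beta> z x + \<beta> z y"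
    "x \<in> E \<Longrightarrow> y \<in> E \<Longrightarrow> \<beta> x (c *\<^sub>R y) = c * \<beta> x y"
    "x \<in> E \<Longrightarrow> y \<in> E \<Longrightarrow> z \<in> E \<Longrightarrow> \<beta> (x - y) z = \<beta> x z - \<beta> y z"
    "x \<in> E \<Longrightarrow> y \<in> E \<Longrightarrow> z \<in> E \<Longrightarrow> \<beta> z (x - y) = \<beta> z x - \<beta> z y"
    "x \<in> E \<Longrightarrow> x \<noteq> 0 \<Longrightarrow> \<beta> x x > 0"
    "x \<in> E \<Longrightarrow> \<beta> x x \<ge> 0"
    by (fact sym add scale add2 scale2 diff diff2 pos nn)+
qed

text \<open>
  With respect to an invariant inner product the coroot is the usual \<open>2 u / (u,
  u)\<close>.
\<close>

lemma root_dual: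
  assumes E: "subspace E" and ip: "inner_product_on E \<beta>" and pr: "preserves_on E \<beta> r" and rt: "root_pair E r a u" and z: "z \<in> E"
  shows "\<beta> u u * (a \<bullet> z) = 2 * \<beta> u z"
proof -
  note ru = rootD[OF rt] and D = inner_product_onD[OF ip E]
  have "\<beta> u z = \<beta> (r u) (r z)" using pr ru(1) z by (simp add: preserves_on_def)
  also have "\<dots> = \<beta> ((-1) *\<^sub>R u) (z - (a \<bullet> z) *\<^sub>R u)" using ru(5) ru(3)[OF z] by simp
  also have "\<dots> = - 1 * \<beta> u (z - (a \<bullet> z) *\<^sub>R u)"
    using ru(1) z E by (intro D(3)) (auto simp: subspace_diff subspace_scale)
  also have "\<beta> u (z - (a \<bullet> z) *\<^sub>R u) = \<beta> u z - (a \<bullet> z) * \<beta> u u"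
    using D(7)[OF z subspace_scale[OF E ru(1)] ru(1)] D(5)[OF ru(1) ru(1)] by simp
  finally show ?thesis by simp
qed

context refl_action begin

text \<open>Average the ambient inner product over the stabilizer of \<open>y\<close>.\<close>

lemma invariant_inner_product:
  assumes y: "y \<in> U"
  shows "\<exists>\<beta>. inner_product_on E \<beta> \<and> (\<forall>\<gamma>\<in>G. \<gamma> y = y \<longrightarrow> preserves_on E \<beta> \<gamma>)"
proof -
  define S where "S = {\<gamma>\<in>G. \<gamma> y = y}"
  have fin: "finite S" unfolding S_def using G_fin y by blast
  have yE: "y \<in> E" using UE y by blast
  have SG: "\<And>\<gamma>. \<gamma> \<in> S \<Longrightarrow> \<gamma> \<in> G" by (simp add: S_def)
  have idS: "(\<lambda>x\<in>E. x) \<in> S" using G_id yE by (simp add: S_def)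
  define \<beta> where "\<beta> p q = (\<Sum>\<gamma>\<in>S. \<gamma> p \<bullet> \<gamma> q)" for p q
  have "inner_product_on E \<beta>"
    unfolding inner_product_on_def
  proof (intro conjI ballI allI impI)
    show "\<beta> p q = \<beta> q p" for p q by (simp add: \<beta>_def inner_commute)
    show "\<beta> (x + y) z = \<beta> x z + \<beta> y z" if "x \<in> E" "y \<in> E" "z \<in> E" for x y z
      unfolding \<beta>_def sum.distrib[symmetric]
      by (rule sum.cong[OF refl]) (simp only: G_add[OF SG that(1,2)] inner_add_left)
    show "\<beta> (c *\<^sub>R x) y = c * \<beta> x y" if "x \<in> E" "y \<in> E" for c x y
      unfolding \<beta>_def sum_distrib_left
      by (rule sum.cong[OF refl]) (simp only: G_scale[OF SG that(1)] inner_scaleR_left)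
    show "\<beta> x x > 0" if "x \<in> E" "x \<noteq> 0" for x
      unfolding \<beta>_def by (rule sum_pos2[OF fin idS]) (use that in auto)
  qed
  moreover have "preserves_on E \<beta> \<delta>" if \<delta>: "\<delta> \<in> S" for \<delta>
    unfolding preserves_on_def
  proof (intro ballI)
    fix p q assume pq: "p \<in> E" "q \<in> E"
    have inj: "inj_on (\<lambda>\<gamma>. compose E \<gamma> \<delta>) S"
    proof (rule inj_onI)
      fix \<gamma> \<gamma>' assume a: "\<gamma> \<in> S" "\<gamma>' \<in> S" "compose E \<gamma> \<delta> = compose E \<gamma>' \<delta>"
      obtain \<epsilon> where \<epsilon>: "\<epsilon> \<in> G" "\<forall>x\<in>E. \<epsilon> (\<delta> x) = x \<and> \<delta> (\<epsilon> x) = x" using G_inv SG \<delta> by blast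
      have "\<gamma> x = \<gamma>' x" if x: "x \<in> E" for x
      proof -
        have ex: "\<epsilon> x \<in> E" using G_E \<epsilon> x by blast
        have "\<gamma> (\<delta> (\<epsilon> x)) = \<gamma>' (\<delta> (\<epsilon> x))" using fun_cong[OF a(3), of "\<epsilon> x"] G_comp_app[OF ex] by metis
        then show ?thesis using \<epsilon> x by simp
      qed
      then show "\<gamma> = \<gamma>'" using G_eqI SG a by blast
    qed
    have im: "(\<lambda>\<gamma>. compose E \<gamma> \<delta>) ` S \<subseteq> S"
    proof (rule image_subsetI)
      fix \<gamma> assume \<gamma>: "\<gamma> \<in> S"
      have "compose E \<gamma> \<delta> \<in> G" by (rule G_comp[OF SG[OF \<gamma>] SG[OF \<delta>]])
      moreover have "compose E \<gamma> \<delta> y = y" using \<gamma> \<delta> unfolding G_comp_app[OF yE] S_def by simp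
      ultimately show "compose E \<gamma> \<delta> \<in> S" by (simp add: S_def)
    qed
    have eq: "(\<lambda>\<gamma>. compose E \<gamma> \<delta>) ` S = S" using endo_inj_surj[OF fin im inj] .
    have "\<beta> p q = (\<Sum>\<gamma>\<in>(\<lambda>\<gamma>. compose E \<gamma> \<delta>) ` S. \<gamma> p \<bullet> \<gamma> q)" unfolding eq \<beta>_def ..
    also have "\<dots> = (\<Sum>\<gamma>\<in>S. compose E \<gamma> \<delta> p \<bullet> compose E \<gamma> \<delta> q)" by (simp add: sum.reindex[OF inj])
    also have "\<dots> = \<beta> (\<delta> p) (\<delta> q)" unfolding \<beta>_def by (simp only: G_comp_app[OF pq(1)] G_comp_app[OF pq(2)])
    finally show "\<beta> (\<delta> p) (\<delta> q) = \<beta> p q" by simp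
  qed
  ultimately show ?thesis by (auto simp: S_def)
qed

lemma normalized_root:
  assumes r: "r \<in> R" and ip: "inner_product_on E \<beta>" and pr: "preserves_on E \<beta> r" and x: "x \<in> E" "r x \<noteq> x"
  shows "\<exists>a u. root_pair E r a u \<and> \<beta> u u = 1 \<and> a \<bullet> x > 0 \<and> (\<forall>z\<in>E. a \<bullet> z = 2 * \<beta> u z)"
proof -
  obtain a1 u1 where rt1: "root_pair E r a1 u1" using R_root[OF r] by blast
  have "a1 \<bullet> x \<noteq> 0" using rootD(6)[OF rt1 x(1)] x by simp
  then obtain a0 u0 where rt: "root_pair E r a0 u0" and pos: "a0 \<bullet> x > 0"
  proof (cases "a1 \<bullet> x > 0")
    case False
    then have "(- a1) \<bullet> x > 0" using \<open>a1 \<bullet> x \<noteq> 0\<close> by simp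
    then show ?thesis using that root_uminus[OF rt1 subspace_E] by blast
  qed (use that rt1 in blast)
  note ru = rootD[OF rt] and D = inner_product_onD[OF ip subspace_E]
  define n where "n = sqrt (\<beta> u0 u0)"
  have n: "n > 0" "n * n = \<beta> u0 u0" using D(8)[OF ru(1,4)] by (auto simp: n_def)
  define u where "u = (1/n) *\<^sub>R u0"
  have uE: "u \<in> E" using ru subspace_E by (simp add: u_def subspace_scale)
  have rt': "root_pair E r (n *\<^sub>R a0) u"
    unfolding root_pair_def using uE ru n(1) by (auto simp: u_def)
  have uu: "\<beta> u u = 1"
  proof -
    have "\<beta> u u = (1/n) * ((1/n) * \<beta> u0 u0)"
      unfolding u_def D(3)[OF ru(1) subspace_scale[OF subspace_E ru(1)]] D(5)[OF ru(1) ru(1)] ..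
    then have "\<beta> u u = (1/n) * ((1/n) * (n * n))" unfolding n(2) .
    then show ?thesis using n(1) by simp
  qed
  have "(n *\<^sub>R a0) \<bullet> z = 2 * \<beta> u z" if "z \<in> E" for z
    using root_dual[OF subspace_E ip pr rt' that] uu by simp
  moreover have "(n *\<^sub>R a0) \<bullet> x > 0" using pos n by simp
  ultimately show ?thesis using rt' uu by blast
qed

text \<open>
  Measure the angle \<open>\<theta>\<close> of the two mirrors by an inner product invariant
  under the stabilizer of a point \<open>y\<close> of the hyperedge. The mirrors of the
  dihedral group must not separate the points \<open>f\<close> and \<open>g\<close> of the two
  facets. For the mirrors of the roots in \<open>dihedral_roots\<close> this says that
  \<open>sin ((j + 1) * \<theta>) * sin (j * \<theta>)\<close> is never negative, so
  \<open>\<theta> = pi / m\<close>.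
\<close>

lemma has_label_exists:
  assumes x: "x \<in> U" "\<forall>r\<in>R. r x \<noteq> x" and r: "r \<in> R" and s: "s \<in> R" and rs: "r \<noteq> s"
    and y: "y \<in> U" "r y = y" "s y = y"
    and f: "f \<in> cell U R x" "r f = f" "s f \<noteq> f" and g: "g \<in> cell U R x" "s g = g" "r g \<noteq> g"
    and F: "F1 \<subseteq> mirror E r" "F2 \<subseteq> mirror E s"
  shows "\<exists>m\<ge>2. \<exists>a u b v. has_label E G (cell U R x) F1 F2 m \<and> root_pair E r a u \<and> root_pair E s b v \<and>
     a \<bullet> x > 0 \<and> b \<bullet> x > 0 \<and> a \<bullet> v = - 2 * cos (pi / real m) \<and> b \<bullet> u = - 2 * cos (pi / real m)"
proof -
  have E: "x \<in> E" "f \<in> E" "g \<in> E" using x f g UE by (auto simp: cell_def)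
  obtain \<beta> where ip: "inner_product_on E \<beta>" and pres: "\<And>\<gamma>. \<gamma> \<in> G \<Longrightarrow> \<gamma> y = y \<Longrightarrow> preserves_on E \<beta> \<gamma>"
    using invariant_inner_product[OF y(1)] by blast
  note D = inner_product_onD[OF ip subspace_E]
  obtain a u where au: "root_pair E r a u" "\<beta> u u = 1" "a \<bullet> x > 0" "\<And>z. z \<in> E \<Longrightarrow> a \<bullet> z = 2 * \<beta> u z"
    using normalized_root[OF r ip pres[OF R_G[OF r] y(2)] E(1)] x r by blast
  obtain b v where bv: "root_pair E s b v" "\<beta> v v = 1" "b \<bullet> x > 0" "\<And>z. z \<in> E \<Longrightarrow> b \<bullet> z = 2 * \<beta> v z"
    using normalized_root[OF s ip pres[OF R_G[OF s] y(3)] E(1)] x s by blast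
  note ru = rootD[OF au(1)] and sv = rootD[OF bv(1)]
  have uE: "u \<in> E" "v \<in> E" using ru sv by auto
  \<comment> \<open>The two mirrors are different because \<open>f\<close> lies on only one of them.\<close>
  have ne: "u \<noteq> v" "u \<noteq> - v"
  proof -
    have f0: "a \<bullet> f = 0" "b \<bullet> f \<noteq> 0" using f ru(6) sv(6) E by auto
    show "u \<noteq> v" using au(4) bv(4) E(2) f0 by auto
    have "\<beta> (- v) f = - \<beta> v f" using D(3)[OF uE(2) E(2), of "-1"] by simp
    then show "u \<noteq> - v" using au(4)[OF E(2)] bv(4)[OF E(2)] f0 by auto
  qed
  define c where "c = - \<beta> u v"
  have sq: "\<beta> (u + v) (u + v) = 2 - 2 * c" "\<beta> (u - v) (u - v) = 2 + 2 * c"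
    using uE au(2) bv(2) D(1)[OF uE(2) uE(1)] subspace_add[OF subspace_E] subspace_diff[OF subspace_E]
    by (simp_all add: D(2,4,6,7) c_def)
  have c: "-1 < c" "c < 1"
  proof -
    have "u + v \<noteq> 0" "u - v \<noteq> 0" using ne by (auto simp: add_eq_0_iff)
    then have "\<beta> (u + v) (u + v) > 0" "\<beta> (u - v) (u - v) > 0"
      using D(8) uE subspace_add[OF subspace_E] subspace_diff[OF subspace_E] by auto
    then show "-1 < c" "c < 1" unfolding sq by auto
  qed
  define \<theta> where "\<theta> = arccos c"
  have th: "0 < \<theta>" "\<theta> < pi" "cos \<theta> = c" unfolding \<theta>_def using c arccos_lt_bounded[of c] by (auto simp: cos_arccos)
  have cart: "a \<bullet> v = - 2 * cos \<theta>" "b \<bullet> u = - 2 * cos \<theta>"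
    using au(4)[OF uE(2)] bv(4)[OF uE(1)] D(1)[OF uE] th(3) by (auto simp: c_def)
  have sin: "sin \<theta> > 0" using th sin_gt_zero by blast
  have af: "a \<bullet> f = 0" "b \<bullet> f > 0"
  proof -
    show "a \<bullet> f = 0" using f ru(6) E by auto
    have "b \<bullet> f \<noteq> 0" using f sv(6) E by auto
    moreover have "side s x f \<ge> 0" using f s by (simp add: cell_def)
    then have "b \<bullet> f \<ge> 0" unfolding root_sign[OF bv(1) E(1,2)] pos_mult_sign(3)[OF bv(3)] .
    ultimately show "b \<bullet> f > 0" by simp
  qed
  have bg: "b \<bullet> g = 0" "a \<bullet> g > 0"
  proof -
    show "b \<bullet> g = 0" using g sv(6) E by auto
    have "a \<bullet> g \<noteq> 0" using g ru(6) E by auto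
    moreover have "side r x g \<ge> 0" using g r by (simp add: cell_def)
    then have "a \<bullet> g \<ge> 0" unfolding root_sign[OF au(1) E(1,3)] pos_mult_sign(3)[OF au(3)] .
    ultimately show "a \<bullet> g > 0" by simp
  qed
  have "sin (real (Suc j) * \<theta>) * sin (real j * \<theta>) \<ge> 0" for j
  proof -
    define P where "P = (\<lambda>j::nat. sin (real j * \<theta>) / sin \<theta>)"
    obtain t where t: "t \<in> R" "root_pair E t (P (Suc j) *\<^sub>R a + P j *\<^sub>R b) (P (Suc j) *\<^sub>R u + P j *\<^sub>R v)"
      using dihedral_roots[OF r au(1) s bv(1) cart] sin unfolding P_def by fastforce
    let ?k = "P (Suc j) *\<^sub>R a + P j *\<^sub>R b" and ?w = "P (Suc j) *\<^sub>R u + P j *\<^sub>R v"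
    note tr = rootD[OF t(2)]
    have kx: "?k \<bullet> x \<noteq> 0" using x t(1) tr(6)[OF E(1)] by blast
    have "side t x f \<ge> 0" "side t x g \<ge> 0" using f g t(1) by (auto simp: cell_def)
    then have "(?k \<bullet> x) * (?k \<bullet> f) \<ge> 0" "(?k \<bullet> x) * (?k \<bullet> g) \<ge> 0"
      unfolding root_sign[OF t(2) E(1,2)] root_sign[OF t(2) E(1,3)] .
    then have "(?k \<bullet> f) * (?k \<bullet> g) \<ge> 0" by (rule same_sign_mult[OF kx])
    moreover have "?k \<bullet> f = P j * (b \<bullet> f)" "?k \<bullet> g = P (Suc j) * (a \<bullet> g)"
      using af bg by (simp_all add: inner_add_left)
    ultimately have "(P (Suc j) * P j) * ((b \<bullet> f) * (a \<bullet> g)) \<ge> 0" by (simp only: mult_ac)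
    then have "P (Suc j) * P j \<ge> 0" unfolding pos_mult_sign(1)[OF mult_pos_pos[OF af(2) bg(2)]] .
    then have "(P (Suc j) * P j) * (sin \<theta> * sin \<theta>) \<ge> 0" unfolding pos_mult_sign(1)[OF mult_pos_pos[OF sin sin]] .
    then show ?thesis using sin by (simp add: P_def)
  qed
  from angle_is_submultiple_of_pi[OF th(1,2) this] obtain m where m: "m \<ge> 2" "\<theta> = pi / real m" by blast
  have span: "span {u, v} \<subseteq> E" using uE subspace_E by (intro span_minimal) auto
  have disp: "(\<exists>t\<ge>0. z - r z = t *\<^sub>R u) \<and> (\<exists>t\<ge>0. z - s z = t *\<^sub>R v)" if z: "z \<in> cell U R x" for z
  proof -
    have zE: "z \<in> E" using z UE by (auto simp: cell_def)
    have sdz: "side r x z \<ge> 0" "side s x z \<ge> 0" using z r s by (auto simp: cell_def)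
    have "a \<bullet> z \<ge> 0" using sdz(1) unfolding root_sign[OF au(1) E(1) zE] pos_mult_sign(3)[OF au(3)] .
    moreover have "b \<bullet> z \<ge> 0" using sdz(2) unfolding root_sign[OF bv(1) E(1) zE] pos_mult_sign(3)[OF bv(3)] .
    ultimately show ?thesis using ru(3)[OF zE] sv(3)[OF zE] by auto
  qed
  have disp': "\<forall>z\<in>cell U R x. \<exists>t\<ge>0. z - r z = t *\<^sub>R u" "\<forall>z\<in>cell U R x. \<exists>t\<ge>0. z - s z = t *\<^sub>R v"
    using disp by blast+
  have ip': "inner_product_on (span {u, v}) \<beta>" using ip span unfolding inner_product_on_def by blast
  have pres': "preserves_on (span {u, v}) \<beta> r" "preserves_on (span {u, v}) \<beta> s"
    using pres[OF R_G[OF r] y(2)] pres[OF R_G[OF s] y(3)] span unfolding preserves_on_def by blast+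
  have ang: "pi - arccos (\<beta> u v) = pi / real m"
  proof -
    have "arccos (- c) = pi - arccos c" using c by (intro arccos_minus) auto
    then show ?thesis using m(2) by (simp add: c_def \<theta>_def)
  qed
  have "has_label E G (cell U R x) F1 F2 m"
    unfolding has_label_def
    by (rule conjI, fact m(1), rule bexI[of _ r], rule bexI[of _ s], rule bexI[of _ u], rule bexI[of _ v], rule exI[of _ \<beta>])
      (intro conjI F ru(5) sv(5) disp' ip' pres' au(2) bv(2) ang r s uE)+
  then show ?thesis using m au(1,3) bv(1,3) cart by blast
qed

text \<open>
  If the roots are unit vectors, the pairings of root and coroot are twice the cosine of the
  angle between the normals.
\<close>

lemma has_label_roots:
  assumes x: "x \<in> U" "\<forall>r\<in>R. r x \<noteq> x" and l: "has_label E G (cell U R x) F1 F2 m"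
  shows "m \<ge> 2 \<and> (\<exists>r\<in>R. \<exists>s\<in>R. \<exists>a u b v. F1 \<subseteq> mirror E r \<and> F2 \<subseteq> mirror E s \<and> root_pair E r a u \<and> root_pair E s b v \<and>
     a \<bullet> x > 0 \<and> b \<bullet> x > 0 \<and> a \<bullet> v = - 2 * cos (pi / real m) \<and> b \<bullet> u = - 2 * cos (pi / real m))"
proof -
  have xE: "x \<in> E" and xC: "x \<in> cell U R x" using x UE mem_cell_self by auto
  obtain r s u v \<beta> where rs: "r \<in> R" "s \<in> R" "u \<in> E" "v \<in> E" "F1 \<subseteq> mirror E r" "F2 \<subseteq> mirror E s"
    and u: "r u = - u" "\<forall>x\<in>cell U R x. \<exists>t\<ge>0. x - r x = t *\<^sub>R u"
    and v: "s v = - v" "\<forall>x\<in>cell U R x. \<exists>t\<ge>0. x - s x = t *\<^sub>R v"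
    and ip: "inner_product_on (span {u, v}) \<beta>" and pres: "preserves_on (span {u, v}) \<beta> r" "preserves_on (span {u, v}) \<beta> s"
    and unit: "\<beta> u u = 1" "\<beta> v v = 1" and angle: "pi - arccos (\<beta> u v) = pi / real m" and m: "m \<ge> 2"
    using l unfolding has_label_def by blast
  have root: "\<exists>a. root_pair E r a u \<and> a \<bullet> x > 0"
    if r: "r \<in> R" and u: "u \<in> E" and t: "\<exists>t\<ge>0. x - r x = t *\<^sub>R u" for r u
  proof -
    obtain a0 u0 where rt: "root_pair E r a0 u0" using R_root[OF r] by blast
    note ru = rootD[OF rt]
    obtain t where t: "t \<ge> 0" "x - r x = t *\<^sub>R u" using t by blast
    have a0: "a0 \<bullet> x \<noteq> 0" using x r ru(6)[OF xE] by blast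
    have eq: "(a0 \<bullet> x) *\<^sub>R u0 = t *\<^sub>R u" using t ru(3)[OF xE] by simp
    have tp: "t > 0" using t eq a0 ru(4) by (cases "t = 0") auto
    \<comment> \<open>The given normal is a multiple of an arbitrary root; rescale the root pair
      accordingly.\<close>
    define l where "l = (a0 \<bullet> x) / t"
    have l: "l \<noteq> 0" using a0 tp by (simp add: l_def)
    have ul: "u = l *\<^sub>R u0"
    proof -
      have "u = (1/t) *\<^sub>R (t *\<^sub>R u)" using tp by simp
      also have "\<dots> = l *\<^sub>R u0" unfolding eq[symmetric] by (simp add: l_def)
      finally show ?thesis .
    qed
    have "root_pair E r ((1/l) *\<^sub>R a0) u" unfolding root_pair_def ul using ru l subspace_scale[OF subspace_E ru(1)] by auto
    moreover have "((1/l) *\<^sub>R a0) \<bullet> x > 0" using a0 tp by (simp add: l_def)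
    ultimately show ?thesis by blast
  qed
  obtain a where a: "root_pair E r a u" "a \<bullet> x > 0" using root[OF rs(1,3)] u xC by blast
  obtain b where b: "root_pair E s b v" "b \<bullet> x > 0" using root[OF rs(2,4)] v xC by blast
  let ?S = "span {u, v}"
  have S: "u \<in> ?S" "v \<in> ?S" by (auto intro: span_base)
  note D = inner_product_onD[OF ip subspace_span]
  have cross: "k \<bullet> w' = 2 * \<beta> w w'" if rt: "root_pair E q k w" and q: "preserves_on ?S \<beta> q" and w: "w \<in> ?S" "w' \<in> ?S" "w' \<in> E" "\<beta> w w = 1" for q k w w'
  proof -
    note qr = rootD[OF rt]
    have "\<beta> w w' = \<beta> (q w) (q w')" using q w by (simp add: preserves_on_def)
    also have "\<dots> = \<beta> ((-1) *\<^sub>R w) (w' - (k \<bullet> w') *\<^sub>R w)" using qr(5) qr(3)[OF w(3)] by simp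
    also have "\<dots> = - 1 * \<beta> w (w' - (k \<bullet> w') *\<^sub>R w)" using w by (intro D(3)) (auto simp: span_diff span_scale)
    also have "\<beta> w (w' - (k \<bullet> w') *\<^sub>R w) = \<beta> w w' - (k \<bullet> w') * \<beta> w w"
      using D(7)[OF w(2) span_scale[OF w(1)] w(1)] D(5)[OF w(1) w(1)] by simp
    finally show ?thesis using w(4) by simp
  qed
  have "\<beta> (u + v) (u + v) = 2 + 2 * \<beta> u v" "\<beta> (u - v) (u - v) = 2 - 2 * \<beta> u v"
    using S unit D(1)[OF S(2,1)] by (simp_all add: D(2,4,6,7) span_add span_diff)
  then have "-1 \<le> \<beta> u v" "\<beta> u v \<le> 1" using D(9)[OF span_add[OF S]] D(9)[OF span_diff[OF S]] by auto
  then have "\<beta> u v = cos (pi - pi / real m)" using angle cos_arccos[of "\<beta> u v"] by (metis add_diff_cancel_left' diff_add_cancel diff_diff_eq2 add.commute)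
  then have "\<beta> u v = - cos (pi / real m)" by simp
  then have "a \<bullet> v = - 2 * cos (pi / real m)" "b \<bullet> u = - 2 * cos (pi / real m)"
    using cross[OF a(1) pres(1) S rs(4) unit(1)] cross[OF b(1) pres(2) S(2,1) rs(3) unit(2)] D(1)[OF S] by auto
  then show ?thesis using m rs a b by blast
qed

text \<open>
  If \<open>m = 2 l + 1\<close>, the root number \<open>l\<close> in
  \<open>dihedral_roots\<close> is a multiple of \<open>u + v\<close>. Its reflection takes
  \<open>u\<close> to \<open>- v\<close>, and so exchanges the two mirrors.
\<close>

lemma odd_label_swap:
  assumes r: "r \<in> R" "root_pair E r a u" and s: "s \<in> R" "root_pair E s b v"
    and c: "a \<bullet> v = - 2 * cos (pi / real m)" "b \<bullet> u = - 2 * cos (pi / real m)" and m: "m \<ge> 2" "odd m"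
  shows "\<exists>\<tau>\<in>R. \<exists>q>0. q * (2 - 2 * cos (pi / real m)) = 1 \<and> (\<forall>z\<in>E. \<tau> z = z - (q * ((a + b) \<bullet> z)) *\<^sub>R (u + v))"
proof -
  let ?\<theta> = "pi / real m" let ?c = "cos ?\<theta>"
  obtain l where l: "m = 2 * l + 1" using m(2) by (auto elim: oddE)
  have "0 < ?\<theta>" "?\<theta> < pi" using m by (auto simp: field_simps)
  then have sin: "sin ?\<theta> > 0" using sin_gt_zero by blast
  define P where "P = (\<lambda>j::nat. sin (real j * ?\<theta>) / sin ?\<theta>)"
  obtain t where t: "t \<in> R" "root_pair E t (P (Suc l) *\<^sub>R a + P l *\<^sub>R b) (P (Suc l) *\<^sub>R u + P l *\<^sub>R v)"
    using dihedral_roots[OF r s c] sin unfolding P_def by fastforce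
  have "real (Suc l) * ?\<theta> = pi - real l * ?\<theta>" using m l by (simp add: field_simps)
  then have PP: "P (Suc l) = P l" by (simp add: P_def)
  note tr = rootD[OF t(2)[unfolded PP]]
  note ru = rootD[OF r(2)] and sv = rootD[OF s(2)]
  define q where "q = P l * P l"
  have "(P l *\<^sub>R a + P l *\<^sub>R b) \<bullet> (P l *\<^sub>R u + P l *\<^sub>R v) = 2 * (q * (2 - 2 * ?c))"
    unfolding q_def by (simp add: inner_add_left inner_add_right ru(2) sv(2) c algebra_simps)
  then have q1: "q * (2 - 2 * ?c) = 1" using tr(2) by simp
  have q0: "q > 0" using q1 by (cases "P l = 0") (auto simp: q_def zero_less_mult_iff linorder_neq_iff)
  have "t z = z - (q * ((a + b) \<bullet> z)) *\<^sub>R (u + v)" if "z \<in> E" for z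
    using tr(3)[OF that] by (simp add: q_def inner_add_left algebra_simps)
  then show ?thesis using t(1) q0 q1 by blast
qed

text \<open>
  If \<open>m = 2 l\<close>, the root number \<open>l\<close> in \<open>dihedral_roots\<close>
  is orthogonal to \<open>u\<close>.
\<close>

lemma even_label_orthogonal:
  assumes r: "r \<in> R" "root_pair E r a u" and s: "s \<in> R" "root_pair E s b v"
    and c: "a \<bullet> v = - 2 * cos (pi / real m)" "b \<bullet> u = - 2 * cos (pi / real m)" and m: "m \<ge> 2" "even m"
  shows "\<exists>t\<in>R. t \<noteq> r \<and> (\<forall>z\<in>E. t (r z) = r (t z)) \<and> (\<forall>z\<in>E. a \<bullet> z = 0 \<longrightarrow> b \<bullet> z = 0 \<longrightarrow> t z = z)"
proof -
  let ?\<theta> = "pi / real m" let ?c = "cos ?\<theta>"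
  obtain l where l: "m = 2 * l" using m(2) by (auto elim: evenE)
  have "0 < ?\<theta>" "?\<theta> < pi" using m by (auto simp: field_simps)
  then have sin: "sin ?\<theta> > 0" using sin_gt_zero by blast
  define P where "P = (\<lambda>j::nat. sin (real j * ?\<theta>) / sin ?\<theta>)"
  obtain t where t: "t \<in> R" "root_pair E t (P (Suc l) *\<^sub>R a + P l *\<^sub>R b) (P (Suc l) *\<^sub>R u + P l *\<^sub>R v)"
    using dihedral_roots[OF r s c] sin unfolding P_def by fastforce
  let ?k = "P (Suc l) *\<^sub>R a + P l *\<^sub>R b" and ?w = "P (Suc l) *\<^sub>R u + P l *\<^sub>R v"
  note tr = rootD[OF t(2)]
  note ru = rootD[OF r(2)] and sv = rootD[OF s(2)]
  have half: "real l * ?\<theta> = pi / 2" using m l by (simp add: field_simps)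
  have "real (Suc l) * ?\<theta> = real l * ?\<theta> + ?\<theta>" by (simp only: of_nat_Suc distrib_right mult_1_left)
  then have PS: "P (Suc l) = ?c * P l" unfolding P_def half by (simp add: sin_add)
  have ku: "?k \<bullet> u = 0" "a \<bullet> ?w = 0"
    by (simp_all add: inner_add_left inner_add_right ru(2) c PS)
  have "t \<noteq> r"
  proof
    assume "t = r"
    then have "r u = u" using tr(6)[OF ru(1)] ku by blast
    then show False using ru(2) ru(6)[OF ru(1)] by simp
  qed
  moreover have "t (r z) = r (t z)" if z: "z \<in> E" for z
  proof -
    have "t (r z) = r z - (?k \<bullet> r z) *\<^sub>R ?w" using tr(3) R_E[OF r(1) z] by blast
    also have "?k \<bullet> r z = ?k \<bullet> z" using ku(1) ru(3)[OF z] by (simp add: inner_diff_right)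
    finally have 1: "t (r z) = z - (a \<bullet> z) *\<^sub>R u - (?k \<bullet> z) *\<^sub>R ?w" using ru(3)[OF z] by simp
    have "r (t z) = t z - (a \<bullet> t z) *\<^sub>R u" using ru(3) R_E[OF t(1) z] by blast
    also have "a \<bullet> t z = a \<bullet> z" using ku(2) tr(3)[OF z] by (simp only: inner_diff_right inner_scaleR_right)
    finally have 2: "r (t z) = z - (?k \<bullet> z) *\<^sub>R ?w - (a \<bullet> z) *\<^sub>R u" using tr(3)[OF z] by simp
    show ?thesis unfolding 1 2 by simp
  qed
  moreover have "t z = z" if z: "z \<in> E" "a \<bullet> z = 0" "b \<bullet> z = 0" for z
    using tr(3)[OF z(1)] z by (simp add: inner_add_left)
  ultimately show ?thesis using t(1) by blast
qed

text \<open>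
  Comparing \<open>t r\<close> with \<open>r t\<close> shows that \<open>(a \<bullet> z) (k
  \<bullet> u) w = (k \<bullet> z) (a \<bullet> w) u\<close> for all \<open>z\<close>. If
  \<open>k \<bullet> u\<close> did not vanish, \<open>u\<close> and \<open>w\<close> would be
  proportional, and then also \<open>a\<close> and \<open>k\<close>, so that the mirrors
  coincide.
\<close>

lemma commuting_roots:
  assumes r: "r \<in> R" "root_pair E r a u" and t: "t \<in> R" "root_pair E t k w" and ne: "t \<noteq> r"
    and comm: "\<And>z. z \<in> E \<Longrightarrow> t (r z) = r (t z)"
  shows "k \<bullet> u = 0" "a \<bullet> w = 0"
proof -
  note ru = rootD[OF r(2)] and tw = rootD[OF t(2)]
  have eq: "((a \<bullet> z) * (k \<bullet> u)) *\<^sub>R w = ((k \<bullet> z) * (a \<bullet> w)) *\<^sub>R u" if z: "z \<in> E" for z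
  proof -
    have "t (r z) = r z - (k \<bullet> r z) *\<^sub>R w" using tw(3) R_E[OF r(1) z] by blast
    moreover have "r (t z) = t z - (a \<bullet> t z) *\<^sub>R u" using ru(3) R_E[OF t(1) z] by blast
    ultimately have "r z - (k \<bullet> r z) *\<^sub>R w = t z - (a \<bullet> t z) *\<^sub>R u" using comm[OF z] by simp
    then show ?thesis unfolding ru(3)[OF z] tw(3)[OF z] by (simp add: inner_diff_right algebra_simps)
  qed
  show ku: "k \<bullet> u = 0"
  proof (rule ccontr)
    assume k0: "k \<bullet> u \<noteq> 0"
    define l where "l = (a \<bullet> w) / 2"
    have "(2 * (k \<bullet> u)) *\<^sub>R w = ((k \<bullet> u) * (a \<bullet> w)) *\<^sub>R u" using eq[OF ru(1)] ru(2) by simp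
    then have "(k \<bullet> u) *\<^sub>R (2 *\<^sub>R w) = (k \<bullet> u) *\<^sub>R ((a \<bullet> w) *\<^sub>R u)" by (simp add: mult.commute)
    then have "2 *\<^sub>R w = (a \<bullet> w) *\<^sub>R u" using k0 scaleR_left_imp_eq by blast
    then have wl: "w = l *\<^sub>R u" by (simp add: l_def) (metis scaleR_half_double scaleR_2 scaleR_scaleR divide_inverse inverse_eq_divide mult.commute scaleR_one)
    then have l0: "l \<noteq> 0" using tw(4) by auto
    have "a \<bullet> z = 0 \<longleftrightarrow> k \<bullet> z = 0" if z: "z \<in> E" for z
    proof -
      have aw: "a \<bullet> w = 2 * l" by (simp add: l_def)
      have "((a \<bullet> z) * (k \<bullet> u)) *\<^sub>R (l *\<^sub>R u) = ((k \<bullet> z) * (2 * l)) *\<^sub>R u"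
        using eq[OF z] unfolding aw unfolding wl .
      then have "(a \<bullet> z) * (k \<bullet> u) * l = (k \<bullet> z) * (2 * l)" using ru(4) by simp
      then show ?thesis using k0 l0 by auto
    qed
    then have "mirror E t = mirror E r" using ru(6) tw(6) by (auto simp: mirror_def)
    then show False using refl_unique[OF t(1) r(1)] ne by blast
  qed
  show "a \<bullet> w = 0" using eq[OF tw(1)] ku tw(2) ru(4) by simp
qed

text \<open>
  On the plane spanned by \<open>u\<close> and \<open>v\<close> the product \<open>t r\<close>
  is \<open>-1\<close>. For odd \<open>m\<close> there is a reflection \<open>\<tau>\<close>
  taking \<open>u\<close> to \<open>- v\<close> and \<open>v\<close> to \<open>- u\<close>. So
  \<open>h = \<tau> t r\<close> exchanges \<open>u\<close> and \<open>v\<close> and fixes the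
  hyperedge: it is the reflection in the bisector of the dihedral angle of the chamber, and
  this bisector separates the points \<open>f\<close> and \<open>g\<close> of the chamber.
\<close>

lemma odd_label_no_orthogonal:
  assumes x: "x \<in> U" "\<forall>r\<in>R. r x \<noteq> x" and r: "r \<in> R" "root_pair E r a u" and s: "s \<in> R" "root_pair E s b v"
    and c: "a \<bullet> v = - 2 * cos (pi / real m)" "b \<bullet> u = - 2 * cos (pi / real m)" and m: "m \<ge> 2" "odd m"
    and f: "f \<in> cell U R x" "a \<bullet> f = 0" "b \<bullet> f > 0" and g: "g \<in> cell U R x" "b \<bullet> g = 0" "a \<bullet> g > 0"
    and y: "y \<in> U" "r y = y" "s y = y"
    and t: "t \<in> R" "t \<noteq> r" "\<And>z. z \<in> E \<Longrightarrow> t (r z) = r (t z)"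
    and J: "\<And>z. z \<in> E \<Longrightarrow> a \<bullet> z = 0 \<Longrightarrow> b \<bullet> z = 0 \<Longrightarrow> t z = z"
  shows False
proof -
  let ?c = "cos (pi / real m)"
  have E: "x \<in> E" "f \<in> E" "g \<in> E" "y \<in> E" using x f g y UE by (auto simp: cell_def)
  have "0 < pi / real m" "pi / real m < pi" using m by (auto simp: field_simps)
  then have "sin (pi / real m) > 0" using sin_gt_zero by blast
  then have c2: "?c * ?c < 1" using sin_cos_squared_add[of "pi / real m"] by (simp add: power2_eq_square) (metis less_add_same_cancel2 zero_less_mult_iff)
  have cpm: "1 - ?c > 0" "1 + ?c > 0" using c2 abs_square_less_1[of ?c] by (auto simp: power2_eq_square)
  note ru = rootD[OF r(2)] and sv = rootD[OF s(2)]
  obtain k w where tr: "root_pair E t k w" using R_root[OF t(1)] by blast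
  note tw = rootD[OF tr]
  have ku: "k \<bullet> u = 0" "a \<bullet> w = 0" using commuting_roots[OF r t(1) tr t(2,3)] by auto
  define den where "den = 2 - 2 * ?c * ?c"
  have den: "den > 0" using c2 by (simp add: den_def)
  \<comment> \<open>These are the coefficients of \<open>u\<close> and \<open>v\<close> in the decomposition
    of \<open>z\<close> relative to the plane spanned by \<open>u\<close> and
    \<open>v\<close> and the intersection of the two mirrors; \<open>jj z\<close> is the
    component in the intersection.\<close>
  define A B where "A z = (a \<bullet> z + ?c * (b \<bullet> z)) / den" and "B z = (?c * (a \<bullet> z) + b \<bullet> z) / den" for z
  define jj where "jj z = z - A z *\<^sub>R u - B z *\<^sub>R v" for z
  have jE: "jj z \<in> E" if "z \<in> E" for z
    using that ru(1) sv(1) subspace_E by (simp add: jj_def subspace_diff subspace_scale)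
  have ABd: "A z * den = a \<bullet> z + ?c * (b \<bullet> z)" "B z * den = ?c * (a \<bullet> z) + b \<bullet> z" for z
    using den by (auto simp: A_def B_def)
  have j0: "a \<bullet> jj z = 0" "b \<bullet> jj z = 0" for z
  proof -
    have "a \<bullet> jj z = a \<bullet> z - 2 * A z + 2 * ?c * B z" "b \<bullet> jj z = b \<bullet> z + 2 * ?c * A z - 2 * B z"
      using c ru(2) sv(2) by (simp_all add: jj_def inner_diff_right)
    moreover have "den * (a \<bullet> z - 2 * A z + 2 * ?c * B z) = 0" 
    proof -
      have "den * (a \<bullet> z - 2 * A z + 2 * ?c * B z) = den * (a \<bullet> z) - 2 * (A z * den) + 2 * ?c * (B z * den)" by (simp add: algebra_simps)
      also have "\<dots> = 0" unfolding ABd by (simp add: den_def algebra_simps)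
      finally show ?thesis .
    qed
    moreover have "den * (b \<bullet> z + 2 * ?c * A z - 2 * B z) = 0"
    proof -
      have "den * (b \<bullet> z + 2 * ?c * A z - 2 * B z) = den * (b \<bullet> z) + 2 * ?c * (A z * den) - 2 * (B z * den)" by (simp add: algebra_simps)
      also have "\<dots> = 0" unfolding ABd by (simp add: den_def algebra_simps)
      finally show ?thesis .
    qed
    ultimately show "a \<bullet> jj z = 0" "b \<bullet> jj z = 0" using den by auto
  qed
  obtain \<beta> where ip: "inner_product_on E \<beta>" and pres: "\<And>\<gamma>. \<gamma> \<in> G \<Longrightarrow> \<gamma> y = y \<Longrightarrow> preserves_on E \<beta> \<gamma>"
    using invariant_inner_product[OF y(1)] by blast
  note D = inner_product_onD[OF ip subspace_E]
  have ty: "t y = y" using J E(4) y ru(6) sv(6) by auto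
  have dual: "\<beta> w' z = 0" if "root_pair E q' k' w'" "q' \<in> R" "q' y = y" "z \<in> E" "k' \<bullet> z = 0" for q' k' w' z
    using root_dual[OF subspace_E ip pres[OF R_G] that(1,4)] that by simp
  \<comment> \<open>The root of \<open>t\<close> lies in the plane, because it is orthogonal to the
    intersection of the mirrors for an inner product invariant under \<open>r\<close>,
    \<open>s\<close> and \<open>t\<close>.\<close>
  have w0: "jj w = 0"
  proof (rule ccontr)
    assume n: "jj w \<noteq> 0"
    have jw: "jj w \<in> E" using jE tw by blast
    have "k \<bullet> jj w = 0" using J[OF jw j0] tw(6)[OF jw] by blast
    then have "\<beta> w (jj w) = 0" using dual[OF tr t(1) ty jw] by blast
    moreover have "\<beta> u (jj w) = 0" "\<beta> v (jj w) = 0"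
      using dual[OF r(2,1) y(2) jw] dual[OF s(2,1) y(3) jw] j0 by auto
    moreover have "\<beta> (jj w) (jj w) = \<beta> w (jj w) - A w * \<beta> u (jj w) - B w * \<beta> v (jj w)"
    proof -
      have "\<beta> (jj w) (jj w) = \<beta> (w - A w *\<^sub>R u - B w *\<^sub>R v) (jj w)" by (simp add: jj_def)
      also have "\<dots> = \<beta> (w - A w *\<^sub>R u) (jj w) - \<beta> (B w *\<^sub>R v) (jj w)"
        using jw ru(1) sv(1) tw(1) subspace_E by (intro D(6)) (auto simp: subspace_diff subspace_scale)
      also have "\<beta> (w - A w *\<^sub>R u) (jj w) = \<beta> w (jj w) - \<beta> (A w *\<^sub>R u) (jj w)"
        using jw ru(1) tw(1) subspace_E by (intro D(6)) (auto simp: subspace_scale)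
      finally show ?thesis using D(3)[OF ru(1) jw] D(3)[OF sv(1) jw] by simp
    qed
    ultimately show False using D(8)[OF jw n] by simp
  qed
  have kvw: "(k \<bullet> v) *\<^sub>R w = 2 *\<^sub>R (?c *\<^sub>R u + v)"
  proof -
    have "A w = ?c * B w" using ku by (simp add: A_def B_def)
    then have w: "w = B w *\<^sub>R (?c *\<^sub>R u + v)" using w0 by (simp add: jj_def algebra_simps)
    have "k \<bullet> w = B w * (k \<bullet> v)" by (subst w) (simp add: inner_add_right ku)
    then have "B w * (k \<bullet> v) = 2" using tw(2) by simp
    then show ?thesis by (subst w) (simp add: mult.commute)
  qed
  obtain \<tau> q where \<tau>: "\<tau> \<in> R" "q > 0" "q * (2 - 2 * ?c) = 1" "\<And>z. z \<in> E \<Longrightarrow> \<tau> z = z - (q * ((a + b) \<bullet> z)) *\<^sub>R (u + v)"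
    using odd_label_swap[OF r s c m] by blast
  have \<tau>u: "\<tau> u = - v"
  proof -
    have "(a + b) \<bullet> u = 2 - 2 * ?c" using c ru(2) by (simp add: inner_add_left)
    then show ?thesis using \<tau>(4)[OF ru(1)] \<tau>(3) by simp
  qed
  have \<tau>v: "\<tau> v = - u"
  proof -
    have "(a + b) \<bullet> v = 2 - 2 * ?c" using c sv(2) by (simp add: inner_add_left)
    then show ?thesis using \<tau>(4)[OF sv(1)] \<tau>(3) by simp
  qed
  define h where "h = compose E \<tau> (compose E t r)"
  have hG: "h \<in> G" unfolding h_def using G_comp R_G \<tau>(1) t(1) r(1) by blast
  have happ: "h z = \<tau> (t (r z))" if "z \<in> E" for z using that R_E[OF r(1) that] by (simp add: h_def G_comp_app)
  have neg\<tau>: "\<tau> (- z) = - \<tau> z" if "z \<in> E" for z using G_scale[OF R_G[OF \<tau>(1)] that, of "-1"] by simp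
  have hu: "h u = v"
  proof -
    have "t u = u" using tw(6)[OF ru(1)] ku by blast
    then have "t (- u) = - u" using G_scale[OF R_G[OF t(1)] ru(1), of "-1"] by simp
    then show ?thesis using happ[OF ru(1)] ru(5) neg\<tau>[OF ru(1)] \<tau>u by simp
  qed
  have hv: "h v = u"
  proof -
    have "r v = v + (2 * ?c) *\<^sub>R u" using ru(3)[OF sv(1)] c by simp
    moreover have "t (v + (2 * ?c) *\<^sub>R u) = (v + (2 * ?c) *\<^sub>R u) - (k \<bullet> (v + (2 * ?c) *\<^sub>R u)) *\<^sub>R w"
      using ru(1) sv(1) subspace_E by (intro tw(3)) (auto simp: subspace_add subspace_scale)
    moreover have "k \<bullet> (v + (2 * ?c) *\<^sub>R u) = k \<bullet> v" using ku by (simp add: inner_add_right)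
    ultimately have "t (r v) = (v + (2 * ?c) *\<^sub>R u) - 2 *\<^sub>R (?c *\<^sub>R u + v)" using kvw by simp
    then have "t (r v) = - v" by (simp add: algebra_simps scaleR_2)
    then show ?thesis using happ[OF sv(1)] neg\<tau>[OF sv(1)] \<tau>v by simp
  qed
  have hj: "h j = j" if j: "j \<in> E" "a \<bullet> j = 0" "b \<bullet> j = 0" for j
  proof -
    have "r j = j" using ru(6) j by blast
    moreover have "t j = j" using J j by blast
    moreover have "\<tau> j = j" using \<tau>(4)[OF j(1)] j by (simp add: inner_add_left)
    ultimately show ?thesis using happ[OF j(1)] by simp
  qed
  \<comment> \<open>This factor makes \<open>e (a - b)\<close> the coroot of \<open>u - v\<close>.\<close>
  define e where "e = 1 / (2 + 2 * ?c)"
  have e: "e * (2 + 2 * ?c) = 1" "e > 0" using cpm by (auto simp: e_def)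
  have "root_pair E h (e *\<^sub>R (a - b)) (u - v)"
    unfolding root_pair_def
  proof (intro conjI ballI)
    show "u - v \<in> E" using ru sv subspace_E by (simp add: subspace_diff)
    have "(a - b) \<bullet> (u - v) = 2 * (2 + 2 * ?c)" using c ru(2) sv(2) by (simp add: inner_diff_left inner_diff_right)
    then have "e *\<^sub>R (a - b) \<bullet> (u - v) = 2 * (e * (2 + 2 * ?c))" by simp
    then show "e *\<^sub>R (a - b) \<bullet> (u - v) = 2" using e by simp
    fix z assume z: "z \<in> E"
    have zd: "z = jj z + (A z *\<^sub>R u + B z *\<^sub>R v)" by (simp add: jj_def)
    have "h z = h (jj z) + h (A z *\<^sub>R u + B z *\<^sub>R v)"
      by (subst zd) (use jE[OF z] ru(1) sv(1) subspace_E hG in \<open>intro G_add, auto simp: subspace_add subspace_scale\<close>)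
    also have "h (A z *\<^sub>R u + B z *\<^sub>R v) = h (A z *\<^sub>R u) + h (B z *\<^sub>R v)"
      using ru(1) sv(1) subspace_E hG by (intro G_add) (auto simp: subspace_scale)
    also have "\<dots> = A z *\<^sub>R v + B z *\<^sub>R u" using G_scale[OF hG ru(1)] G_scale[OF hG sv(1)] hu hv by simp
    finally have hz: "h z = jj z + (A z *\<^sub>R v + B z *\<^sub>R u)" using hj[OF jE[OF z] j0] by simp
    have "A z - B z = e * ((a - b) \<bullet> z)"
    proof -
      have "(A z - B z) * den = (1 - ?c) * ((a - b) \<bullet> z)" using ABd[of z] by (simp add: algebra_simps inner_diff_left)
      moreover have "den = (1 - ?c) * (2 + 2 * ?c)" by (simp add: den_def algebra_simps)
      ultimately have "(1 - ?c) * ((A z - B z) * (2 + 2 * ?c)) = (1 - ?c) * ((a - b) \<bullet> z)" by (simp add: algebra_simps)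
      then have "(A z - B z) * (2 + 2 * ?c) = (a - b) \<bullet> z" using cpm by simp
      then have "e * ((a - b) \<bullet> z) = (A z - B z) * (e * (2 + 2 * ?c))" by simp
      then show ?thesis using e by simp
    qed
    moreover have "h z = z - (A z - B z) *\<^sub>R (u - v)" using hz by (simp add: jj_def algebra_simps)
    ultimately show "h z = z - (e *\<^sub>R (a - b) \<bullet> z) *\<^sub>R (u - v)" by simp
  qed
  note hr = rootD[OF this] and hR = R_I[OF hG this]
  have kf: "(e *\<^sub>R (a - b)) \<bullet> f < 0" "(e *\<^sub>R (a - b)) \<bullet> g > 0" using f g e by (simp_all add: inner_diff_left)
  have "side h x f \<ge> 0" "side h x g \<ge> 0" using f g hR by (auto simp: cell_def)
  moreover have "h f \<noteq> f" "h g \<noteq> g" using kf hr(6) E by (metis less_irrefl)+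
  ultimately have "side h f x > 0" "side h x g > 0" using side_pos[OF hR] E x hR by (auto simp: side_commute)
  then have "side h f g > 0" using side_trans[OF hR] E by blast
  moreover have "side h f g < 0"
    unfolding hr(7)[OF E(2,3)] using kf hr(4) by (intro mult_neg_pos) (auto simp only: inner_gt_zero_iff)
  ultimately show False by simp
qed

end

section \<open>Rolling along a mirror\<close>

lemma wall_atD:
  assumes "wall_at E U R x r w"
  shows "r \<in> R" "w \<in> cell U R x" "r w = w" "s \<in> R \<Longrightarrow> s w = w \<Longrightarrow> mirror E s = mirror E r" "w \<in> U"
  using assms unfolding wall_at_def cell_def by blast+

lemma (in arrangement) side_neg_same_mirror:
  assumes r: "r \<in> R" and s: "s \<in> R" and eq: "mirror E r = mirror E s" and xy: "x \<in> E" "y \<in> E" and neg: "side r x y < 0"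
  shows "side s x y < 0"
proof (rule ccontr)
  assume n: "\<not> ?thesis"
  have fix_iff: "r z = z \<longleftrightarrow> s z = z" if "z \<in> E" for z
    using eq that unfolding mirror_def by blast
  have "r x \<noteq> x" "r y \<noteq> y" using side_nz[OF r xy] neg by auto
  then have sx: "s x \<noteq> x" "s y \<noteq> y" using fix_iff xy by auto
  then have pos: "side s x y > 0" using side_nz[OF s xy] n by auto
  obtain z where z: "z \<in> closed_segment x y" "r z = z" using opposite_sides_meet[OF r xy] neg by auto
  have "closed_segment x y \<subseteq> E" using xy subspace_imp_convex[OF subE] by (intro closed_segment_subset) auto
  then have sz: "s z = z" using z fix_iff by blast
  obtain l where l: "0 \<le> l" "l \<le> 1" "z = (1 - l) *\<^sub>R x + l *\<^sub>R y" using z by (auto simp: closed_segment_def)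
  have "side s x z = (1 - l) * side s x x + l * side s x y" unfolding l(3) by (rule side_convex[OF s xy(1) xy])
  moreover have "side s x z = 0" using sz by (simp add: side_def)
  ultimately have zero: "(1 - l) * side s x x + l * side s x y = 0" by simp
  have "(1 - l) * side s x x \<ge> 0" "l * side s x y \<ge> 0" using l pos side_self[OF s xy(1) sx(1)] by simp_all
  then have "(1 - l) * side s x x = 0" "l * side s x y = 0" using zero by linarith+
  then show False using pos side_self[OF s xy(1) sx(1)] by auto
qed

text \<open>
  For different reflections, commuting is the form of orthogonality that refers to no inner
  product.
\<close>

definition orthogonal_reflections :: "'a::euclidean_space set \<Rightarrow> ('a \<Rightarrow> 'a) set \<Rightarrow> ('a \<Rightarrow> 'a) \<Rightarrow> ('a \<Rightarrow> 'a) set" where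
  "orthogonal_reflections E G r = {t\<in>reflections E G. t \<noteq> r \<and> (\<forall>z\<in>E. t (r z) = r (t z))}"

context refl_action begin

lemma reflection_moves_mirror:
  assumes "\<rho> \<in> R" "s \<in> R" "s \<noteq> \<rho>" shows "\<exists>x\<in>mirror E \<rho>. s x \<noteq> x"
proof (rule ccontr)
  assume "\<not> ?thesis"
  then have "mirror E \<rho> \<subseteq> mirror E s" by (auto simp: mirror_def)
  then have "mirror E \<rho> = mirror E s" using mirror_subset_eq assms by blast
  then show False using refl_unique assms by blast
qed

lemma arrangement_on_mirror:
  assumes \<rho>: "\<rho> \<in> R" and R': "R' \<subseteq> R - {\<rho>}"
  shows "arrangement (mirror E \<rho>) (U \<inter> mirror E \<rho>) R'"
proof (rule local_arrangement)
  show "subspace (mirror E \<rho>)" using subspace_mirror \<rho> .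
  then show "convex (U \<inter> mirror E \<rho>)" using convex_U subspace_imp_convex convex_Int by blast
  obtain T where T: "open T" "U = E \<inter> T" using openin_U by (auto simp: openin_open)
  then have "U \<inter> mirror E \<rho> = mirror E \<rho> \<inter> T" by (auto simp: mirror_def)
  then show "openin (top_of_set (mirror E \<rho>)) (U \<inter> mirror E \<rho>)" using T by (auto simp: openin_open)
  show "\<exists>x\<in>mirror E \<rho>. r x \<noteq> x" if "r \<in> R'" for r using reflection_moves_mirror[OF \<rho>] R' that by blast
qed (use R' in \<open>auto simp: mirror_def\<close>)

text \<open>
  The witness \<open>f\<close> of the facet lies on no mirror but that of
  \<open>\<rho>\<close>. It is on the same side as \<open>x\<close> of all other mirrors, so
  inside the mirror of \<open>\<rho>\<close> the chamber of \<open>x\<close> looks like the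
  cell of \<open>f\<close>.
\<close>

lemma facet_in_mirror:
  assumes x: "x \<in> U" "\<forall>r\<in>R. r x \<noteq> x" and \<rho>: "\<rho> \<in> R" and F: "F facet_of cell U R x" "F \<subseteq> mirror E \<rho>"
  obtains f where "wall_at E U R x \<rho> f" "f \<in> U \<inter> mirror E \<rho>" "\<forall>s\<in>R - {\<rho>}. s f \<noteq> f" "\<forall>s\<in>R - {\<rho>}. side s x f > 0"
    "F = cell U R x \<inter> mirror E \<rho>" "F = cell (U \<inter> mirror E \<rho>) (R - {\<rho>}) f"
proof -
  obtain r f where rf: "wall_at E U R x r f" "F = cell U R x \<inter> mirror E r" using facet_of_cellE[OF x F(1)] .
  have fC: "f \<in> cell U R x" "r \<in> R" "r f = f" using wall_atD[OF rf(1)] by blast+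
  have E: "f \<in> E" "f \<in> U" "x \<in> E" using fC UE x by (auto simp: cell_def)
  have "f \<in> F" using rf fC E by (auto simp: mirror_def)
  then have "\<rho> f = f" using F by (auto simp: mirror_def)
  then have "mirror E \<rho> = mirror E r" using wall_atD(4)[OF rf(1) \<rho>] by blast
  then have r\<rho>: "r = \<rho>" using refl_unique \<rho> fC by blast
  have 1: "\<forall>s\<in>R - {\<rho>}. s f \<noteq> f"
  proof (intro ballI notI)
    fix s assume s: "s \<in> R - {\<rho>}" "s f = f"
    then have "mirror E s = mirror E r" using rf unfolding wall_at_def by blast
    then show False using refl_unique[of s r] s fC r\<rho> by blast
  qed
  have 2: "\<forall>s\<in>R - {\<rho>}. side s x f > 0"
  proof
    fix s assume s: "s \<in> R - {\<rho>}"
    show "side s x f > 0" using s E x 1 fC by (intro side_pos) (auto simp: cell_def)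
  qed
  have "cell U R x \<inter> mirror E \<rho> = cell (U \<inter> mirror E \<rho>) (R - {\<rho>}) f"
  proof (intro equalityI subsetI)
    fix y assume y: "y \<in> cell U R x \<inter> mirror E \<rho>"
    then have yE: "y \<in> E" by (auto simp: mirror_def)
    have "side s f y \<ge> 0" if "s \<in> R - {\<rho>}" for s
      using side_trans_ge[of s f x y] that 2 E yE y by (auto simp: cell_def side_commute)
    then show "y \<in> cell (U \<inter> mirror E \<rho>) (R - {\<rho>}) f" using y by (auto simp: cell_def)
  next
    fix y assume y: "y \<in> cell (U \<inter> mirror E \<rho>) (R - {\<rho>}) f"
    then have yE: "y \<in> E" "\<rho> y = y" by (auto simp: cell_def mirror_def)
    have "side s x y \<ge> 0" if s: "s \<in> R" for s
    proof (cases "s = \<rho>")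
      case True then show ?thesis using yE by (simp add: side_def)
    next
      case False then show ?thesis using side_trans_ge[of s x f y] s 2 E yE y by (auto simp: cell_def)
    qed
    then show "y \<in> cell U R x \<inter> mirror E \<rho>" using y by (auto simp: cell_def)
  qed
  then show ?thesis using that[of f] rf r\<rho> E 1 2 \<open>f \<in> F\<close> F by blast
qed

text \<open>
  Conjugation by \<open>\<gamma>\<close> maps the mirrors through \<open>w\<close> to those
  through \<open>\<gamma> w\<close>.
\<close>

lemma image_wall:
  assumes \<gamma>: "\<gamma> \<in> G" and w: "wall_at E U R x s w" and x: "x \<in> E"
  shows "\<exists>s'. wall_at E U R (\<gamma> x) s' (\<gamma> w) \<and> \<gamma> ` (cell U R x \<inter> mirror E s) = cell U R (\<gamma> x) \<inter> mirror E s'"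
proof -
  have s: "s \<in> R" "s w = w" "w \<in> cell U R x" using w by (auto dest: wall_atD)
  have wE: "w \<in> E" using s UE by (auto simp: cell_def)
  obtain \<delta> where \<delta>: "\<delta> \<in> G" "\<And>x. x \<in> E \<Longrightarrow> \<delta> (\<gamma> x) = x" "\<And>x. x \<in> E \<Longrightarrow> \<gamma> (\<delta> x) = x" using G_inv[OF \<gamma>] by blast
  obtain s' where s': "s' \<in> R" "\<forall>y\<in>E. s' (\<gamma> y) = \<gamma> (s y)" "\<forall>y\<in>E. s' (\<gamma> y) = \<gamma> y \<longleftrightarrow> s y = y" using conj_refl[OF \<gamma> s(1)] by blast
  have gm: "\<gamma> ` mirror E q = mirror E q'" if "\<forall>y\<in>E. q' (\<gamma> y) = \<gamma> y \<longleftrightarrow> q y = y" for q q'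
  proof (intro equalityI subsetI)
    fix y assume "y \<in> \<gamma> ` mirror E q" then show "y \<in> mirror E q'" using that G_E[OF \<gamma>] by (auto simp: mirror_def)
  next
    fix y assume y: "y \<in> mirror E q'"
    then have "\<delta> y \<in> E" "\<gamma> (\<delta> y) = y" using \<delta> G_E by (auto simp: mirror_def)
    moreover have "q' y = y" using y by (simp add: mirror_def)
    ultimately have "q (\<delta> y) = \<delta> y" using that by metis
    then have "\<delta> y \<in> mirror E q" using \<open>\<delta> y \<in> E\<close> by (simp add: mirror_def)
    then show "y \<in> \<gamma> ` mirror E q" using \<open>\<gamma> (\<delta> y) = y\<close> by (metis image_eqI)
  qed
  have inj: "inj_on \<gamma> E" using G_inj[OF \<gamma>] by (auto simp: inj_on_def)
  have cE: "cell U R x \<subseteq> E" "mirror E s \<subseteq> E" using UE by (auto simp: cell_def mirror_def)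
  have im: "\<gamma> ` (cell U R x \<inter> mirror E s) = cell U R (\<gamma> x) \<inter> mirror E s'"
    using inj_on_image_Int[OF inj cE] image_cell[OF \<gamma> x] gm[OF s'(3)] by simp
  have "mirror E q = mirror E s'" if q: "q \<in> R" "q (\<gamma> w) = \<gamma> w" for q
  proof -
    obtain q' where q': "q' \<in> R" "\<forall>y\<in>E. q' (\<delta> y) = \<delta> (q y)" "\<forall>y\<in>E. q' (\<delta> y) = \<delta> y \<longleftrightarrow> q y = y" using conj_refl[OF \<delta>(1) q(1)] by blast
    have q'': "q (\<gamma> y) = \<gamma> y \<longleftrightarrow> q' y = y" if "y \<in> E" for y
      using q'(3) G_E[OF \<gamma> that] \<delta>(2)[OF that] by metis
    have "q' w = w" using q''[OF wE] q by blast
    then have "mirror E q' = mirror E s" using w q' unfolding wall_at_def by blast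
    then show ?thesis using gm[of q q'] gm[OF s'(3)] q'' by blast
  qed
  moreover have "\<gamma> w \<in> cell U R (\<gamma> x)" using image_cell_subset[OF \<gamma> x s(3)] .
  moreover have "s' (\<gamma> w) = \<gamma> w" using s'(3) wE s by blast
  ultimately have "wall_at E U R (\<gamma> x) s' (\<gamma> w)" unfolding wall_at_def using s'(1) by blast
  then show ?thesis using im by blast
qed

end

text \<open>
  The facet \<open>F0\<close> in the mirror of \<open>\<rho>\<close> where rolling starts is
  named by a point \<open>f0\<close> of its interior, as the chamber is named by
  \<open>x0\<close>.
\<close>

locale rolling_setup = refl_action E U G for E U :: "'a::euclidean_space set" and G :: "('a \<Rightarrow> 'a) set" +
  fixes \<rho> :: "'a \<Rightarrow> 'a" and x0 :: 'a and F0 :: "'a set" and f0 :: 'a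
  assumes rho: "\<rho> \<in> reflections E G" and x0: "x0 \<in> U" "\<forall>r\<in>reflections E G. r x0 \<noteq> x0"
    and F0: "F0 facet_of cell U (reflections E G) x0" "F0 \<subseteq> mirror E \<rho>"
    and f0: "f0 \<in> U \<inter> mirror E \<rho>" "\<forall>s\<in>reflections E G - {\<rho>}. s f0 \<noteq> f0"
      "F0 = cell (U \<inter> mirror E \<rho>) (reflections E G - {\<rho>}) f0"
begin

abbreviation "X \<equiv> mirror E \<rho>"
text \<open>
  The mirrors of \<open>RX\<close> cut \<open>X\<close> into facets of chambers; those of
  \<open>RD\<close> are orthogonal to \<open>X\<close>.
\<close>

abbreviation "RX \<equiv> R - {\<rho>}"
abbreviation "RD \<equiv> orthogonal_reflections E G \<rho>"
abbreviation "tile f \<equiv> cell (U \<inter> X) RX f"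
abbreviation "rolled \<equiv> rolling E G X (cell U R x0) F0"

lemma RD_RX: "RD \<subseteq> RX" by (auto simp: orthogonal_reflections_def)

sublocale AX: arrangement X "U \<inter> X" RX using arrangement_on_mirror[OF rho] by blast

lemma XE: "y \<in> X \<Longrightarrow> y \<in> E" by (simp add: mirror_def)
lemma X_fix: "y \<in> X \<Longrightarrow> \<rho> y = y" by (simp add: mirror_def)
lemma mirror_X: "mirror X s = X \<inter> mirror E s" by (auto simp: mirror_def)

text \<open>
  This is the invariant of rolling. The chamber is named by \<open>x\<close>, its facet in
  \<open>X\<close> by \<open>f\<close>, and the last condition says that no mirror orthogonal
  to \<open>X\<close> has been crossed.
\<close>

definition rolled_ok :: "'a set \<times> 'a set \<Rightarrow> 'a \<Rightarrow> 'a \<Rightarrow> bool" where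
  "rolled_ok CF x f \<longleftrightarrow> x \<in> U \<and> (\<forall>r\<in>R. r x \<noteq> x) \<and> fst CF = cell U R x \<and> snd CF facet_of cell U R x \<and> snd CF \<subseteq> X \<and>
     wall_at E U R x \<rho> f \<and> f \<in> U \<inter> X \<and> (\<forall>s\<in>RX. s f \<noteq> f) \<and> (\<forall>s\<in>RX. side s x f > 0) \<and>
     snd CF = cell U R x \<inter> X \<and> snd CF = tile f \<and> (\<forall>t\<in>RD. side t f0 f > 0)"

lemma tile_sides:
  assumes f: "f \<in> U \<inter> X" "\<forall>s\<in>RX. s f \<noteq> f" and f': "f' \<in> U \<inter> X" "\<forall>s\<in>RX. s f' \<noteq> f'" and eq: "tile f = tile f'"
    and t: "t \<in> RX"
  shows "side t f f' > 0"
proof -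
  have "f' \<in> tile f" using AX.mem_cell_self[OF f'(1)] eq by simp
  then have "side t f f' \<ge> 0" using t by (simp add: cell_def)
  then show ?thesis using t f f' by (intro AX.side_pos) auto
qed

lemma rolled_ok_start: "\<exists>x f. rolled_ok (cell U R x0, F0) x f"
proof -
  obtain f where f: "wall_at E U R x0 \<rho> f" "f \<in> U \<inter> X" "\<forall>s\<in>RX. s f \<noteq> f" "\<forall>s\<in>RX. side s x0 f > 0"
    "F0 = cell U R x0 \<inter> X" "F0 = tile f" using facet_in_mirror[OF x0 rho F0] .
  have "\<forall>t\<in>RD. side t f0 f > 0"
  proof
    fix t assume "t \<in> RD"
    then have t: "t \<in> RX" using RD_RX by blast
    show "side t f0 f > 0" using tile_sides[OF f0(1,2) f(2,3) _ t] f0(3) f(6) by simp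
  qed
  then have "rolled_ok (cell U R x0, F0) x0 f" unfolding rolled_ok_def using x0 F0 f by simp
  then show ?thesis by blast
qed

lemma facet_of_tile:
  assumes f: "f \<in> U \<inter> X" "\<forall>s\<in>RX. s f \<noteq> f" and I: "I facet_of tile f"
  obtains b w where "wall_at X (U \<inter> X) RX f b w" "I = tile f \<inter> mirror X b" "span I = mirror X b" "w \<in> I"
proof -
  obtain b w where bw: "wall_at X (U \<inter> X) RX f b w" "I = tile f \<inter> mirror X b"
    using AX.facet_of_cellE[OF f I] .
  moreover have "span I = mirror X b" using AX.wall_facet(2)[OF f bw(1)] bw(2) by simp
  moreover have "w \<in> I" using wall_atD(2,3,5)[OF bw(1)] unfolding bw(2) mirror_def by blast
  ultimately show ?thesis using that by blast
qed

lemma two_wall_points: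
  assumes ok: "rolled_ok CF x f" and g: "wall_at E U R x s g" and s: "s \<noteq> \<rho>"
    and ra: "root_pair E \<rho> a u" "a \<bullet> x > 0" and rb: "root_pair E s b v" "b \<bullet> x > 0"
  shows "a \<bullet> f = 0" "b \<bullet> f > 0" "b \<bullet> g = 0" "a \<bullet> g > 0" "f \<in> cell U R x" "g \<in> cell U R x" "\<rho> f = f" "s f \<noteq> f" "s g = g" "\<rho> g \<noteq> g"
proof -
  have sR: "s \<in> R" and gC: "g \<in> cell U R x" "s g = g" using wall_atD[OF g] by blast+
  have fC: "f \<in> cell U R x" "\<rho> f = f" using ok by (auto simp: rolled_ok_def wall_at_def)
  have E: "x \<in> E" "f \<in> E" "g \<in> E" using ok fC gC UE by (auto simp: cell_def rolled_ok_def)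
  have sf: "s f \<noteq> f" using ok sR s by (auto simp: rolled_ok_def)
  have rg: "\<rho> g \<noteq> g"
  proof
    assume "\<rho> g = g"
    then have "mirror E \<rho> = mirror E s" using g rho unfolding wall_at_def by blast
    then show False using refl_unique[OF rho sR] s by blast
  qed
  show "f \<in> cell U R x" "g \<in> cell U R x" "\<rho> f = f" "s f \<noteq> f" "s g = g" "\<rho> g \<noteq> g" by (fact fC gC sf rg)+
  show "a \<bullet> f = 0" "b \<bullet> g = 0" using rootD(6)[OF ra(1) E(2)] rootD(6)[OF rb(1) E(3)] fC gC by auto
  have "side s x f \<ge> 0" using fC sR by (simp add: cell_def)
  then have "b \<bullet> f \<ge> 0" unfolding root_sign[OF rb(1) E(1,2)] pos_mult_sign(3)[OF rb(2)] .
  then show "b \<bullet> f > 0" using rootD(6)[OF rb(1) E(2)] sf by simp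
  have "side \<rho> x g \<ge> 0" using gC rho by (simp add: cell_def)
  then have "a \<bullet> g \<ge> 0" unfolding root_sign[OF ra(1) E(1,3)] pos_mult_sign(3)[OF ra(2)] .
  then show "a \<bullet> g > 0" using rootD(6)[OF ra(1) E(3)] rg by simp
qed

text \<open>
  The old facet and the new one have the hyperedge \<open>I\<close> in common. If a mirror
  orthogonal to \<open>X\<close> separated them, it would contain \<open>I\<close>, which is
  impossible as the label is odd.
\<close>

lemma rolled_ok_step:
  assumes ok: "rolled_ok (C', F') x f" and I: "I facet_of F'" and G': "G' facet_of C'" "G' \<noteq> F'" "I \<subseteq> G'"
    and lab: "has_label E G C' F' G' m" "odd m" and \<gamma>: "\<gamma> \<in> G" "\<forall>x\<in>I. \<gamma> x = x" "\<gamma> ` G' \<subseteq> X"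
  shows "\<exists>x f. rolled_ok (\<gamma> ` C', \<gamma> ` G') x f"
proof -
  have x: "x \<in> U" "\<forall>r\<in>R. r x \<noteq> x" and C': "C' = cell U R x" and F': "F' = cell U R x \<inter> X" "F' = tile f"
    and f: "wall_at E U R x \<rho> f" "f \<in> U \<inter> X" "\<forall>s\<in>RX. s f \<noteq> f" "\<forall>t\<in>RD. side t f0 f > 0"
    using ok by (auto simp: rolled_ok_def)
  have xE: "x \<in> E" using x UE by blast
  obtain s g where sg: "wall_at E U R x s g" "G' = cell U R x \<inter> mirror E s" using facet_of_cellE[OF x G'(1)[unfolded C']] .
  have sR: "s \<in> R" using wall_atD[OF sg(1)] by blast
  have s\<rho>: "s \<noteq> \<rho>" using G'(2) F'(1) sg(2) by auto
  obtain s' where s': "wall_at E U R (\<gamma> x) s' (\<gamma> g)" "\<gamma> ` G' = cell U R (\<gamma> x) \<inter> mirror E s'"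
    using image_wall[OF \<gamma>(1) sg(1) xE] sg(2) by blast
  have gx: "\<gamma> x \<in> U" "\<forall>r\<in>R. r (\<gamma> x) \<noteq> \<gamma> x" using regular_image[OF \<gamma>(1) x] by auto
  have facet: "\<gamma> ` G' facet_of cell U R (\<gamma> x)" using wall_facet(1)[OF gx s'(1)] s'(2) by simp
  obtain f2 where f2: "wall_at E U R (\<gamma> x) \<rho> f2" "f2 \<in> U \<inter> X" "\<forall>s\<in>RX. s f2 \<noteq> f2" "\<forall>s\<in>RX. side s (\<gamma> x) f2 > 0"
    "\<gamma> ` G' = cell U R (\<gamma> x) \<inter> X" "\<gamma> ` G' = tile f2" using facet_in_mirror[OF gx rho facet \<gamma>(3)] .
  have E: "f \<in> E" "f2 \<in> E" using f f2 XE by auto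
  obtain b' w where b': "wall_at X (U \<inter> X) RX f b' w" "I = tile f \<inter> mirror X b'" "span I = mirror X b'" "w \<in> I"
    using facet_of_tile[OF f(2,3)] I F'(2) by metis
  have IF: "I \<subseteq> F'" using b'(2) F'(2) by blast
  have IE: "I \<subseteq> E" "I \<subseteq> U" using IF F'(2) XE by (auto simp: cell_def)
  \<comment> \<open>no mirror orthogonal to \<open>X\<close> is crossed\<close>
  have keep: "side t f f2 > 0" if t: "t \<in> RD" for t
  proof (rule ccontr)
    assume neg: "\<not> ?thesis"
    have tRX: "t \<in> RX" "t \<in> R" using t RD_RX by auto
    have t\<rho>: "t \<noteq> \<rho>" "\<And>z. z \<in> E \<Longrightarrow> t (\<rho> z) = \<rho> (t z)" using t by (auto simp: orthogonal_reflections_def)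
    have "side t f f2 \<noteq> 0" using side_nz[OF tRX(2) E] f(3) f2(3) tRX by blast
    then have neg: "side t f f2 < 0" using neg by simp
    have It: "I \<subseteq> mirror E t"
    proof
      fix i assume i: "i \<in> I"
      then have iE: "i \<in> E" using IE by blast
      have "side t f i \<ge> 0" using i IF F'(2) tRX by (auto simp: cell_def)
      moreover have "i \<in> \<gamma> ` G'" using i \<gamma>(2) G'(3) by (metis image_eqI subsetD)
      then have "side t f2 i \<ge> 0" using f2(6) tRX by (auto simp: cell_def)
      ultimately have "t i = i"
        using neg cn_side[OF tRX(2)] cn_fix[OF tRX(2) iE] E iE by (auto simp: mult_less_0_iff zero_le_mult_iff)
      then show "i \<in> mirror E t" using iE by (simp add: mirror_def)
    qed
    obtain r0 s0 a u b v where lr: "m \<ge> 2" "r0 \<in> R" "s0 \<in> R" "F' \<subseteq> mirror E r0" "G' \<subseteq> mirror E s0" "root_pair E r0 a u" "root_pair E s0 b v"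
      "a \<bullet> x > 0" "b \<bullet> x > 0" "a \<bullet> v = - 2 * cos (pi / real m)" "b \<bullet> u = - 2 * cos (pi / real m)"
      using has_label_roots[OF x lab(1)[unfolded C']] by blast
    have "f \<in> F'" using AX.mem_cell_self f(2) F'(2) by blast
    then have "r0 f = f" using lr(4) by (auto simp: mirror_def)
    then have r0: "r0 = \<rho>" using f(3) lr(2) by blast
    have "g \<in> G'" using wall_atD(2,3,5)[OF sg(1)] UE unfolding sg(2) mirror_def by blast
    then have "s0 g = g" using lr(5) by (auto simp: mirror_def)
    then have "mirror E s0 = mirror E s" using sg(1) lr(3) unfolding wall_at_def by blast
    then have s0: "s0 = s" using refl_unique lr(3) sR by blast
    note tw = two_wall_points[OF ok sg(1) s\<rho> lr(6)[unfolded r0] lr(8) lr(7)[unfolded s0] lr(9)]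
    have sRX: "s \<in> RX" and b'RX: "b' \<in> RX" using sR s\<rho> b'(1) by (auto dest: wall_atD)
    have "I \<subseteq> mirror X s" using G'(3) sg(2) IF F'(1) by (auto simp: mirror_X)
    then have "span I \<subseteq> mirror X s" using AX.subspace_mirror[OF sRX] by (simp add: span_minimal)
    then have Xs: "mirror X b' = mirror X s" using AX.mirror_subset_eq[OF b'RX sRX] b'(3) by simp
    have wI: "w \<in> U" "\<rho> w = w" "s w = w"
      using b'(4) IE \<open>I \<subseteq> mirror X s\<close> by (auto simp: mirror_def)
    show False
    proof (rule odd_label_no_orthogonal[OF x rho lr(6)[unfolded r0] sR lr(7)[unfolded s0] lr(10,11) lr(1) lab(2)])
      show "f \<in> cell U R x" "a \<bullet> f = 0" "b \<bullet> f > 0" "g \<in> cell U R x" "b \<bullet> g = 0" "a \<bullet> g > 0" by (fact tw)+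
      show "w \<in> U" "\<rho> w = w" "s w = w" by (fact wI)+
      show "t \<in> R" "t \<noteq> \<rho>" "\<And>z. z \<in> E \<Longrightarrow> t (\<rho> z) = \<rho> (t z)" by (fact tRX t\<rho>)+
      fix z assume z: "z \<in> E" "a \<bullet> z = 0" "b \<bullet> z = 0"
      then have "\<rho> z = z" "s z = z" using rootD(6)[OF lr(6)[unfolded r0]] rootD(6)[OF lr(7)[unfolded s0]] by auto
      then have "z \<in> mirror X s" using z by (auto simp: mirror_def)
      then have "z \<in> span I" using Xs b'(3) by simp
      moreover have "span I \<subseteq> mirror E t" using It subspace_mirror[OF tRX(2)] by (simp add: span_minimal)
      ultimately show "t z = z" by (auto simp: mirror_def)
    qed
  qed
  have "\<forall>t\<in>RD. side t f0 f2 > 0"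
  proof
    fix t assume t: "t \<in> RD"
    have "t \<in> R" using t RD_RX by blast
    then show "side t f0 f2 > 0" using side_trans[of t f0 f f2] f(4) keep t E f0(1) XE by blast
  qed
  then have "rolled_ok (\<gamma> ` C', \<gamma> ` G') (\<gamma> x) f2"
    unfolding rolled_ok_def using gx image_cell[OF \<gamma>(1) xE] C' facet \<gamma>(3) f2 by simp
  then show ?thesis by blast
qed

lemma rolled_ok: "(C', F') \<in> rolled \<Longrightarrow> \<exists>x f. rolled_ok (C', F') x f"
proof (induction rule: rolling.induct)
  case start
  then show ?case using rolled_ok_start by blast
next
  case (step C' F' I G' m \<gamma>)
  obtain x f where ok: "rolled_ok (C', F') x f" using step.IH by blast
  show ?case by (rule rolled_ok_step[OF ok step.hyps(2-10)])
qed

text \<open>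
  Let \<open>s\<close> be the other wall of the chamber at the point \<open>w\<close> of the
  wall \<open>b\<close> of the facet. If the label of the hyperedge were even, a mirror
  orthogonal to \<open>X\<close> would contain it, and its trace on \<open>X\<close> would be
  \<open>b\<close>. So the label is odd, and the reflection \<open>\<tau>\<close> exchanging
  the two mirrors gives a rolling step over \<open>b\<close>.
\<close>

lemma cross_wall:
  assumes mem: "(C1, F1) \<in> rolled" and ok: "rolled_ok (C1, F1) x f" and w: "wall_at X (U \<inter> X) RX f b w"
    and no: "\<And>t. t \<in> RD \<Longrightarrow> mirror X t \<noteq> mirror X b"
  shows "\<exists>CF x' f'. CF \<in> rolled \<and> rolled_ok CF x' f' \<and> w \<in> tile f' \<and> side b f f' < 0"
proof -
  have x: "x \<in> U" "\<forall>r\<in>R. r x \<noteq> x" and C1: "C1 = cell U R x" and F1: "F1 facet_of C1" "F1 = cell U R x \<inter> X" "F1 = tile f"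
    and f: "wall_at E U R x \<rho> f" "f \<in> U \<inter> X" "\<forall>s\<in>RX. s f \<noteq> f"
    using ok by (auto simp: rolled_ok_def)
  have b: "b \<in> RX" "b w = w" "w \<in> tile f" using w by (auto dest: wall_atD)
  have wX: "w \<in> X" "w \<in> U" "w \<in> cell U R x" using b F1 by (auto simp: cell_def)
  have E: "x \<in> E" "w \<in> E" "f \<in> E" using x wX f XE UE by auto
  have bR: "b \<in> R" using b by simp
  obtain e where e: "e \<in> X" "b e \<noteq> e" using reflection_moves_mirror[OF rho bR] b by auto
  have eE: "e \<in> E" using e XE by blast
  have "side b x e \<noteq> 0" using side_nz[OF bR E(1) eE] x bR e by blast
  then obtain v where v: "v \<in> X" "side b x v < 0"
  proof (cases "side b x e < 0")
    case False
    then have "side b x e > 0" using \<open>side b x e \<noteq> 0\<close> by simp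
    moreover have "side b x ((-1) *\<^sub>R e) = - side b x e"
      using side_convex[OF bR E(1) eE eE, of "-1" 0] by simp
    moreover have "(-1) *\<^sub>R e \<in> X" using e(1) subspace_mirror[OF rho] by (simp add: subspace_neg)
    ultimately show ?thesis using that[of "(-1) *\<^sub>R e"] by linarith
  qed (use that e in blast)
  have vE: "v \<in> E" using v XE by blast
  have sxx: "side b x x > 0" "side \<rho> x x > 0" using side_self E x bR rho by auto
  \<comment> \<open>The point \<open>z\<close> lies on the same side of \<open>X\<close> as \<open>x\<close>
    but beyond \<open>b\<close>. A wall at \<open>w\<close> that separates it from
    \<open>x\<close> is therefore different from \<open>X\<close>.\<close>
  define \<epsilon> where "\<epsilon> = - side b x v / (2 * side b x x)"
  have \<epsilon>: "\<epsilon> > 0" unfolding \<epsilon>_def using v sxx by (intro divide_pos_pos) auto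
  define z where "z = 1 *\<^sub>R v + \<epsilon> *\<^sub>R x"
  have zE: "z \<in> E" unfolding z_def using vE E subspace_E by (intro subspace_add subspace_scale)
  have "side \<rho> x z = 1 * side \<rho> x v + \<epsilon> * side \<rho> x x" unfolding z_def by (rule side_convex[OF rho E(1) vE E(1)])
  moreover have "side \<rho> x v = 0" using X_fix[OF v(1)] by (simp add: side_def)
  ultimately have zr: "side \<rho> x z > 0" using \<epsilon> sxx by simp
  have "side b x z = 1 * side b x v + \<epsilon> * side b x x" unfolding z_def by (rule side_convex[OF bR E(1) vE E(1)])
  moreover have "\<epsilon> * side b x x = - side b x v / 2" using sxx by (simp add: \<epsilon>_def)
  ultimately have zb: "side b x z < 0" using v by simp
  obtain s g where sg: "wall_at E U R x s g" "s w = w" "side s x z < 0"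
    using local_wall[OF x wX(3) zE bR b(2) zb] by blast
  have sR: "s \<in> R" using wall_atD[OF sg(1)] by blast
  have s\<rho>: "s \<noteq> \<rho>" using sg zr by auto
  have sRX: "s \<in> RX" using sR s\<rho> by simp
  have Xs: "mirror X s = mirror X b" using w sRX sg(2) unfolding wall_at_def by blast
  define G' where "G' = cell U R x \<inter> mirror E s"
  define I where "I = tile f \<inter> mirror X b"
  have G'f: "G' facet_of C1" unfolding G'_def C1 using wall_facet(1)[OF x sg(1)] .
  have If: "I facet_of F1" unfolding I_def F1(3) using AX.wall_facet(1)[OF f(2,3) w] .
  have IG: "I \<subseteq> G'" using F1 Xs by (auto simp: I_def G'_def mirror_X)
  have gG: "g \<in> G'" using wall_atD(2,3,5)[OF sg(1)] UE unfolding G'_def mirror_def by blast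
  obtain m a u b1 v1 where lab: "m \<ge> 2" "has_label E G (cell U R x) F1 G' m" "root_pair E \<rho> a u" "root_pair E s b1 v1"
     "a \<bullet> x > 0" "b1 \<bullet> x > 0" "a \<bullet> v1 = - 2 * cos (pi / real m)" "b1 \<bullet> u = - 2 * cos (pi / real m)"
  proof -
    have "\<rho> f = f" "s f \<noteq> f" "f \<in> cell U R x" using wall_atD(2,3)[OF f(1)] f(3) sRX by blast+
    moreover have "g \<in> cell U R x" "s g = g" using wall_atD(2,3)[OF sg(1)] by blast+
    moreover have "\<rho> g \<noteq> g"
    proof
      assume "\<rho> g = g"
      then have "mirror E \<rho> = mirror E s" using sg rho unfolding wall_at_def by blast
      then show False using refl_unique[OF rho sR] s\<rho> by blast
    qed
    ultimately show ?thesis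
      using has_label_exists[OF x rho sR s\<rho>[symmetric] wX(2) X_fix[OF wX(1)] sg(2), of f g F1 G'] F1(2) that unfolding G'_def by blast
  qed
  note tw = two_wall_points[OF ok sg(1) s\<rho> lab(3,5,4,6)]
  have ne: "G' \<noteq> F1" using gG F1(2) tw(10) X_fix by blast
  have odd: "odd m"
  proof (rule ccontr)
    assume "\<not> odd m"
    then obtain t where t: "t \<in> R" "t \<noteq> \<rho>" "\<forall>z\<in>E. t (\<rho> z) = \<rho> (t z)" "\<forall>z\<in>E. a \<bullet> z = 0 \<longrightarrow> b1 \<bullet> z = 0 \<longrightarrow> t z = z"
      using even_label_orthogonal[OF rho lab(3) sR lab(4) lab(7,8,1)] by auto
    have tRD: "t \<in> RD" using t by (simp add: orthogonal_reflections_def)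
    have "mirror X s \<subseteq> mirror X t"
    proof
      fix z assume "z \<in> mirror X s"
      then have z: "z \<in> X" "z \<in> E" "\<rho> z = z" "s z = z" by (auto simp: mirror_def)
      then have "a \<bullet> z = 0" "b1 \<bullet> z = 0" using rootD(6)[OF lab(3)] rootD(6)[OF lab(4)] by auto
      then show "z \<in> mirror X t" using t(4) z by (auto simp: mirror_def)
    qed
    then have "mirror X s = mirror X t" using AX.mirror_subset_eq[OF sRX] tRD RD_RX by blast
    then show False using no[OF tRD] Xs by simp
  qed
  let ?c = "cos (pi / real m)"
  obtain \<tau> q where \<tau>: "\<tau> \<in> R" "q > 0" "q * (2 - 2 * ?c) = 1" "\<And>z. z \<in> E \<Longrightarrow> \<tau> z = z - (q * ((a + b1) \<bullet> z)) *\<^sub>R (u + v1)"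
    using odd_label_swap[OF rho lab(3) sR lab(4) lab(7,8,1) odd] by blast
  have au: "a \<bullet> u = 2" "b1 \<bullet> v1 = 2" using rootD(2) lab by auto
  have at: "a \<bullet> \<tau> y = - (b1 \<bullet> y)" "b1 \<bullet> \<tau> y = - (a \<bullet> y)" if y: "y \<in> E" for y
  proof -
    have "a \<bullet> (u + v1) = 2 - 2 * ?c" "b1 \<bullet> (u + v1) = 2 - 2 * ?c" using au lab(7,8) by (auto simp: inner_add_right)
    then have "a \<bullet> \<tau> y = a \<bullet> y - (q * (2 - 2 * ?c)) * ((a + b1) \<bullet> y)" "b1 \<bullet> \<tau> y = b1 \<bullet> y - (q * (2 - 2 * ?c)) * ((a + b1) \<bullet> y)"
      unfolding \<tau>(4)[OF y] by (simp_all add: inner_diff_right)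
    then show "a \<bullet> \<tau> y = - (b1 \<bullet> y)" "b1 \<bullet> \<tau> y = - (a \<bullet> y)" unfolding \<tau>(3) by (simp_all add: inner_add_left)
  qed
  have \<tau>E: "\<tau> y \<in> E" if "y \<in> E" for y using R_E[OF \<tau>(1) that] .
  have \<tau>X: "\<tau> ` G' \<subseteq> X"
  proof
    fix y assume "y \<in> \<tau> ` G'"
    then obtain y' where y': "y' \<in> G'" "y = \<tau> y'" by blast
    then have y'E: "y' \<in> E" "s y' = y'" by (auto simp: G'_def mirror_def)
    then have "b1 \<bullet> y' = 0" using rootD(6)[OF lab(4)] by blast
    then have "a \<bullet> y = 0" using at(1)[OF y'E(1)] y' by simp
    then show "y \<in> X" using rootD(6)[OF lab(3) \<tau>E[OF y'E(1)]] y' \<tau>E[OF y'E(1)] by (auto simp: mirror_def)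
  qed
  have \<tau>I: "\<forall>y\<in>I. \<tau> y = y"
  proof
    fix y assume y: "y \<in> I"
    have "y \<in> X" using y unfolding I_def cell_def by blast
    then have yE: "y \<in> E" "\<rho> y = y" using XE X_fix by blast+
    have "y \<in> mirror E s" using y IG unfolding G'_def by blast
    then have "s y = y" by (simp add: mirror_def)
    note yE = yE this
    then have "a \<bullet> y = 0" "b1 \<bullet> y = 0" using rootD(6)[OF lab(3)] rootD(6)[OF lab(4)] by auto
    then show "\<tau> y = y" using \<tau>(4)[OF yE(1)] by (simp add: inner_add_left)
  qed
  have gE: "g \<in> E" "g \<in> U" using tw(6) UE by (auto simp: cell_def)
  have negs: "b1 \<bullet> \<tau> g < 0" using at(2)[OF gE(1)] tw(4) by simp
  have notF: "\<tau> ` G' \<noteq> F1"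
  proof
    assume "\<tau> ` G' = F1"
    then have "\<tau> g \<in> cell U R x" using gG F1(2) by blast
    then have "side s x (\<tau> g) \<ge> 0" using sR by (simp add: cell_def)
    then have "b1 \<bullet> \<tau> g \<ge> 0" unfolding root_sign[OF lab(4) E(1) \<tau>E[OF gE(1)]] pos_mult_sign(3)[OF lab(6)] .
    then show False using negs by simp
  qed
  have new: "(\<tau> ` C1, \<tau> ` G') \<in> rolled"
    by (rule rolling.step[OF mem If G'f ne IG lab(2)[folded C1] odd R_G[OF \<tau>(1)] \<tau>I \<tau>X notF])
  obtain x' f' where ok': "rolled_ok (\<tau> ` C1, \<tau> ` G') x' f'" using rolled_ok[OF new] by blast
  have tile': "\<tau> ` G' = tile f'" "f' \<in> U \<inter> X" "\<forall>s\<in>RX. s f' \<noteq> f'" using ok' by (auto simp: rolled_ok_def)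
  have "w \<in> I" using b(2,3) wX by (auto simp: I_def mirror_def)
  then have "w \<in> tile f'" using IG \<tau>I tile'(1) by (metis image_eqI subsetD)
  moreover have "side b f f' < 0"
  proof -
    have f'E: "f' \<in> E" using tile' XE by blast
    have tgE: "\<tau> g \<in> E" "\<tau> g \<in> tile f'" using \<tau>E[OF gE(1)] gG tile'(1) by auto
    have "side s f' (\<tau> g) \<ge> 0" using tgE(2) sRX by (simp add: cell_def)
    moreover have "s (\<tau> g) \<noteq> \<tau> g" using rootD(6)[OF lab(4) tgE(1)] negs by auto
    ultimately have "side s f' (\<tau> g) > 0" using tile'(3) sRX by (intro side_pos sR f'E tgE) auto
    then have "(b1 \<bullet> f') * (b1 \<bullet> \<tau> g) > 0" unfolding root_sign[OF lab(4) f'E tgE(1)] .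
    then have "b1 \<bullet> f' < 0" using negs by (auto simp: zero_less_mult_iff)
    then have "(b1 \<bullet> f) * (b1 \<bullet> f') < 0" using tw(2) by (simp add: mult_pos_neg)
    then have "side s f f' < 0" using root_sign(1)[OF lab(4) E(3) f'E] by linarith
    then show ?thesis using AX.side_neg_same_mirror[OF sRX b(1) Xs] f(2) tile'(2) by blast
  qed
  ultimately show ?thesis using new ok' by blast
qed

text \<open>
  To reach the facet of \<open>h\<close>, proceed by induction on the number of mirrors
  separating it from the current facet of \<open>f\<close>. Some wall \<open>b\<close> of the
  current facet separates them. No mirror orthogonal to \<open>X\<close> does, so
  \<open>cross_wall\<close> applies to \<open>b\<close>, and after this step \<open>b\<close>
  does not separate any more, while no mirror has been added.
\<close>

theorem rolled_facets_eq:
  "rolled_facets E G X (cell U R x0) F0 = tile ` {f\<in>U \<inter> X. (\<forall>s\<in>RX. s f \<noteq> f) \<and> (\<forall>t\<in>RD. side t f0 f > 0)}"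
proof (intro equalityI subsetI)
  fix F assume "F \<in> rolled_facets E G X (cell U R x0) F0"
  then obtain C where "(C, F) \<in> rolled" by (auto simp: rolled_facets_def)
  then obtain x f where "rolled_ok (C, F) x f" using rolled_ok by blast
  then show "F \<in> tile ` {f\<in>U \<inter> X. (\<forall>s\<in>RX. s f \<noteq> f) \<and> (\<forall>t\<in>RD. side t f0 f > 0)}" by (auto simp: rolled_ok_def)
next
  fix F assume "F \<in> tile ` {f\<in>U \<inter> X. (\<forall>s\<in>RX. s f \<noteq> f) \<and> (\<forall>t\<in>RD. side t f0 f > 0)}"
  then obtain h where h: "h \<in> U \<inter> X" "\<forall>s\<in>RX. s h \<noteq> h" "\<forall>t\<in>RD. side t f0 h > 0" "F = tile h" by auto
  have hE: "h \<in> E" using h XE by blast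
  have "\<exists>C. (C, tile h) \<in> rolled" if "CF \<in> rolled" "rolled_ok CF x f" for CF x f
    using that
  proof (induction "card {s\<in>RX. side s f h < 0}" arbitrary: CF x f rule: less_induct)
    case less
    have f: "f \<in> U \<inter> X" "\<forall>s\<in>RX. s f \<noteq> f" "\<forall>t\<in>RD. side t f0 f > 0" and CF: "snd CF = tile f"
      using less.prems(2) by (auto simp: rolled_ok_def)
    have fE: "f \<in> E" using f XE by blast
    have fin: "finite {s\<in>RX. side s f h < 0}" using AX.finite_separating f h by blast
    show ?case
    proof (cases "\<exists>s\<in>RX. side s f h < 0")
      case False
      have "\<forall>s\<in>RX. side s f h > 0"
      proof
        fix s assume s: "s \<in> RX"
        then have "side s f h \<ge> 0" using False by (auto simp: not_less)
        then show "side s f h > 0" using s f h by (intro AX.side_pos) auto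
      qed
      then have "tile f = tile h" using AX.cell_cong[of f h] f h by blast
      then show ?thesis using less.prems(1) CF by (metis prod.collapse)
    next
      case True
      then obtain b w where b: "wall_at X (U \<inter> X) RX f b w" "side b f h < 0" using AX.separating_wall[OF f(1,2) h(1)] by blast
      have bRX: "b \<in> RX" and bR: "b \<in> R" using b by (auto dest: wall_atD)
      have no: "mirror X t \<noteq> mirror X b" if t: "t \<in> RD" for t
      proof
        assume eq: "mirror X t = mirror X b"
        have tR: "t \<in> R" using t RD_RX by blast
        have "side t f h > 0" using side_trans[OF tR fE _ hE, of f0] f(3) h(3) t f0(1) XE by (auto simp: side_commute)
        moreover have "side t f h < 0"
          using AX.side_neg_same_mirror[OF bRX _ eq[symmetric] _ _ b(2)] t RD_RX f(1) h(1) by blast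
        ultimately show False by simp
      qed
      obtain C1 F1 where CF1: "CF = (C1, F1)" by (cases CF)
      obtain CF' x' f' where new: "CF' \<in> rolled" "rolled_ok CF' x' f'" "w \<in> tile f'" "side b f f' < 0"
        using cross_wall[OF less.prems[unfolded CF1] b(1) no] by blast
      have f': "f' \<in> U \<inter> X" "\<forall>s\<in>RX. s f' \<noteq> f'" using new by (auto simp: rolled_ok_def)
      have sub: "{s\<in>RX. side s f' h < 0} \<subset> {s\<in>RX. side s f h < 0}"
      proof
        show "{s\<in>RX. side s f' h < 0} \<subseteq> {s\<in>RX. side s f h < 0}"
        proof
          fix s assume s: "s \<in> {s\<in>RX. side s f' h < 0}"
          have wt: "w \<in> tile f" "w \<in> U \<inter> X" using b(1) by (auto simp: wall_at_def cell_def)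
          show "s \<in> {s\<in>RX. side s f h < 0}"
          proof (cases "s w = w")
            case False
            then have "side s f w > 0" "side s w f' > 0"
              using s f f' wt new(3) by (auto intro!: AX.side_pos simp: cell_def side_commute)
            then have "side s f f' > 0" using AX.side_trans[of s f w f'] s f f' wt by auto
            then show ?thesis using AX.side_trans_less[of s f f' h] s f f' h by auto
          next
            case True
            then have eq: "mirror X s = mirror X b" using b(1) s unfolding wall_at_def by blast
            have "side b f' h > 0" using AX.side_neg_pos[OF bRX, of f f' h] new(4) b(2) f f' h by auto
            moreover have "side b f' h < 0"
              using AX.side_neg_same_mirror[OF _ bRX eq, of f' h] s f'(1) h(1) by blast
            ultimately show ?thesis by simp
          qed
        qed
        have "side b f' h > 0" using AX.side_neg_pos[OF bRX, of f f' h] new(4) b(2) f f' h by auto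
        then have "b \<notin> {s\<in>RX. side s f' h < 0}" by simp
        moreover have "b \<in> {s\<in>RX. side s f h < 0}" using b(2) bRX by simp
        ultimately show "{s\<in>RX. side s f' h < 0} \<noteq> {s\<in>RX. side s f h < 0}" by blast
      qed
      then show ?thesis using less.hyps[OF psubset_card_mono[OF fin sub] new(1,2)] by blast
    qed
  qed
  moreover obtain x f where "rolled_ok (cell U R x0, F0) x f" using rolled_ok_start by blast
  moreover have "(cell U R x0, F0) \<in> rolled" by (rule rolling.start)
  ultimately obtain C where "(C, tile h) \<in> rolled" by blast
  then show "F \<in> rolled_facets E G X (cell U R x0) F0" using h(4) by (force simp: rolled_facets_def)
qed

text \<open>
  Every point on the closed side of \<open>f0\<close> is a limit of regular points on the open
  side, so it lies in one of the facets of \<open>rolled_facets_eq\<close>.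
\<close>

lemma Union_rolled_facets:
  "\<Union>(rolled_facets E G X (cell U R x0) F0) = cell (U \<inter> X) RD f0"
proof (intro equalityI subsetI)
  fix y assume "y \<in> \<Union>(rolled_facets E G X (cell U R x0) F0)"
  then obtain f where f: "f \<in> U \<inter> X" "\<forall>s\<in>RX. s f \<noteq> f" "\<forall>t\<in>RD. side t f0 f > 0" "y \<in> tile f"
    unfolding rolled_facets_eq by auto
  have "side t f0 y \<ge> 0" if t: "t \<in> RD" for t
  proof -
    have "t \<in> RX" using t RD_RX by blast
    moreover have "side t f y \<ge> 0" using f(4) \<open>t \<in> RX\<close> by (simp add: cell_def)
    moreover have "y \<in> X" using f(4) by (simp add: cell_def)
    ultimately show ?thesis using AX.side_trans_ge[of t f0 f y] f t f0(1) by auto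
  qed
  then show "y \<in> cell (U \<inter> X) RD f0" using f(4) by (auto simp: cell_def)
next
  fix y assume y: "y \<in> cell (U \<inter> X) RD f0"
  then have yU: "y \<in> U \<inter> X" by (simp add: cell_def)
  obtain w where w: "w \<in> U \<inter> X" "\<forall>r\<in>RX. r w \<noteq> w" "y \<in> tile w" "\<And>r. r \<in> RX \<Longrightarrow> side r f0 y \<ge> 0 \<Longrightarrow> side r f0 w > 0"
    using AX.regular_nearby[OF f0(1,2) yU] by blast
  then have "\<forall>t\<in>RD. side t f0 w > 0" using y RD_RX by (auto simp: cell_def)
  then show "y \<in> \<Union>(rolled_facets E G X (cell U R x0) F0)"
    unfolding rolled_facets_eq using w(1-3) by blast
qed

end

section \<open>The normal space of a stratum\<close>

lemma (in arrangement) cell_eq_of_mem: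
  assumes x: "x \<in> U" "\<forall>r\<in>R. r x \<noteq> x" and y: "y \<in> cell U R x" "\<forall>r\<in>R. r y \<noteq> y"
  shows "cell U R x = cell U R y"
proof (rule cell_cong)
  show "x \<in> E" "y \<in> E" using x y UE by (auto simp: cell_def)
  then show "\<forall>r\<in>R. side r x y > 0" using x y side_pos by (auto simp: cell_def)
qed

lemma cell_restrict:
  assumes "V \<subseteq> N" "x \<in> N" shows "cell V ((\<lambda>r. restrict r N) ` R') x = cell V R' x"
  using assms by (auto simp: cell_def side_def subset_iff)

text \<open>
  Here the group acts on the whole space, the chamber is that of \<open>x0\<close>, and
  \<open>p\<close> is an interior point of its stratum \<open>H\<close>.
\<close>

locale stratum_setup = rolling_setup UNIV U \<Gamma> \<rho> x0 F0 f0
  for U :: "'a::euclidean_space set" and \<Gamma> :: "('a \<Rightarrow> 'a) set" and \<rho> :: "'a \<Rightarrow> 'a" and x0 :: 'a and F0 :: "'a set" and f0 :: 'a +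
  fixes H :: "'a set" and p :: 'a
  assumes H_face: "H face_of cell U (reflections UNIV \<Gamma>) x0" and H_F0: "H \<subseteq> F0" and p_H: "p \<in> rel_interior H"
begin

abbreviation "C \<equiv> cell U R x0"
text \<open>
  The space is the direct sum of the span \<open>L\<close> of the stratum, on which the group
  \<open>A\<close> of the stratum is trivial, and the span \<open>N\<close> of the normals of
  the mirrors through \<open>p\<close>.
\<close>

definition "Rp = {r\<in>R. r p = p}"
definition "A = stratum_group UNIV \<Gamma> C H"
definition "N = span {v. \<exists>r\<in>Rp. r v = - v}"
definition "L = {z. \<forall>r\<in>Rp. r z = z}"

lemma p_mem: "p \<in> H" "p \<in> C" "p \<in> F0" "p \<in> U" "p \<in> X" "\<rho> \<in> Rp" and H_C: "H \<subseteq> C"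
proof -
  show "p \<in> H" using p_H rel_interior_subset by blast
  show "H \<subseteq> C" using H_face face_of_imp_subset by blast
  show "p \<in> C" "p \<in> F0" using \<open>p \<in> H\<close> \<open>H \<subseteq> C\<close> H_F0 by auto
  then show "p \<in> U" "p \<in> X" using F0(2) by (auto simp: cell_def)
  then show "\<rho> \<in> Rp" using rho by (simp add: Rp_def mirror_def)
qed

lemma RpR: "r \<in> Rp \<Longrightarrow> r \<in> R" "r \<in> Rp \<Longrightarrow> r p = p" by (auto simp: Rp_def)

lemma finite_Rp: "finite Rp" unfolding Rp_def using finite_fixing p_mem(4) by blast

text \<open>
  The mirror supports the chamber and contains an interior point of its face \<open>H\<close>.
\<close>

lemma H_fixed: assumes s: "s \<in> Rp" and h: "h \<in> H" shows "s h = h"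
proof -
  have "C \<inter> mirror UNIV s face_of C" using cell_Int_mirror_face[OF x0 RpR(1)[OF s]] .
  moreover have "(C \<inter> mirror UNIV s) \<inter> rel_interior H \<noteq> {}"
    using p_H p_mem(2) RpR(2)[OF s] by (auto simp: mirror_def)
  ultimately have "H \<subseteq> C \<inter> mirror UNIV s" using subset_of_face_of[OF _ H_C] by blast
  then show ?thesis using h by (auto simp: mirror_def)
qed

lemma lin: "\<gamma> \<in> \<Gamma> \<Longrightarrow> linear \<gamma>"
  using G_lin[of \<gamma>] by (metis UNIV_I ext)

lemma subspace_L: "subspace L"
proof -
  have "L = (\<Inter>r\<in>Rp. mirror UNIV r)" by (auto simp: L_def mirror_def)
  then show ?thesis using subspace_mirror RpR(1) by (auto intro!: subspace_Inter)
qed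

lemma subspace_N: "subspace N" by (simp add: N_def)

text \<open>
  From \<open>p\<close> one can move within \<open>C\<close> in the direction of a vector of
  \<open>L\<close> as well as in the opposite direction. As \<open>H\<close> is a face, both
  moves stay in \<open>H\<close>.
\<close>

lemma span_H: "span H = L"
proof
  show "span H \<subseteq> L" using H_fixed subspace_L by (intro span_minimal) (auto simp: L_def)
  show "L \<subseteq> span H"
  proof
    fix l assume l: "l \<in> L"
    have inC: "\<exists>d>0. \<forall>t. 0 \<le> t \<and> t < d \<longrightarrow> p + t *\<^sub>R l' \<in> C" if l': "l' \<in> L" for l'
    proof -
      have "l' \<in> cell UNIV {r\<in>R. r p = p} x0" using l' by (auto simp: cell_def L_def Rp_def side_def)
      then have "l' \<in> normal_cone_at UNIV p C" using normal_cone_cell[OF x0 p_mem(2), of UNIV] by simp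
      then show ?thesis by (auto simp: normal_cone_at_def)
    qed
    obtain d where d: "d > 0" "\<And>t. 0 \<le> t \<Longrightarrow> t < d \<Longrightarrow> p + t *\<^sub>R l \<in> C" using inC[OF l] by blast
    obtain d' where d': "d' > 0" "\<And>t. 0 \<le> t \<Longrightarrow> t < d' \<Longrightarrow> p + t *\<^sub>R (- l) \<in> C"
      using inC[of "- l"] l subspace_L by (auto simp: subspace_neg)
    define t where "t = min d d' / 2"
    have t: "0 < t" "t < d" "t < d'" using d d' by (auto simp: t_def)
    show "l \<in> span H"
    proof (cases "l = 0")
      case False
      have a: "p + t *\<^sub>R l \<in> C" "p - t *\<^sub>R l \<in> C" using d(2)[of t] d'(2)[of t] t by auto
      have "p \<in> open_segment (p + t *\<^sub>R l) (p - t *\<^sub>R l)"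
        unfolding in_segment using False t by (intro conjI exI[of _ "1/2"]) (auto simp: algebra_simps simp flip: scaleR_add_left)
      then have "p + t *\<^sub>R l \<in> H" using H_face a p_mem(1) unfolding face_of_def by blast
      then have "(1/t) *\<^sub>R ((p + t *\<^sub>R l) - p) \<in> span H" using p_mem(1) by (intro span_scale span_diff span_base)
      then show ?thesis using t by simp
    qed (simp add: span_zero)
  qed
qed

text \<open>
  By \<open>reflections_in_stratum_group\<close> the group of the stratum contains all
  reflections fixing \<open>p\<close>, not only those in the walls.
\<close>

lemma Rp_A: "Rp \<subseteq> A"
proof
  fix r assume r: "r \<in> Rp"
  have "\<And>s h. s \<in> R \<Longrightarrow> s p = p \<Longrightarrow> h \<in> H \<Longrightarrow> s h = h" using H_fixed unfolding Rp_def by blast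
  then show "r \<in> A" unfolding A_def
    by (rule reflections_in_stratum_group[OF x0 p_mem(2) H_C _ RpR(1)[OF r] RpR(2)[OF r]])
qed

lemma A_generate: "\<exists>S. S \<subseteq> Rp \<and> A = generate (BijGroup UNIV) S"
proof -
  have "{r \<in> R. \<exists>W. W facet_of C \<and> H \<subseteq> W \<and> W \<subseteq> mirror UNIV r} \<subseteq> Rp"
    using p_mem(1) by (auto simp: Rp_def mirror_def)
  then show ?thesis unfolding A_def stratum_group_def by blast
qed

lemma Rp_carrier: "Rp \<subseteq> carrier (BijGroup UNIV)" using R_Bij RpR(1) by blast

lemma A_eq_generate: "A = generate (BijGroup UNIV) Rp"
proof
  interpret B: group "BijGroup (UNIV::'a set)" by (rule group_BijGroup)
  obtain S where S: "S \<subseteq> Rp" "A = generate (BijGroup UNIV) S" using A_generate by blast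
  show "A \<subseteq> generate (BijGroup UNIV) Rp" using S B.mono_generate by blast
  have "subgroup A (BijGroup UNIV)" unfolding S(2) using S(1) Rp_carrier by (intro B.generate_is_subgroup) blast
  then show "generate (BijGroup UNIV) Rp \<subseteq> A" using B.generate_subgroup_incl[OF Rp_A] by blast
qed

lemma A_subgroup: "subgroup A (BijGroup UNIV)"
  unfolding A_eq_generate by (rule group.generate_is_subgroup[OF group_BijGroup Rp_carrier])

lemma A_prop:
  assumes "\<gamma> \<in> A" shows "\<gamma> \<in> \<Gamma>" "\<gamma> p = p" "z \<in> L \<Longrightarrow> \<gamma> z = z" "z - \<gamma> z \<in> N"
proof -
  have "\<gamma> \<in> \<Gamma> \<and> \<gamma> p = p \<and> (\<forall>z\<in>L. \<gamma> z = z) \<and> (\<forall>z. z - \<gamma> z \<in> N)"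
    using assms unfolding A_eq_generate
  proof (induction rule: generate_involutions_induct)
    case one
    then show ?case using G_id subspace_0[OF subspace_N] by (simp add: restrict_def)
  next
    case (gen r)
    obtain a u where rt: "root_pair UNIV r a u" using R_root RpR(1) gen by blast
    have "u \<in> N" unfolding N_def by (rule span_base) (use rootD(5)[OF rt] gen in blast)
    then have "z - r z \<in> N" for z using rootD(3)[OF rt, of z] subspace_N by (simp add: subspace_scale)
    then show ?case using gen RpR R_G by (auto simp: L_def)
  next
    case (comp f h)
    have "z - f (h z) \<in> N" for z
    proof -
      have "(z - h z) + (h z - f (h z)) \<in> N" using comp.IH subspace_N by (intro subspace_add) auto
      then show ?thesis by simp
    qed
    then show ?case using comp.IH G_comp[of f h] by (simp add: compose_def restrict_def)
  qed (use Rp_carrier R_invol RpR in auto)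
  then show "\<gamma> \<in> \<Gamma>" "\<gamma> p = p" "z \<in> L \<Longrightarrow> \<gamma> z = z" "z - \<gamma> z \<in> N" by auto
qed

lemmas A_comp = subgroup_BijGroup(4)[OF A_subgroup]

lemma finite_A: "finite A"
  by (rule finite_subset[OF _ G_fin[OF p_mem(4)]]) (use A_prop in blast)

lemmas id_A = subgroup_BijGroup(1)[OF A_subgroup]

lemma reflections_A: "reflections UNIV A = Rp"
  using A_prop(1,2) Rp_A RpR(1) by (auto simp: reflections_def Rp_def)

text \<open>
  The projection \<open>pr\<close> to \<open>N\<close> along \<open>L\<close> is obtained by
  averaging over \<open>A\<close>.
\<close>

definition avg :: "'a \<Rightarrow> 'a" where "avg z = (1 / real (card A)) *\<^sub>R (\<Sum>\<gamma>\<in>A. \<gamma> z)"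
definition pr :: "'a \<Rightarrow> 'a" where "pr z = z - avg z"

lemma card_A: "card A > 0" using finite_A id_A by (auto simp: card_gt_0_iff)

lemma avg_linear: "linear avg"
  unfolding avg_def using lin A_prop(1) by (intro linear_compose_scale_right linear_compose_sum) blast

text \<open>Composition with \<open>r\<close> permutes \<open>A\<close>.\<close>

lemma avg_in_L: "avg z \<in> L"
  unfolding L_def
proof clarify
  fix r assume r: "r \<in> Rp"
  have rl: "linear r" using lin R_G RpR(1) r by blast
  have inj: "inj_on (compose UNIV r) A"
  proof (rule inj_onI)
    fix g h assume eq: "compose UNIV r g = compose UNIV r h"
    show "g = h"
    proof
      fix z
      have "r (g z) = r (h z)" using fun_cong[OF eq, of z] by (simp add: compose_def)
      then show "g z = h z"
        using R_invol[OF RpR(1)[OF r] UNIV_I, of "g z"] R_invol[OF RpR(1)[OF r] UNIV_I, of "h z"] by metis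
    qed
  qed
  have im: "compose UNIV r ` A \<subseteq> A" using A_comp r Rp_A by blast
  have eq: "compose UNIV r ` A = A" using endo_inj_surj[OF finite_A im inj] .
  have "(\<Sum>\<gamma>\<in>A. \<gamma> z) = (\<Sum>\<gamma>\<in>compose UNIV r ` A. \<gamma> z)" unfolding eq ..
  also have "\<dots> = (\<Sum>\<gamma>\<in>A. r (\<gamma> z))" by (subst sum.reindex[OF inj]) (simp add: compose_def)
  also have "\<dots> = r (\<Sum>\<gamma>\<in>A. \<gamma> z)" using linear_sum[OF rl] by metis
  finally show "r (avg z) = avg z" by (simp add: avg_def linear_scale[OF rl])
qed

lemma pr_N: "pr z \<in> N"
proof -
  have "pr z = (1 / real (card A)) *\<^sub>R (\<Sum>\<gamma>\<in>A. z - \<gamma> z)"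
    using card_A by (simp add: pr_def avg_def sum_subtractf sum_constant_scaleR scaleR_diff_right)
  moreover have "(\<Sum>\<gamma>\<in>A. z - \<gamma> z) \<in> N" using A_prop(4) subspace_N by (intro subspace_sum) auto
  ultimately show ?thesis using subspace_N by (simp add: subspace_scale)
qed

lemma pr_L: "z - pr z \<in> L" using avg_in_L by (simp add: pr_def)

text \<open>
  If \<open>r v = - v\<close>, the averages over the orbits of \<open>v\<close> and \<open>-
  v\<close> coincide, and so they vanish.
\<close>

lemma avg_N: assumes "z \<in> N" shows "avg z = 0"
proof -
  have "avg v = 0" if v: "r \<in> Rp" "r v = - v" for r v
  proof -
    have inj: "inj_on (\<lambda>\<gamma>. compose UNIV \<gamma> r) A"
    proof (rule inj_onI)
      fix g h assume eq: "compose UNIV g r = compose UNIV h r"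
      have "g (r (r z)) = h (r (r z))" for z using fun_cong[OF eq, of "r z"] by (simp add: compose_def)
      then show "g = h" using R_invol[OF RpR(1)[OF v(1)]] by auto
    qed
    have im: "(\<lambda>\<gamma>. compose UNIV \<gamma> r) ` A \<subseteq> A" using A_comp v(1) Rp_A by blast
    have eq: "(\<lambda>\<gamma>. compose UNIV \<gamma> r) ` A = A" using endo_inj_surj[OF finite_A im inj] .
    have "(\<Sum>\<gamma>\<in>A. \<gamma> v) = (\<Sum>\<gamma>\<in>(\<lambda>\<gamma>. compose UNIV \<gamma> r) ` A. \<gamma> v)" unfolding eq ..
    also have "\<dots> = (\<Sum>\<gamma>\<in>A. \<gamma> (- v))" by (subst sum.reindex[OF inj]) (simp add: compose_def v(2))
    finally have "avg v = avg (- v)" by (simp add: avg_def)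
    then have "avg v = - avg v" using linear_neg[OF avg_linear] by simp
    then have "2 *\<^sub>R avg v = 0" by (metis add.right_inverse scaleR_2)
    then show ?thesis by simp
  qed
  then have "N \<subseteq> {z. avg z = 0}" unfolding N_def
    by (intro span_minimal) (auto intro: linear_subspace_kernel[OF avg_linear])
  then show ?thesis using assms by blast
qed

lemma pr_id: "z \<in> N \<Longrightarrow> pr z = z" using avg_N by (simp add: pr_def)

lemma A_N: "\<gamma> \<in> A \<Longrightarrow> z \<in> N \<Longrightarrow> \<gamma> z \<in> N"
  using A_prop(4)[of \<gamma> z] subspace_diff[OF subspace_N, of z "z - \<gamma> z"] by simp

lemma displacement_pr: assumes r: "r \<in> Rp" shows "pr z - r (pr z) = z - r z"
proof -
  have rl: "linear r" using lin R_G RpR(1) r by blast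
  have "r (z - pr z) = z - pr z" using pr_L r by (auto simp: L_def)
  then have "r z - r (pr z) = z - pr z" using linear_diff[OF rl] by simp
  then show ?thesis by (simp add: algebra_simps)
qed

lemma side_pr: "r \<in> Rp \<Longrightarrow> side r (pr z) y = side r z y" "r \<in> Rp \<Longrightarrow> side r y (pr z) = side r y z"
  by (simp_all add: side_def displacement_pr)

lemma fix_pr: "r \<in> Rp \<Longrightarrow> r (pr z) = pr z \<longleftrightarrow> r z = z"
  using displacement_pr[of r z] by (metis eq_iff_diff_eq_0)

text \<open>The finite reflection group of the stratum, acting on the normal space.\<close>

definition "G = (\<lambda>\<gamma>. restrict \<gamma> N) ` A"

lemma root_restrict:
  assumes r: "r \<in> Rp" and rt: "root_pair UNIV r a u" shows "root_pair N (restrict r N) a u" "u \<in> N"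
proof -
  show u: "u \<in> N" unfolding N_def by (rule span_base) (use rootD(5)[OF rt] r in blast)
  show "root_pair N (restrict r N) a u" using rt u by (simp add: root_pair_def)
qed

lemma restrict_eq_iff: assumes "\<gamma> \<in> A" "\<delta> \<in> A" shows "restrict \<gamma> N = restrict \<delta> N \<longleftrightarrow> \<gamma> = \<delta>"
proof
  assume eq: "restrict \<gamma> N = restrict \<delta> N"
  show "\<gamma> = \<delta>"
  proof
    fix z
    have 1: "\<gamma> (pr z) = \<delta> (pr z)" using fun_cong[OF eq, of "pr z"] pr_N by simp
    have 2: "\<gamma> (z - pr z) = \<delta> (z - pr z)" using A_prop(3) pr_L assms by metis
    have "\<gamma> (pr z + (z - pr z)) = \<delta> (pr z + (z - pr z))"
      using linear_add[OF lin[OF A_prop(1)[OF assms(1)]]] linear_add[OF lin[OF A_prop(1)[OF assms(2)]]] 1 2 by metis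
    then show "\<gamma> z = \<delta> z" by simp
  qed
qed simp

text \<open>
  A reflection of \<open>N\<close> that is induced by an element \<open>\<gamma>\<close> of
  \<open>A\<close> comes from a reflection, because \<open>\<gamma>\<close> is trivial on
  \<open>L\<close>; its coroot is pulled back along \<open>pr\<close>.
\<close>

lemma reflections_G: "reflections N G = (\<lambda>r. restrict r N) ` Rp"
proof (intro equalityI subsetI)
  fix r assume "r \<in> (\<lambda>r. restrict r N) ` Rp"
  then obtain s where s: "s \<in> Rp" "r = restrict s N" by blast
  obtain a u where rt: "root_pair UNIV s a u" using R_root RpR(1) s by blast
  have "is_reflection N r" unfolding s(2) using root_reflection[OF subspace_N _ root_restrict(1)[OF s(1) rt]] by simp
  then show "r \<in> reflections N G" using s Rp_A by (auto simp: reflections_def G_def)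
next
  fix r assume r: "r \<in> reflections N G"
  then obtain \<gamma> where \<gamma>: "\<gamma> \<in> A" "r = restrict \<gamma> N" by (auto simp: reflections_def G_def)
  have "is_reflection N r" using r by (simp add: reflections_def)
  then obtain a u where rt: "root_pair N r a u" using reflection_root[OF subspace_N] by blast
  note ru = rootD[OF rt]
  have pl: "linear pr" unfolding pr_def using avg_linear by (intro linear_compose_sub linear_ident) 
  have "root_pair UNIV \<gamma> (adjoint pr a) u"
    unfolding root_pair_def
  proof (intro conjI ballI)
    have ad: "adjoint pr a \<bullet> z = a \<bullet> pr z" for z using adjoint_works[OF pl, of z a] by (simp add: inner_commute)
    show "u \<in> UNIV" by simp
    show "adjoint pr a \<bullet> u = 2" using ad pr_id[OF ru(1)] ru(2) by simp
    fix z
    have "\<gamma> (pr z) = pr z - (a \<bullet> pr z) *\<^sub>R u" using ru(3)[OF pr_N] \<gamma>(2) pr_N by simp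
    moreover have "\<gamma> (z - pr z) = z - pr z" using A_prop(3)[OF \<gamma>(1)] pr_L by blast
    moreover have "\<gamma> z = \<gamma> (pr z) + \<gamma> (z - pr z)" using linear_add[OF lin[OF A_prop(1)[OF \<gamma>(1)]], of "pr z" "z - pr z"] by simp
    ultimately show "\<gamma> z = z - (adjoint pr a \<bullet> z) *\<^sub>R u" by (simp add: ad)
  qed
  then have "\<gamma> \<in> R" using R_I A_prop(1) \<gamma>(1) by blast
  then have "\<gamma> \<in> Rp" using A_prop(2) \<gamma>(1) by (simp add: Rp_def)
  then show "r \<in> (\<lambda>r. restrict r N) ` Rp" using \<gamma>(2) by blast
qed

lemma G_generate: "G = generate (BijGroup N) (reflections N G)" and G_sub: "subgroup G (BijGroup N)"
proof -
  note gr = generate_restrict[of N UNIV Rp]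
  have c: "\<And>s. s \<in> Rp \<Longrightarrow> s \<in> carrier (BijGroup UNIV)" "\<And>s z. s \<in> Rp \<Longrightarrow> s (s z) = z" "\<And>s z. s \<in> Rp \<Longrightarrow> z \<in> N \<Longrightarrow> s z \<in> N"
    using Rp_carrier R_invol RpR(1) A_N Rp_A by blast+
  show eq: "G = generate (BijGroup N) (reflections N G)"
    unfolding reflections_G unfolding G_def A_eq_generate by (rule gr(1)) (use c in auto)
  show "subgroup G (BijGroup N)"
    by (subst eq, unfold reflections_G, rule gr(2)) (use c in auto)
qed

lemma finite_G: "finite G" using finite_A by (simp add: G_def)

sublocale NA: refl_action N N G
proof (rule refl_action.intro)
  show "subspace N" using subspace_N .
  then show "convex N" by (rule subspace_imp_convex)
  show "openin (top_of_set N) N" by simp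
  show "N \<noteq> {}" using subspace_0[OF subspace_N] by blast
  show "subgroup G (BijGroup N)" using G_sub .
  show "finite {\<gamma> \<in> G. \<gamma> x = x}" for x using finite_G by simp
  show "\<exists>V. open V \<and> x \<in> V \<and> finite {r \<in> reflections N G. \<exists>y\<in>V \<inter> N. r y = y}" for x
    using finite_Rp unfolding reflections_G by (intro exI[of _ UNIV]) auto
  fix \<gamma> assume "\<gamma> \<in> G"
  then obtain g where g: "g \<in> A" "\<gamma> = restrict g N" by (auto simp: G_def)
  show "\<exists>f. linear f \<and> (\<forall>x\<in>N. \<gamma> x = f x)" using g lin A_prop(1) by (intro exI[of _ g]) auto
  show "\<gamma> x \<in> N" if "x \<in> N" for x using that g A_N by simp
qed

end

section \<open>The normal cone of the rolled domain\<close>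

text \<open>
  If \<open>u\<close> and \<open>w\<close> are orthogonal, invariance of the form makes each
  of the two coroots vanish on the root of the other reflection, and then the reflections
  commute. Conversely, if they commute, \<open>s\<close> fixes \<open>u\<close> and negates
  \<open>w\<close>, while it preserves \<open>\<beta> u w\<close>. The form is not assumed
  definite, and it lives on a subspace \<open>V\<close> only, in order to include the Lorentz
  form and the metric of Euclidean space.
\<close>

lemma (in refl_action) form_orthogonal_iff:
  assumes V: "subspace V" "V \<subseteq> E"
    and sym: "\<And>x y. x \<in> V \<Longrightarrow> y \<in> V \<Longrightarrow> \<beta> x y = \<beta> y x"
    and add: "\<And>x y z. x \<in> V \<Longrightarrow> y \<in> V \<Longrightarrow> z \<in> V \<Longrightarrow> \<beta> (x + y) z = \<beta> x z + \<beta> y z"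
    and scale: "\<And>c x y. x \<in> V \<Longrightarrow> y \<in> V \<Longrightarrow> \<beta> (c *\<^sub>R x) y = c * \<beta> x y"
    and r: "r \<in> R" "root_pair E r a u" "u \<in> V" "\<And>x y. x \<in> V \<Longrightarrow> y \<in> V \<Longrightarrow> \<beta> (r x) (r y) = \<beta> x y" "\<beta> u u \<noteq> 0"
    and s: "s \<in> R" "root_pair E s k w" "w \<in> V" "\<And>x y. x \<in> V \<Longrightarrow> y \<in> V \<Longrightarrow> \<beta> (s x) (s y) = \<beta> x y" "\<beta> w w \<noteq> 0"
  shows "\<beta> u w = 0 \<longleftrightarrow> s \<noteq> r \<and> (\<forall>z\<in>E. s (r z) = r (s z))"
proof -
  note ru = rootD[OF r(2)] and sw = rootD[OF s(2)]
  have key: "k' \<bullet> u' = 0" if h: "root_pair E q k' w'" "w' \<in> V" "u' \<in> V" "\<beta> u' w' = 0" "\<beta> w' w' \<noteq> 0"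
    and q: "\<And>x y. x \<in> V \<Longrightarrow> y \<in> V \<Longrightarrow> \<beta> (q x) (q y) = \<beta> x y" for q k' w' u'
  proof -
    note qw = rootD[OF h(1)]
    have m: "- w' \<in> V" "- (k' \<bullet> u') *\<^sub>R w' \<in> V" using h(2) V(1) by (auto simp: subspace_neg subspace_scale)
    have "0 = \<beta> (q u') (q w')" using q[OF h(3,2)] h(4) by simp
    also have "q u' = u' + (- (k' \<bullet> u')) *\<^sub>R w'" using qw(3)[of u'] h(3) V(2) by auto
    also have "q w' = - w'" by (rule qw(5))
    also have "\<beta> (u' + - (k' \<bullet> u') *\<^sub>R w') (- w') = \<beta> u' (- w') + \<beta> (- (k' \<bullet> u') *\<^sub>R w') (- w')"
      using h(3) m by (intro add)
    also have "\<beta> u' (- w') = - \<beta> u' w'" using sym[OF h(3) m(1)] scale[OF h(2,3), of "-1"] sym[OF h(3,2)] by simp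
    also have "\<beta> (- (k' \<bullet> u') *\<^sub>R w') (- w') = - (k' \<bullet> u') * \<beta> w' (- w')" using h(2) m by (intro scale)
    also have "\<beta> w' (- w') = - \<beta> w' w'" using sym[OF h(2) m(1)] scale[OF h(2,2), of "-1"] by simp
    finally show ?thesis using h(4,5) by simp
  qed
  show ?thesis
  proof
    assume o: "\<beta> u w = 0"
    have ku: "k \<bullet> u = 0" using key[OF s(2,3) r(3) o s(5,4)] .
    have aw: "a \<bullet> w = 0" using key[OF r(2,3) s(3) _ r(5,4)] o sym[OF r(3) s(3)] by simp
    have "s \<noteq> r"
    proof
      assume "s = r"
      then have "r u = u" using sw(6)[OF ru(1)] ku by blast
      then show False using ru(2) ru(6)[OF ru(1)] by simp
    qed
    moreover have "s (r z) = r (s z)" if z: "z \<in> E" for z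
    proof -
      have 1: "s (r z) = r z - (k \<bullet> r z) *\<^sub>R w" using sw(3) R_E[OF r(1) z] by blast
      have "k \<bullet> r z = k \<bullet> z" using ku ru(3)[OF z] by (simp add: inner_diff_right)
      then have 1: "s (r z) = z - (a \<bullet> z) *\<^sub>R u - (k \<bullet> z) *\<^sub>R w" using 1 ru(3)[OF z] by simp
      have 2: "r (s z) = s z - (a \<bullet> s z) *\<^sub>R u" using ru(3) R_E[OF s(1) z] by blast
      have "a \<bullet> s z = a \<bullet> z" using aw sw(3)[OF z] by (simp add: inner_diff_right)
      then have 2: "r (s z) = z - (k \<bullet> z) *\<^sub>R w - (a \<bullet> z) *\<^sub>R u" using 2 sw(3)[OF z] by simp
      show ?thesis unfolding 1 2 by simp
    qed
    ultimately show "s \<noteq> r \<and> (\<forall>z\<in>E. s (r z) = r (s z))" by blast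
  next
    assume c: "s \<noteq> r \<and> (\<forall>z\<in>E. s (r z) = r (s z))"
    have "k \<bullet> u = 0" using commuting_roots(1)[OF r(1,2) s(1,2)] c by blast
    then have "s u = u" using sw(6)[OF ru(1)] by blast
    then have "\<beta> u w = \<beta> u (- w)" using s(4)[OF r(3) s(3)] sw(5) by simp
    also have "\<dots> = - \<beta> u w"
      using sym[OF r(3), of "- w"] scale[OF s(3) r(3), of "-1"] sym[OF r(3) s(3)] s(3) V(1) by (simp add: subspace_neg)
    finally show "\<beta> u w = 0" by simp
  qed
qed

context stratum_setup begin

text \<open>
  These are the counterparts at \<open>p\<close> of the mirror \<open>X\<close>, of the
  arrangements \<open>RX\<close> and \<open>RD\<close> on it, and of the reflection
  \<open>\<rho>\<close>, the chamber point \<open>x0\<close> and the facet point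
  \<open>f0\<close>.
\<close>

definition "Q = N \<inter> X"
definition "RQ = Rp - {\<rho>}"
definition "RDp = {t\<in>RD. t p = p}"
definition "\<rho>N = restrict \<rho> N"
definition "xN = pr x0"
definition "fN = pr f0"

lemma RDp_sub: "RDp \<subseteq> RQ" "RQ \<subseteq> Rp" "RDp \<subseteq> RD" "RQ \<subseteq> RX"
  using RD_RX by (auto simp: RDp_def RQ_def Rp_def)

lemma Q_eq: "Q = mirror N \<rho>N" by (auto simp: Q_def mirror_def \<rho>N_def)

lemma subspace_Q: "subspace Q" unfolding Q_def using subspace_N subspace_mirror[OF rho] by (rule subspace_inter)

lemma Q_sub: "Q \<subseteq> N" "Q \<subseteq> X" by (auto simp: Q_def)

lemma restrict_Rp_eq: "s \<in> Rp \<Longrightarrow> t \<in> Rp \<Longrightarrow> restrict s N = restrict t N \<longleftrightarrow> s = t"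
  using restrict_eq_iff Rp_A by blast

lemma reflections_G_minus: "reflections N G - {\<rho>N} = (\<lambda>r. restrict r N) ` RQ"
  unfolding reflections_G \<rho>N_def RQ_def using restrict_Rp_eq p_mem(6) by (auto simp: image_iff)

text \<open>
  Elements of \<open>A\<close> are trivial on \<open>L\<close>, so they commute if they
  commute on \<open>N\<close>.
\<close>

lemma orthogonal_reflections_G: "orthogonal_reflections N G \<rho>N = (\<lambda>r. restrict r N) ` RDp"
proof -
  have comm: "(\<forall>z\<in>N. restrict s N (restrict \<rho> N z) = restrict \<rho> N (restrict s N z)) \<longleftrightarrow> (\<forall>z. s (\<rho> z) = \<rho> (s z))" if s: "s \<in> Rp" for s
  proof -
    have sA: "s \<in> A" "\<rho> \<in> A" using s p_mem(6) Rp_A by auto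
    note sl = lin[OF A_prop(1)[OF sA(1)]] lin[OF A_prop(1)[OF sA(2)]]
    have N: "\<And>z. z \<in> N \<Longrightarrow> s z \<in> N" "\<And>z. z \<in> N \<Longrightarrow> \<rho> z \<in> N" using A_N sA by auto
    have "(\<forall>z\<in>N. restrict s N (restrict \<rho> N z) = restrict \<rho> N (restrict s N z)) \<longleftrightarrow> (\<forall>z\<in>N. s (\<rho> z) = \<rho> (s z))" using N by simp
    also have "\<dots> \<longleftrightarrow> (\<forall>z. s (\<rho> z) = \<rho> (s z))"
    proof
      assume c: "\<forall>z\<in>N. s (\<rho> z) = \<rho> (s z)"
      show "\<forall>z. s (\<rho> z) = \<rho> (s z)"
      proof
        fix z
        have l: "s (z - pr z) = z - pr z" "\<rho> (z - pr z) = z - pr z" using A_prop(3) sA pr_L by auto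
        have s1: "s z = s (pr z) + s (z - pr z)" and r1: "\<rho> z = \<rho> (pr z) + \<rho> (z - pr z)"
          using linear_add[OF sl(1), of "pr z" "z - pr z"] linear_add[OF sl(2), of "pr z" "z - pr z"] by simp_all
        have "s (\<rho> z) = s (\<rho> (pr z)) + s (\<rho> (z - pr z))" unfolding r1 by (rule linear_add[OF sl(1)])
        also have "\<dots> = \<rho> (s (pr z)) + \<rho> (s (z - pr z))" using c pr_N l by simp
        also have "\<dots> = \<rho> (s z)" unfolding s1 by (rule linear_add[OF sl(2), symmetric])
        finally show "s (\<rho> z) = \<rho> (s z)" .
      qed
    qed blast
    finally show ?thesis .
  qed
  have RDp: "s \<in> RDp \<longleftrightarrow> s \<in> Rp \<and> s \<noteq> \<rho> \<and> (\<forall>z. s (\<rho> z) = \<rho> (s z))" for s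
    by (auto simp: RDp_def Rp_def orthogonal_reflections_def)
  have mem: "restrict s N \<in> orthogonal_reflections N G \<rho>N \<longleftrightarrow> s \<in> RDp" if s: "s \<in> Rp" for s
  proof -
    have "restrict s N \<in> reflections N G" unfolding reflections_G using s by blast
    then show ?thesis
      unfolding orthogonal_reflections_def \<rho>N_def mem_Collect_eq comm[OF s] restrict_Rp_eq[OF s p_mem(6)] RDp using s by blast
  qed
  have "orthogonal_reflections N G \<rho>N \<subseteq> (\<lambda>r. restrict r N) ` Rp"
    unfolding reflections_G[symmetric] orthogonal_reflections_def by blast
  moreover have "RDp \<subseteq> Rp" using RDp by blast
  ultimately show ?thesis using mem by blast
qed

lemma f0_C: "f0 \<in> C" "F0 = C \<inter> X"
proof -
  obtain f where "F0 = C \<inter> X" using facet_in_mirror[OF x0 rho F0] by blast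
  then show "F0 = C \<inter> X" .
  then show "f0 \<in> C" using AX.mem_cell_self[OF f0(1)] f0(3) by blast
qed

lemma fN_Q: "fN \<in> Q"
proof -
  have "\<rho> fN = fN" unfolding fN_def fix_pr[OF p_mem(6)] using f0(1) X_fix by blast
  then show ?thesis using pr_N by (auto simp: Q_def fN_def mirror_def)
qed

lemma xN_N: "xN \<in> N" using pr_N by (simp add: xN_def)

lemma xN_regular: "\<forall>r\<in>reflections N G. r xN \<noteq> xN"
  unfolding reflections_G using x0(2) RpR(1) xN_N fix_pr by (auto simp: xN_def)

lemma fN_regular: "\<forall>s\<in>RQ. s fN \<noteq> fN"
  using f0(2) RDp_sub fix_pr unfolding fN_def by blast

lemma local_chamber: "normal_cone_at N p C = cell N (reflections N G) xN"
proof -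
  have "normal_cone_at N p C = cell N Rp x0" using normal_cone_cell[OF x0 p_mem(2), of N] by (simp add: Rp_def)
  also have "\<dots> = cell N Rp xN" unfolding cell_def xN_def by (auto simp: side_pr)
  finally show ?thesis unfolding reflections_G using cell_restrict[of N N xN Rp] xN_N by simp
qed

lemma local_wall_rho: "wall_at N N (reflections N G) xN \<rho>N fN"
  unfolding wall_at_def
proof (intro conjI ballI impI)
  show "\<rho>N \<in> reflections N G" unfolding reflections_G \<rho>N_def using p_mem(6) by blast
  have f: "fN \<in> N" "fN \<in> X" using fN_Q Q_sub by auto
  have "side s xN fN \<ge> 0" if "s \<in> Rp" for s
    unfolding xN_def fN_def side_pr[OF that] using f0_C that RpR by (simp add: cell_def)
  then have "fN \<in> cell N Rp xN" using f by (simp add: cell_def)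
  then show "fN \<in> cell N (reflections N G) xN" unfolding reflections_G using cell_restrict[of N N xN Rp] xN_N by simp
  show "\<rho>N fN = fN" using f X_fix by (simp add: \<rho>N_def)
  fix s assume s: "s \<in> reflections N G" "s fN = fN"
  then obtain t where t: "t \<in> Rp" "s = restrict t N" unfolding reflections_G by blast
  then have "t fN = fN" using s f by simp
  then have "t = \<rho>" using fN_regular t by (auto simp: RQ_def)
  then show "mirror N s = mirror N \<rho>N" using t by (simp add: \<rho>N_def)
qed

text \<open>The facet in which the rolling in the normal space starts.\<close>

definition "FN = cell N (reflections N G) xN \<inter> mirror N \<rho>N"

text \<open>The results about rolling now apply to the finite group as well.\<close>

lemma rolling_setup_N: "rolling_setup N N G \<rho>N xN FN fN"
proof (unfold_locales)
  show rho': "\<rho>N \<in> reflections N G" unfolding reflections_G \<rho>N_def using p_mem(6) by blast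
  show "xN \<in> N" using xN_N .
  show reg: "\<forall>r\<in>reflections N G. r xN \<noteq> xN" using xN_regular .
  show facet: "FN facet_of cell N (reflections N G) xN" unfolding FN_def using NA.wall_facet(1)[OF xN_N reg local_wall_rho] .
  show sub: "FN \<subseteq> mirror N \<rho>N" by (auto simp: FN_def)
  show fNm: "fN \<in> N \<inter> mirror N \<rho>N" using fN_Q Q_eq Q_sub by auto
  show fNr: "\<forall>s\<in>reflections N G - {\<rho>N}. s fN \<noteq> fN"
    unfolding reflections_G_minus using fN_regular fNm by auto
  interpret AN: arrangement "mirror N \<rho>N" "N \<inter> mirror N \<rho>N" "reflections N G - {\<rho>N}"
    using NA.arrangement_on_mirror[OF rho'] by blast
  obtain f where f: "f \<in> N \<inter> mirror N \<rho>N" "\<forall>s\<in>reflections N G - {\<rho>N}. s f \<noteq> f"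
    "FN = cell (N \<inter> mirror N \<rho>N) (reflections N G - {\<rho>N}) f"
    using NA.facet_in_mirror[OF xN_N reg rho' facet sub] by metis
  have "fN \<in> FN" using wall_atD(2)[OF local_wall_rho] fNm by (auto simp: FN_def)
  then show "FN = cell (N \<inter> mirror N \<rho>N) (reflections N G - {\<rho>N}) fN"
    using AN.cell_eq_of_mem[OF f(1,2)] f(3) fNr by simp
qed

sublocale NS: rolling_setup N N G \<rho>N xN FN fN using rolling_setup_N .

lemma N_Int_mirror: "mirror N \<rho>N = Q" "N \<inter> Q = Q" using Q_eq Q_sub by auto

lemma local_tiles:
  "rolled_facets N G Q (normal_cone_at N p C) FN = cell Q RQ ` {f\<in>Q. (\<forall>s\<in>RQ. s f \<noteq> f) \<and> (\<forall>t\<in>RDp. side t fN f > 0)}"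
proof -
  have "rolled_facets N G Q (normal_cone_at N p C) FN = cell Q (reflections N G - {\<rho>N}) `
      {f\<in>Q. (\<forall>s\<in>reflections N G - {\<rho>N}. s f \<noteq> f) \<and> (\<forall>t\<in>orthogonal_reflections N G \<rho>N. side t fN f > 0)}"
    using NS.rolled_facets_eq unfolding N_Int_mirror local_chamber .
  also have "{f\<in>Q. (\<forall>s\<in>reflections N G - {\<rho>N}. s f \<noteq> f) \<and> (\<forall>t\<in>orthogonal_reflections N G \<rho>N. side t fN f > 0)} =
     {f\<in>Q. (\<forall>s\<in>RQ. s f \<noteq> f) \<and> (\<forall>t\<in>RDp. side t fN f > 0)}"
    unfolding reflections_G_minus orthogonal_reflections_G using Q_sub(1) fN_Q by (auto simp: side_def subset_iff)
  also have "cell Q (reflections N G - {\<rho>N}) ` {f\<in>Q. (\<forall>s\<in>RQ. s f \<noteq> f) \<and> (\<forall>t\<in>RDp. side t fN f > 0)} =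
     cell Q RQ ` {f\<in>Q. (\<forall>s\<in>RQ. s f \<noteq> f) \<and> (\<forall>t\<in>RDp. side t fN f > 0)}"
    unfolding reflections_G_minus by (rule image_cong[OF refl], rule cell_restrict) (use Q_sub in auto)
  finally show ?thesis .
qed

lemma local_domain: "\<Union>(rolled_facets N G Q (normal_cone_at N p C) FN) = cell Q RDp fN"
proof -
  have "\<Union>(rolled_facets N G Q (normal_cone_at N p C) FN) = cell Q (orthogonal_reflections N G \<rho>N) fN"
    using NS.Union_rolled_facets unfolding N_Int_mirror local_chamber .
  then show ?thesis unfolding orthogonal_reflections_G using cell_restrict[of Q N fN RDp] Q_sub fN_Q by auto
qed

abbreviation "\<T> \<equiv> rolled_facets UNIV \<Gamma> X C F0"
abbreviation "B \<equiv> cell (U \<inter> X) RD f0"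

lemma Union_T: "\<Union>\<T> = B" using Union_rolled_facets .

sublocale AD: arrangement X "U \<inter> X" RD using arrangement_on_mirror[OF rho] RD_RX by blast

lemma f0_RD: "\<forall>r\<in>RD. r f0 \<noteq> f0" using f0(2) RD_RX by blast

lemma F0_B: "F0 \<subseteq> B"
  using f0(3) RD_RX by (auto simp: cell_def)

lemma side_fN: "t \<in> Rp \<Longrightarrow> side t fN y = side t f0 y" by (simp add: fN_def side_pr)

text \<open>
  By \<open>Union_rolled_facets\<close> the domain \<open>B\<close> is a cell of the
  arrangement \<open>RD\<close> on \<open>X\<close>.
\<close>

lemma normal_cone_B: "normal_cone_at Q p B = cell Q RDp fN"
proof -
  have "normal_cone_at Q p B = cell Q {r\<in>RD. r p = p} f0"
    using AD.normal_cone_cell[OF f0(1) f0_RD, of p Q] F0_B p_mem(3) Q_sub by blast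
  moreover have "\<forall>r\<in>RDp. \<forall>y. side r fN y = side r f0 y" using side_fN RDp_sub by blast
  then have "cell Q RDp f0 = cell Q RDp fN" by (simp add: cell_def)
  ultimately show ?thesis by (simp add: RDp_def)
qed

section \<open>The subdivision of the normal cone\<close>

abbreviation "Es \<equiv> {e. (\<exists>F'\<in>\<T>. e facet_of F') \<and> H \<subseteq> e}"

sublocale AQ: arrangement Q Q RQ
proof (rule local_arrangement)
  show "subspace Q" using subspace_Q .
  then show "convex Q" by (rule subspace_imp_convex)
  show "openin (top_of_set Q) Q" by simp
  show "RQ \<subseteq> R" using RDp_sub(2) RpR by blast
  show "finite RQ \<or> Q \<subseteq> U" using finite_Rp by (simp add: RQ_def)
  show "\<exists>x\<in>Q. r x \<noteq> x" if "r \<in> RQ" for r using fN_Q fN_regular that by blast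
qed simp

lemma hyperedge_span:
  assumes e: "e \<in> Es" shows "\<exists>b\<in>RQ. span e = mirror X b"
proof -
  obtain f where f: "f \<in> U \<inter> X" "\<forall>s\<in>RX. s f \<noteq> f" "e facet_of tile f" using e unfolding rolled_facets_eq by auto
  obtain b w where b: "wall_at X (U \<inter> X) RX f b w" "e = tile f \<inter> mirror X b" "span e = mirror X b" "w \<in> e"
    using facet_of_tile[OF f] .
  have "p \<in> mirror X b" using e p_mem(1) b(2) by blast
  then have "b \<in> RQ" using wall_atD(1)[OF b(1)] by (auto simp: RQ_def Rp_def mirror_def)
  then show ?thesis using b by blast
qed

text \<open>
  Moving from \<open>p\<close> a little in the directions of \<open>f\<close> and
  \<open>w\<close> gives a point \<open>g\<close> of a facet of the tiling and a point
  \<open>y\<close> on a wall of that facet. This wall contains \<open>H\<close>, because all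
  mirrors through \<open>p\<close> do.
\<close>

lemma local_wall_hyperedge:
  assumes f: "f \<in> Q" "\<forall>s\<in>RQ. s f \<noteq> f" "\<forall>t\<in>RDp. side t fN f > 0" and b: "wall_at Q Q RQ f b w"
  shows "\<exists>e\<in>Es. span e = mirror X b"
proof -
  have fX: "f \<in> X" "f \<in> N" using f Q_sub by auto
  have w: "w \<in> Q" "w \<in> X" "b w = w" "b \<in> RQ" "w \<in> cell Q RQ f" using wall_atD[OF b] Q_sub by auto
  have pUX: "p \<in> U \<inter> X" using p_mem by auto
  obtain d where d: "d > 0" "\<And>t. 0 \<le> t \<Longrightarrow> t < d \<Longrightarrow> p + t *\<^sub>R f \<in> U \<inter> X \<and> (\<forall>s\<in>RX. s p \<noteq> p \<longrightarrow> side s p (p + t *\<^sub>R f) > 0)"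
    using AX.ray_nbhd[OF pUX fX(1)] by blast
  obtain d' where d': "d' > 0" "\<And>t. 0 \<le> t \<Longrightarrow> t < d' \<Longrightarrow> p + t *\<^sub>R w \<in> U \<inter> X \<and> (\<forall>s\<in>RX. s p \<noteq> p \<longrightarrow> side s p (p + t *\<^sub>R w) > 0)"
    using AX.ray_nbhd[OF pUX w(2)] by blast
  define t where "t = d / 2"
  define t' where "t' = d' / 2"
  have t: "0 < t" "t < d" "0 < t'" "t' < d'" using d d' by (auto simp: t_def t'_def)
  define g where "g = p + t *\<^sub>R f"
  define y where "y = p + t' *\<^sub>R w"
  have g: "g \<in> U \<inter> X" "\<And>s. s \<in> RX \<Longrightarrow> s p \<noteq> p \<Longrightarrow> side s p g > 0" using d(2)[of t] t by (auto simp: g_def)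
  have y: "y \<in> U \<inter> X" "\<And>s. s \<in> RX \<Longrightarrow> s p \<noteq> p \<Longrightarrow> side s p y > 0" using d'(2)[of t'] t by (auto simp: y_def)
  have RXp: "s \<in> RQ" if "s \<in> RX" "s p = p" for s using that by (auto simp: RQ_def Rp_def)
  have pX: "p \<in> X" using p_mem by blast
  have loc: "side s z g = t * side s z f" "side s z y = t' * side s z w" "s g = g \<longleftrightarrow> s f = f" "s y = y \<longleftrightarrow> s w = w"
    if "s \<in> RX" "s p = p" "z \<in> X" for s z
    unfolding g_def y_def
    using AX.side_local[OF that(1) pX fX(1) that(3,2)] AX.side_local[OF that(1) pX w(2) that(3,2)]
      AX.fix_local[OF that(1) pX fX(1) that(2)] AX.fix_local[OF that(1) pX w(2) that(2)] t by auto
  have g_reg: "\<forall>s\<in>RX. s g \<noteq> g"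
  proof
    fix s assume s: "s \<in> RX"
    show "s g \<noteq> g"
    proof (cases "s p = p")
      case True then show ?thesis using loc(3)[OF s True pX] f(2) RXp[OF s True] by blast
    next
      case False then show ?thesis using g(2)[OF s False] by (auto simp: side_def)
    qed
  qed
  have fp: "side s f0 p > 0" if "s \<in> RX" "s p \<noteq> p" for s
    using that f0(1,2) p_mem(3) f0(3) pX by (intro AX.side_pos) (auto simp: cell_def)
  have g_RD: "\<forall>s\<in>RD. side s f0 g > 0"
  proof
    fix s assume s: "s \<in> RD"
    then have sRX: "s \<in> RX" using RD_RX by blast
    show "side s f0 g > 0"
    proof (cases "s p = p")
      case True
      then have sp: "s \<in> RDp" using s by (simp add: RDp_def)
      have "side s fN f > 0" using f(3) sp by blast
      then have "side s f0 f > 0" using side_fN[of s f] sp RDp_sub by auto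
      then show ?thesis using loc(1)[OF sRX True, of f0] f0(1) t by simp
    next
      case False
      then show ?thesis using AX.side_trans[OF sRX, of f0 p g] fp[OF sRX False] g(2)[OF sRX False] f0(1) pX g(1) by blast
    qed
  qed
  have wall: "wall_at X (U \<inter> X) RX g b y"
    unfolding wall_at_def
  proof (intro conjI ballI impI)
    show bRX: "b \<in> RX" using w(4) RDp_sub by blast
    have bp: "b p = p" using w(4) by (auto simp: RQ_def Rp_def)
    show "b y = y" using loc(4)[OF bRX bp pX] w(3) by blast
    have "side s g y \<ge> 0" if s: "s \<in> RX" for s
    proof (cases "s p = p")
      case True
      have "side s f w \<ge> 0" using w(5) RXp[OF s True] by (simp add: cell_def)
      moreover have "side s g y = t' * (t * side s w f)" using loc(2)[OF s True, of g] loc(1)[OF s True w(2)] g(1) by (simp add: side_commute)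
      ultimately show ?thesis using t by (simp add: side_commute)
    next
      case False
      have "side s g p > 0" using g(2)[OF s False] by (simp add: side_commute)
      then show ?thesis using AX.side_trans[OF s, of g p y] g(1) y(1) pX y(2)[OF s False] by (meson IntD2 less_imp_le)
    qed
    then show "y \<in> cell (U \<inter> X) RX g" using y(1) by (simp add: cell_def)
    fix s assume s: "s \<in> RX" "s y = y"
    have sp: "s p = p"
    proof (rule ccontr)
      assume "s p \<noteq> p"
      then have "side s p y > 0" using y(2) s by blast
      then show False using s by (simp add: side_def)
    qed
    then have sw: "s w = w" using loc(4)[OF s(1) sp pX] s(2) by blast
    have sQ: "s \<in> RQ" using RXp s sp by blast
    have eqQ: "mirror Q s = mirror Q b" using wall_atD(4)[OF b sQ sw] .
    have prQ: "pr z \<in> Q" if "z \<in> X" for z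
      using that pr_N fix_pr[OF p_mem(6)] by (auto simp: Q_def mirror_def)
    have "q z = z \<longleftrightarrow> pr z \<in> mirror Q q" if "z \<in> X" "q \<in> RQ" for q z
      using fix_pr[of q z] that RDp_sub prQ by (auto simp: mirror_def)
    then have "s z = z \<longleftrightarrow> b z = z" if "z \<in> X" for z using that sQ w(4) eqQ by simp
    then show "mirror X s = mirror X b" by (auto simp: mirror_def)
  qed
  let ?e = "tile g \<inter> mirror X b"
  have "tile g \<in> \<T>" unfolding rolled_facets_eq using g(1) g_reg g_RD by blast
  moreover have "?e facet_of tile g" "span ?e = mirror X b"
    using AX.wall_facet[OF g(1) g_reg wall] by auto
  moreover have "H \<subseteq> ?e"
  proof
    fix h assume h: "h \<in> H"
    have hF: "h \<in> F0" "h \<in> U \<inter> X" using H_F0 f0(3) h by (auto simp: cell_def)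
    have "side s g h \<ge> 0" if s: "s \<in> RX" for s
    proof (cases "s p = p")
      case True
      then have "s h = h" using H_fixed[OF _ h] s by (simp add: Rp_def)
      then show ?thesis by (simp add: side_def)
    next
      case False
      have "side s f0 h \<ge> 0" using hF(1) f0(3) s by (auto simp: cell_def)
      then have "side s p h \<ge> 0" using AX.side_trans_ge[OF s, of p f0 h] fp[OF s False] pX f0(1) hF(2) by (auto simp: side_commute)
      moreover have "side s g p > 0" using g(2)[OF s False] by (simp add: side_commute)
      ultimately show ?thesis using AX.side_trans_ge[OF s, of g p h] g(1) pX hF(2) by blast
    qed
    moreover have "b h = h" using H_fixed[OF _ h] w(4) RDp_sub by blast
    ultimately show "h \<in> ?e" using hF(2) by (auto simp: cell_def mirror_def)
  qed
  ultimately show ?thesis by blast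
qed

text \<open>
  Let a point \<open>v\<close> of the cone lie on a mirror of \<open>RQ\<close>. It belongs to
  a cell within the cone, and then a wall of this cell contains \<open>v\<close>; this wall is
  spanned by a hyperedge through \<open>H\<close> by \<open>local_wall_hyperedge\<close>.
\<close>

lemma complement_of_hyperedges:
  "cell Q RDp fN - (\<Union>e\<in>Es. span e) = {v \<in> open_cell Q RDp fN. \<forall>a\<in>RQ. a v \<noteq> v}"
proof (intro equalityI subsetI)
  fix v assume v: "v \<in> {v \<in> open_cell Q RDp fN. \<forall>a\<in>RQ. a v \<noteq> v}"
  then have "v \<in> cell Q RDp fN" by (auto simp: cell_def open_cell_def less_imp_le)
  moreover have "v \<notin> span e" if "e \<in> Es" for e
    using hyperedge_span[OF that] v by (auto simp: mirror_def)
  ultimately show "v \<in> cell Q RDp fN - (\<Union>e\<in>Es. span e)" by blast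
next
  fix v assume v: "v \<in> cell Q RDp fN - (\<Union>e\<in>Es. span e)"
  then have vQ: "v \<in> Q" by (simp add: cell_def)
  have reg: "\<forall>a\<in>RQ. a v \<noteq> v"
  proof (rule ccontr)
    assume "\<not> ?thesis"
    then obtain a where a: "a \<in> RQ" "a v = v" by blast
    obtain f where f: "f \<in> Q" "\<forall>r\<in>RQ. r f \<noteq> f" "v \<in> cell Q RQ f" "\<And>r. r \<in> RQ \<Longrightarrow> side r fN v \<ge> 0 \<Longrightarrow> side r fN f > 0"
      using AQ.regular_nearby[OF fN_Q fN_regular vQ] by blast
    note f_reg = f(2) and vf = f(3)
    have f_RD: "\<forall>t\<in>RDp. side t fN f > 0" using f(4) v RDp_sub by (auto simp: cell_def)
    have mf: "- f \<in> Q" using f(1) subspace_Q by (simp add: subspace_neg)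
    \<comment> \<open>The mirror of \<open>a\<close> separates \<open>f\<close> from \<open>- f\<close>, so
      \<open>local_wall\<close> provides a wall through \<open>v\<close>.\<close>
    have "side a f ((-1) *\<^sub>R f + 0 *\<^sub>R f) = - 1 * side a f f + 0 * side a f f" by (rule AQ.side_convex[OF a(1) f(1) f(1) f(1)])
    then have "side a f (- f) < 0" using AQ.side_self[OF a(1) f(1)] f_reg a(1) by simp
    then obtain b w where b: "wall_at Q Q RQ f b w" "b v = v"
      using AQ.local_wall[OF f(1) f_reg vf mf a] by blast
    obtain e where e: "e \<in> Es" "span e = mirror X b" using local_wall_hyperedge[OF f(1) f_reg f_RD b(1)] by blast
    have "v \<in> span e" unfolding e(2) using vQ Q_sub b(2) by (auto simp: mirror_def)
    then show False using v e(1) by blast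
  qed
  moreover have "v \<in> open_cell Q RDp fN"
  proof -
    have "side t fN v > 0" if t: "t \<in> RDp" for t
    proof -
      have tQ: "t \<in> RQ" using t RDp_sub by blast
      have "side t fN v \<ge> 0" using v t by (simp add: cell_def)
      then show ?thesis using AQ.side_pos[OF tQ fN_Q vQ] fN_regular reg tQ by blast
    qed
    then show ?thesis using vQ by (simp add: open_cell_def)
  qed
  ultimately show "v \<in> {v \<in> open_cell Q RDp fN. \<forall>a\<in>RQ. a v \<noteq> v}" by blast
qed

text \<open>
  By \<open>complement_of_hyperedges\<close> the pieces are the components of the complement
  of the mirrors of \<open>RQ\<close> in the open cone.
\<close>

lemma subdivision_eq_tiles:
  "subdivision (cell Q RDp fN) Es = cell Q RQ ` {f\<in>Q. (\<forall>s\<in>RQ. s f \<noteq> f) \<and> (\<forall>t\<in>RDp. side t fN f > 0)}"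
proof -
  let ?V = "open_cell Q RDp fN"
  interpret ADp: arrangement Q Q RDp
  proof (rule AQ.local_arrangement)
    show "subspace Q" "convex Q" using subspace_Q subspace_imp_convex by auto
    show "\<exists>x\<in>Q. r x \<noteq> x" if "r \<in> RDp" for r using fN_Q fN_regular that RDp_sub by blast
  qed (use RDp_sub in auto)
  have conv: "convex ?V" using ADp.open_cell_convex[OF fN_Q] .
  have fin2: "finite RQ" using finite_Rp by (simp add: RQ_def)
  have fin: "finite RDp" by (rule finite_subset[OF RDp_sub(1) fin2])
  have Veq: "?V = Q \<inter> (\<Inter>t\<in>RDp. {v. (conormal Q t \<bullet> fN) * (conormal Q t \<bullet> v) > 0})"
    using ADp.cn_side[OF _ fN_Q] by (auto simp: open_cell_def)
  have op: "openin (top_of_set Q) ?V"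
    unfolding Veq by (intro openin_open_Int open_INT fin ballI open_Collect_less continuous_intros)
  interpret V: arrangement Q ?V RQ
  proof (rule AQ.local_arrangement)
    show "subspace Q" using subspace_Q .
    show "\<exists>x\<in>Q. r x \<noteq> x" if "r \<in> RQ" for r using fN_Q fN_regular that by blast
  qed (use conv op fin2 in auto)
  let ?S = "{f\<in>Q. (\<forall>s\<in>RQ. s f \<noteq> f) \<and> (\<forall>t\<in>RDp. side t fN f > 0)}"
  have S: "?S = {v\<in>?V. \<forall>a\<in>RQ. a v \<noteq> v}" by (auto simp: open_cell_def)
  have "subdivision (cell Q RDp fN) Es = closure ` (open_cell ?V RQ ` ?S)"
    unfolding subdivision_def complement_of_hyperedges V.components_regular S ..
  also have "\<dots> = cell Q RQ ` ?S"
  proof -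
    have "closure (open_cell ?V RQ f) = cell Q RQ f" if f: "f \<in> ?S" for f
    proof -
      have "open_cell ?V RQ f = open_cell Q RQ f"
      proof (intro equalityI subsetI)
        fix v assume v: "v \<in> open_cell Q RQ f"
        have "side t fN v > 0" if t: "t \<in> RDp" for t
          using ADp.side_trans[OF t fN_Q, of f v] f v t RDp_sub by (auto simp: open_cell_def)
        then show "v \<in> open_cell ?V RQ f" using v by (auto simp: open_cell_def)
      qed (auto simp: open_cell_def)
      moreover have "closure (open_cell Q RQ f) \<subseteq> Q"
        by (rule closure_minimal) (use closed_subspace[OF subspace_Q] in \<open>auto simp: open_cell_def\<close>)
      ultimately show ?thesis using AQ.closure_open_cell[of f] f by auto
    qed
    then show ?thesis unfolding image_image by (rule image_cong[OF refl])
  qed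
  finally show ?thesis .
qed

text \<open>
  \<open>local_tiles\<close> and \<open>subdivision_eq_tiles\<close> describe the tiles of the
  development and the pieces of the subdivision as the same cells.
\<close>

theorem partial_development:
  "is_partial_development N G Q (normal_cone_at N p C) (normal_cone_at Q p B) (subdivision (normal_cone_at Q p B) Es)"
  unfolding is_partial_development_def
proof (intro conjI exI)
  have "chambers N N G = cell N (reflections N G) ` {x\<in>N. \<forall>r\<in>reflections N G. r x \<noteq> x}"
    unfolding chambers_def by (rule NA.chambers_are_cells)
  then show "normal_cone_at N p C \<in> chambers N N G" unfolding local_chamber using xN_N xN_regular by blast
  show "FN facet_of normal_cone_at N p C" unfolding local_chamber by (rule NS.F0(1))
  show "FN \<subseteq> Q" using NS.F0(2) unfolding N_Int_mirror .
  show "subdivision (normal_cone_at Q p B) Es = rolled_facets N G Q (normal_cone_at N p C) FN"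
    unfolding normal_cone_B subdivision_eq_tiles local_tiles ..
  then show "normal_cone_at Q p B = \<Union>(subdivision (normal_cone_at Q p B) Es)"
    using local_domain normal_cone_B by simp
qed

end

section \<open>The group of the stratum in the mirror\<close>

text \<open>
  A normal \<open>v\<close> differs from a multiple of the root by a vector \<open>y\<close>
  of the mirror that is orthogonal to itself.
\<close>

lemma normals_of_root:
  assumes E: "subspace E" and ip: "inner_product_on E \<beta>" and pr: "preserves_on E \<beta> r" and rt: "root_pair E r k w"
  shows "w \<in> normals E \<beta> (mirror E r)" "v \<in> normals E \<beta> (mirror E r) \<Longrightarrow> \<exists>c. v = c *\<^sub>R w"
proof -
  note rw = rootD[OF rt] and D = inner_product_onD[OF ip E]
  have wy: "\<beta> w y = 0" if y: "y \<in> mirror E r" for y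
  proof -
    have yE: "y \<in> E" "k \<bullet> y = 0" using y rw(6) by (auto simp: mirror_def)
    then show ?thesis using root_dual[OF E ip pr rt yE(1)] by simp
  qed
  then show "w \<in> normals E \<beta> (mirror E r)" using rw(1) by (simp add: normals_def)
  assume v: "v \<in> normals E \<beta> (mirror E r)"
  then have vE: "v \<in> E" by (simp add: normals_def)
  define y where "y = v - ((k \<bullet> v) / 2) *\<^sub>R w"
  have cw: "((k \<bullet> v) / 2) *\<^sub>R w \<in> E" using rw(1) E by (simp add: subspace_scale)
  have yE: "y \<in> E" using vE cw E by (simp add: y_def subspace_diff)
  have "k \<bullet> y = 0" using rw(2) by (simp add: y_def inner_diff_right)
  then have yM: "y \<in> mirror E r" using yE rw(6) by (simp add: mirror_def)
  have "\<beta> y y = \<beta> v y - \<beta> (((k \<bullet> v) / 2) *\<^sub>R w) y" unfolding y_def using vE cw yE[unfolded y_def] by (intro D(6))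
  also have "\<dots> = 0" using D(3)[OF rw(1) yE] wy[OF yM] v yM by (simp add: normals_def)
  finally have "y = 0" using D(8)[OF yE] by force
  then show "\<exists>c. v = c *\<^sub>R w" unfolding y_def by (metis eq_iff_diff_eq_0)
qed

context stratum_setup begin

lemma finite_reflection_group_exists: "\<exists>\<beta>. finite_reflection_group N \<beta> G"
proof -
  obtain \<beta> where \<beta>: "inner_product_on N \<beta>" "\<forall>\<gamma>\<in>G. \<gamma> 0 = 0 \<longrightarrow> preserves_on N \<beta> \<gamma>"
    using NA.invariant_inner_product[OF subspace_0[OF subspace_N]] by blast
  then have "finite_reflection_group N \<beta> G"
    unfolding finite_reflection_group_def using subspace_N finite_G G_generate NA.G_zero by blast
  then show ?thesis by blast
qed

lemma finite_reflection_groupI: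
  "inner_product_on N \<beta> \<Longrightarrow> (\<And>\<gamma>. \<gamma> \<in> A \<Longrightarrow> preserves_on N \<beta> \<gamma>) \<Longrightarrow> finite_reflection_group N \<beta> G"
  unfolding finite_reflection_group_def using subspace_N finite_G G_generate by (auto simp: G_def preserves_on_def)

text \<open>
  By \<open>form_orthogonal_iff\<close> the orthogonality in the definition of the reduction
  does not depend on \<open>\<beta>\<close>.
\<close>

lemma reduction_eq:
  assumes fr: "finite_reflection_group N \<beta> G"
  shows "reduction N \<beta> G Q = generate (BijGroup Q) ((\<lambda>s. restrict s Q) ` RDp)"
proof -
  have ip: "inner_product_on N \<beta>" and pres: "\<And>\<gamma>. \<gamma> \<in> G \<Longrightarrow> preserves_on N \<beta> \<gamma>"
    using fr by (auto simp: finite_reflection_group_def)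
  note D = inner_product_onD[OF ip subspace_N]
  have rhoN: "\<rho>N \<in> reflections N G" using NS.rho .
  obtain a u where ru: "root_pair N \<rho>N a u" using NA.R_root[OF rhoN] by blast
  have iff: "(\<forall>v\<in>normals N \<beta> (mirror N r). \<forall>w\<in>normals N \<beta> Q. \<beta> v w = 0) \<longleftrightarrow> r \<in> orthogonal_reflections N G \<rho>N"
    if r: "r \<in> reflections N G" for r
  proof -
    obtain k w where rw: "root_pair N r k w" using NA.R_root[OF r] by blast
    note U = rootD[OF ru] and W = rootD[OF rw]
    have pr: "preserves_on N \<beta> r" "preserves_on N \<beta> \<rho>N" using pres NA.R_G r rhoN by auto
    note nw = normals_of_root[OF subspace_N ip pr(1) rw] and nu = normals_of_root[OF subspace_N ip pr(2) ru, unfolded N_Int_mirror(1)]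
    have "(\<forall>v\<in>normals N \<beta> (mirror N r). \<forall>w\<in>normals N \<beta> Q. \<beta> v w = 0) \<longleftrightarrow> \<beta> u w = 0"
    proof
      assume "\<forall>v\<in>normals N \<beta> (mirror N r). \<forall>w\<in>normals N \<beta> Q. \<beta> v w = 0"
      then have "\<beta> w u = 0" using nw(1) nu(1) by blast
      then show "\<beta> u w = 0" using D(1)[OF U(1) W(1)] by simp
    next
      assume uw: "\<beta> u w = 0"
      show "\<forall>v\<in>normals N \<beta> (mirror N r). \<forall>w\<in>normals N \<beta> Q. \<beta> v w = 0"
      proof (intro ballI)
        fix v w' assume "v \<in> normals N \<beta> (mirror N r)" "w' \<in> normals N \<beta> Q"
        then obtain c d where cd: "v = c *\<^sub>R w" "w' = d *\<^sub>R u" using nw(2) nu(2) by blast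
        have "\<beta> v w' = c * (d * \<beta> w u)"
          unfolding cd D(3)[OF W(1) subspace_scale[OF subspace_N U(1)]] D(5)[OF W(1) U(1)] ..
        then show "\<beta> v w' = 0" using uw D(1)[OF U(1) W(1)] by simp
      qed
    qed
    also have "\<dots> \<longleftrightarrow> r \<noteq> \<rho>N \<and> (\<forall>z\<in>N. r (\<rho>N z) = \<rho>N (r z))"
    proof (rule NA.form_orthogonal_iff[where V=N])
      show "\<beta> u u \<noteq> 0" "\<beta> w w \<noteq> 0" using D(8)[OF U(1,4)] D(8)[OF W(1,4)] by simp_all
    qed (use subspace_N D(1-3) rhoN ru r rw U W pr in \<open>auto simp: preserves_on_def\<close>)
    finally show ?thesis using r by (simp add: orthogonal_reflections_def)
  qed
  have "{restrict r Q | r. r \<in> reflections N G \<and>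
          (\<forall>v\<in>normals N \<beta> (mirror N r). \<forall>w\<in>normals N \<beta> Q. \<beta> v w = 0)} = (\<lambda>r. restrict r Q) ` orthogonal_reflections N G \<rho>N"
  proof -
    have "{r \<in> reflections N G. \<forall>v\<in>normals N \<beta> (mirror N r). \<forall>w\<in>normals N \<beta> Q. \<beta> v w = 0} = orthogonal_reflections N G \<rho>N"
      using iff unfolding orthogonal_reflections_def by blast
    then show ?thesis by blast
  qed
  also have "\<dots> = (\<lambda>s. restrict (restrict s N) Q) ` RDp" unfolding orthogonal_reflections_G image_image ..
  also have "\<dots> = (\<lambda>s. restrict s Q) ` RDp"
    by (rule image_cong[OF refl], rule ext) (use Q_sub in \<open>auto simp: restrict_def\<close>)
  finally show ?thesis unfolding reduction_def by simp
qed

text \<open>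
  \<open>AD\<close> is the group generated by the reflections orthogonal to
  \<open>\<rho>\<close>, acting on the whole space.
\<close>

definition "\<Delta> = generate (BijGroup X) ((\<lambda>s. restrict s X) ` RD)"
definition "AD = generate (BijGroup UNIV) RD"

lemma RD_D: assumes "t \<in> RD" shows "t \<in> R" "t \<noteq> \<rho>" "t (\<rho> z) = \<rho> (t z)" "z \<in> X \<Longrightarrow> t z \<in> X" "\<rho> u = - u \<Longrightarrow> t u = u"
proof -
  show t: "t \<in> R" "t \<noteq> \<rho>" and c: "t (\<rho> z) = \<rho> (t z)" for z using assms by (auto simp: orthogonal_reflections_def)
  show "t z \<in> X" if "z \<in> X" using c[of z] X_fix[OF that] by (simp add: mirror_def)
  assume u: "\<rho> u = - u"
  obtain a v where rv: "root_pair UNIV \<rho> a v" using R_root[OF rho] by blast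
  obtain k w where rw: "root_pair UNIV t k w" using R_root[OF t(1)] by blast
  have kv: "k \<bullet> v = 0" using commuting_roots(1)[OF rho rv t(1) rw t(2)] c by blast
  have "- u = u - (a \<bullet> u) *\<^sub>R v" using rootD(3)[OF rv, of u] u by simp
  then have "(a \<bullet> u) *\<^sub>R v = 2 *\<^sub>R u" by (simp add: scaleR_2 algebra_simps)
  then have "2 * (k \<bullet> u) = 0" using kv by (metis inner_scaleR_right mult_zero_right)
  then show "t u = u" using rootD(6)[OF rw, of u] by simp
qed

lemma RD_carrier: "RD \<subseteq> carrier (BijGroup UNIV)" using R_Bij RD_D(1) by blast

lemma AD_prop:
  assumes "\<gamma> \<in> AD" shows "\<gamma> \<in> \<Gamma>" "\<gamma> (\<rho> z) = \<rho> (\<gamma> z)" "\<rho> u = - u \<Longrightarrow> \<gamma> u = u" "z \<in> X \<Longrightarrow> \<gamma> z \<in> X"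
proof -
  have "\<gamma> \<in> \<Gamma> \<and> (\<forall>z. \<gamma> (\<rho> z) = \<rho> (\<gamma> z)) \<and> (\<forall>u. \<rho> u = - u \<longrightarrow> \<gamma> u = u)"
    using assms unfolding AD_def
  proof (induction rule: generate_involutions_induct)
    case one then show ?case using G_id by (simp add: restrict_def)
  next
    case (gen t) then show ?case using RD_D R_G by blast
  next
    case (comp f h) then show ?case using G_comp[of f h] by (simp add: compose_def restrict_def)
  qed (use RD_carrier R_invol RD_D(1) in auto)
  then show "\<gamma> \<in> \<Gamma>" and c: "\<gamma> (\<rho> z) = \<rho> (\<gamma> z)" and "\<rho> u = - u \<Longrightarrow> \<gamma> u = u" for z by auto
  show "\<gamma> z \<in> X" if "z \<in> X" using c[of z] X_fix[OF that] by (simp add: mirror_def)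
qed

lemma Delta_eq: "\<Delta> = (\<lambda>\<gamma>. restrict \<gamma> X) ` AD" and Delta_subgroup: "subgroup \<Delta> (BijGroup X)"
proof -
  note gr = generate_restrict[of X UNIV RD]
  have c: "\<And>s. s \<in> RD \<Longrightarrow> s \<in> carrier (BijGroup UNIV)" "\<And>s z. s \<in> RD \<Longrightarrow> s (s z) = z"
    using RD_carrier R_invol RD_D(1) by blast+
  show "\<Delta> = (\<lambda>\<gamma>. restrict \<gamma> X) ` AD" unfolding \<Delta>_def AD_def by (rule gr(1)[symmetric]) (use c RD_D(4) in auto)
  show "subgroup \<Delta> (BijGroup X)" unfolding \<Delta>_def by (rule gr(2)) (use c RD_D(4) in auto)
qed

text \<open>
  The elements of \<open>AD\<close> fix the normal line of \<open>X\<close>. So an element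
  that induces a reflection on \<open>X\<close> is itself a reflection, and it commutes with
  \<open>\<rho>\<close>.
\<close>

lemma reflections_Delta: "reflections X \<Delta> = (\<lambda>s. restrict s X) ` RD"
proof (intro equalityI subsetI)
  obtain a u where ru: "root_pair UNIV \<rho> a u" using R_root[OF rho] by blast
  have sX: "subspace X" using subspace_mirror[OF rho] .
  have Xa: "z \<in> X \<longleftrightarrow> a \<bullet> z = 0" for z using rootD(6)[OF ru, of z] by (simp add: mirror_def)
  {
    fix r assume "r \<in> (\<lambda>s. restrict s X) ` RD"
    then obtain t where t: "t \<in> RD" "r = restrict t X" by blast
    obtain k w where rw: "root_pair UNIV t k w" using R_root RD_D(1)[OF t(1)] by blast
    have "a \<bullet> w = 0" using commuting_roots(2)[OF rho ru RD_D(1)[OF t(1)] rw RD_D(2)[OF t(1)]] RD_D(3)[OF t(1)] by blast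
    then have "root_pair X r k w" using rw Xa t(2) by (simp add: root_pair_def)
    then have "is_reflection X r" using root_reflection[OF sX] t(2) by simp
    moreover have "r \<in> \<Delta>" unfolding \<Delta>_def using t by (auto intro: generate.incl)
    ultimately show "r \<in> reflections X \<Delta>" by (simp add: reflections_def)
  }
  fix r assume r: "r \<in> reflections X \<Delta>"
  then obtain \<gamma> where \<gamma>: "\<gamma> \<in> AD" "r = restrict \<gamma> X" unfolding reflections_def Delta_eq by blast
  have "is_reflection X r" using r by (simp add: reflections_def)
  then obtain k w where rw: "root_pair X r k w" using reflection_root[OF sX] by blast
  note W = rootD[OF rw] and U = rootD[OF ru]
  have gl: "linear \<gamma>" using lin AD_prop(1) \<gamma> by blast
  have gu: "\<gamma> u = u" using AD_prop(3)[OF \<gamma>(1)] U(5) by blast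
  have "root_pair UNIV \<gamma> (k - ((k \<bullet> u) / 2) *\<^sub>R a) w"
    unfolding root_pair_def
  proof (intro conjI ballI)
    show "w \<in> UNIV" by simp
    show "(k - ((k \<bullet> u) / 2) *\<^sub>R a) \<bullet> w = 2" using W(1,2) Xa by (simp add: inner_diff_left)
    fix z
    let ?y = "z - ((a \<bullet> z) / 2) *\<^sub>R u"
    have yX: "?y \<in> X" using U(2) Xa by (simp add: inner_diff_right)
    have "\<gamma> ?y = ?y - (k \<bullet> ?y) *\<^sub>R w" using W(3)[OF yX] \<gamma>(2) yX by simp
    moreover have "\<gamma> z = \<gamma> ?y + ((a \<bullet> z) / 2) *\<^sub>R u"
      using linear_add[OF gl, of ?y "((a \<bullet> z) / 2) *\<^sub>R u"] linear_scale[OF gl] gu by simp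
    moreover have "k \<bullet> ?y = (k - ((k \<bullet> u) / 2) *\<^sub>R a) \<bullet> z" by (simp add: inner_diff_left inner_diff_right)
    ultimately show "\<gamma> z = z - ((k - ((k \<bullet> u) / 2) *\<^sub>R a) \<bullet> z) *\<^sub>R w" by simp
  qed
  then have gR: "\<gamma> \<in> R" using R_I AD_prop(1) \<gamma>(1) by blast
  have "\<gamma> \<noteq> \<rho>"
  proof
    assume "\<gamma> = \<rho>"
    then have "a \<bullet> u = 0" using gu U(6)[of u] by simp
    then show False using U(2) by simp
  qed
  then have "\<gamma> \<in> RD" using gR AD_prop(2)[OF \<gamma>(1)] by (simp add: orthogonal_reflections_def)
  then show "r \<in> (\<lambda>s. restrict s X) ` RD" using \<gamma>(2) by blast
qed

sublocale DA: refl_action X "U \<inter> X" \<Delta>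
proof (rule refl_action.intro)
  show "subspace X" using subspace_mirror[OF rho] .
  show "convex (U \<inter> X)" "openin (top_of_set X) (U \<inter> X)" using AX.convU AX.openU by auto
  show "U \<inter> X \<noteq> {}" using p_mem by blast
  show "subgroup \<Delta> (BijGroup X)" using Delta_subgroup .
  show "finite {\<delta> \<in> \<Delta>. \<delta> x = x}" if x: "x \<in> U \<inter> X" for x
  proof (rule finite_subset)
    show "{\<delta> \<in> \<Delta>. \<delta> x = x} \<subseteq> (\<lambda>\<gamma>. restrict \<gamma> X) ` {\<gamma>\<in>\<Gamma>. \<gamma> x = x}"
      unfolding Delta_eq using AD_prop(1) x by auto
    show "finite ((\<lambda>\<gamma>. restrict \<gamma> X) ` {\<gamma>\<in>\<Gamma>. \<gamma> x = x})" using G_fin x by blast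
  qed
  show "\<exists>V. open V \<and> x \<in> V \<and> finite {r \<in> reflections X \<Delta>. \<exists>y\<in>V \<inter> (U \<inter> X). r y = y}" if x: "x \<in> U \<inter> X" for x
  proof -
    obtain V where V: "open V" "x \<in> V" "finite {r \<in> R. \<exists>y\<in>V \<inter> U. r y = y}" using G_lf x by blast
    have sub: "{r \<in> reflections X \<Delta>. \<exists>y\<in>V \<inter> (U \<inter> X). r y = y} \<subseteq> (\<lambda>s. restrict s X) ` {r \<in> R. \<exists>y\<in>V \<inter> U. r y = y}"
    proof
      fix r assume "r \<in> {r \<in> reflections X \<Delta>. \<exists>y\<in>V \<inter> (U \<inter> X). r y = y}"
      then obtain s y where "s \<in> RD" "r = restrict s X" "y \<in> V \<inter> U" "y \<in> X" "r y = y"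
        unfolding reflections_Delta by blast
      then show "r \<in> (\<lambda>s. restrict s X) ` {r \<in> R. \<exists>y\<in>V \<inter> U. r y = y}" using RD_D(1) by auto
    qed
    have "finite {r \<in> reflections X \<Delta>. \<exists>y\<in>V \<inter> (U \<inter> X). r y = y}"
      by (rule finite_subset[OF sub finite_imageI[OF V(3)]])
    then show ?thesis using V(1,2) by blast
  qed
  fix \<gamma> assume "\<gamma> \<in> \<Delta>"
  then obtain g where g: "g \<in> AD" "\<gamma> = restrict g X" unfolding Delta_eq by blast
  show "\<exists>f. linear f \<and> (\<forall>x\<in>X. \<gamma> x = f x)" using g lin AD_prop(1) by (intro exI[of _ g]) auto
  show "\<gamma> x \<in> U \<inter> X" if "x \<in> U \<inter> X" for x using that g AD_prop(1,4) G_U by simp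
qed

lemma B_cell: "B = cell (U \<inter> X) (reflections X \<Delta>) f0"
  unfolding reflections_Delta using cell_restrict[of "U \<inter> X" X f0 RD] f0(1) by auto

text \<open>
  This is \<open>reflections_in_stratum_group\<close> for the group \<open>\<Delta>\<close>
  and its chamber \<open>B\<close>.
\<close>

lemma stratum_group_B:
  "stratum_group X \<Delta> B H = generate (BijGroup X) ((\<lambda>s. restrict s X) ` RDp)"
proof
  interpret BX: group "BijGroup X" by (rule group_BijGroup)
  let ?S = "{r \<in> reflections X \<Delta>. \<exists>W. W facet_of B \<and> H \<subseteq> W \<and> W \<subseteq> mirror X r}"
  let ?T = "(\<lambda>s. restrict s X) ` RDp"
  have Tc: "?T \<subseteq> carrier (BijGroup X)"
    using DA.G_Bij DA.R_G RDp_sub(3) unfolding reflections_Delta by blast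
  have Sc: "?S \<subseteq> carrier (BijGroup X)" using DA.G_Bij DA.R_G by blast
  have "?S \<subseteq> ?T"
  proof
    fix r assume r: "r \<in> ?S"
    then obtain t where t: "t \<in> RD" "r = restrict t X" unfolding reflections_Delta by blast
    have "p \<in> mirror X r" using r p_mem(1) by blast
    then have "t p = p" using t(2) by (auto simp: mirror_def)
    then show "r \<in> ?T" using t by (auto simp: RDp_def)
  qed
  then show "stratum_group X \<Delta> B H \<subseteq> generate (BijGroup X) ?T"
    unfolding stratum_group_def by (rule BX.mono_generate)
  have "?T \<subseteq> stratum_group X \<Delta> B H"
  proof
    fix r assume "r \<in> ?T"
    then obtain t where t: "t \<in> RDp" "r = restrict t X" by blast
    have fX: "f0 \<in> U \<inter> X" using f0(1) .
    have reg: "\<forall>r\<in>reflections X \<Delta>. r f0 \<noteq> f0" unfolding reflections_Delta using f0_RD fX by auto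
    have rR: "r \<in> reflections X \<Delta>" unfolding reflections_Delta using t RDp_sub by blast
    have rp: "r p = p" using t p_mem(5) by (simp add: RDp_def)
    have pB: "p \<in> cell (U \<inter> X) (reflections X \<Delta>) f0" using F0_B p_mem(3) unfolding B_cell by blast
    have HB: "H \<subseteq> cell (U \<inter> X) (reflections X \<Delta>) f0" using F0_B H_F0 unfolding B_cell by blast
    have fixd: "s h = h" if s: "s \<in> reflections X \<Delta>" "s p = p" and h: "h \<in> H" for s h
    proof -
      obtain q where q: "q \<in> RD" "s = restrict q X" using s unfolding reflections_Delta by blast
      have "q \<in> Rp" using q s(2) p_mem(5) RD_D(1) by (simp add: Rp_def)
      then have "q h = h" using H_fixed h by blast
      moreover have "h \<in> X" using h H_F0 F0(2) by blast
      ultimately show ?thesis using q by simp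
    qed
    have "r \<in> stratum_group X \<Delta> (cell (U \<inter> X) (reflections X \<Delta>) f0) H"
      using DA.reflections_in_stratum_group[where x=f0 and p=p and H=H and r=r, OF fX reg pB HB _ rR rp] fixd by blast
    then show "r \<in> stratum_group X \<Delta> B H" using B_cell by simp
  qed
  then show "generate (BijGroup X) ?T \<subseteq> stratum_group X \<Delta> B H"
    using BX.generate_subgroup_incl BX.generate_is_subgroup[OF Sc] unfolding stratum_group_def by blast
qed

lemma stratum_group_B_restrict:
  "(\<lambda>\<gamma>. restrict \<gamma> Q) ` stratum_group X \<Delta> B H = generate (BijGroup Q) ((\<lambda>s. restrict s Q) ` RDp)"
proof -
  have "(\<lambda>\<gamma>. restrict \<gamma> Q) ` stratum_group X \<Delta> B H =
      generate (BijGroup Q) ((\<lambda>s. restrict s Q) ` ((\<lambda>s. restrict s X) ` RDp))"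
    unfolding stratum_group_B
  proof (rule generate_restrict(1)[OF Q_sub(2)])
    fix s assume "s \<in> (\<lambda>s. restrict s X) ` RDp"
    then obtain t where t: "t \<in> RDp" "s = restrict t X" by blast
    have sR: "s \<in> reflections X \<Delta>" unfolding reflections_Delta using t RDp_sub by blast
    show "s \<in> carrier (BijGroup X)" using DA.G_Bij DA.R_G sR by blast
    show "s (s z) = z" if "z \<in> X" for z using DA.R_invol sR that by blast
    show "s z \<in> Q" if z: "z \<in> Q" for z
    proof -
      have "t \<in> A" using t RDp_sub Rp_A by blast
      then have "t z \<in> N" using A_N z Q_sub by blast
      moreover have "t z \<in> X" using RD_D(4) t RDp_sub z Q_sub by blast
      ultimately show ?thesis using t z Q_sub by (auto simp: Q_def)
    qed
  qed
  also have "(\<lambda>s. restrict s Q) ` ((\<lambda>s. restrict s X) ` RDp) = (\<lambda>s. restrict s Q) ` RDp"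
    unfolding image_image by (rule image_cong[OF refl], rule ext) (use Q_sub in \<open>auto simp: restrict_def\<close>)
  finally show ?thesis .
qed

end

section \<open>The geometries\<close>

text \<open>In this form the cone over the hyperboloid is visibly convex.\<close>

lemma lorentz_cone:
  fixes e :: "'a::euclidean_space"
  shows "e \<bullet> x > 0 \<and> lorentz e x x < 0 \<longleftrightarrow> norm x < sqrt 2 * (e \<bullet> x)"
proof
  assume a: "e \<bullet> x > 0 \<and> lorentz e x x < 0"
  then have "(norm x)\<^sup>2 < (sqrt 2 * (e \<bullet> x))\<^sup>2"
    by (simp add: lorentz_def power_mult_distrib dot_square_norm) (simp add: power2_eq_square)
  then show "norm x < sqrt 2 * (e \<bullet> x)" by (rule power_less_imp_less_base) (use a in simp)
next
  assume a: "norm x < sqrt 2 * (e \<bullet> x)"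
  then have pos: "0 < sqrt 2 * (e \<bullet> x)" using norm_ge_zero[of x] by linarith
  have "(norm x)\<^sup>2 < (sqrt 2 * (e \<bullet> x))\<^sup>2" using a by (intro power_strict_mono) auto
  then have "lorentz e x x < 0"
    by (simp add: lorentz_def power_mult_distrib dot_square_norm) (simp add: power2_eq_square)
  then show "e \<bullet> x > 0 \<and> lorentz e x x < 0" using pos by (simp add: zero_less_mult_iff)
qed

lemma space_cone:
  assumes "wf_geometry g"
  shows "open (space_cone g)" "convex (space_cone g)" "space_cone g \<noteq> {}"
    "0 \<in> space_cone g \<Longrightarrow> space_cone g = UNIV"
    "x \<in> space_cone g \<Longrightarrow> t > 0 \<Longrightarrow> t *\<^sub>R x \<in> space_cone g"
proof -
  have "open (space_cone g) \<and> convex (space_cone g) \<and> space_cone g \<noteq> {} \<and> (\<forall>x\<in>space_cone g. \<forall>t>0. t *\<^sub>R x \<in> space_cone g)"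
  proof (cases g)
    case (Euclidean e)
    then have "e \<noteq> 0" using assms by auto
    then have "e \<in> space_cone g" using Euclidean by simp
    moreover have "open (space_cone g)" "convex (space_cone g)" using Euclidean by (simp_all add: open_halfspace_gt convex_halfspace_gt)
    moreover have "\<forall>x\<in>space_cone g. \<forall>t>0. t *\<^sub>R x \<in> space_cone g" using Euclidean by simp
    ultimately show ?thesis by blast
  next
    case Spherical then show ?thesis by auto
  next
    case (Lobachevsky e)
    have ee: "norm e = 1" using assms Lobachevsky by simp
    have eq: "space_cone g = {x. norm x < sqrt 2 * (e \<bullet> x)}" using Lobachevsky lorentz_cone[of e] by auto
    have "open (space_cone g)" unfolding eq by (intro open_Collect_less continuous_intros)
    moreover have "convex (space_cone g)" unfolding eq
    proof (rule convexI)
      fix x y and u v :: real assume a: "x \<in> {x. norm x < sqrt 2 * (e \<bullet> x)}" "y \<in> {x. norm x < sqrt 2 * (e \<bullet> x)}" "0 \<le> u" "0 \<le> v" "u + v = 1"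
      have "norm (u *\<^sub>R x + v *\<^sub>R y) \<le> u * norm x + v * norm y"
        using norm_triangle_ineq[of "u *\<^sub>R x" "v *\<^sub>R y"] a by simp
      also have "\<dots> < u * (sqrt 2 * (e \<bullet> x)) + v * (sqrt 2 * (e \<bullet> y))"
      proof (cases "u = 0")
        case True then show ?thesis using a by simp
      next
        case False
        then have "u * norm x < u * (sqrt 2 * (e \<bullet> x))" using a by simp
        moreover have "v * norm y \<le> v * (sqrt 2 * (e \<bullet> y))" using a by (intro mult_left_mono) auto
        ultimately show ?thesis by simp
      qed
      finally show "u *\<^sub>R x + v *\<^sub>R y \<in> {x. norm x < sqrt 2 * (e \<bullet> x)}" by (simp add: inner_add_right algebra_simps)
    qed
    moreover have "e \<in> space_cone g" unfolding eq using ee by (simp add: dot_square_norm)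
    moreover have "\<forall>x\<in>space_cone g. \<forall>t>0. t *\<^sub>R x \<in> space_cone g" unfolding eq
    proof (intro ballI allI impI)
      fix x and t :: real assume x: "x \<in> {x. norm x < sqrt 2 * (e \<bullet> x)}" and t: "t > 0"
      have "t * norm x < t * (sqrt 2 * (e \<bullet> x))" using x t by simp
      then show "t *\<^sub>R x \<in> {x. norm x < sqrt 2 * (e \<bullet> x)}" using t by (simp add: mult.left_commute)
    qed
    ultimately show ?thesis by blast
  next
    case (Projective \<Omega>) then show ?thesis using assms by auto
  qed
  then show op: "open (space_cone g)" and "convex (space_cone g)" "space_cone g \<noteq> {}"
    and sc: "\<And>x t. x \<in> space_cone g \<Longrightarrow> t > 0 \<Longrightarrow> t *\<^sub>R x \<in> space_cone g" by blast+
  assume z: "0 \<in> space_cone g"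
  then obtain d where d: "d > 0" "ball 0 d \<subseteq> space_cone g" using openE[OF op z] by metis
  have "x \<in> space_cone g" for x
  proof -
    define t where "t = (norm x + 1) / d"
    have t: "t > 0" using d norm_ge_zero[of x] by (simp add: t_def add_nonneg_pos)
    have "norm x / t < d"
    proof -
      have "norm x < t * d" using d(1) by (simp add: t_def)
      then show ?thesis using t by (simp add: divide_less_eq mult.commute)
    qed
    then have "(1/t) *\<^sub>R x \<in> ball 0 d" using t by simp
    then have "t *\<^sub>R ((1/t) *\<^sub>R x) \<in> space_cone g" using sc t d by blast
    then show ?thesis using t by simp
  qed
  then show "space_cone g = UNIV" by blast
qed

lemma euclidean_motion_height:
  assumes "linear f" "f ` {x. e \<bullet> x = 1} = {x. e \<bullet> x = 1}" "norm e = 1"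
  shows "e \<bullet> f x = e \<bullet> x"
proof -
  have one: "e \<bullet> f y = 1" if "e \<bullet> y = 1" for y using assms(2) that by blast
  have ee: "e \<bullet> e = 1" using assms(3) by (simp add: dot_square_norm)
  have "e \<bullet> f (x + (1 - e \<bullet> x) *\<^sub>R e) = 1" using one ee by (simp add: inner_add_right)
  moreover have "e \<bullet> f e = 1" using one ee by simp
  ultimately show ?thesis by (simp add: linear_add[OF assms(1)] linear_scale[OF assms(1)] inner_add_right)
qed

text \<open>
  A Euclidean motion preserves the inner product only of vectors parallel to the affine
  hyperplane.
\<close>

definition metric_vectors :: "'a::euclidean_space geometry \<Rightarrow> 'a set" where
  "metric_vectors g = (case g of Euclidean e \<Rightarrow> {v. e \<bullet> v = 0} | _ \<Rightarrow> UNIV)"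

text \<open>
  These consequences of being a motion are preserved by composition, so they need to be
  checked for the generating reflections only.
\<close>

definition preserves :: "'a::euclidean_space geometry \<Rightarrow> ('a \<Rightarrow> 'a) \<Rightarrow> bool" where
  "preserves g f \<longleftrightarrow> linear f \<and> f ` space_cone g \<subseteq> space_cone g \<and> (\<forall>e. g = Euclidean e \<longrightarrow> (\<forall>x. e \<bullet> f x = e \<bullet> x)) \<and>
     (\<forall>b. metric g = Some b \<longrightarrow> (\<forall>x\<in>metric_vectors g. \<forall>y\<in>metric_vectors g. b (f x) (f y) = b x y))"

lemma norm_preserving_inner:
  assumes f: "linear f" and V: "subspace V" and n: "\<And>x. x \<in> V \<Longrightarrow> norm (f x) = norm x" and x: "x \<in> V" "y \<in> V"
  shows "f x \<bullet> f y = x \<bullet> y"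
proof -
  have "(norm (f (x + y)))\<^sup>2 = (norm (x + y))\<^sup>2" using n subspace_add[OF V x] by simp
  then have "(f x + f y) \<bullet> (f x + f y) = (x + y) \<bullet> (x + y)" by (simp add: linear_add[OF f] dot_square_norm)
  moreover have "f x \<bullet> f x = x \<bullet> x" "f y \<bullet> f y = y \<bullet> y" using n x by (simp_all add: dot_square_norm)
  ultimately show ?thesis by (simp add: inner_add_left inner_add_right inner_commute)
qed

lemma motion_preserves:
  assumes "wf_geometry g" "is_motion g f" shows "preserves g f"
proof (cases g)
  case (Euclidean e)
  have ee: "norm e = 1" "e \<bullet> e = 1" using assms Euclidean by (auto simp: dot_square_norm)
  have f: "linear f" "f ` {x. e \<bullet> x = 1} = {x. e \<bullet> x = 1}" "\<And>x y. e \<bullet> x = 1 \<Longrightarrow> e \<bullet> y = 1 \<Longrightarrow> dist (f x) (f y) = dist x y"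
    using assms Euclidean by auto
  note h = euclidean_motion_height[OF f(1,2) ee(1)]
  have nrm: "norm (f z) = norm z" if z: "z \<in> {z. e \<bullet> z = 0}" for z
  proof -
    have "dist (f (e + z)) (f e) = dist (e + z) e" using z ee by (intro f(3)) (auto simp: inner_add_right)
    then show ?thesis by (simp add: linear_add[OF f(1)] dist_norm)
  qed
  show ?thesis unfolding preserves_def using Euclidean f(1) h norm_preserving_inner[OF f(1) subspace_hyperplane nrm]
    by (auto simp: metric_vectors_def)
next
  case Spherical
  then have "linear f" "\<And>x. norm (f x) = norm x" using assms by auto
  then show ?thesis unfolding preserves_def using Spherical norm_preserving_inner[of f UNIV] by auto
next
  case (Lobachevsky e)
  then have "f ` space_cone g = space_cone g" using assms by (simp del: space_cone.simps)
  then show ?thesis unfolding preserves_def using Lobachevsky assms by (auto simp del: space_cone.simps)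
next
  case (Projective \<Omega>) then show ?thesis unfolding preserves_def using assms by auto
qed

lemma preserves_compose:
  assumes "preserves g f" "preserves g h" shows "preserves g (f \<circ> h)"
proof -
  have "h x \<in> metric_vectors g" if "x \<in> metric_vectors g" for x
    using that assms(2) by (cases g) (auto simp: preserves_def metric_vectors_def)
  moreover have "(f \<circ> h) ` space_cone g \<subseteq> space_cone g" using assms unfolding preserves_def by fastforce
  ultimately show ?thesis using assms unfolding preserves_def by (clarsimp simp: linear_compose)
qed

lemma involutions_BijGroup:
  assumes "\<And>s. s \<in> S \<Longrightarrow> is_reflection UNIV s" "s \<in> S"
  shows "s \<in> carrier (BijGroup UNIV)" "s (s z) = z"
proof -
  show inv: "s (s z) = z" for z using assms by (simp add: is_reflection_def)
  show "s \<in> carrier (BijGroup UNIV)" by (rule involution_in_BijGroup) (use inv in auto)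
qed

lemma coxeter_group_preserves:
  assumes S: "\<And>s. s \<in> S \<Longrightarrow> is_reflection UNIV s" "\<And>s. s \<in> S \<Longrightarrow> preserves g s" and \<gamma>: "\<gamma> \<in> generate (BijGroup UNIV) S"
  shows "preserves g \<gamma>"
  using \<gamma>
proof (induction rule: generate_involutions_induct)
  case one
  then show ?case by (simp add: preserves_def linear_ident restrict_def)
next
  case (comp f h)
  have "compose UNIV f h = f \<circ> h" by (auto simp: compose_def)
  then show ?case using preserves_compose comp.IH by metis
qed (use S involutions_BijGroup[OF S(1)] in auto)

text \<open>
  If \<open>x\<close> lies in the tile \<open>\<gamma>0 D\<close> and \<open>\<gamma>\<close>
  fixes \<open>x\<close>, then \<open>\<gamma> \<gamma>0 D\<close> is one of the finitely many
  tiles near \<open>x\<close>; this bounds the stabilizer. A reflection fixing a point near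
  \<open>x\<close> is likewise determined by two such tiles. The origin belongs to the cone
  only if the cone is the whole space. Then the whole group has to be finite, and this follows
  from the compactness of the unit sphere.
\<close>

lemma coxeter_refl_action:
  fixes g :: "'a::euclidean_space geometry"
  assumes wf: "wf_geometry g" and cox: "coxeter_group g \<Gamma>"
  shows "refl_action UNIV (space_cone g) \<Gamma>" and "\<And>\<gamma>. \<gamma> \<in> \<Gamma> \<Longrightarrow> preserves g \<gamma>"
proof -
  obtain D S where cd: "coxeter_domain g D S" and \<Gamma>: "\<Gamma> = generate (BijGroup UNIV) S" using cox by (auto simp: coxeter_group_def)
  let ?U = "space_cone g"
  have S: "\<And>s. s \<in> S \<Longrightarrow> is_reflection UNIV s" "\<And>s. s \<in> S \<Longrightarrow> preserves g s"
    using cd motion_preserves[OF wf] by (auto simp: coxeter_domain_def)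
  have cover: "(\<Union>\<gamma>\<in>\<Gamma>. \<gamma> ` D) = ?U" and lf: "\<And>x. x \<in> ?U - {0} \<Longrightarrow> \<exists>V. open V \<and> x \<in> V \<and> finite {\<gamma>\<in>\<Gamma>. \<gamma> ` D \<inter> V \<noteq> {}}"
    and intD: "interior D \<noteq> {}" using cd unfolding coxeter_domain_def Let_def \<Gamma> by auto
  obtain \<H> where \<H>: "\<forall>h\<in>\<H>. \<exists>a. a \<noteq> 0 \<and> h = {x. 0 \<le> a \<bullet> x}" "D = ?U \<inter> \<Inter>\<H>"
    using cd unfolding coxeter_domain_def by blast
  have Dcone: "t *\<^sub>R d \<in> D" if "d \<in> D" "t > 0" for d t
  proof -
    have "t *\<^sub>R d \<in> h" if h: "h \<in> \<H>" for h
    proof -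
      obtain a where a: "h = {x. 0 \<le> a \<bullet> x}" using \<H>(1) h by blast
      have "d \<in> h" using \<open>d \<in> D\<close> \<H>(2) h by blast
      then show ?thesis using a \<open>t > 0\<close> by simp
    qed
    then show ?thesis using \<H>(2) that space_cone(5)[OF wf] by blast
  qed
  show motion: "preserves g \<gamma>" if "\<gamma> \<in> \<Gamma>" for \<gamma> using coxeter_group_preserves[OF S] that \<Gamma> by blast
  have sub: "subgroup \<Gamma> (BijGroup UNIV)"
    unfolding \<Gamma> by (rule group.generate_is_subgroup[OF group_BijGroup]) (use involutions_BijGroup(1)[OF S(1)] in blast)
  note comp = subgroup_BijGroup(4)[OF sub]
  have app: "compose UNIV \<gamma> \<delta> z = \<gamma> (\<delta> z)" for \<gamma> \<delta> :: "'a \<Rightarrow> 'a" and z by (simp add: compose_def)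
  have invs: "\<exists>\<delta>\<in>\<Gamma>. \<forall>x. \<delta> (\<gamma> x) = x \<and> \<gamma> (\<delta> x) = x" if "\<gamma> \<in> \<Gamma>" for \<gamma>
    using subgroup_BijGroup(5)[OF sub that] by simp
  have lin: "linear \<gamma>" if "\<gamma> \<in> \<Gamma>" for \<gamma> using motion[OF that] by (simp add: preserves_def)
  have inj: "x = y" if "\<gamma> \<in> \<Gamma>" "\<gamma> x = \<gamma> y" for \<gamma> x y using invs[OF that(1)] that(2) by metis
  have fin0: "finite \<Gamma>" if z: "0 \<in> ?U"
  proof -
    have U: "?U = UNIV" using space_cone(4)[OF wf z] .
    define V where "V x = (SOME V. open V \<and> x \<in> V \<and> finite {\<gamma>\<in>\<Gamma>. \<gamma> ` D \<inter> V \<noteq> {}})" for x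
    have V: "open (V x) \<and> x \<in> V x \<and> finite {\<gamma>\<in>\<Gamma>. \<gamma> ` D \<inter> V x \<noteq> {}}" if "x \<in> sphere 0 1" for x
    proof -
      have "x \<in> ?U - {0}" using U that by auto
      from lf[OF this] show ?thesis unfolding V_def by (rule someI_ex)
    qed
    have sub: "sphere (0::'a) 1 \<subseteq> (\<Union>x\<in>sphere 0 1. V x)" using V by blast
    obtain K where K: "K \<subseteq> sphere 0 1" "finite K" "sphere 0 1 \<subseteq> (\<Union>x\<in>K. V x)"
      using compactE_image[OF compact_sphere[of "0::'a" 1], of "sphere 0 1" V] V sub by metis
    have "interior D \<noteq> {0}" using open_interior[of D] not_open_singleton by metis
    then obtain d where d: "d \<in> D" "d \<noteq> 0" using intD interior_subset by blast
    have "\<Gamma> \<subseteq> (\<Union>x\<in>K. {\<gamma>\<in>\<Gamma>. \<gamma> ` D \<inter> V x \<noteq> {}})"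
    proof
      fix \<gamma> assume \<gamma>: "\<gamma> \<in> \<Gamma>"
      have "\<gamma> d \<noteq> 0" using inj[OF \<gamma>, of d 0] d linear_0[OF lin[OF \<gamma>]] by auto
      then have n: "norm (\<gamma> d) > 0" by simp
      let ?y = "(1 / norm (\<gamma> d)) *\<^sub>R \<gamma> d"
      have "?y \<in> sphere 0 1" using n by simp
      then obtain x where x: "x \<in> K" "?y \<in> V x" using K(3) by blast
      have "?y = \<gamma> ((1 / norm (\<gamma> d)) *\<^sub>R d)" using linear_scale[OF lin[OF \<gamma>]] by simp
      moreover have "(1 / norm (\<gamma> d)) *\<^sub>R d \<in> D" using Dcone[OF d(1)] n by simp
      ultimately have "?y \<in> \<gamma> ` D" by blast
      then show "\<gamma> \<in> (\<Union>x\<in>K. {\<gamma>\<in>\<Gamma>. \<gamma> ` D \<inter> V x \<noteq> {}})" using x \<gamma> by blast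
    qed
    moreover have "finite (\<Union>x\<in>K. {\<gamma>\<in>\<Gamma>. \<gamma> ` D \<inter> V x \<noteq> {}})" using K V by (intro finite_UN_I) auto
    ultimately show ?thesis by (rule finite_subset)
  qed
  have fin: "finite {\<gamma>\<in>\<Gamma>. \<gamma> x = x}" if x: "x \<in> ?U" for x
  proof (cases "x = 0")
    case True then show ?thesis using fin0 x by simp
  next
    case False
    then obtain V where V: "open V" "x \<in> V" "finite {\<gamma>\<in>\<Gamma>. \<gamma> ` D \<inter> V \<noteq> {}}" using lf[of x] x by blast
    obtain \<gamma>0 d where g0: "\<gamma>0 \<in> \<Gamma>" "d \<in> D" "x = \<gamma>0 d" using cover x by blast
    obtain \<delta> where \<delta>: "\<forall>x. \<delta> (\<gamma>0 x) = x \<and> \<gamma>0 (\<delta> x) = x" using invs[OF g0(1)] by blast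
    have "inj_on (\<lambda>\<gamma>. compose UNIV \<gamma> \<gamma>0) {\<gamma>\<in>\<Gamma>. \<gamma> x = x}"
    proof (rule inj_onI)
      fix \<gamma> \<gamma>' assume eq: "compose UNIV \<gamma> \<gamma>0 = compose UNIV \<gamma>' \<gamma>0"
      have "\<gamma> (\<gamma>0 (\<delta> z)) = \<gamma>' (\<gamma>0 (\<delta> z))" for z using fun_cong[OF eq, of "\<delta> z"] by (simp add: compose_def)
      then show "\<gamma> = \<gamma>'" using \<delta> by (simp add: fun_eq_iff)
    qed
    moreover have "(\<lambda>\<gamma>. compose UNIV \<gamma> \<gamma>0) ` {\<gamma>\<in>\<Gamma>. \<gamma> x = x} \<subseteq> {\<gamma>\<in>\<Gamma>. \<gamma> ` D \<inter> V \<noteq> {}}"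
    proof clarify
      fix \<gamma> assume \<gamma>: "\<gamma> \<in> \<Gamma>" "\<gamma> x = x"
      have "compose UNIV \<gamma> \<gamma>0 d = x" using \<gamma> g0(3) app by simp
      then have "x \<in> compose UNIV \<gamma> \<gamma>0 ` D \<inter> V" using g0(2) V(2) by blast
      then show "compose UNIV \<gamma> \<gamma>0 \<in> \<Gamma> \<and> compose UNIV \<gamma> \<gamma>0 ` D \<inter> V \<noteq> {}" using comp[OF \<gamma>(1) g0(1)] by blast
    qed
    ultimately show ?thesis using V(3) by (meson finite_imageD finite_subset)
  qed
  have lfr: "\<exists>V. open V \<and> x \<in> V \<and> finite {r\<in>reflections UNIV \<Gamma>. \<exists>y\<in>V \<inter> ?U. r y = y}" if x: "x \<in> ?U" for x
  proof (cases "x = 0")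
    case True
    then have "finite (reflections UNIV \<Gamma>)" using fin0 x by (simp add: reflections_def)
    then show ?thesis by (intro exI[of _ UNIV]) auto
  next
    case False
    then obtain V where V: "open V" "x \<in> V" "finite {\<gamma>\<in>\<Gamma>. \<gamma> ` D \<inter> V \<noteq> {}}" using lf[of x] x by blast
    let ?F = "{\<gamma>\<in>\<Gamma>. \<gamma> ` D \<inter> V \<noteq> {}}"
    have "{r\<in>reflections UNIV \<Gamma>. \<exists>y\<in>V \<inter> ?U. r y = y} \<subseteq> (\<lambda>(\<alpha>, \<beta>). \<alpha> \<circ> inv_into UNIV \<beta>) ` (?F \<times> ?F)"
    proof
      fix r assume "r \<in> {r\<in>reflections UNIV \<Gamma>. \<exists>y\<in>V \<inter> ?U. r y = y}"
      then obtain y where r: "r \<in> \<Gamma>" "y \<in> V" "y \<in> ?U" "r y = y" by (auto simp: reflections_def)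
      obtain \<gamma> d where g: "\<gamma> \<in> \<Gamma>" "d \<in> D" "y = \<gamma> d" using cover r(3) by blast
      have "y \<in> \<gamma> ` D \<inter> V" using g r(2) by blast
      then have 1: "\<gamma> \<in> ?F" using g(1) by blast
      have "compose UNIV r \<gamma> d = y" using app g(3) r(4) by simp
      then have "y \<in> compose UNIV r \<gamma> ` D \<inter> V" using g(2) r(2) by blast
      then have 2: "compose UNIV r \<gamma> \<in> ?F" using comp[OF r(1) g(1)] by blast
      obtain \<delta> where \<delta>: "\<forall>x. \<delta> (\<gamma> x) = x \<and> \<gamma> (\<delta> x) = x" using invs[OF g(1)] by blast
      have "surj \<gamma>" using \<delta> by (metis surjI)
      then have "r = compose UNIV r \<gamma> \<circ> inv_into UNIV \<gamma>" by (auto simp: compose_def fun_eq_iff surj_f_inv_f)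
      then show "r \<in> (\<lambda>(\<alpha>, \<beta>). \<alpha> \<circ> inv_into UNIV \<beta>) ` (?F \<times> ?F)" using 1 2 by (intro image_eqI[of _ _ "(compose UNIV r \<gamma>, \<gamma>)"]) auto
    qed
    moreover have "finite ((\<lambda>(\<alpha>, \<beta>). \<alpha> \<circ> inv_into UNIV \<beta>) ` (?F \<times> ?F))" using V(3) by blast
    ultimately show ?thesis using V(1,2) finite_subset by blast
  qed
  show "refl_action UNIV ?U \<Gamma>"
  proof (rule refl_action.intro)
    show "subspace (UNIV::'a set)" by simp
    show "convex ?U" "?U \<noteq> {}" using space_cone[OF wf] by auto
    show "openin (top_of_set UNIV) ?U" using space_cone[OF wf] by simp
    show "subgroup \<Gamma> (BijGroup UNIV)" by (rule sub)
    show "\<And>\<gamma>. \<gamma> \<in> \<Gamma> \<Longrightarrow> \<exists>f. linear f \<and> (\<forall>x\<in>UNIV. \<gamma> x = f x)" using lin by blast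
    show "\<And>\<gamma> x. \<gamma> \<in> \<Gamma> \<Longrightarrow> x \<in> ?U \<Longrightarrow> \<gamma> x \<in> ?U" using motion unfolding preserves_def by blast
    show "\<And>x. x \<in> ?U \<Longrightarrow> finite {\<gamma>\<in>\<Gamma>. \<gamma> x = x}" using fin .
    show "\<And>x. x \<in> ?U \<Longrightarrow> \<exists>V. open V \<and> x \<in> V \<and> finite {r\<in>reflections UNIV \<Gamma>. \<exists>y\<in>V \<inter> ?U. r y = y}" using lfr .
  qed
qed

lemma metric_bilinear:
  assumes "metric g = Some b"
  shows "b x y = b y x" "b (x + y) z = b x z + b y z" "b (c *\<^sub>R x) y = c * b x y"
  using assms by (cases g; auto simp: lorentz_def inner_commute inner_add_left inner_add_right algebra_simps)+

lemma subspace_metric_vectors: "subspace (metric_vectors g)"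
  by (cases g) (auto simp: metric_vectors_def subspace_hyperplane)

lemma preserves_metric:
  assumes g: "metric g = Some b" and m: "preserves g f"
  shows "x \<in> metric_vectors g \<Longrightarrow> y \<in> metric_vectors g \<Longrightarrow> b (f x) (f y) = b x y"
    and "f u = - u \<Longrightarrow> u \<in> metric_vectors g"
proof -
  show "x \<in> metric_vectors g \<Longrightarrow> y \<in> metric_vectors g \<Longrightarrow> b (f x) (f y) = b x y" using assms unfolding preserves_def by blast
  assume u: "f u = - u"
  have "e \<bullet> u = 0" if "g = Euclidean e" for e
  proof -
    have "e \<bullet> f u = e \<bullet> u" using m that unfolding preserves_def by blast
    then show ?thesis using u by simp
  qed
  then show "u \<in> metric_vectors g" by (cases g) (auto simp: metric_vectors_def)
qed

text \<open>
  In the Lorentzian case the positivity on the tangent space is the reversed Cauchy-Schwarz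
  inequality.
\<close>

lemma tangent_space_metric:
  assumes g: "wf_geometry g" "metric g = Some b" and p: "p \<in> space_cone g" "p \<noteq> 0"
  shows "v \<in> tangent_space g p \<Longrightarrow> v \<noteq> 0 \<Longrightarrow> b v v > 0"
    and "subspace (tangent_space g p)" and "tangent_space g p \<subseteq> metric_vectors g"
    and "\<exists>c. v - c *\<^sub>R p \<in> tangent_space g p"
    and "preserves g r \<Longrightarrow> r p = p \<Longrightarrow> r u = - u \<Longrightarrow> u \<in> tangent_space g p"
proof -
  have "(v \<in> tangent_space g p \<longrightarrow> v \<noteq> 0 \<longrightarrow> b v v > 0) \<and> subspace (tangent_space g p) \<and> tangent_space g p \<subseteq> metric_vectors g
     \<and> (\<exists>c. v - c *\<^sub>R p \<in> tangent_space g p) \<and> (preserves g r \<longrightarrow> r p = p \<longrightarrow> r u = - u \<longrightarrow> u \<in> tangent_space g p)"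
  proof (cases g)
    case (Euclidean e)
    have "e \<bullet> (v - ((e \<bullet> v) / (e \<bullet> p)) *\<^sub>R p) = 0" using p Euclidean by (simp add: inner_diff_right)
    moreover have "u \<in> tangent_space g p" if "preserves g r" "r u = - u"
      using preserves_metric(2)[OF g(2) that] Euclidean by (simp add: metric_vectors_def)
    ultimately show ?thesis using Euclidean g by (auto simp: metric_vectors_def subspace_hyperplane)
  next
    case Spherical
    have "p \<bullet> (v - ((p \<bullet> v) / (p \<bullet> p)) *\<^sub>R p) = 0" using p by (simp add: inner_diff_right)
    moreover have "p \<bullet> u = 0" if "preserves g r" "r p = p" "r u = - u"
    proof -
      have "b (r p) (r u) = b p u" using preserves_metric(1)[OF g(2) that(1)] Spherical by (simp add: metric_vectors_def)
      then show ?thesis using that g Spherical by simp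
    qed
    ultimately show ?thesis using Spherical g by (auto simp: metric_vectors_def subspace_hyperplane)
  next
    case (Lobachevsky e)
    have b: "b = lorentz e" using g Lobachevsky by simp
    have pl: "lorentz e p p < 0" and np: "norm p < sqrt 2 * (e \<bullet> p)" using p Lobachevsky lorentz_cone[of e p] by auto
    have ep: "e \<bullet> p > 0" using p Lobachevsky by simp
    have T: "tangent_space g p = {v. (p - (2 * (e \<bullet> p)) *\<^sub>R e) \<bullet> v = 0}"
      using Lobachevsky by (auto simp: lorentz_def inner_diff_left)
    have 1: "lorentz e v v > 0" if v: "lorentz e p v = 0" "v \<noteq> 0"
    proof -
      have eq: "p \<bullet> v = 2 * (e \<bullet> p) * (e \<bullet> v)" using v by (simp add: lorentz_def)
      have "(2 * (e \<bullet> p)) * \<bar>e \<bullet> v\<bar> = \<bar>p \<bullet> v\<bar>" using eq ep by (simp add: abs_mult)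
      also have "\<dots> \<le> norm p * norm v" by (rule Cauchy_Schwarz_ineq2)
      also have "\<dots> < (sqrt 2 * (e \<bullet> p)) * norm v" using np v by simp
      finally have "(e \<bullet> p) * (2 * \<bar>e \<bullet> v\<bar>) < (e \<bullet> p) * (sqrt 2 * norm v)" by (simp add: mult_ac)
      then have "2 * \<bar>e \<bullet> v\<bar> < sqrt 2 * norm v" using ep by simp
      then have "(2 * \<bar>e \<bullet> v\<bar>)\<^sup>2 < (sqrt 2 * norm v)\<^sup>2" by (intro power_strict_mono) auto
      then have "2 * (e \<bullet> v)\<^sup>2 < v \<bullet> v" by (simp add: power_mult_distrib dot_square_norm)
      then show ?thesis by (simp add: lorentz_def power2_eq_square)
    qed
    have 2: "lorentz e p (v - (lorentz e p v / lorentz e p p) *\<^sub>R p) = 0"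
    proof -
      have "lorentz e p (v - c *\<^sub>R p) = lorentz e p v - c * lorentz e p p" for c
        by (simp add: lorentz_def inner_diff_right algebra_simps)
      then show ?thesis using pl by simp
    qed
    have 3: "lorentz e p u = 0" if "preserves g r" "r p = p" "r u = - u"
    proof -
      have "b (r p) (r u) = b p u" using preserves_metric(1)[OF g(2) that(1)] Lobachevsky by (simp add: metric_vectors_def)
      then have "lorentz e p (- u) = lorentz e p u" using that b by simp
      moreover have "lorentz e p (- u) = - lorentz e p u" by (simp add: lorentz_def)
      ultimately show ?thesis by simp
    qed
    have "subspace (tangent_space g p)" unfolding T by (rule subspace_hyperplane)
    moreover have "\<exists>c. v - c *\<^sub>R p \<in> tangent_space g p" using 2 Lobachevsky by (intro exI) simp
    ultimately show ?thesis using Lobachevsky b 1 3 by (auto simp: metric_vectors_def simp del: space_cone.simps)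
  next
    case (Projective \<Omega>) then show ?thesis using g by simp
  qed
  then show "v \<in> tangent_space g p \<Longrightarrow> v \<noteq> 0 \<Longrightarrow> b v v > 0"
    and "subspace (tangent_space g p)" and "tangent_space g p \<subseteq> metric_vectors g"
    and "\<exists>c. v - c *\<^sub>R p \<in> tangent_space g p"
    and "preserves g r \<Longrightarrow> r p = p \<Longrightarrow> r u = - u \<Longrightarrow> u \<in> tangent_space g p" by blast+
qed

text \<open>
  In the metric geometries this is \<open>form_orthogonal_iff\<close> for the metric. Roots
  are not isotropic, because a root is tangent to the space at the points of its mirror.
\<close>

lemma orthogonal_mirrors_iff:
  fixes g :: "'a::euclidean_space geometry"
  assumes wf: "wf_geometry g" and cox: "coxeter_group g \<Gamma>" and dim: "DIM('a) \<ge> 2"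
    and r: "r \<in> reflections UNIV \<Gamma>" and s: "s \<in> reflections UNIV \<Gamma>"
  shows "orthogonal_mirrors g r s \<longleftrightarrow> s \<noteq> r \<and> (\<forall>z. s (r z) = r (s z))"
proof -
  interpret A: refl_action UNIV "space_cone g" \<Gamma> using coxeter_refl_action(1)[OF wf cox] .
  note motion = coxeter_refl_action(2)[OF wf cox]
  show ?thesis
  proof (cases "metric g")
    case None
    have "mirror UNIV r \<noteq> mirror UNIV s \<longleftrightarrow> s \<noteq> r" using A.refl_unique[OF r s] by blast
    moreover have "r \<circ> s = s \<circ> r \<longleftrightarrow> (\<forall>z. s (r z) = r (s z))" by (auto simp: fun_eq_iff)
    ultimately show ?thesis using None by (simp add: orthogonal_mirrors_def)
  next
    case (Some b)
    obtain a u where ru: "root_pair UNIV r a u" using A.R_root[OF r] by blast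
    obtain k w where sw: "root_pair UNIV s k w" using A.R_root[OF s] by blast
    have pos: "b v v \<noteq> 0 \<and> v \<in> metric_vectors g" if q: "q \<in> reflections UNIV \<Gamma>" "root_pair UNIV q c v" for q c v
    proof -
      note V = rootD[OF q(2)]
      have qm: "preserves g q" using motion A.R_G q(1) by blast
      \<comment> \<open>The mirror contains a point of the space, that is, not only the origin.\<close>
      have "\<exists>y\<in>space_cone g - {0}. q y = y"
      proof -
        obtain y where y: "y \<in> space_cone g" "q y = y" using A.mirror_meets_U[OF q(1)] by blast
        show ?thesis
        proof (cases "y = 0")
          case True
          then have U: "space_cone g = UNIV" using space_cone(4)[OF wf] y by simp
          have "Suc (dim (mirror UNIV q)) = DIM('a)" using q(1) by (simp add: reflections_def is_reflection_def)
          then have "dim (mirror UNIV q) \<noteq> 0" using dim by linarith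
          then have "\<not> mirror UNIV q \<subseteq> {0}" by (metis dim_eq_0)
          then show ?thesis using U by (auto simp: mirror_def)
        qed (use y in blast)
      qed
      then obtain y where y: "y \<in> space_cone g" "y \<noteq> 0" "q y = y" by blast
      have "v \<in> tangent_space g y" using tangent_space_metric(5)[OF wf Some y(1,2) qm y(3) V(5)] .
      then show ?thesis using tangent_space_metric(1,3)[OF wf Some y(1,2)] V(4) by (metis less_irrefl subsetD)
    qed
    have inv: "b (q x) (q y) = b x y" if "q \<in> reflections UNIV \<Gamma>" "x \<in> metric_vectors g" "y \<in> metric_vectors g" for q x y
      using preserves_metric(1)[OF Some motion[OF A.R_G[OF that(1)]] that(2,3)] .
    have iff: "b u w = 0 \<longleftrightarrow> s \<noteq> r \<and> (\<forall>z\<in>UNIV. s (r z) = r (s z))"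
    proof (rule A.form_orthogonal_iff[where V="metric_vectors g"])
      show "root_pair UNIV r a u" "root_pair UNIV s k w" by (fact ru sw)+
    qed (use subspace_metric_vectors metric_bilinear[OF Some] r s inv pos[OF r ru] pos[OF s sw] in auto)
    have mult: "\<exists>c. v = c *\<^sub>R v'" if "root_pair UNIV q k' v'" "q v = - v" for q k' v' v
    proof -
      have "- v = v - (k' \<bullet> v) *\<^sub>R v'" using rootD(3)[OF that(1), of v] that(2) by simp
      then have "(k' \<bullet> v) *\<^sub>R v' = 2 *\<^sub>R v" by (simp add: scaleR_2 algebra_simps)
      then have "v = (1/2) *\<^sub>R ((k' \<bullet> v) *\<^sub>R v')" by simp
      then show ?thesis by (metis scaleR_scaleR)
    qed
    have "(\<forall>u' w'. r u' = - u' \<longrightarrow> s w' = - w' \<longrightarrow> b u' w' = 0) \<longleftrightarrow> b u w = 0"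
    proof
      assume "\<forall>u' w'. r u' = - u' \<longrightarrow> s w' = - w' \<longrightarrow> b u' w' = 0"
      then show "b u w = 0" using rootD(5)[OF ru] rootD(5)[OF sw] by blast
    next
      assume o: "b u w = 0"
      show "\<forall>u' w'. r u' = - u' \<longrightarrow> s w' = - w' \<longrightarrow> b u' w' = 0"
      proof (intro allI impI)
        fix u' w' assume "r u' = - u'" "s w' = - w'"
        then obtain c d where cd: "u' = c *\<^sub>R u" "w' = d *\<^sub>R w" using mult[OF ru] mult[OF sw] by blast
        have "b u' w' = c * b u (d *\<^sub>R w)" unfolding cd by (rule metric_bilinear(3)[OF Some])
        also have "b u (d *\<^sub>R w) = b (d *\<^sub>R w) u" by (rule metric_bilinear(1)[OF Some])
        also have "\<dots> = d * b w u" by (rule metric_bilinear(3)[OF Some])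
        also have "b w u = b u w" by (rule metric_bilinear(1)[OF Some])
        finally show "b u' w' = 0" using o by simp
      qed
    qed
    then show ?thesis using iff Some by (simp add: orthogonal_mirrors_def)
  qed
qed

text \<open>
  Roots of reflections fixing \<open>p\<close> are tangent at \<open>p\<close> and orthogonal
  to the tangent vectors in \<open>L\<close>. Conversely, the component in \<open>L\<close> of
  a vector orthogonal to these is orthogonal to itself.
\<close>

lemma (in stratum_setup) normal_space_eq:
  assumes wf: "wf_geometry g" and U: "U = space_cone g" and motion: "\<And>\<gamma>. \<gamma> \<in> \<Gamma> \<Longrightarrow> preserves g \<gamma>" and p0: "p \<noteq> 0"
  shows "normal_space_at g A p H = N" and "metric g = Some b \<Longrightarrow> inner_product_on N b \<and> (\<forall>\<gamma>\<in>A. preserves_on N b \<gamma>)"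
proof -
  have main: "normal_space_at g A p H = N \<and> inner_product_on N b \<and> (\<forall>\<gamma>\<in>A. preserves_on N b \<gamma>)"
    if m: "metric g = Some b" for b
  proof -
    have pU: "p \<in> space_cone g" using p_mem U by simp
    note T = tangent_space_metric[OF wf m pU p0] and bil = metric_bilinear[OF m]
    let ?T = "tangent_space g p"
    have b0: "b x (y - z) = b x y - b x z" for x y z
    proof -
      have "b x y = b x ((y - z) + z)" by simp
      also have "\<dots> = b ((y - z) + z) x" by (rule bil(1))
      also have "\<dots> = b (y - z) x + b z x" by (rule bil(2))
      finally show ?thesis using bil(1) by (metis add_diff_cancel_right')
    qed
    have ns: "normal_space_at g A p H = {v\<in>?T. \<forall>w\<in>?T \<inter> L. b v w = 0}"
      using m by (simp add: normal_space_at_def span_H)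
    have N_T: "v \<in> ?T \<and> (\<forall>w\<in>?T \<inter> L. b v w = 0)" if v: "r \<in> Rp" "r v = - v" for r v
    proof -
      have rm: "preserves g r" using motion R_G RpR v(1) by blast
      have vT: "v \<in> ?T" using T(5)[OF rm RpR(2)[OF v(1)] v(2)] .
      moreover have "b v w = 0" if w: "w \<in> ?T \<inter> L" for w
      proof -
        have "r w = w" using w v by (auto simp: L_def)
        moreover have "b (r v) (r w) = b v w" using preserves_metric(1)[OF m rm] T(3) vT w by blast
        ultimately have e: "b (- v) w = b v w" using v by simp
        have "b ((-1) *\<^sub>R v) w = -1 * b v w" by (rule bil(3))
        then show ?thesis using e by simp
      qed
      ultimately show ?thesis by blast
    qed
    have sub: "subspace {v\<in>?T. \<forall>w\<in>?T \<inter> L. b v w = 0}"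
      unfolding subspace_def
    proof (intro conjI ballI allI)
      have "b 0 w = 0" for w using bil(3)[of 0 0 w] by simp
      then show "0 \<in> {v\<in>?T. \<forall>w\<in>?T \<inter> L. b v w = 0}" using subspace_0[OF T(2)] by simp
    qed (use T(2) bil in \<open>auto simp: subspace_add subspace_scale\<close>)
    have N1: "N \<subseteq> {v\<in>?T. \<forall>w\<in>?T \<inter> L. b v w = 0}"
      unfolding N_def using N_T by (intro span_minimal sub) blast
    have N2: "{v\<in>?T. \<forall>w\<in>?T \<inter> L. b v w = 0} \<subseteq> N"
    proof
      fix v assume v: "v \<in> {v\<in>?T. \<forall>w\<in>?T \<inter> L. b v w = 0}"
      have pv: "pr v \<in> {v\<in>?T. \<forall>w\<in>?T \<inter> L. b v w = 0}" using N1 pr_N by blast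
      define h where "h = v - pr v"
      have h: "h \<in> {v\<in>?T. \<forall>w\<in>?T \<inter> L. b v w = 0}" unfolding h_def using v pv sub by (simp only: subspace_diff)
      have hL: "h \<in> L" unfolding h_def by (rule pr_L)
      have "b h h = 0" using h hL by blast
      then have "h = 0" using T(1)[of h] h by force
      then have "v = pr v" by (simp add: h_def)
      then show "v \<in> N" using pr_N by metis
    qed
    have NT: "N \<subseteq> ?T" using N1 by blast
    have "inner_product_on N b" unfolding inner_product_on_def
    proof (intro conjI ballI allI impI)
      show "b x x > 0" if "x \<in> N" "x \<noteq> 0" for x using T(1) NT that by blast
    qed (rule bil)+
    moreover have "preserves_on N b \<gamma>" if \<gamma>: "\<gamma> \<in> A" for \<gamma>
      unfolding preserves_on_def using preserves_metric(1)[OF m motion[OF A_prop(1)[OF \<gamma>]]] NT T(3) by blast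
    ultimately show ?thesis using ns N1 N2 by blast
  qed
  then show "metric g = Some b \<Longrightarrow> inner_product_on N b \<and> (\<forall>\<gamma>\<in>A. preserves_on N b \<gamma>)" by blast
  show "normal_space_at g A p H = N"
  proof (cases "metric g")
    case None
    then show ?thesis by (simp add: normal_space_at_def reflections_A N_def)
  next
    case (Some b) then show ?thesis using main by blast
  qed
qed

theorem theorem3p2:
  fixes g :: "'a::euclidean_space geometry"
    and \<Gamma> :: "('a \<Rightarrow> 'a) set" and \<rho> :: "'a \<Rightarrow> 'a"
    and C F H :: "'a set" and p :: 'a and n k :: nat
  assumes dim_space: "DIM('a) = n + 1" and geometry: "wf_geometry g"
    and coxeter: "coxeter_group g \<Gamma>"
    and mirror: "\<rho> \<in> reflections UNIV \<Gamma>"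
    and chamber: "C \<in> chambers UNIV (space_cone g) \<Gamma>"
    and facet: "F facet_of C" "F \<subseteq> mirror UNIV \<rho>"
    and stratum: "H face_of C" "H \<subseteq> F" "aff_dim H = int n - int k + 1"
    and codim: "3 \<le> k" "k \<le> n"
    and point: "p \<in> rel_interior H" "p \<noteq> 0"
  defines "X \<equiv> mirror UNIV \<rho>"
  defines "\<T> \<equiv> rolled_facets UNIV \<Gamma> X C F"
  defines "B \<equiv> \<Union>\<T>"
  defines "\<Gamma>\<^sub>C \<equiv> stratum_group UNIV \<Gamma> C H"
    and "\<Gamma>\<^sub>B \<equiv> stratum_group X (mirror_group g \<Gamma> \<rho>) B H"
  defines "N \<equiv> normal_space_at g \<Gamma>\<^sub>C p H"
  defines "G \<equiv> (\<lambda>\<gamma>. restrict \<gamma> N) ` \<Gamma>\<^sub>C"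
  shows "(\<exists>\<beta>. normal_metric g N \<beta> \<and> finite_reflection_group N \<beta> G) \<and>
    (\<forall>\<beta>. normal_metric g N \<beta> \<and> finite_reflection_group N \<beta> G \<longrightarrow>
       (\<lambda>\<gamma>. restrict \<gamma> (N \<inter> X)) ` \<Gamma>\<^sub>B = reduction N \<beta> G (N \<inter> X)) \<and>
    is_partial_development N G (N \<inter> X)
      (normal_cone_at N p C) (normal_cone_at (N \<inter> X) p B)
      (subdivision (normal_cone_at (N \<inter> X) p B)
         {e. (\<exists>F'\<in>\<T>. e facet_of F') \<and> H \<subseteq> e})"
proof -
  let ?U = "space_cone g"
  interpret A: refl_action UNIV ?U \<Gamma> using coxeter_refl_action(1)[OF geometry coxeter] .
  note motion = coxeter_refl_action(2)[OF geometry coxeter]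
  obtain x0 where x0: "x0 \<in> ?U" "\<forall>r\<in>reflections UNIV \<Gamma>. r x0 \<noteq> x0" "C = cell ?U (reflections UNIV \<Gamma>) x0"
    using chamber A.chambers_are_cells unfolding chambers_def by auto
  obtain f0 where f0: "f0 \<in> ?U \<inter> mirror UNIV \<rho>" "\<forall>s\<in>reflections UNIV \<Gamma> - {\<rho>}. s f0 \<noteq> f0"
    "F = cell (?U \<inter> mirror UNIV \<rho>) (reflections UNIV \<Gamma> - {\<rho>}) f0"
    using A.facet_in_mirror[OF x0(1,2) mirror facet(1)[unfolded x0(3)] facet(2)] by metis
  interpret S: stratum_setup ?U \<Gamma> \<rho> x0 F f0 H p
    by unfold_locales (use mirror x0 f0 facet stratum point in auto)
  have \<Gamma>C: "\<Gamma>\<^sub>C = S.A" unfolding \<Gamma>\<^sub>C_def S.A_def x0(3) ..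
  have N: "N = S.N" unfolding N_def \<Gamma>C using S.normal_space_eq(1)[OF geometry refl motion point(2)] by blast
  have G: "G = S.G" unfolding G_def N \<Gamma>C S.G_def ..
  have Q: "N \<inter> X = S.Q" unfolding N X_def S.Q_def ..
  have T: "\<T> = rolled_facets UNIV \<Gamma> (mirror UNIV \<rho>) (cell ?U (reflections UNIV \<Gamma>) x0) F" unfolding \<T>_def X_def x0(3) ..
  have B: "B = cell (?U \<inter> mirror UNIV \<rho>) (orthogonal_reflections UNIV \<Gamma> \<rho>) f0" unfolding B_def T by (rule S.Union_T)
  have dim2: "DIM('a) \<ge> 2" using dim_space codim by simp
  have "{s. s \<in> reflections UNIV \<Gamma> \<and> orthogonal_mirrors g \<rho> s} = orthogonal_reflections UNIV \<Gamma> \<rho>"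
    using orthogonal_mirrors_iff[OF geometry coxeter dim2 mirror] by (auto simp: orthogonal_reflections_def)
  then have "{restrict s (mirror UNIV \<rho>) | s. s \<in> reflections UNIV \<Gamma> \<and> orthogonal_mirrors g \<rho> s} =
     (\<lambda>s. restrict s (mirror UNIV \<rho>)) ` orthogonal_reflections UNIV \<Gamma> \<rho>" by blast
  then have Delta: "mirror_group g \<Gamma> \<rho> = S.\<Delta>" unfolding mirror_group_def S.\<Delta>_def by simp
  have \<Gamma>B: "(\<lambda>\<gamma>. restrict \<gamma> S.Q) ` \<Gamma>\<^sub>B = generate (BijGroup S.Q) ((\<lambda>s. restrict s S.Q) ` S.RDp)"
    unfolding \<Gamma>\<^sub>B_def Delta B X_def by (rule S.stratum_group_B_restrict)
  have ex: "\<exists>\<beta>. normal_metric g N \<beta> \<and> finite_reflection_group N \<beta> G"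
  proof (cases "metric g")
    case None
    then show ?thesis unfolding N G using S.finite_reflection_group_exists by (simp add: normal_metric_def)
  next
    case (Some b)
    have "inner_product_on S.N b" "\<And>\<gamma>. \<gamma> \<in> S.A \<Longrightarrow> preserves_on S.N b \<gamma>"
      using S.normal_space_eq(2)[OF geometry refl motion point(2) Some] by blast+
    then have "finite_reflection_group S.N b S.G" by (rule S.finite_reflection_groupI)
    then show ?thesis unfolding N G using Some by (intro exI[of _ b]) (simp add: normal_metric_def)
  qed
  have red: "(\<lambda>\<gamma>. restrict \<gamma> (N \<inter> X)) ` \<Gamma>\<^sub>B = reduction N \<beta> G (N \<inter> X)" if "finite_reflection_group N \<beta> G" for \<beta>
    using S.reduction_eq that \<Gamma>B unfolding Q unfolding N G by metis
  have "is_partial_development N G (N \<inter> X)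
      (normal_cone_at N p C) (normal_cone_at (N \<inter> X) p B)
      (subdivision (normal_cone_at (N \<inter> X) p B) {e. (\<exists>F'\<in>\<T>. e facet_of F') \<and> H \<subseteq> e})"
    unfolding Q T B x0(3) unfolding N G by (rule S.partial_development)
  then show ?thesis using ex red by blast
qed

end
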